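(* Let $k$ be a field, $Q$ a finite acyclic quiver and $A$ a finite-dimensional self-injective $k$-algebra. Then: (i) $\mathrm{Mon}(Q,A)$ is an exact category whose conflations are the sequences $0\to X\xrightarrow{f}Y\xrightarrow{g}Z\to 0$ in $\mathrm{Mon}(Q,A)$ such that the induced sequence $0\to X_i\xrightarrow{f_i}Y_i\xrightarrow{g_i}Z_i\to 0$ is exact in $A$-mod for each $i\in Q_0$. (ii) The exact category $\mathrm{Mon}(Q,A)$ is Frobenius, and its indecomposable projective objects are of the form $\mathbf{m}_i(P)$ (up to isomorphism), where $i\in Q_0$ and $P$ is an indecomposable projective module in $A$-mod.
   Context: $Q=(Q_0,Q_1,s,e)$ with $Q_0$ the vertices, $Q_1$ the arrows, $s(\alpha)$ and $e(\alpha)$ the starting and ending vertices of an arrow $\alpha$; acyclic means without oriented cycles. $A$-mod is the category of finite-dimensional left $A$-modules. $\mathrm{Rep}(Q,A)$ is the category of finite-dimensional representations of $Q$ over $A$: an object $X=(X_i,X_\alpha)$ consists of $X_i\in A$-mod for $i\in Q_0$ and $A$-maps $X_\alpha:X_{s(\alpha)}\to X_{e(\alpha)}$ for $\alpha\in Q_1$; a morphism $f:X\to Y$ is a family of $A$-maps $f_i:X_i\to Y_i$ with $Y_\alpha f_{s(\alpha)}=f_{e(\alpha)}X_\alpha$ for all $\alpha\in Q_1$. $X\in\mathrm{Rep}(Q,A)$ is monic if for each $i\in Q_0$ the $A$-map $\delta_i(X)=(X_\alpha)_{e(\alpha)=i}:\bigoplus_{\alpha\in Q_1,\,e(\alpha)=i}X_{s(\alpha)}\to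 X_i$ is injective. $\mathrm{Mon}(Q,A)$ is the full subcategory of $\mathrm{Rep}(Q,A)$ of monic representations. Left $kQ$-modules are identified with representations of $Q$ over $k$; $P(i)$ is the indecomposable projective $kQ$-module at $i$, i.e. the representation whose space at $j$ has as basis the paths from $i$ to $j$, arrows acting by composition. The functor $\mathbf{m}_i=P(i)\otimes_k-:A\text{-mod}\to\mathrm{Mon}(Q,A)$ is given by $P(i)\otimes_kT=(P(i)_j\otimes_kT,\ P(i)_\alpha\otimes_k\mathrm{Id}_T)$. An exact category is Frobenius if it has enough projective objects, enough injective objects, and its projective and injective objects coincide (all with respect to the exact structure). *)

theory Defs
  imports
    "HOL-Library.Equipollence"
    "HOL-Algebra.Module"
    "HOL-Algebra.Free_Abelian_Groups"
    "Graph_Theory.Arc_Walk"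
begin

section \<open>Additive categories\<close>

text \<open>
  Arrows are untyped: \<open>Hom C X Y\<close> is a set of arrows, and different Hom-sets need not be disjoint.
  Hence composition is indexed by the three objects involved:
  \<open>Comp C X Y Z g f\<close> is \<open>g\<close> after \<open>f\<close> for \<open>f \<in> Hom C X Y\<close> and \<open>g \<in> Hom C Y Z\<close>.
\<close>

record ('o, 'f) cat =
  Obj :: "'o set"
  Hom :: "'o \<Rightarrow> 'o \<Rightarrow> 'f set"
  Comp :: "'o \<Rightarrow> 'o \<Rightarrow> 'o \<Rightarrow> 'f \<Rightarrow> 'f \<Rightarrow> 'f"
  Ident :: "'o \<Rightarrow> 'f"
  Hplus :: "'o \<Rightarrow> 'o \<Rightarrow> 'f \<Rightarrow> 'f \<Rightarrow> 'f"
  Hzero :: "'o \<Rightarrow> 'o \<Rightarrow> 'f"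

locale category =
  fixes C :: "('o, 'f) cat"
  assumes Ident_in: "X \<in> Obj C \<Longrightarrow> Ident C X \<in> Hom C X X"
    and Comp_in: "\<lbrakk>X \<in> Obj C; Y \<in> Obj C; Z \<in> Obj C; f \<in> Hom C X Y; g \<in> Hom C Y Z\<rbrakk>
      \<Longrightarrow> Comp C X Y Z g f \<in> Hom C X Z"
    and Ident_left: "\<lbrakk>X \<in> Obj C; Y \<in> Obj C; f \<in> Hom C X Y\<rbrakk> \<Longrightarrow> Comp C X Y Y (Ident C Y) f = f"
    and Ident_right: "\<lbrakk>X \<in> Obj C; Y \<in> Obj C; f \<in> Hom C X Y\<rbrakk> \<Longrightarrow> Comp C X X Y f (Ident C X) = f"
    and Comp_assoc:
      "\<lbrakk>W \<in> Obj C; X \<in> Obj C; Y \<in> Obj C; Z \<in> Obj C;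
        f \<in> Hom C W X; g \<in> Hom C X Y; h \<in> Hom C Y Z\<rbrakk>
      \<Longrightarrow> Comp C W X Z (Comp C X Y Z h g) f = Comp C W Y Z h (Comp C W X Y g f)"

locale preadditive_category = category +
  assumes Hom_comm_group: "\<lbrakk>X \<in> Obj C; Y \<in> Obj C\<rbrakk>
      \<Longrightarrow> comm_group \<lparr>carrier = Hom C X Y, monoid.mult = Hplus C X Y, one = Hzero C X Y\<rparr>"
    and Comp_Hplus_left:
      "\<lbrakk>X \<in> Obj C; Y \<in> Obj C; Z \<in> Obj C; f \<in> Hom C X Y; g \<in> Hom C Y Z; h \<in> Hom C Y Z\<rbrakk>
      \<Longrightarrow> Comp C X Y Z (Hplus C Y Z g h) f = Hplus C X Z (Comp C X Y Z g f) (Comp C X Y Z h f)"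
    and Comp_Hplus_right:
      "\<lbrakk>X \<in> Obj C; Y \<in> Obj C; Z \<in> Obj C; f \<in> Hom C X Y; g \<in> Hom C X Y; h \<in> Hom C Y Z\<rbrakk>
      \<Longrightarrow> Comp C X Y Z h (Hplus C X Y f g) = Hplus C X Z (Comp C X Y Z h f) (Comp C X Y Z h g)"

definition zero_object :: "('o, 'f) cat \<Rightarrow> 'o \<Rightarrow> bool" where
  "zero_object C X \<longleftrightarrow> X \<in> Obj C \<and>
     (\<forall>Y\<in>Obj C. (\<exists>!f. f \<in> Hom C X Y) \<and> (\<exists>!f. f \<in> Hom C Y X))"

definition is_biproduct ::
  "('o, 'f) cat \<Rightarrow> 'o \<Rightarrow> 'o \<Rightarrow> 'o \<Rightarrow> 'f \<Rightarrow> 'f \<Rightarrow> 'f \<Rightarrow> 'f \<Rightarrow> bool" where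
  "is_biproduct C X Y B i\<^sub>1 i\<^sub>2 p\<^sub>1 p\<^sub>2 \<longleftrightarrow>
     X \<in> Obj C \<and> Y \<in> Obj C \<and> B \<in> Obj C \<and>
     i\<^sub>1 \<in> Hom C X B \<and> i\<^sub>2 \<in> Hom C Y B \<and> p\<^sub>1 \<in> Hom C B X \<and> p\<^sub>2 \<in> Hom C B Y \<and>
     Comp C X B X p\<^sub>1 i\<^sub>1 = Ident C X \<and> Comp C Y B Y p\<^sub>2 i\<^sub>2 = Ident C Y \<and>
     Comp C X B Y p\<^sub>2 i\<^sub>1 = Hzero C X Y \<and> Comp C Y B X p\<^sub>1 i\<^sub>2 = Hzero C Y X \<and>
     Hplus C B B (Comp C B X B i\<^sub>1 p\<^sub>1) (Comp C B Y B i\<^sub>2 p\<^sub>2) = Ident C B"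

locale additive_category = preadditive_category +
  assumes zero_object_exists: "\<exists>X. zero_object C X"
    and biproduct_exists: "\<lbrakk>X \<in> Obj C; Y \<in> Obj C\<rbrakk>
      \<Longrightarrow> \<exists>B i\<^sub>1 i\<^sub>2 p\<^sub>1 p\<^sub>2. is_biproduct C X Y B i\<^sub>1 i\<^sub>2 p\<^sub>1 p\<^sub>2"

definition indecomposable :: "('o, 'f) cat \<Rightarrow> 'o \<Rightarrow> bool" where
  "indecomposable C X \<longleftrightarrow> X \<in> Obj C \<and> \<not> zero_object C X \<and>
     (\<forall>Y Z i\<^sub>1 i\<^sub>2 p\<^sub>1 p\<^sub>2. is_biproduct C Y Z X i\<^sub>1 i\<^sub>2 p\<^sub>1 p\<^sub>2 \<longrightarrow>
        zero_object C Y \<or> zero_object C Z)"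

definition is_iso :: "('o, 'f) cat \<Rightarrow> 'o \<Rightarrow> 'o \<Rightarrow> 'f \<Rightarrow> bool" where
  "is_iso C X Y f \<longleftrightarrow> X \<in> Obj C \<and> Y \<in> Obj C \<and> f \<in> Hom C X Y \<and>
     (\<exists>g\<in>Hom C Y X. Comp C X Y X g f = Ident C X \<and> Comp C Y X Y f g = Ident C Y)"

definition is_kernel :: "('o, 'f) cat \<Rightarrow> 'o \<Rightarrow> 'f \<Rightarrow> 'o \<Rightarrow> 'f \<Rightarrow> 'o \<Rightarrow> bool" where
  "is_kernel C X f Y g Z \<longleftrightarrow>
     X \<in> Obj C \<and> Y \<in> Obj C \<and> Z \<in> Obj C \<and> f \<in> Hom C X Y \<and> g \<in> Hom C Y Z \<and>
     Comp C X Y Z g f = Hzero C X Z \<and>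
     (\<forall>W\<in>Obj C. \<forall>h\<in>Hom C W Y. Comp C W Y Z g h = Hzero C W Z \<longrightarrow>
        (\<exists>!u. u \<in> Hom C W X \<and> Comp C W X Y f u = h))"

definition is_cokernel :: "('o, 'f) cat \<Rightarrow> 'o \<Rightarrow> 'f \<Rightarrow> 'o \<Rightarrow> 'f \<Rightarrow> 'o \<Rightarrow> bool" where
  "is_cokernel C X f Y g Z \<longleftrightarrow>
     X \<in> Obj C \<and> Y \<in> Obj C \<and> Z \<in> Obj C \<and> f \<in> Hom C X Y \<and> g \<in> Hom C Y Z \<and>
     Comp C X Y Z g f = Hzero C X Z \<and>
     (\<forall>W\<in>Obj C. \<forall>h\<in>Hom C Y W. Comp C X Y W h f = Hzero C X W \<longrightarrow>
        (\<exists>!u. u \<in> Hom C Z W \<and> Comp C Y Z W u g = h))"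

text \<open>\<open>is_pushout C X Y X' Y' f a f' b\<close>: the square with \<open>f : X \<rightarrow> Y\<close>, \<open>a : X \<rightarrow> X'\<close>,
  \<open>f' : X' \<rightarrow> Y'\<close>, \<open>b : Y \<rightarrow> Y'\<close> is a pushout of \<open>f\<close> along \<open>a\<close>.\<close>

definition is_pushout ::
  "('o, 'f) cat \<Rightarrow> 'o \<Rightarrow> 'o \<Rightarrow> 'o \<Rightarrow> 'o \<Rightarrow> 'f \<Rightarrow> 'f \<Rightarrow> 'f \<Rightarrow> 'f \<Rightarrow> bool" where
  "is_pushout C X Y X' Y' f a f' b \<longleftrightarrow>
     X \<in> Obj C \<and> Y \<in> Obj C \<and> X' \<in> Obj C \<and> Y' \<in> Obj C \<and>
     f \<in> Hom C X Y \<and> a \<in> Hom C X X' \<and> f' \<in> Hom C X' Y' \<and> b \<in> Hom C Y Y' \<and>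
     Comp C X Y Y' b f = Comp C X X' Y' f' a \<and>
     (\<forall>W\<in>Obj C. \<forall>h\<in>Hom C Y W. \<forall>h'\<in>Hom C X' W. Comp C X Y W h f = Comp C X X' W h' a \<longrightarrow>
        (\<exists>!u. u \<in> Hom C Y' W \<and> Comp C Y Y' W u b = h \<and> Comp C X' Y' W u f' = h'))"

text \<open>\<open>is_pullback C Y Z Y' Z' g c g' b\<close>: the square with \<open>g : Y \<rightarrow> Z\<close>, \<open>c : Z' \<rightarrow> Z\<close>,
  \<open>g' : Y' \<rightarrow> Z'\<close>, \<open>b : Y' \<rightarrow> Y\<close> is a pullback of \<open>g\<close> along \<open>c\<close>.\<close>

definition is_pullback ::
  "('o, 'f) cat \<Rightarrow> 'o \<Rightarrow> 'o \<Rightarrow> 'o \<Rightarrow> 'o \<Rightarrow> 'f \<Rightarrow> 'f \<Rightarrow> 'f \<Rightarrow> 'f \<Rightarrow> bool" where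
  "is_pullback C Y Z Y' Z' g c g' b \<longleftrightarrow>
     Y \<in> Obj C \<and> Z \<in> Obj C \<and> Y' \<in> Obj C \<and> Z' \<in> Obj C \<and>
     g \<in> Hom C Y Z \<and> c \<in> Hom C Z' Z \<and> g' \<in> Hom C Y' Z' \<and> b \<in> Hom C Y' Y \<and>
     Comp C Y' Y Z g b = Comp C Y' Z' Z c g' \<and>
     (\<forall>W\<in>Obj C. \<forall>h\<in>Hom C W Y. \<forall>h'\<in>Hom C W Z'. Comp C W Y Z g h = Comp C W Z' Z c h' \<longrightarrow>
        (\<exists>!u. u \<in> Hom C W Y' \<and> Comp C W Y' Y b u = h \<and> Comp C W Y' Z' g' u = h'))"


section \<open>Exact and Frobenius categories\<close>

text \<open>
  \<open>E X f Y g Z\<close> says that \<open>0 \<rightarrow> X \<rightarrow> Y \<rightarrow> Z \<rightarrow> 0\<close>, with maps \<open>f\<close> and \<open>g\<close>, is a conflation.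
  The axioms are Quillen's, in the form E0, E0op, E1, E1op, E2, E2op of
  Buehler, Exact categories (2010).
\<close>

type_synonym ('o, 'f) seqs = "'o \<Rightarrow> 'f \<Rightarrow> 'o \<Rightarrow> 'f \<Rightarrow> 'o \<Rightarrow> bool"

definition inflation :: "('o, 'f) seqs \<Rightarrow> 'o \<Rightarrow> 'f \<Rightarrow> 'o \<Rightarrow> bool" where
  "inflation E X f Y \<longleftrightarrow> (\<exists>g Z. E X f Y g Z)"

definition deflation :: "('o, 'f) seqs \<Rightarrow> 'o \<Rightarrow> 'f \<Rightarrow> 'o \<Rightarrow> bool" where
  "deflation E Y g Z \<longleftrightarrow> (\<exists>X f. E X f Y g Z)"

locale exact_category = additive_category C for C :: "('o, 'f) cat" +
  fixes E :: "('o, 'f) seqs"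
  assumes conflation_kernel: "E X f Y g Z \<Longrightarrow> is_kernel C X f Y g Z"
    and conflation_cokernel: "E X f Y g Z \<Longrightarrow> is_cokernel C X f Y g Z"
    and conflation_iso:
      "\<lbrakk>E X f Y g Z; is_iso C X X' a; is_iso C Y Y' b; is_iso C Z Z' c;
        f' \<in> Hom C X' Y'; g' \<in> Hom C Y' Z';
        Comp C X X' Y' f' a = Comp C X Y Y' b f; Comp C Y Y' Z' g' b = Comp C Y Z Z' c g\<rbrakk>
      \<Longrightarrow> E X' f' Y' g' Z'"
    and Ident_inflation: "X \<in> Obj C \<Longrightarrow> inflation E X (Ident C X) X"
    and Ident_deflation: "X \<in> Obj C \<Longrightarrow> deflation E X (Ident C X) X"
    and inflation_Comp: "\<lbrakk>inflation E X f Y; inflation E Y g Z\<rbrakk>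
      \<Longrightarrow> inflation E X (Comp C X Y Z g f) Z"
    and deflation_Comp: "\<lbrakk>deflation E X f Y; deflation E Y g Z\<rbrakk>
      \<Longrightarrow> deflation E X (Comp C X Y Z g f) Z"
    and inflation_pushout: "\<lbrakk>inflation E X f Y; X' \<in> Obj C; a \<in> Hom C X X'\<rbrakk>
      \<Longrightarrow> \<exists>Y' f' b. is_pushout C X Y X' Y' f a f' b \<and> inflation E X' f' Y'"
    and deflation_pullback: "\<lbrakk>deflation E Y g Z; Z' \<in> Obj C; c \<in> Hom C Z' Z\<rbrakk>
      \<Longrightarrow> \<exists>Y' g' b. is_pullback C Y Z Y' Z' g c g' b \<and> deflation E Y' g' Z'"

definition projective_object :: "('o, 'f) cat \<Rightarrow> ('o, 'f) seqs \<Rightarrow> 'o \<Rightarrow> bool" where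
  "projective_object C E P \<longleftrightarrow> P \<in> Obj C \<and>
     (\<forall>Y g Z. deflation E Y g Z \<longrightarrow>
        (\<forall>h\<in>Hom C P Z. \<exists>u\<in>Hom C P Y. Comp C P Y Z g u = h))"

definition injective_object :: "('o, 'f) cat \<Rightarrow> ('o, 'f) seqs \<Rightarrow> 'o \<Rightarrow> bool" where
  "injective_object C E I \<longleftrightarrow> I \<in> Obj C \<and>
     (\<forall>X f Y. inflation E X f Y \<longrightarrow>
        (\<forall>h\<in>Hom C X I. \<exists>u\<in>Hom C Y I. Comp C X Y I u f = h))"

locale frobenius_category = exact_category +
  assumes enough_projectives: "X \<in> Obj C \<Longrightarrow> \<exists>P p. projective_object C E P \<and> deflation E P p X"
    and enough_injectives: "X \<in> Obj C \<Longrightarrow> \<exists>I i. injective_object C E I \<and> inflation E X i I"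
    and projective_iff_injective:
      "X \<in> Obj C \<Longrightarrow> projective_object C E X \<longleftrightarrow> injective_object C E X"


section \<open>Finite-dimensional algebras and modules\<close>

text \<open>
  The library's \<^locale>\<open>Module.module\<close> is restricted to commutative scalars.  Its record type is used
  here for left modules over an arbitrary ring as well; the fields \<^const>\<open>monoid.mult\<close> and
  \<^const>\<open>one\<close> that it inherits from the ring record are irrelevant.
\<close>

locale left_module = R?: ring R + M?: abelian_group M
  for R (structure) and M :: "('a, 'm) module" (structure) +
  assumes smult_closed: "\<lbrakk>a \<in> carrier R; x \<in> carrier M\<rbrakk> \<Longrightarrow> a \<odot>\<^bsub>M\<^esub> x \<in> carrier M"
    and smult_l_distr: "\<lbrakk>a \<in> carrier R; b \<in> carrier R; x \<in> carrier M\<rbrakk>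
      \<Longrightarrow> (a \<oplus>\<^bsub>R\<^esub> b) \<odot>\<^bsub>M\<^esub> x = (a \<odot>\<^bsub>M\<^esub> x) \<oplus>\<^bsub>M\<^esub> (b \<odot>\<^bsub>M\<^esub> x)"
    and smult_r_distr: "\<lbrakk>a \<in> carrier R; x \<in> carrier M; y \<in> carrier M\<rbrakk>
      \<Longrightarrow> a \<odot>\<^bsub>M\<^esub> (x \<oplus>\<^bsub>M\<^esub> y) = (a \<odot>\<^bsub>M\<^esub> x) \<oplus>\<^bsub>M\<^esub> (a \<odot>\<^bsub>M\<^esub> y)"
    and smult_assoc: "\<lbrakk>a \<in> carrier R; b \<in> carrier R; x \<in> carrier M\<rbrakk>
      \<Longrightarrow> (a \<otimes>\<^bsub>R\<^esub> b) \<odot>\<^bsub>M\<^esub> x = a \<odot>\<^bsub>M\<^esub> (b \<odot>\<^bsub>M\<^esub> x)"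
    and smult_one: "x \<in> carrier M \<Longrightarrow> \<one>\<^bsub>R\<^esub> \<odot>\<^bsub>M\<^esub> x = x"

definition finite_dimensional :: "'k ring \<Rightarrow> ('k, 'm) module \<Rightarrow> bool" where
  "finite_dimensional K V \<longleftrightarrow> field K \<and> Module.module K V \<and>
     (\<exists>B. finite B \<and> B \<subseteq> carrier V \<and>
        carrier V = {\<Oplus>\<^bsub>V\<^esub>b\<in>B. c b \<odot>\<^bsub>V\<^esub> b | c. c \<in> Pi B (\<lambda>_. carrier K)})"

text \<open>The library's \<^locale>\<open>algebra\<close> is commutative, so this is not an instance of it.\<close>

locale fd_algebra =
  fixes K :: "'k ring" and A :: "('k, 'a) module"
  assumes field_K: "field K"
    and ring_A: "ring A"
    and module_A: "Module.module K A"
    and smult_mult_left: "\<lbrakk>c \<in> carrier K; x \<in> carrier A; y \<in> carrier A\<rbrakk>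
      \<Longrightarrow> (c \<odot>\<^bsub>A\<^esub> x) \<otimes>\<^bsub>A\<^esub> y = c \<odot>\<^bsub>A\<^esub> (x \<otimes>\<^bsub>A\<^esub> y)"
    and smult_mult_right: "\<lbrakk>c \<in> carrier K; x \<in> carrier A; y \<in> carrier A\<rbrakk>
      \<Longrightarrow> x \<otimes>\<^bsub>A\<^esub> (c \<odot>\<^bsub>A\<^esub> y) = c \<odot>\<^bsub>A\<^esub> (x \<otimes>\<^bsub>A\<^esub> y)"
    and finite_dimensional_A: "finite_dimensional K A"

text \<open>The vector space over \<open>K\<close> underlying a left \<open>A\<close>-module.\<close>

definition underlying :: "'k ring \<Rightarrow> ('k, 'a) module \<Rightarrow> ('a, 'm) module \<Rightarrow> ('k, 'm) module" where
  "underlying K A M = \<lparr>carrier = carrier M, monoid.mult = monoid.mult M, one = one M,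
     ring.zero = ring.zero M, ring.add = ring.add M, smult = (\<lambda>c x. (c \<odot>\<^bsub>A\<^esub> \<one>\<^bsub>A\<^esub>) \<odot>\<^bsub>M\<^esub> x)\<rparr>"

definition fd_module :: "'k ring \<Rightarrow> ('k, 'a) module \<Rightarrow> ('a, 'm) module \<Rightarrow> bool" where
  "fd_module K A M \<longleftrightarrow> left_module A M \<and> finite_dimensional K (underlying K A M)"

definition regular_module :: "('k, 'a) module \<Rightarrow> ('a, 'a) module" where
  "regular_module A = \<lparr>carrier = carrier A, monoid.mult = monoid.mult A, one = one A,
     ring.zero = ring.zero A, ring.add = ring.add A, smult = monoid.mult A\<rparr>"

text \<open>
  Linear maps are extensional functions (\<^const>\<open>undefined\<close> outside the carrier), so that equality of
  maps is equality of functions.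
\<close>

definition mod_hom :: "('a, 'z) ring_scheme \<Rightarrow> ('a, 'm) module \<Rightarrow> ('a, 'n) module \<Rightarrow> ('m \<Rightarrow> 'n) set"
  where
  "mod_hom R M N = {f \<in> carrier M \<rightarrow>\<^sub>E carrier N.
     (\<forall>x\<in>carrier M. \<forall>y\<in>carrier M. f (x \<oplus>\<^bsub>M\<^esub> y) = f x \<oplus>\<^bsub>N\<^esub> f y) \<and>
     (\<forall>a\<in>carrier R. \<forall>x\<in>carrier M. f (a \<odot>\<^bsub>M\<^esub> x) = a \<odot>\<^bsub>N\<^esub> f x)}"

definition mod_iso :: "('a, 'z) ring_scheme \<Rightarrow> ('a, 'm) module \<Rightarrow> ('a, 'n) module \<Rightarrow> bool" where
  "mod_iso R M N \<longleftrightarrow> (\<exists>f\<in>mod_hom R M N. bij_betw f (carrier M) (carrier N))"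

definition short_exact ::
  "('m, 'x) ring_scheme \<Rightarrow> ('m \<Rightarrow> 'n) \<Rightarrow> ('n, 'y) ring_scheme \<Rightarrow> ('n \<Rightarrow> 'p) \<Rightarrow> ('p, 'z) ring_scheme \<Rightarrow> bool"
  where
  "short_exact X f Y g Z \<longleftrightarrow> inj_on f (carrier X) \<and>
     f ` carrier X = {y \<in> carrier Y. g y = \<zero>\<^bsub>Z\<^esub>} \<and> g ` carrier Y = carrier Z"

text \<open>
  The category of finite-dimensional left \<open>A\<close>-modules whose elements have type \<open>'m\<close>.  If all finite
  lists over \<open>carrier K\<close> embed into \<open>'m\<close>, then every finite-dimensional left \<open>A\<close>-module, over
  whatever type, is isomorphic to an object of this category.
\<close>

definition mod_cat :: "'k ring \<Rightarrow> ('k, 'a) module \<Rightarrow> (('a, 'm) module, 'm \<Rightarrow> 'm) cat" where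
  "mod_cat K A = \<lparr>
     Obj = {M. fd_module K A M},
     Hom = mod_hom A,
     Comp = (\<lambda>X Y Z g f. compose (carrier X) g f),
     Ident = (\<lambda>X. \<lambda>x\<in>carrier X. x),
     Hplus = (\<lambda>X Y f g. \<lambda>x\<in>carrier X. f x \<oplus>\<^bsub>Y\<^esub> g x),
     Hzero = (\<lambda>X Y. \<lambda>x\<in>carrier X. \<zero>\<^bsub>Y\<^esub>)\<rparr>"

definition mod_exact :: "'k ring \<Rightarrow> ('k, 'a) module \<Rightarrow> (('a, 'm) module, 'm \<Rightarrow> 'm) seqs" where
  "mod_exact K A X f Y g Z \<longleftrightarrow>
     X \<in> Obj (mod_cat K A) \<and> Y \<in> Obj (mod_cat K A) \<and> Z \<in> Obj (mod_cat K A) \<and>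
     f \<in> Hom (mod_cat K A) X Y \<and> g \<in> Hom (mod_cat K A) Y Z \<and> short_exact X f Y g Z"

text \<open>
  The left regular module is injective in the category of finite-dimensional modules.  Its elements
  have type \<open>'a\<close> rather than \<open>'m\<close>, hence the isomorphic copy.
\<close>

definition self_injective :: "'m itself \<Rightarrow> 'k ring \<Rightarrow> ('k, 'a) module \<Rightarrow> bool" where
  "self_injective _ K A \<longleftrightarrow>
     (\<exists>I :: ('a, 'm) module. mod_iso A (regular_module A) I \<and>
        injective_object (mod_cat K A) (mod_exact K A) I)"


section \<open>Representations of quivers\<close>

text \<open>A quiver is a digraph possibly with loops and multiple arcs; \<open>s\<close> is \<^const>\<open>tail\<close> and
  \<open>e\<close> is \<^const>\<open>head\<close>.\<close>

definition acyclic_quiver :: "('v, 'e) pre_digraph \<Rightarrow> bool" where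
  "acyclic_quiver Q \<longleftrightarrow> \<not> (\<exists>u p. p \<noteq> [] \<and> pre_digraph.awalk Q u p u)"

text \<open>Paths are lists of arrows in the order in which they are traversed.\<close>

definition paths :: "('v, 'e) pre_digraph \<Rightarrow> 'v \<Rightarrow> 'v \<Rightarrow> 'e list set" where
  "paths Q i j = {p. pre_digraph.awalk Q i p j}"

record ('v, 'e, 'a, 'm) rep =
  space :: "'v \<Rightarrow> ('a, 'm) module"
  arr :: "'e \<Rightarrow> 'm \<Rightarrow> 'm"

definition rep_hom :: "('v, 'e) pre_digraph \<Rightarrow> ('a, 'z) ring_scheme \<Rightarrow>
    ('v, 'e, 'a, 'm) rep \<Rightarrow> ('v, 'e, 'a, 'n) rep \<Rightarrow> ('v \<Rightarrow> 'm \<Rightarrow> 'n) set" where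
  "rep_hom Q R X Y = {f \<in> (\<Pi>\<^sub>E i\<in>verts Q. mod_hom R (space X i) (space Y i)).
     \<forall>\<alpha>\<in>arcs Q. \<forall>x\<in>carrier (space X (tail Q \<alpha>)).
       arr Y \<alpha> (f (tail Q \<alpha>) x) = f (head Q \<alpha>) (arr X \<alpha> x)}"

definition rep_iso :: "('v, 'e) pre_digraph \<Rightarrow> ('a, 'z) ring_scheme \<Rightarrow>
    ('v, 'e, 'a, 'm) rep \<Rightarrow> ('v, 'e, 'a, 'n) rep \<Rightarrow> bool" where
  "rep_iso Q R X Y \<longleftrightarrow> (\<exists>f\<in>rep_hom Q R X Y.
     \<forall>i\<in>verts Q. bij_betw (f i) (carrier (space X i)) (carrier (space Y i)))"

definition Rep :: "('v, 'e) pre_digraph \<Rightarrow> 'k ring \<Rightarrow> ('k, 'a) module \<Rightarrow>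
    (('v, 'e, 'a, 'm) rep, 'v \<Rightarrow> 'm \<Rightarrow> 'm) cat" where
  "Rep Q K A = \<lparr>
     Obj = {X. (\<forall>i\<in>verts Q. space X i \<in> Obj (mod_cat K A)) \<and>
               (\<forall>\<alpha>\<in>arcs Q. arr X \<alpha> \<in> Hom (mod_cat K A) (space X (tail Q \<alpha>)) (space X (head Q \<alpha>)))},
     Hom = rep_hom Q A,
     Comp = (\<lambda>X Y Z g f. \<lambda>i\<in>verts Q.
       Comp (mod_cat K A) (space X i) (space Y i) (space Z i) (g i) (f i)),
     Ident = (\<lambda>X. \<lambda>i\<in>verts Q. Ident (mod_cat K A) (space X i)),
     Hplus = (\<lambda>X Y f g. \<lambda>i\<in>verts Q. Hplus (mod_cat K A) (space X i) (space Y i) (f i) (g i)),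
     Hzero = (\<lambda>X Y. \<lambda>i\<in>verts Q. Hzero (mod_cat K A) (space X i) (space Y i))\<rparr>"

definition arrows_into :: "('v, 'e) pre_digraph \<Rightarrow> 'v \<Rightarrow> 'e set" where
  "arrows_into Q i = {\<alpha> \<in> arcs Q. head Q \<alpha> = i}"

text \<open>The direct sum in the domain of \<open>delta Q X i\<close> is finite, hence given by the set of all families.\<close>

definition delta_domain ::
  "('v, 'e) pre_digraph \<Rightarrow> ('v, 'e, 'a, 'm) rep \<Rightarrow> 'v \<Rightarrow> ('e \<Rightarrow> 'm) set" where
  "delta_domain Q X i = (\<Pi>\<^sub>E \<alpha>\<in>arrows_into Q i. carrier (space X (tail Q \<alpha>)))"

definition delta ::
  "('v, 'e) pre_digraph \<Rightarrow> ('v, 'e, 'a, 'm) rep \<Rightarrow> 'v \<Rightarrow> ('e \<Rightarrow> 'm) \<Rightarrow> 'm" where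
  "delta Q X i x = (\<Oplus>\<^bsub>space X i\<^esub>\<alpha>\<in>arrows_into Q i. arr X \<alpha> (x \<alpha>))"

definition monic :: "('v, 'e) pre_digraph \<Rightarrow> ('v, 'e, 'a, 'm) rep \<Rightarrow> bool" where
  "monic Q X \<longleftrightarrow> (\<forall>i\<in>verts Q. inj_on (delta Q X i) (delta_domain Q X i))"

definition Mon :: "('v, 'e) pre_digraph \<Rightarrow> 'k ring \<Rightarrow> ('k, 'a) module \<Rightarrow>
    (('v, 'e, 'a, 'm) rep, 'v \<Rightarrow> 'm \<Rightarrow> 'm) cat" where
  "Mon Q K A = (Rep Q K A)\<lparr>Obj := {X \<in> Obj (Rep Q K A). monic Q X}\<rparr>"

definition Mon_exact :: "('v, 'e) pre_digraph \<Rightarrow> 'k ring \<Rightarrow> ('k, 'a) module \<Rightarrow>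
    (('v, 'e, 'a, 'm) rep, 'v \<Rightarrow> 'm \<Rightarrow> 'm) seqs" where
  "Mon_exact Q K A X f Y g Z \<longleftrightarrow>
     X \<in> Obj (Mon Q K A) \<and> Y \<in> Obj (Mon Q K A) \<and> Z \<in> Obj (Mon Q K A) \<and>
     f \<in> Hom (Mon Q K A) X Y \<and> g \<in> Hom (Mon Q K A) Y Z \<and>
     (\<forall>i\<in>verts Q. short_exact (space X i) (f i) (space Y i) (g i) (space Z i))"


section \<open>The functors \<open>m\<^sub>i\<close>\<close>

text \<open>For finite \<open>B\<close>, the vector space with basis \<open>B\<close>, a vector being its family of coordinates.\<close>

definition free_space :: "'k ring \<Rightarrow> 'b set \<Rightarrow> ('k, 'b \<Rightarrow> 'k) module" where
  "free_space K B = \<lparr>carrier = B \<rightarrow>\<^sub>E carrier K, monoid.mult = undefined, one = undefined,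
     ring.zero = (\<lambda>b\<in>B. \<zero>\<^bsub>K\<^esub>), ring.add = (\<lambda>x y. \<lambda>b\<in>B. x b \<oplus>\<^bsub>K\<^esub> y b),
     smult = (\<lambda>c x. \<lambda>b\<in>B. c \<otimes>\<^bsub>K\<^esub> x b)\<rparr>"

text \<open>
  \<open>P(i)\<close> as a representation over \<open>K\<close>.  An arrow \<open>\<alpha>\<close> acts by the linear extension of
  \<open>p \<mapsto> p @ [\<alpha>]\<close> on basis elements.
\<close>

definition proj_rep ::
  "('v, 'e) pre_digraph \<Rightarrow> 'k ring \<Rightarrow> 'v \<Rightarrow> ('v, 'e, 'k, 'e list \<Rightarrow> 'k) rep" where
  "proj_rep Q K i = \<lparr>
     space = (\<lambda>j. free_space K (paths Q i j)),
     arr = (\<lambda>\<alpha>. \<lambda>x\<in>carrier (free_space K (paths Q i (tail Q \<alpha>))). \<lambda>q\<in>paths Q i (head Q \<alpha>).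
       \<Oplus>\<^bsub>K\<^esub>p\<in>{p \<in> paths Q i (tail Q \<alpha>). p @ [\<alpha>] = q}. x p)\<rparr>"

text \<open>
  The tensor product of two vector spaces over \<open>K\<close>: the free abelian group on
  \<open>carrier V \<times> carrier T\<close> modulo the subgroup generated by the relations of bilinearity and balance.
\<close>

definition tensor_free ::
  "('k, 'x) module \<Rightarrow> ('k, 'm) module \<Rightarrow> ('x \<times> 'm \<Rightarrow>\<^sub>0 int) monoid" where
  "tensor_free V T = free_Abelian_group (carrier V \<times> carrier T)"

definition tensor_relations ::
  "'k ring \<Rightarrow> ('k, 'x) module \<Rightarrow> ('k, 'm) module \<Rightarrow> ('x \<times> 'm \<Rightarrow>\<^sub>0 int) set" where
  "tensor_relations K V T = generate (tensor_free V T)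
     ({frag_of (v \<oplus>\<^bsub>V\<^esub> w, t) - frag_of (v, t) - frag_of (w, t) | v w t.
         v \<in> carrier V \<and> w \<in> carrier V \<and> t \<in> carrier T} \<union>
      {frag_of (v, t \<oplus>\<^bsub>T\<^esub> u) - frag_of (v, t) - frag_of (v, u) | v t u.
         v \<in> carrier V \<and> t \<in> carrier T \<and> u \<in> carrier T} \<union>
      {frag_of (c \<odot>\<^bsub>V\<^esub> v, t) - frag_of (v, c \<odot>\<^bsub>T\<^esub> t) | c v t.
         c \<in> carrier K \<and> v \<in> carrier V \<and> t \<in> carrier T})"

definition tensor_group ::
  "'k ring \<Rightarrow> ('k, 'x) module \<Rightarrow> ('k, 'm) module \<Rightarrow> ('x \<times> 'm \<Rightarrow>\<^sub>0 int) set monoid" where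
  "tensor_group K V T = tensor_free V T Mod tensor_relations K V T"

text \<open>The map \<open>V \<otimes> T \<rightarrow> W \<otimes> U\<close> with \<open>v \<otimes> t \<mapsto> \<phi> v \<otimes> \<psi> t\<close>, for linear maps \<open>\<phi>\<close> and \<open>\<psi>\<close>; its
  value at a coset is the coset (independent of \<open>z\<close>) of the images of its elements \<open>z\<close>.\<close>

definition tensor_map ::
  "'k ring \<Rightarrow> ('k, 'x) module \<Rightarrow> ('k, 'm) module \<Rightarrow> ('k, 'y) module \<Rightarrow> ('k, 'n) module \<Rightarrow>
   ('x \<Rightarrow> 'y) \<Rightarrow> ('m \<Rightarrow> 'n) \<Rightarrow> ('x \<times> 'm \<Rightarrow>\<^sub>0 int) set \<Rightarrow> ('y \<times> 'n \<Rightarrow>\<^sub>0 int) set" where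
  "tensor_map K V T W U \<phi> \<psi> = (\<lambda>z\<^sub>0\<in>carrier (tensor_group K V T).
     \<Union>z\<in>z\<^sub>0. tensor_relations K W U #>\<^bsub>tensor_free W U\<^esub>
       frag_extend (\<lambda>(v, t). frag_of (\<phi> v, \<psi> t)) z)"

text \<open>The left \<open>A\<close>-module \<open>V \<otimes> T\<close> for a vector space \<open>V\<close> and a left \<open>A\<close>-module \<open>T\<close>, with
  \<open>a (v \<otimes> t) = v \<otimes> a t\<close>.\<close>

definition tensor_module :: "'k ring \<Rightarrow> ('k, 'a) module \<Rightarrow> ('k, 'x) module \<Rightarrow> ('a, 'm) module \<Rightarrow>
    ('a, ('x \<times> 'm \<Rightarrow>\<^sub>0 int) set) module" where
  "tensor_module K A V T = (let T\<^sub>K = underlying K A T; G = tensor_group K V T\<^sub>K in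
     \<lparr>carrier = carrier G, monoid.mult = undefined, one = undefined,
      ring.zero = \<one>\<^bsub>G\<^esub>, ring.add = monoid.mult G,
      smult = (\<lambda>a. tensor_map K V T\<^sub>K V T\<^sub>K (\<lambda>v. v) (\<lambda>t. a \<odot>\<^bsub>T\<^esub> t))\<rparr>)"

definition m_functor :: "('v, 'e) pre_digraph \<Rightarrow> 'k ring \<Rightarrow> ('k, 'a) module \<Rightarrow> 'v \<Rightarrow>
    ('a, 'm) module \<Rightarrow> ('v, 'e, 'a, (('e list \<Rightarrow> 'k) \<times> 'm \<Rightarrow>\<^sub>0 int) set) rep" where
  "m_functor Q K A i T = \<lparr>
     space = (\<lambda>j. tensor_module K A (space (proj_rep Q K i) j) T),
     arr = (\<lambda>\<alpha>. tensor_map K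
       (space (proj_rep Q K i) (tail Q \<alpha>)) (underlying K A T)
       (space (proj_rep Q K i) (head Q \<alpha>)) (underlying K A T)
       (arr (proj_rep Q K i) \<alpha>) (\<lambda>t. t))\<rparr>"

end

theory Submission
  imports Defs
begin

text \<open>
  Over a self-injective algebra finite-dimensional injective and projective modules coincide: a counting
  argument on maximal left ideals shows that every simple module embeds into \<open>A\<close>, so every
  finite-dimensional module embeds into a free one.  By induction along the arrows, a monic
  representation is projective, and also injective, as soon as all its modules are injective.  For a
  family \<open>J\<close> of modules the representation \<open>\<Oplus>\<^sub>v m\<^sub>v(J\<^sub>v)\<close> is determined by maps out of the \<open>J\<^sub>v\<close>; if the
  \<open>J\<^sub>v\<close> are injective, then maps from a monic \<open>X\<close> into it also extend from maps \<open>X\<^sub>v \<rightarrow> J\<^sub>v\<close> that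
  vanish on the image of \<open>\<delta>\<^sub>v\<close>.  This gives enough projectives and injectives, both with injective
  components.  If \<open>X\<close> is indecomposable projective, take \<open>i\<close> minimal with \<open>X\<^sub>i \<noteq> 0\<close>: a
  nonzero direct summand \<open>P\<close> of \<open>X\<^sub>i\<close> splits off a summand \<open>m\<^sub>i(P)\<close> of \<open>X\<close>, which must be all of \<open>X\<close>.
\<close>

section \<open>Modules\<close>

text \<open>Two constraints shape the development. Dimension is replaced by a natural number that
  grows strictly along proper inclusions of submodules, and finiteness (of the set of simple
  modules, of a family of functionals with zero common kernel) always comes from a finite set at
  which such a measure is extremal. And no quantifier ranges over the modules of all types:
  products, free representations and tensor products have elements of their own types, so linear
  maps and morphisms are handled across types, and a result is copied into the type of the category
  when it has to be an object there. The hypothesis on lists over \<open>carrier K\<close> provides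
  the room; injectivity is tested on \<open>'k list\<close> and does not depend on that choice. The
  exact structure hides an asymmetry. Monic representations are closed under subobjects but not
  under quotients, so deflations are the vertexwise surjections, while an inflation f must also
  satisfy a clause on \<delta>: a family sent by \<delta> into the image of f consists of elements
  of that image. Extension of morphisms along inflations works vertex by vertex because of this
  clause.\<close>

context abelian_group
begin

lemma minus_eq_zero_iff:
  assumes "x \<in> carrier G" "y \<in> carrier G"
  shows "x \<ominus> y = \<zero> \<longleftrightarrow> x = y"
proof
  assume "x \<ominus> y = \<zero>"
  then have "x \<oplus> \<ominus> y \<oplus> y = \<zero> \<oplus> y" by (simp add: minus_eq)
  with assms show "x = y" by (simp add: a_assoc l_neg)
qed (use assms in \<open>simp add: minus_eq r_neg\<close>)

lemma minus_add_cancel: "\<lbrakk>x \<in> carrier G; y \<in> carrier G\<rbrakk> \<Longrightarrow> (x \<ominus> y) \<oplus> y = x"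
  by (simp add: minus_eq a_assoc l_neg)

lemma add_minus_cancel: "\<lbrakk>x \<in> carrier G; y \<in> carrier G\<rbrakk> \<Longrightarrow> (x \<oplus> y) \<ominus> y = x"
  by (simp add: minus_eq a_assoc r_neg)

lemma minus_self: "x \<in> carrier G \<Longrightarrow> x \<ominus> x = \<zero>"
  by (simp add: minus_eq r_neg)

lemma minus_add_minus: "\<lbrakk>x \<in> carrier G; y \<in> carrier G; z \<in> carrier G\<rbrakk> \<Longrightarrow> (x \<ominus> y) \<oplus> (y \<ominus> z) = x \<ominus> z"
  by (simp add: minus_eq a_assoc r_neg1)

lemma add_minus_add:
  "\<lbrakk>x \<in> carrier G; y \<in> carrier G; x' \<in> carrier G; y' \<in> carrier G\<rbrakk>
   \<Longrightarrow> (x \<oplus> y) \<ominus> (x' \<oplus> y') = (x \<ominus> x') \<oplus> (y \<ominus> y')"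
  by (simp add: minus_eq minus_add a_ac)

lemma zero_of_idem: "\<lbrakk>x \<in> carrier G; x \<oplus> x = x\<rbrakk> \<Longrightarrow> x = \<zero>"
  by (metis add.r_cancel_one)

end

context left_module
begin

lemma smult_zero_right: "a \<in> carrier R \<Longrightarrow> a \<odot>\<^bsub>M\<^esub> \<zero>\<^bsub>M\<^esub> = \<zero>\<^bsub>M\<^esub>"
  by (metis M.zero_closed M.l_zero M.zero_of_idem smult_closed smult_r_distr)

lemma smult_zero_left: "x \<in> carrier M \<Longrightarrow> \<zero> \<odot>\<^bsub>M\<^esub> x = \<zero>\<^bsub>M\<^esub>"
  by (metis R.zero_closed R.l_zero M.zero_of_idem smult_closed smult_l_distr)

lemma smult_neg_one: "x \<in> carrier M \<Longrightarrow> (\<ominus> \<one>) \<odot>\<^bsub>M\<^esub> x = \<ominus>\<^bsub>M\<^esub> x"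
  by (metis M.minus_equality R.add.inv_closed R.l_neg R.one_closed smult_closed smult_l_distr
      smult_one smult_zero_left)

lemma smult_neg: "\<lbrakk>a \<in> carrier R; x \<in> carrier M\<rbrakk> \<Longrightarrow> a \<odot>\<^bsub>M\<^esub> (\<ominus>\<^bsub>M\<^esub> x) = \<ominus>\<^bsub>M\<^esub> (a \<odot>\<^bsub>M\<^esub> x)"
  by (metis M.add.inv_closed M.l_neg M.minus_equality smult_closed smult_r_distr smult_zero_right)

lemma smult_minus: "\<lbrakk>a \<in> carrier R; x \<in> carrier M; y \<in> carrier M\<rbrakk>
    \<Longrightarrow> a \<odot>\<^bsub>M\<^esub> (x \<ominus>\<^bsub>M\<^esub> y) = a \<odot>\<^bsub>M\<^esub> x \<ominus>\<^bsub>M\<^esub> a \<odot>\<^bsub>M\<^esub> y"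
  by (simp add: M.minus_eq smult_r_distr smult_neg)

end

text \<open>Additive inverses are not among the assumptions: (-1)x is one, because (-1)x + x = 0x by
  distributivity and the last assumption makes 0x zero.\<close>

lemma left_moduleI:
  fixes R (structure) and M (structure)
  assumes "ring R"
    and "\<And>x y. \<lbrakk>x \<in> carrier M; y \<in> carrier M\<rbrakk> \<Longrightarrow> x \<oplus>\<^bsub>M\<^esub> y \<in> carrier M"
    and "\<zero>\<^bsub>M\<^esub> \<in> carrier M"
    and "\<And>x y z. \<lbrakk>x \<in> carrier M; y \<in> carrier M; z \<in> carrier M\<rbrakk>
      \<Longrightarrow> (x \<oplus>\<^bsub>M\<^esub> y) \<oplus>\<^bsub>M\<^esub> z = x \<oplus>\<^bsub>M\<^esub> (y \<oplus>\<^bsub>M\<^esub> z)"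
    and "\<And>x y. \<lbrakk>x \<in> carrier M; y \<in> carrier M\<rbrakk> \<Longrightarrow> x \<oplus>\<^bsub>M\<^esub> y = y \<oplus>\<^bsub>M\<^esub> x"
    and "\<And>x. x \<in> carrier M \<Longrightarrow> \<zero>\<^bsub>M\<^esub> \<oplus>\<^bsub>M\<^esub> x = x"
    and "\<And>a x. \<lbrakk>a \<in> carrier R; x \<in> carrier M\<rbrakk> \<Longrightarrow> a \<odot>\<^bsub>M\<^esub> x \<in> carrier M"
    and "\<And>a b x. \<lbrakk>a \<in> carrier R; b \<in> carrier R; x \<in> carrier M\<rbrakk>
      \<Longrightarrow> (a \<oplus>\<^bsub>R\<^esub> b) \<odot>\<^bsub>M\<^esub> x = (a \<odot>\<^bsub>M\<^esub> x) \<oplus>\<^bsub>M\<^esub> (b \<odot>\<^bsub>M\<^esub> x)"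
    and "\<And>a x y. \<lbrakk>a \<in> carrier R; x \<in> carrier M; y \<in> carrier M\<rbrakk>
      \<Longrightarrow> a \<odot>\<^bsub>M\<^esub> (x \<oplus>\<^bsub>M\<^esub> y) = (a \<odot>\<^bsub>M\<^esub> x) \<oplus>\<^bsub>M\<^esub> (a \<odot>\<^bsub>M\<^esub> y)"
    and "\<And>a b x. \<lbrakk>a \<in> carrier R; b \<in> carrier R; x \<in> carrier M\<rbrakk>
      \<Longrightarrow> (a \<otimes>\<^bsub>R\<^esub> b) \<odot>\<^bsub>M\<^esub> x = a \<odot>\<^bsub>M\<^esub> (b \<odot>\<^bsub>M\<^esub> x)"
    and one: "\<And>x. x \<in> carrier M \<Longrightarrow> \<one>\<^bsub>R\<^esub> \<odot>\<^bsub>M\<^esub> x = x"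
    and zero: "\<And>x. x \<in> carrier M \<Longrightarrow> \<zero>\<^bsub>R\<^esub> \<odot>\<^bsub>M\<^esub> x = \<zero>\<^bsub>M\<^esub>"
  shows "left_module R M"
proof -
  interpret R: ring R by fact
  have "abelian_group M"
  proof (rule abelian_groupI)
    fix x assume x: "x \<in> carrier M"
    have "((\<ominus>\<^bsub>R\<^esub> \<one>\<^bsub>R\<^esub>) \<oplus>\<^bsub>R\<^esub> \<one>\<^bsub>R\<^esub>) \<odot>\<^bsub>M\<^esub> x = \<zero>\<^bsub>M\<^esub>" using x by (simp add: R.l_neg zero)
    then have "((\<ominus>\<^bsub>R\<^esub> \<one>\<^bsub>R\<^esub>) \<odot>\<^bsub>M\<^esub> x) \<oplus>\<^bsub>M\<^esub> x = \<zero>\<^bsub>M\<^esub>" using x assms(8)[of "\<ominus>\<^bsub>R\<^esub> \<one>\<^bsub>R\<^esub>" "\<one>\<^bsub>R\<^esub>" x] one by simp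
    then show "\<exists>y\<in>carrier M. y \<oplus>\<^bsub>M\<^esub> x = \<zero>\<^bsub>M\<^esub>" using x assms(7) by blast
  qed (use assms in auto)
  then show ?thesis using assms by (simp add: left_module_def left_module_axioms_def)
qed

subsection \<open>Linear maps\<close>

text \<open>\<open>M\<close> and \<open>N\<close> are arbitrary records here, so closure of
  \<open>carrier M\<close> is assumed along with each equation: the restricted function has to be
  evaluated at the sum and at the multiple.\<close>

lemma mod_homI:
  assumes "\<And>x. x \<in> carrier M \<Longrightarrow> F x \<in> carrier N"
    and "\<And>x y. \<lbrakk>x \<in> carrier M; y \<in> carrier M\<rbrakk> \<Longrightarrow> x \<oplus>\<^bsub>M\<^esub> y \<in> carrier M \<and> F (x \<oplus>\<^bsub>M\<^esub> y) = F x \<oplus>\<^bsub>N\<^esub> F y"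
    and "\<And>a x. \<lbrakk>a \<in> carrier R; x \<in> carrier M\<rbrakk> \<Longrightarrow> a \<odot>\<^bsub>M\<^esub> x \<in> carrier M \<and> F (a \<odot>\<^bsub>M\<^esub> x) = a \<odot>\<^bsub>N\<^esub> F x"
  shows "(\<lambda>x\<in>carrier M. F x) \<in> mod_hom R M N"
  using assms by (auto simp: mod_hom_def)

lemma mod_hom_closed: "\<lbrakk>f \<in> mod_hom R M N; x \<in> carrier M\<rbrakk> \<Longrightarrow> f x \<in> carrier N"
  by (auto simp: mod_hom_def)

lemma mod_hom_add: "\<lbrakk>f \<in> mod_hom R M N; x \<in> carrier M; y \<in> carrier M\<rbrakk> \<Longrightarrow> f (x \<oplus>\<^bsub>M\<^esub> y) = f x \<oplus>\<^bsub>N\<^esub> f y"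
  by (auto simp: mod_hom_def)

lemma mod_hom_smult: "\<lbrakk>f \<in> mod_hom R M N; a \<in> carrier R; x \<in> carrier M\<rbrakk> \<Longrightarrow> f (a \<odot>\<^bsub>M\<^esub> x) = a \<odot>\<^bsub>N\<^esub> f x"
  by (auto simp: mod_hom_def)

lemma mod_hom_eqI:
  "\<lbrakk>f \<in> mod_hom R M N; g \<in> mod_hom R M N'; \<And>x. x \<in> carrier M \<Longrightarrow> f x = g x\<rbrakk> \<Longrightarrow> f = g"
  by (rule extensionalityI[of _ "carrier M"]) (auto simp: mod_hom_def PiE_def)

lemma mod_hom_restrict: "f \<in> mod_hom R M N \<Longrightarrow> restrict f (carrier M) = f"
  by (auto simp: mod_hom_def PiE_def extensional_restrict)

lemma mod_hom_zero:
  assumes "left_module R M" "left_module R' N" "f \<in> mod_hom R M N"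
  shows "f \<zero>\<^bsub>M\<^esub> = \<zero>\<^bsub>N\<^esub>"
proof -
  interpret M: left_module R M by fact
  interpret N: left_module R' N by fact
  have "f (\<zero>\<^bsub>M\<^esub> \<oplus>\<^bsub>M\<^esub> \<zero>\<^bsub>M\<^esub>) = f \<zero>\<^bsub>M\<^esub> \<oplus>\<^bsub>N\<^esub> f \<zero>\<^bsub>M\<^esub>"
    using assms(3) by (rule mod_hom_add) auto
  then show ?thesis
    using mod_hom_closed[OF assms(3), of "\<zero>\<^bsub>M\<^esub>"] by (intro N.M.zero_of_idem) auto
qed

lemma mod_hom_neg:
  assumes "left_module R M" "left_module R' N" "f \<in> mod_hom R M N" "x \<in> carrier M"
  shows "f (\<ominus>\<^bsub>M\<^esub> x) = \<ominus>\<^bsub>N\<^esub> f x"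
proof -
  interpret M: left_module R M by fact
  interpret N: left_module R' N by fact
  have "f (\<ominus>\<^bsub>M\<^esub> x) \<oplus>\<^bsub>N\<^esub> f x = f (\<ominus>\<^bsub>M\<^esub> x \<oplus>\<^bsub>M\<^esub> x)"
    using assms by (simp add: mod_hom_add)
  also have "\<dots> = \<zero>\<^bsub>N\<^esub>"
    using assms by (simp add: M.M.l_neg mod_hom_zero)
  finally show ?thesis
    using mod_hom_closed[OF assms(3)] assms(4) by (metis N.M.minus_equality M.M.a_inv_closed)
qed

lemma mod_hom_minus:
  assumes "left_module R M" "left_module R' N" "f \<in> mod_hom R M N" "x \<in> carrier M" "y \<in> carrier M"
  shows "f (x \<ominus>\<^bsub>M\<^esub> y) = f x \<ominus>\<^bsub>N\<^esub> f y"
proof -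
  interpret M: left_module R M by fact
  show ?thesis
    using assms mod_hom_neg[OF assms(1,2,3)] by (simp add: a_minus_def mod_hom_add)
qed

lemma mod_hom_inj_iff:
  assumes "left_module R M" "left_module R' N" "f \<in> mod_hom R M N"
  shows "inj_on f (carrier M) \<longleftrightarrow> (\<forall>x\<in>carrier M. f x = \<zero>\<^bsub>N\<^esub> \<longrightarrow> x = \<zero>\<^bsub>M\<^esub>)"
proof -
  interpret M: left_module R M by fact
  interpret N: left_module R' N by fact
  show ?thesis
  proof
    assume "inj_on f (carrier M)"
    then show "\<forall>x\<in>carrier M. f x = \<zero>\<^bsub>N\<^esub> \<longrightarrow> x = \<zero>\<^bsub>M\<^esub>"
      by (metis M.M.zero_closed assms inj_onD mod_hom_zero)
  next
    assume *: "\<forall>x\<in>carrier M. f x = \<zero>\<^bsub>N\<^esub> \<longrightarrow> x = \<zero>\<^bsub>M\<^esub>"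
    show "inj_on f (carrier M)"
    proof (rule inj_onI)
      fix x y assume "x \<in> carrier M" "y \<in> carrier M" "f x = f y"
      then have "f (x \<ominus>\<^bsub>M\<^esub> y) = \<zero>\<^bsub>N\<^esub>"
        using assms mod_hom_closed[OF assms(3)] by (simp add: mod_hom_minus N.M.minus_eq_zero_iff)
      then have "x \<ominus>\<^bsub>M\<^esub> y = \<zero>\<^bsub>M\<^esub>"
        using * \<open>x \<in> carrier M\<close> \<open>y \<in> carrier M\<close> by blast
      then show "x = y"
        using \<open>x \<in> carrier M\<close> \<open>y \<in> carrier M\<close> by (simp add: M.M.minus_eq_zero_iff)
    qed
  qed
qed

lemma mod_hom_id: "left_module R M \<Longrightarrow> (\<lambda>x\<in>carrier M. x) \<in> mod_hom R M M"
  by (auto intro!: mod_homI simp: left_module.smult_closed left_module_def abelian_groupE)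

lemma mod_hom_compose:
  assumes "f \<in> mod_hom R L M" "g \<in> mod_hom R M N" "left_module R L"
  shows "compose (carrier L) g f \<in> mod_hom R L N"
  unfolding compose_def
  by (rule mod_homI)
    (use assms in \<open>auto simp: mod_hom_closed mod_hom_add mod_hom_smult left_module.smult_closed
       left_module_def abelian_groupE\<close>)

lemma mod_hom_plus:
  assumes "f \<in> mod_hom R M N" "g \<in> mod_hom R M N" "left_module R M" "left_module R N"
  shows "(\<lambda>x\<in>carrier M. f x \<oplus>\<^bsub>N\<^esub> g x) \<in> mod_hom R M N"
proof -
  interpret M: left_module R M by fact
  interpret N: left_module R N by fact
  note c = mod_hom_closed[OF assms(1)] mod_hom_closed[OF assms(2)]
  show ?thesis
    by (rule mod_homI)
      (use assms in \<open>auto simp: c mod_hom_add mod_hom_smult M.smult_closed N.smult_r_distr N.M.a_ac\<close>)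
qed

lemma mod_hom_diff:
  assumes "f \<in> mod_hom R M N" "g \<in> mod_hom R M N" "left_module R M" "left_module R N"
  shows "(\<lambda>x\<in>carrier M. f x \<ominus>\<^bsub>N\<^esub> g x) \<in> mod_hom R M N"
proof -
  interpret M: left_module R M by fact
  interpret N: left_module R N by fact
  note c = mod_hom_closed[OF assms(1)] mod_hom_closed[OF assms(2)]
  show ?thesis
    by (rule mod_homI)
      (use assms in \<open>auto simp: c mod_hom_add mod_hom_smult M.smult_closed N.smult_minus N.M.add_minus_add\<close>)
qed

lemma mod_hom_const_zero:
  assumes "left_module R M" "left_module R N"
  shows "(\<lambda>x\<in>carrier M. \<zero>\<^bsub>N\<^esub>) \<in> mod_hom R M N"
proof -
  interpret M: left_module R M by fact
  interpret N: left_module R N by fact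
  show ?thesis
    by (rule mod_homI) (auto simp: M.smult_closed N.smult_zero_right)
qed

lemma mod_hom_finsum:
  assumes "left_module R M" "left_module R' N" "f \<in> mod_hom R M N" "finite I" "g \<in> I \<rightarrow> carrier M"
  shows "f (\<Oplus>\<^bsub>M\<^esub>i\<in>I. g i) = (\<Oplus>\<^bsub>N\<^esub>i\<in>I. f (g i))"
proof -
  interpret M: left_module R M by fact
  interpret N: left_module R' N by fact
  from assms(4,5) show ?thesis
  proof (induction I)
    case empty
    then show ?case using mod_hom_zero[OF assms(1-3)] by simp
  next
    case (insert i I)
    then have g: "g i \<in> carrier M" "g \<in> I \<rightarrow> carrier M" by auto
    then have "(\<Oplus>\<^bsub>M\<^esub>i\<in>I. g i) \<in> carrier M" by simp
    moreover have "(\<lambda>i. f (g i)) \<in> I \<rightarrow> carrier N" using g mod_hom_closed[OF assms(3)] by auto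
    ultimately show ?case
      using insert.hyps g insert.IH mod_hom_closed[OF assms(3)]
      by (simp add: mod_hom_add[OF assms(3)])
  qed
qed

lemma (in left_module) smult_finsum:
  assumes "finite I" "g \<in> I \<rightarrow> carrier M" "a \<in> carrier R"
  shows "a \<odot>\<^bsub>M\<^esub> (\<Oplus>\<^bsub>M\<^esub>i\<in>I. g i) = (\<Oplus>\<^bsub>M\<^esub>i\<in>I. a \<odot>\<^bsub>M\<^esub> g i)"
  using assms(1,2)
proof (induction I)
  case empty
  then show ?case using assms(3) by (simp add: smult_zero_right)
next
  case (insert i I)
  then have g: "g i \<in> carrier M" "g \<in> I \<rightarrow> carrier M" by auto
  then have "(\<Oplus>\<^bsub>M\<^esub>i\<in>I. g i) \<in> carrier M" by simp
  moreover have "(\<lambda>i. a \<odot>\<^bsub>M\<^esub> g i) \<in> I \<rightarrow> carrier M" using g assms(3) by (auto intro!: smult_closed)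
  ultimately show ?case
    using insert.hyps g insert.IH assms(3) by (simp add: smult_closed smult_r_distr)
qed

lemma mod_hom_inv:
  assumes "f \<in> mod_hom R M N" "bij_betw f (carrier M) (carrier N)" "left_module R M" "left_module R N"
  shows "(\<lambda>y\<in>carrier N. inv_into (carrier M) f y) \<in> mod_hom R N M"
proof -
  interpret M: left_module R M by fact
  interpret N: left_module R N by fact
  let ?g = "inv_into (carrier M) f"
  have inj: "inj_on f (carrier M)" and im: "f ` carrier M = carrier N"
    using assms(2) by (auto simp: bij_betw_def)
  have g: "?g y \<in> carrier M" "f (?g y) = y" if "y \<in> carrier N" for y
    using that im by (auto intro: inv_into_into f_inv_into_f)
  have gI: "?g y = x" if "x \<in> carrier M" "f x = y" for x y
    using that inj by (auto simp: inv_into_f_eq)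
  show ?thesis
  proof (rule mod_homI)
    fix x y assume "x \<in> carrier N" "y \<in> carrier N"
    then show "x \<oplus>\<^bsub>N\<^esub> y \<in> carrier N \<and> ?g (x \<oplus>\<^bsub>N\<^esub> y) = ?g x \<oplus>\<^bsub>M\<^esub> ?g y"
      by (auto intro!: gI simp: g mod_hom_add[OF assms(1)])
  next
    fix a x assume "a \<in> carrier R" "x \<in> carrier N"
    then show "a \<odot>\<^bsub>N\<^esub> x \<in> carrier N \<and> ?g (a \<odot>\<^bsub>N\<^esub> x) = a \<odot>\<^bsub>M\<^esub> ?g x"
      by (auto intro!: gI simp: g mod_hom_smult[OF assms(1)] N.smult_closed M.smult_closed)
  qed (auto simp: g)
qed

subsection \<open>Submodules\<close>

text \<open>Closure under negatives comes from multiplication by -1 (\<open>lsub_minus\<close>). The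
  predicate presupposes no module, so one set can be compared as an \<open>A\<close>-submodule and
  as a \<open>K\<close>-subspace of the same group.\<close>

definition lsub :: "('a, 'z) ring_scheme \<Rightarrow> ('a, 'm) module \<Rightarrow> 'm set \<Rightarrow> bool" where
  "lsub R M U \<longleftrightarrow> U \<subseteq> carrier M \<and> \<zero>\<^bsub>M\<^esub> \<in> U \<and> (\<forall>x\<in>U. \<forall>y\<in>U. x \<oplus>\<^bsub>M\<^esub> y \<in> U) \<and>
     (\<forall>a\<in>carrier R. \<forall>x\<in>U. a \<odot>\<^bsub>M\<^esub> x \<in> U)"

lemma lsubD:
  assumes "lsub R M U"
  shows "U \<subseteq> carrier M" "\<zero>\<^bsub>M\<^esub> \<in> U" "\<lbrakk>x \<in> U; y \<in> U\<rbrakk> \<Longrightarrow> x \<oplus>\<^bsub>M\<^esub> y \<in> U" "\<lbrakk>a \<in> carrier R; x \<in> U\<rbrakk> \<Longrightarrow> a \<odot>\<^bsub>M\<^esub> x \<in> U"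
    "x \<in> U \<Longrightarrow> x \<in> carrier M"
  using assms by (auto simp: lsub_def)

lemma lsub_minus:
  assumes "left_module R M" "lsub R M U" "x \<in> U" "y \<in> U"
  shows "x \<ominus>\<^bsub>M\<^esub> y \<in> U"
proof -
  interpret M: left_module R M by fact
  show ?thesis
    using assms by (metis M.M.minus_eq M.R.add.inv_closed M.R.one_closed M.smult_neg_one lsubD(3,4,5))
qed

lemma lsub_finsum:
  assumes "left_module R M" "lsub R M U" "finite I" "g \<in> I \<rightarrow> U"
  shows "(\<Oplus>\<^bsub>M\<^esub>i\<in>I. g i) \<in> U"
proof -
  interpret M: left_module R M by fact
  from assms(3,4) show ?thesis
  proof (induction I)
    case empty
    then show ?case using lsubD[OF assms(2)] by simp
  next
    case (insert i I)
    then show ?case using lsubD[OF assms(2)] by (auto simp: Pi_def)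
  qed
qed

lemma lsub_carrier: "left_module R M \<Longrightarrow> lsub R M (carrier M)"
  by (auto simp: lsub_def left_module.smult_closed left_module_def abelian_groupE)

lemma lsub_zero: "left_module R M \<Longrightarrow> lsub R M {\<zero>\<^bsub>M\<^esub>}"
  by (auto simp: lsub_def left_module.smult_zero_right left_module_def abelian_groupE)

lemma lsub_Inter: "(\<And>U. U \<in> \<U> \<Longrightarrow> lsub R M U) \<Longrightarrow> \<U> \<noteq> {} \<Longrightarrow> lsub R M (\<Inter>\<U>)"
  unfolding lsub_def by (auto simp: subset_iff)

lemma lsub_kernel:
  assumes "left_module R M" "left_module R N" "f \<in> mod_hom R M N" "lsub R N U"
  shows "lsub R M {x \<in> carrier M. f x \<in> U}"
proof -
  interpret M: left_module R M by fact
  show ?thesis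
    using assms lsubD[OF assms(4)] mod_hom_zero[OF assms(1-3)]
    by (auto simp: lsub_def mod_hom_add M.smult_closed mod_hom_smult)
qed

lemma lsub_ker:
  assumes "left_module R M" "left_module R N" "f \<in> mod_hom R M N"
  shows "lsub R M {x \<in> carrier M. f x = \<zero>\<^bsub>N\<^esub>}"
  using lsub_kernel[OF assms lsub_zero[OF assms(2)]] by simp

lemma lsub_image:
  assumes "left_module R M" "left_module R N" "f \<in> mod_hom R M N" "lsub R M U"
  shows "lsub R N (f ` U)"
  unfolding lsub_def
proof (intro conjI ballI)
  show "f ` U \<subseteq> carrier N" using lsubD[OF assms(4)] mod_hom_closed[OF assms(3)] by blast
  show "\<zero>\<^bsub>N\<^esub> \<in> f ` U"
    using lsubD(2)[OF assms(4)] mod_hom_zero[OF assms(1-3)] by (metis image_eqI)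
next
  fix x y assume "x \<in> f ` U" "y \<in> f ` U"
  then show "x \<oplus>\<^bsub>N\<^esub> y \<in> f ` U"
    using lsubD[OF assms(4)] mod_hom_add[OF assms(3)] by (smt (verit) image_iff)
next
  fix a x assume "a \<in> carrier R" "x \<in> f ` U"
  then show "a \<odot>\<^bsub>N\<^esub> x \<in> f ` U"
    using lsubD[OF assms(4)] mod_hom_smult[OF assms(3)] by (smt (verit) image_iff)
qed

text \<open>A submodule is the same record with a smaller carrier, so zero and the operations are
  literally shared with \<open>M\<close>; the module laws are then restrictions of those of
  \<open>M\<close>.\<close>

lemma left_module_lsub:
  assumes "left_module R M" "lsub R M U"
  shows "left_module R (M\<lparr>carrier := U\<rparr>)"
proof -
  interpret M: left_module R M by fact
  show ?thesis
    by (rule left_moduleI)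
      (use lsubD[OF assms(2)] M.R.ring_axioms in \<open>auto simp: M.M.a_assoc subsetD M.smult_l_distr
         M.smult_r_distr M.smult_assoc M.smult_one M.smult_zero_left intro: M.M.a_comm\<close>)
qed

lemma lsub_lsub:
  assumes "lsub R M U"
  shows "lsub R (M\<lparr>carrier := U\<rparr>) W \<longleftrightarrow> lsub R M W \<and> W \<subseteq> U"
  using lsubD[OF assms] by (auto simp: lsub_def)

lemma mod_hom_incl: "\<lbrakk>left_module R M; lsub R M U\<rbrakk> \<Longrightarrow> (\<lambda>x\<in>U. x) \<in> mod_hom R (M\<lparr>carrier := U\<rparr>) M"
  using mod_homI[of "M\<lparr>carrier := U\<rparr>" "\<lambda>x. x" M R] lsubD[of R M U] by (auto simp: subsetD)

lemma mod_hom_restrict_dom: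
  assumes "f \<in> mod_hom R M N" "lsub R M U"
  shows "restrict f U \<in> mod_hom R (M\<lparr>carrier := U\<rparr>) N"
  using mod_homI[of "M\<lparr>carrier := U\<rparr>" f N R] assms lsubD[OF assms(2)]
  by (auto simp: subsetD mod_hom_closed mod_hom_add mod_hom_smult)

lemma mod_hom_restrict_cod:
  assumes "f \<in> mod_hom R M N" "f ` carrier M \<subseteq> U"
  shows "f \<in> mod_hom R M (N\<lparr>carrier := U\<rparr>)"
  using assms by (auto simp: mod_hom_def PiE_def)

subsection \<open>Factoring linear maps\<close>

text \<open>The universal property of a quotient: \<open>u\<close> sends a point to the value of
  \<open>h\<close> at a chosen preimage under \<open>q\<close>, and two preimages differ by an
  element of the kernel of \<open>q\<close>, which \<open>h\<close> kills. The three modules may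
  have different element types.\<close>

lemma factor_surj:
  assumes "left_module R M" "left_module R N" "left_module R L"
    and q: "q \<in> mod_hom R M N" "q ` carrier M = carrier N"
    and h: "h \<in> mod_hom R M L" "\<And>x. \<lbrakk>x \<in> carrier M; q x = \<zero>\<^bsub>N\<^esub>\<rbrakk> \<Longrightarrow> h x = \<zero>\<^bsub>L\<^esub>"
  obtains u where "u \<in> mod_hom R N L" "\<And>x. x \<in> carrier M \<Longrightarrow> u (q x) = h x"
proof -
  interpret M: left_module R M by fact
  interpret N: left_module R N by fact
  interpret L: left_module R L by fact
  let ?g = "inv_into (carrier M) q"
  have g: "?g y \<in> carrier M" "q (?g y) = y" if "y \<in> carrier N" for y
    using that q(2) by (auto intro: inv_into_into f_inv_into_f)
  have eq: "h x = h y" if "x \<in> carrier M" "y \<in> carrier M" "q x = q y" for x y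
  proof -
    have "q (x \<ominus>\<^bsub>M\<^esub> y) = \<zero>\<^bsub>N\<^esub>"
      using that assms(1,2) q(1) by (simp add: mod_hom_minus mod_hom_closed N.M.minus_self)
    then have "h x \<ominus>\<^bsub>L\<^esub> h y = \<zero>\<^bsub>L\<^esub>"
      using h that assms(1,3) by (metis M.M.minus_closed mod_hom_minus)
    then show ?thesis
      using that h(1) by (simp add: L.M.minus_eq_zero_iff mod_hom_closed)
  qed
  let ?u = "\<lambda>y\<in>carrier N. h (?g y)"
  have u: "?u \<in> mod_hom R N L"
  proof (rule mod_homI)
    fix y assume "y \<in> carrier N" then show "h (?g y) \<in> carrier L" using g h(1) by (simp add: mod_hom_closed)
  next
    fix x y assume xy: "x \<in> carrier N" "y \<in> carrier N"
    then have "h (?g (x \<oplus>\<^bsub>N\<^esub> y)) = h (?g x \<oplus>\<^bsub>M\<^esub> ?g y)"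
      by (intro eq) (use q(1) in \<open>auto simp: g mod_hom_add\<close>)
    then show "x \<oplus>\<^bsub>N\<^esub> y \<in> carrier N \<and> h (?g (x \<oplus>\<^bsub>N\<^esub> y)) = h (?g x) \<oplus>\<^bsub>L\<^esub> h (?g y)"
      using xy h(1) by (simp add: mod_hom_add g)
  next
    fix a x assume xy: "a \<in> carrier R" "x \<in> carrier N"
    then have "h (?g (a \<odot>\<^bsub>N\<^esub> x)) = h (a \<odot>\<^bsub>M\<^esub> ?g x)"
      by (intro eq) (use q(1) in \<open>auto simp: g mod_hom_smult M.smult_closed N.smult_closed\<close>)
    then show "a \<odot>\<^bsub>N\<^esub> x \<in> carrier N \<and> h (?g (a \<odot>\<^bsub>N\<^esub> x)) = a \<odot>\<^bsub>L\<^esub> h (?g x)"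
      using xy h(1) by (simp add: mod_hom_smult g N.smult_closed)
  qed
  show ?thesis
  proof
    show "?u \<in> mod_hom R N L" by (rule u)
    fix x assume "x \<in> carrier M"
    then show "?u (q x) = h x" using q g by (auto simp: mod_hom_closed intro!: eq)
  qed
qed

text \<open>The universal property of a submodule: every value of \<open>h\<close> has exactly one
  preimage under \<open>j\<close>, and uniqueness makes the choice of preimages linear.\<close>

lemma factor_inj:
  assumes "left_module R M" "left_module R N" "left_module R L"
    and j: "j \<in> mod_hom R M N" "inj_on j (carrier M)"
    and h: "h \<in> mod_hom R L N" "h ` carrier L \<subseteq> j ` carrier M"
  obtains u where "u \<in> mod_hom R L M" "\<And>x. x \<in> carrier L \<Longrightarrow> j (u x) = h x"
proof -
  interpret M: left_module R M by fact
  interpret L: left_module R L by fact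
  let ?g = "inv_into (carrier M) j"
  have g: "?g (h x) \<in> carrier M" "j (?g (h x)) = h x" if "x \<in> carrier L" for x
    using subsetD[OF h(2) imageI[OF that]] by (auto intro: inv_into_into f_inv_into_f)
  have gI: "?g y = x" if "x \<in> carrier M" "j x = y" for x y
    using that j by (auto simp: inv_into_f_eq)
  show ?thesis
  proof
    show "(\<lambda>x\<in>carrier L. ?g (h x)) \<in> mod_hom R L M"
    proof (rule mod_homI)
      fix x y assume "x \<in> carrier L" "y \<in> carrier L"
      then show "x \<oplus>\<^bsub>L\<^esub> y \<in> carrier L \<and> ?g (h (x \<oplus>\<^bsub>L\<^esub> y)) = ?g (h x) \<oplus>\<^bsub>M\<^esub> ?g (h y)"
        by (auto intro!: gI simp: g mod_hom_add[OF j(1)] mod_hom_add[OF h(1)])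
    next
      fix a x assume "a \<in> carrier R" "x \<in> carrier L"
      then show "a \<odot>\<^bsub>L\<^esub> x \<in> carrier L \<and> ?g (h (a \<odot>\<^bsub>L\<^esub> x)) = a \<odot>\<^bsub>M\<^esub> ?g (h x)"
        by (auto intro!: gI simp: g mod_hom_smult[OF j(1)] mod_hom_smult[OF h(1)] L.smult_closed M.smult_closed)
    qed (auto simp: g)
  qed (auto simp: g)
qed

subsection \<open>Products\<close>

text \<open>For a finite \<open>I\<close> this is also the direct sum. The index type is left open
  because the same construction is used over arrows, paths, generators and sets of linear maps.
  Families are extensional, so that equal coordinates give equal elements.\<close>

definition prodm :: "'i set \<Rightarrow> ('i \<Rightarrow> ('a, 'm) module) \<Rightarrow> ('a, 'i \<Rightarrow> 'm) module" where
  "prodm I M = \<lparr>carrier = \<Pi>\<^sub>E i\<in>I. carrier (M i), monoid.mult = undefined, one = undefined,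
     ring.zero = (\<lambda>i\<in>I. \<zero>\<^bsub>M i\<^esub>), ring.add = (\<lambda>x y. \<lambda>i\<in>I. x i \<oplus>\<^bsub>M i\<^esub> y i),
     smult = (\<lambda>a x. \<lambda>i\<in>I. a \<odot>\<^bsub>M i\<^esub> x i)\<rparr>"

lemma prodm_simps [simp]:
  "carrier (prodm I M) = (\<Pi>\<^sub>E i\<in>I. carrier (M i))"
  "\<zero>\<^bsub>prodm I M\<^esub> = (\<lambda>i\<in>I. \<zero>\<^bsub>M i\<^esub>)"
  "x \<oplus>\<^bsub>prodm I M\<^esub> y = (\<lambda>i\<in>I. x i \<oplus>\<^bsub>M i\<^esub> y i)"
  "a \<odot>\<^bsub>prodm I M\<^esub> x = (\<lambda>i\<in>I. a \<odot>\<^bsub>M i\<^esub> x i)"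
  by (auto simp: prodm_def)

lemma prodm_mem: "\<lbrakk>x \<in> carrier (prodm I M); i \<in> I\<rbrakk> \<Longrightarrow> x i \<in> carrier (M i)"
  by auto

lemma left_module_prodm:
  assumes "ring R" "\<And>i. i \<in> I \<Longrightarrow> left_module R (M i)"
  shows "left_module R (prodm I M)"
proof (rule left_moduleI)
  have *: "left_module R (M i)" "abelian_group (M i)" if "i \<in> I" for i
    using assms(2)[OF that] by (auto simp: left_module_def)
  note [simp] = left_module.smult_closed[OF *(1)] abelian_groupE(1,2,5)[OF *(2)]
  {
    fix x y z assume "x \<in> carrier (prodm I M)" "y \<in> carrier (prodm I M)" "z \<in> carrier (prodm I M)"
    then have "x i \<oplus>\<^bsub>M i\<^esub> y i \<oplus>\<^bsub>M i\<^esub> z i = x i \<oplus>\<^bsub>M i\<^esub> (y i \<oplus>\<^bsub>M i\<^esub> z i)" if "i \<in> I" for i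
      using abelian_groupE(3)[OF *(2)[OF that], of "x i" "y i" "z i"] prodm_mem[OF _ that, of _ M] by blast
    then show "x \<oplus>\<^bsub>prodm I M\<^esub> y \<oplus>\<^bsub>prodm I M\<^esub> z = x \<oplus>\<^bsub>prodm I M\<^esub> (y \<oplus>\<^bsub>prodm I M\<^esub> z)"
      by (auto simp: fun_eq_iff restrict_def)
  }
  {
    fix x y assume "x \<in> carrier (prodm I M)" "y \<in> carrier (prodm I M)"
    then have "x i \<oplus>\<^bsub>M i\<^esub> y i = y i \<oplus>\<^bsub>M i\<^esub> x i" if "i \<in> I" for i
      using abelian_groupE(4)[OF *(2)[OF that], of "x i" "y i"] prodm_mem[OF _ that, of _ M] by blast
    then show "x \<oplus>\<^bsub>prodm I M\<^esub> y = y \<oplus>\<^bsub>prodm I M\<^esub> x"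
      by (auto simp: fun_eq_iff restrict_def)
  }
  fix x assume x: "x \<in> carrier (prodm I M)"
  show "\<zero>\<^bsub>prodm I M\<^esub> \<oplus>\<^bsub>prodm I M\<^esub> x = x" "\<one>\<^bsub>R\<^esub> \<odot>\<^bsub>prodm I M\<^esub> x = x" "\<zero>\<^bsub>R\<^esub> \<odot>\<^bsub>prodm I M\<^esub> x = \<zero>\<^bsub>prodm I M\<^esub>"
    using x by (auto simp: fun_eq_iff restrict_def PiE_def extensional_def Pi_def
      left_module.smult_one[OF *(1)] left_module.smult_zero_left[OF *(1)])
  fix a b y assume ab: "a \<in> carrier R" "b \<in> carrier R" "y \<in> carrier (prodm I M)"
  show "(a \<oplus>\<^bsub>R\<^esub> b) \<odot>\<^bsub>prodm I M\<^esub> x = (a \<odot>\<^bsub>prodm I M\<^esub> x) \<oplus>\<^bsub>prodm I M\<^esub> (b \<odot>\<^bsub>prodm I M\<^esub> x)"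
    "(a \<otimes>\<^bsub>R\<^esub> b) \<odot>\<^bsub>prodm I M\<^esub> x = a \<odot>\<^bsub>prodm I M\<^esub> (b \<odot>\<^bsub>prodm I M\<^esub> x)"
    "a \<odot>\<^bsub>prodm I M\<^esub> (x \<oplus>\<^bsub>prodm I M\<^esub> y) = (a \<odot>\<^bsub>prodm I M\<^esub> x) \<oplus>\<^bsub>prodm I M\<^esub> (a \<odot>\<^bsub>prodm I M\<^esub> y)"
    using ab x prodm_mem[OF x] prodm_mem[OF ab(3)]
    by (auto simp: fun_eq_iff restrict_def left_module.smult_l_distr[OF assms(2)]
      left_module.smult_assoc[OF assms(2)] left_module.smult_r_distr[OF assms(2)])
qed (use assms(1) in \<open>auto intro: abelian_groupE(1,2)[OF left_module.axioms(2)[OF assms(2)]]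
  left_module.smult_closed[OF assms(2)]\<close>)

lemma prodm_proj:
  assumes "ring R" "\<And>i. i \<in> I \<Longrightarrow> left_module R (M i)" "i \<in> I"
  shows "(\<lambda>x\<in>carrier (prodm I M). x i) \<in> mod_hom R (prodm I M) (M i)"
proof -
  interpret P: left_module R "prodm I M" using left_module_prodm assms by blast
  show ?thesis
  proof (rule mod_homI)
    fix x y assume "x \<in> carrier (prodm I M)" "y \<in> carrier (prodm I M)"
    then show "x \<oplus>\<^bsub>prodm I M\<^esub> y \<in> carrier (prodm I M) \<and> (x \<oplus>\<^bsub>prodm I M\<^esub> y) i = x i \<oplus>\<^bsub>M i\<^esub> y i"
      using P.M.a_closed[of x y] assms(3) by simp
  next
    fix a x assume "a \<in> carrier R" "x \<in> carrier (prodm I M)"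
    then show "a \<odot>\<^bsub>prodm I M\<^esub> x \<in> carrier (prodm I M) \<and> (a \<odot>\<^bsub>prodm I M\<^esub> x) i = a \<odot>\<^bsub>M i\<^esub> x i"
      using P.smult_closed[of a x] assms(3) by simp
  qed (use assms(3) in auto)
qed

definition single :: "'i set \<Rightarrow> ('i \<Rightarrow> ('a, 'm) module) \<Rightarrow> 'i \<Rightarrow> 'm \<Rightarrow> 'i \<Rightarrow> 'm" where
  "single I M i x = (\<lambda>j\<in>I. if j = i then x else \<zero>\<^bsub>M j\<^esub>)"

lemma single_mod_hom:
  assumes "ring R" "\<And>i. i \<in> I \<Longrightarrow> left_module R (M i)" "i \<in> I"
  shows "(\<lambda>x\<in>carrier (M i). single I M i x) \<in> mod_hom R (M i) (prodm I M)"
proof (rule mod_homI)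
  have *: "left_module R (M i)" "abelian_group (M i)" if "i \<in> I" for i
    using assms(2)[OF that] by (auto simp: left_module_def)
  note [simp] = left_module.smult_closed[OF *(1)] abelian_groupE(1,2,5)[OF *(2)] left_module.smult_zero_right[OF *(1)]
  show "single I M i x \<in> carrier (prodm I M)" if "x \<in> carrier (M i)" for x
    using that by (auto simp: single_def)
  show "x \<oplus>\<^bsub>M i\<^esub> y \<in> carrier (M i) \<and>
       single I M i (x \<oplus>\<^bsub>M i\<^esub> y) = single I M i x \<oplus>\<^bsub>prodm I M\<^esub> single I M i y"
    if "x \<in> carrier (M i)" "y \<in> carrier (M i)" for x y
    using that assms(3) by (auto simp: single_def fun_eq_iff)
  show "a \<odot>\<^bsub>M i\<^esub> x \<in> carrier (M i) \<and> single I M i (a \<odot>\<^bsub>M i\<^esub> x) = a \<odot>\<^bsub>prodm I M\<^esub> single I M i x"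
    if "a \<in> carrier R" "x \<in> carrier (M i)" for a x
    using that assms(3) by (auto simp: single_def fun_eq_iff)
qed

lemma single_closed:
  assumes "\<And>i. i \<in> I \<Longrightarrow> left_module R (M i)" "x \<in> carrier (M i)"
  shows "single I M i x \<in> carrier (prodm I M)"
  using assms by (auto simp: single_def left_module_def abelian_groupE)

text \<open>Taking the j-th coordinate is linear, so it passes through the sum, where only the
  summand with index j contributes.\<close>

lemma prodm_decomp:
  assumes "ring R" "finite I" "\<And>i. i \<in> I \<Longrightarrow> left_module R (M i)" "x \<in> carrier (prodm I M)"
  shows "(\<Oplus>\<^bsub>prodm I M\<^esub>i\<in>I. single I M i (x i)) = x"
proof -
  interpret P: left_module R "prodm I M" using left_module_prodm assms by blast
  have s: "(\<lambda>i. single I M i (x i)) \<in> I \<rightarrow> carrier (prodm I M)"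
    by (intro Pi_I single_closed[OF assms(3)] prodm_mem[OF assms(4)])
  have mem: "(\<Oplus>\<^bsub>prodm I M\<^esub>i\<in>I. single I M i (x i)) \<in> carrier (prodm I M)"
    using s by (rule P.M.finsum_closed)
  have "(\<Oplus>\<^bsub>prodm I M\<^esub>i\<in>I. single I M i (x i)) j = x j" if j: "j \<in> I" for j
  proof -
    interpret J: left_module R "M j" using assms(3) j .
    let ?p = "\<lambda>x\<in>carrier (prodm I M). x j"
    have "(\<Oplus>\<^bsub>prodm I M\<^esub>i\<in>I. single I M i (x i)) j = ?p (\<Oplus>\<^bsub>prodm I M\<^esub>i\<in>I. single I M i (x i))"
      using mem by simp
    also have "\<dots> = (\<Oplus>\<^bsub>M j\<^esub>i\<in>I. ?p (single I M i (x i)))"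
      by (rule mod_hom_finsum[OF P.left_module_axioms J.left_module_axioms
            prodm_proj[OF assms(1,3) j] assms(2) s])
    also have "\<dots> = (\<Oplus>\<^bsub>M j\<^esub>i\<in>I. if j = i then x j else \<zero>\<^bsub>M j\<^esub>)"
      using s j prodm_mem[OF assms(4) j] by (intro J.M.finsum_cong') (auto simp: single_def Pi_iff)
    also have "\<dots> = x j"
      using J.M.finsum_singleton[OF j assms(2), of "\<lambda>_. x j"] prodm_mem[OF assms(4) j] by simp
    finally show ?thesis .
  qed
  then show ?thesis
    using mem assms(4) by (auto intro!: extensionalityI[of _ I] simp: PiE_def)
qed

text \<open>Together with \<open>finsum_single\<close> this is the universal property of the finite
  direct sum: maps out of the summands combine to a map out of the sum.\<close>

lemma copair_mod_hom:
  assumes "ring R" "finite I" "\<And>i. i \<in> I \<Longrightarrow> left_module R (M i)" "left_module R N"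
    and h: "\<And>i. i \<in> I \<Longrightarrow> h i \<in> mod_hom R (M i) N"
  shows "(\<lambda>x\<in>carrier (prodm I M). \<Oplus>\<^bsub>N\<^esub>i\<in>I. h i (x i)) \<in> mod_hom R (prodm I M) N"
proof -
  interpret P: left_module R "prodm I M" using left_module_prodm assms by blast
  interpret N: left_module R N by fact
  have c: "h i (x i) \<in> carrier N" if "x \<in> carrier (prodm I M)" "i \<in> I" for x i
    using that by (auto intro: mod_hom_closed[OF h])
  show ?thesis
  proof (rule mod_homI)
    fix x assume x: "x \<in> carrier (prodm I M)"
    show "(\<Oplus>\<^bsub>N\<^esub>i\<in>I. h i (x i)) \<in> carrier N"
      using c[OF x] by auto
    fix y assume y: "y \<in> carrier (prodm I M)"
    have "(\<Oplus>\<^bsub>N\<^esub>i\<in>I. h i ((x \<oplus>\<^bsub>prodm I M\<^esub> y) i)) = (\<Oplus>\<^bsub>N\<^esub>i\<in>I. h i (x i) \<oplus>\<^bsub>N\<^esub> h i (y i))"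
      using c[OF x] c[OF y] x y by (intro N.M.finsum_cong') (auto simp: mod_hom_add[OF h prodm_mem[OF x] prodm_mem[OF y]])
    also have "\<dots> = (\<Oplus>\<^bsub>N\<^esub>i\<in>I. h i (x i)) \<oplus>\<^bsub>N\<^esub> (\<Oplus>\<^bsub>N\<^esub>i\<in>I. h i (y i))"
      using c[OF x] c[OF y] by (intro N.M.finsum_addf) auto
    finally show "x \<oplus>\<^bsub>prodm I M\<^esub> y \<in> carrier (prodm I M) \<and> (\<Oplus>\<^bsub>N\<^esub>i\<in>I. h i ((x \<oplus>\<^bsub>prodm I M\<^esub> y) i))
       = (\<Oplus>\<^bsub>N\<^esub>i\<in>I. h i (x i)) \<oplus>\<^bsub>N\<^esub> (\<Oplus>\<^bsub>N\<^esub>i\<in>I. h i (y i))"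
      using P.M.a_closed[OF x y] by blast
  next
    fix a x assume x: "x \<in> carrier (prodm I M)" and a: "a \<in> carrier R"
    have "(\<Oplus>\<^bsub>N\<^esub>i\<in>I. h i ((a \<odot>\<^bsub>prodm I M\<^esub> x) i)) = (\<Oplus>\<^bsub>N\<^esub>i\<in>I. a \<odot>\<^bsub>N\<^esub> h i (x i))"
      using c[OF x] x a by (intro N.M.finsum_cong') (auto simp: mod_hom_smult[OF h _ prodm_mem[OF x]] N.smult_closed)
    also have "\<dots> = a \<odot>\<^bsub>N\<^esub> (\<Oplus>\<^bsub>N\<^esub>i\<in>I. h i (x i))"
      using c[OF x] a assms(2) by (subst N.smult_finsum) auto
    finally show "a \<odot>\<^bsub>prodm I M\<^esub> x \<in> carrier (prodm I M) \<and> (\<Oplus>\<^bsub>N\<^esub>i\<in>I. h i ((a \<odot>\<^bsub>prodm I M\<^esub> x) i))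
       = a \<odot>\<^bsub>N\<^esub> (\<Oplus>\<^bsub>N\<^esub>i\<in>I. h i (x i))"
      using P.smult_closed[OF a x] by blast
  qed
qed

lemma finsum_single:
  assumes "finite I" "\<And>i. i \<in> I \<Longrightarrow> left_module R (M i)" "left_module R N"
    and h: "\<And>i. i \<in> I \<Longrightarrow> h i \<in> mod_hom R (M i) N" and "k \<in> I" "x \<in> carrier (M k)"
  shows "(\<Oplus>\<^bsub>N\<^esub>i\<in>I. h i (single I M k x i)) = h k x"
proof -
  interpret N: left_module R N by fact
  have "(\<Oplus>\<^bsub>N\<^esub>i\<in>I. h i (single I M k x i)) = (\<Oplus>\<^bsub>N\<^esub>i\<in>I. if k = i then h k x else \<zero>\<^bsub>N\<^esub>)"
    using assms(5,6) by (intro N.M.finsum_cong')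
      (auto simp: single_def mod_hom_closed[OF h] mod_hom_zero[OF assms(2) assms(3) h])
  also have "\<dots> = h k x"
    using N.M.finsum_singleton[OF assms(5,1), of "\<lambda>_. h k x"] mod_hom_closed[OF h[OF assms(5)] assms(6)]
    by simp
  finally show ?thesis .
qed

lemma tuple_mod_hom:
  assumes "left_module R M" "\<And>i. i \<in> I \<Longrightarrow> h i \<in> mod_hom R M (N i)"
  shows "(\<lambda>x\<in>carrier M. \<lambda>i\<in>I. h i x) \<in> mod_hom R M (prodm I N)"
proof -
  interpret M: left_module R M by fact
  show ?thesis
    by (rule mod_homI) (use mod_hom_closed[OF assms(2)] mod_hom_add[OF assms(2)] mod_hom_smult[OF assms(2)]
       in \<open>auto simp: M.smult_closed fun_eq_iff\<close>)
qed

text \<open>Kept apart from \<open>prodm\<close> since the two factors may have different element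
  types.\<close>

definition pairm :: "('a, 'm) module \<Rightarrow> ('a, 'n) module \<Rightarrow> ('a, 'm \<times> 'n) module" where
  "pairm M N = \<lparr>carrier = carrier M \<times> carrier N, monoid.mult = undefined, one = undefined,
     ring.zero = (\<zero>\<^bsub>M\<^esub>, \<zero>\<^bsub>N\<^esub>), ring.add = (\<lambda>x y. (fst x \<oplus>\<^bsub>M\<^esub> fst y, snd x \<oplus>\<^bsub>N\<^esub> snd y)),
     smult = (\<lambda>a x. (a \<odot>\<^bsub>M\<^esub> fst x, a \<odot>\<^bsub>N\<^esub> snd x))\<rparr>"

lemma pairm_simps [simp]:
  "carrier (pairm M N) = carrier M \<times> carrier N"
  "\<zero>\<^bsub>pairm M N\<^esub> = (\<zero>\<^bsub>M\<^esub>, \<zero>\<^bsub>N\<^esub>)"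
  "x \<oplus>\<^bsub>pairm M N\<^esub> y = (fst x \<oplus>\<^bsub>M\<^esub> fst y, snd x \<oplus>\<^bsub>N\<^esub> snd y)"
  "a \<odot>\<^bsub>pairm M N\<^esub> x = (a \<odot>\<^bsub>M\<^esub> fst x, a \<odot>\<^bsub>N\<^esub> snd x)"
  by (auto simp: pairm_def)

lemma left_module_pairm:
  assumes "left_module R M" "left_module R N"
  shows "left_module R (pairm M N)"
proof -
  interpret M: left_module R M by fact
  interpret N: left_module R N by fact
  show ?thesis
    by (rule left_moduleI)
      (auto simp: M.R.ring_axioms M.M.a_assoc N.M.a_assoc M.smult_closed N.smult_closed
        M.smult_l_distr N.smult_l_distr M.smult_r_distr N.smult_r_distr M.smult_assoc N.smult_assoc
        M.smult_one N.smult_one M.smult_zero_left N.smult_zero_left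
        intro: M.M.a_comm N.M.a_comm)
qed

subsection \<open>Finite generation over a field\<close>

text \<open>Generation is expressed through submodules instead of linear combinations. It then
  depends only on the carrier and on which subsets are submodules, so it carries over at once
  between records with the same submodules, such as a product of underlying spaces and the
  underlying space of a product.\<close>

definition fg :: "('a, 'z) ring_scheme \<Rightarrow> ('a, 'm) module \<Rightarrow> bool" where
  "fg R M \<longleftrightarrow> (\<exists>B. finite B \<and> B \<subseteq> carrier M \<and> (\<forall>W. lsub R M W \<and> B \<subseteq> W \<longrightarrow> W = carrier M))"

definition lhull :: "('a, 'z) ring_scheme \<Rightarrow> ('a, 'm) module \<Rightarrow> 'm set \<Rightarrow> 'm set" where
  "lhull R M B = \<Inter>{W. lsub R M W \<and> B \<subseteq> W}"

lemma lhull_lsub: "\<lbrakk>left_module R M; B \<subseteq> carrier M\<rbrakk> \<Longrightarrow> lsub R M (lhull R M B)"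
  unfolding lhull_def using lsub_carrier by (intro lsub_Inter) blast+

lemma lhull_superset: "B \<subseteq> lhull R M B"
  by (auto simp: lhull_def)

lemma lhull_least: "\<lbrakk>lsub R M W; B \<subseteq> W\<rbrakk> \<Longrightarrow> lhull R M B \<subseteq> W"
  by (auto simp: lhull_def)

text \<open>The elements of the form c b + v make up a submodule containing \<open>b\<close> and
  \<open>B\<close>, so the hull lies in it. Splitting off one generator in this way drives the
  induction on generators below.\<close>

lemma lhull_insert:
  assumes "left_module R M" "B \<subseteq> carrier M" "b \<in> carrier M" "x \<in> lhull R M (insert b B)"
  shows "\<exists>c\<in>carrier R. \<exists>v\<in>lhull R M B. x = c \<odot>\<^bsub>M\<^esub> b \<oplus>\<^bsub>M\<^esub> v"
proof -
  interpret M: left_module R M by fact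
  note B = lsubD[OF lhull_lsub[OF assms(1,2)]]
  let ?W = "{c \<odot>\<^bsub>M\<^esub> b \<oplus>\<^bsub>M\<^esub> v | c v. c \<in> carrier R \<and> v \<in> lhull R M B}"
  have "lsub R M ?W"
    unfolding lsub_def
  proof (intro conjI ballI)
    show "?W \<subseteq> carrier M" using B(1) assms(3) by (auto simp: M.smult_closed subset_iff)
    have "\<zero>\<^bsub>M\<^esub> = \<zero>\<^bsub>R\<^esub> \<odot>\<^bsub>M\<^esub> b \<oplus>\<^bsub>M\<^esub> \<zero>\<^bsub>M\<^esub>" using assms(3) by (simp add: M.smult_zero_left)
    then show "\<zero>\<^bsub>M\<^esub> \<in> ?W" using B(2) M.R.zero_closed by blast
  next
    fix x y assume "x \<in> ?W" "y \<in> ?W"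
    then obtain c v d w where *: "x = c \<odot>\<^bsub>M\<^esub> b \<oplus>\<^bsub>M\<^esub> v" "c \<in> carrier R" "v \<in> lhull R M B"
      "y = d \<odot>\<^bsub>M\<^esub> b \<oplus>\<^bsub>M\<^esub> w" "d \<in> carrier R" "w \<in> lhull R M B" by blast
    then have "x \<oplus>\<^bsub>M\<^esub> y = (c \<oplus>\<^bsub>R\<^esub> d) \<odot>\<^bsub>M\<^esub> b \<oplus>\<^bsub>M\<^esub> (v \<oplus>\<^bsub>M\<^esub> w)"
      using assms(3) B(5) by (simp add: M.smult_l_distr M.smult_closed M.M.a_ac)
    then show "x \<oplus>\<^bsub>M\<^esub> y \<in> ?W" using * B(3) M.R.a_closed by blast
  next
    fix a x assume a: "a \<in> carrier R" and "x \<in> ?W"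
    then obtain c v where *: "x = c \<odot>\<^bsub>M\<^esub> b \<oplus>\<^bsub>M\<^esub> v" "c \<in> carrier R" "v \<in> lhull R M B" by blast
    then have "a \<odot>\<^bsub>M\<^esub> x = (a \<otimes>\<^bsub>R\<^esub> c) \<odot>\<^bsub>M\<^esub> b \<oplus>\<^bsub>M\<^esub> (a \<odot>\<^bsub>M\<^esub> v)"
      using a assms(3) B(5) by (simp add: M.smult_r_distr M.smult_assoc M.smult_closed)
    then show "a \<odot>\<^bsub>M\<^esub> x \<in> ?W" using * a B(4) M.R.m_closed by blast
  qed
  moreover have "insert b B \<subseteq> ?W"
  proof -
    have "b = \<one>\<^bsub>R\<^esub> \<odot>\<^bsub>M\<^esub> b \<oplus>\<^bsub>M\<^esub> \<zero>\<^bsub>M\<^esub>" using assms(3) by (simp add: M.smult_one)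
    then have "b \<in> ?W" using B(2) M.R.one_closed by blast
    moreover have "v \<in> ?W" if "v \<in> B" for v
    proof -
      have "v = \<zero>\<^bsub>R\<^esub> \<odot>\<^bsub>M\<^esub> b \<oplus>\<^bsub>M\<^esub> v" using assms(2,3) that by (auto simp: M.smult_zero_left)
      then show ?thesis using that lhull_superset[of B R M] M.R.zero_closed by blast
    qed
    ultimately show ?thesis by blast
  qed
  ultimately have "x \<in> ?W" using lhull_least[of R M ?W "insert b B"] assms(4) by blast
  then show ?thesis by auto
qed

lemma field_left_inverse:
  assumes "field K" "c \<in> carrier K" "c \<noteq> \<zero>\<^bsub>K\<^esub>"
  obtains d where "d \<in> carrier K" "d \<otimes>\<^bsub>K\<^esub> c = \<one>\<^bsub>K\<^esub>"
proof -
  interpret K: field K by fact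
  have "c \<in> Units K" using assms by (simp add: K.field_Units)
  then show ?thesis using that[of "inv\<^bsub>K\<^esub> c"] by simp
qed

text \<open>The measure \<open>d\<close> below counts the pivots of a subspace with respect to a flag.\<close>

lemma subspace_measure_aux:
  assumes "field K" "left_module K V" "finite B" "B \<subseteq> carrier V"
  shows "\<exists>d::'v set \<Rightarrow> nat. \<forall>W W'. lsub K V W \<and> lsub K V W' \<and> W \<subset> W' \<and> W' \<subseteq> lhull K V B \<longrightarrow> d W < d W'"
  using assms(3,4)
proof (induction B)
  case empty
  interpret V: left_module K V by fact
  have "lhull K V {} = {\<zero>\<^bsub>V\<^esub>}"
    using lhull_least[OF lsub_zero[OF assms(2)], of "{}"] lsubD(2)[OF lhull_lsub[OF assms(2), of "{}"]] by auto
  then show ?case by (auto simp: lsub_def)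
next
  case (insert b B)
  interpret V: left_module K V by fact
  let ?H = "lhull K V B"
  have H: "lsub K V ?H" using insert.prems assms(2) by (simp add: lhull_lsub)
  from insert obtain d :: "'v set \<Rightarrow> nat"
    where d: "\<And>W W'. \<lbrakk>lsub K V W; lsub K V W'; W \<subset> W'; W' \<subseteq> ?H\<rbrakk> \<Longrightarrow> d W < d W'" by (metis insert_subset)
  have int: "lsub K V (W \<inter> ?H)" if "lsub K V W" for W using that H by (auto simp: lsub_def)
  \<comment> \<open>\<open>W\<close> is measured by its trace on the span of \<open>B\<close>, plus
    one if it leaves that span.\<close>
  define d' where "d' W = d (W \<inter> ?H) + (if W \<subseteq> ?H then 0 else 1)" for W
  have "d' W < d' W'" if W: "lsub K V W" "lsub K V W'" "W \<subset> W'" "W' \<subseteq> lhull K V (insert b B)" for W W'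
  proof (cases "W \<inter> ?H = W' \<inter> ?H")
    case False
    then have "W \<inter> ?H \<subset> W' \<inter> ?H" using W(3) by blast
    then have "d (W \<inter> ?H) < d (W' \<inter> ?H)" using d int W by simp
    then show ?thesis using W(3) by (auto simp: d'_def)
  next
    case True
    \<comment> \<open>If \<open>W\<close> contained some w outside \<open>?H\<close>, the
      coefficient of w at \<open>b\<close> would be invertible, and any w' in \<open>W'\<close>
      could be reduced by a multiple of w into the trace of \<open>W'\<close> on \<open>?H\<close>.
      That trace lies in \<open>W\<close>, so w' would lie in \<open>W\<close> too, against the
      proper inclusion.\<close>
    have "W \<subseteq> ?H"
    proof (rule ccontr)
      assume "\<not> W \<subseteq> ?H"
      then obtain w where w: "w \<in> W" "w \<notin> ?H" by blast
      obtain w' where w': "w' \<in> W'" "w' \<notin> W" using W(3) by blast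
      have wV: "w \<in> carrier V" "w' \<in> carrier V" using w w' W lsubD by blast+
      have b: "b \<in> carrier V" using insert.prems by simp
      have "w \<in> lhull K V (insert b B)" "w' \<in> lhull K V (insert b B)" using w w' W by blast+
      then obtain c v c' v' where c: "c \<in> carrier K" "v \<in> ?H" "w = c \<odot>\<^bsub>V\<^esub> b \<oplus>\<^bsub>V\<^esub> v"
        and c': "c' \<in> carrier K" "v' \<in> ?H" "w' = c' \<odot>\<^bsub>V\<^esub> b \<oplus>\<^bsub>V\<^esub> v'"
        using lhull_insert[OF assms(2), of B b] insert.prems by (metis insert_subset)
      have v: "v \<in> carrier V" "v' \<in> carrier V" using c c' H lsubD by blast+
      have "c \<noteq> \<zero>\<^bsub>K\<^esub>" using c w(2) b v by (auto simp: V.smult_zero_left)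
      then obtain e where e: "e \<in> carrier K" "e \<otimes>\<^bsub>K\<^esub> c = \<one>\<^bsub>K\<^esub>" using assms(1) c field_left_inverse by metis
      define f where "f = c' \<otimes>\<^bsub>K\<^esub> e"
      have f: "f \<in> carrier K" "f \<otimes>\<^bsub>K\<^esub> c = c'" using e c c' by (auto simp: f_def V.R.m_assoc)
      have "w' \<ominus>\<^bsub>V\<^esub> f \<odot>\<^bsub>V\<^esub> w = v' \<ominus>\<^bsub>V\<^esub> f \<odot>\<^bsub>V\<^esub> v"
      proof -
        have "f \<odot>\<^bsub>V\<^esub> w = c' \<odot>\<^bsub>V\<^esub> b \<oplus>\<^bsub>V\<^esub> f \<odot>\<^bsub>V\<^esub> v"
          using c f b v by (metis V.smult_assoc V.smult_closed V.smult_r_distr)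
        then have "w' \<ominus>\<^bsub>V\<^esub> f \<odot>\<^bsub>V\<^esub> w = (c' \<odot>\<^bsub>V\<^esub> b \<ominus>\<^bsub>V\<^esub> c' \<odot>\<^bsub>V\<^esub> b) \<oplus>\<^bsub>V\<^esub> (v' \<ominus>\<^bsub>V\<^esub> f \<odot>\<^bsub>V\<^esub> v)"
          using c' f b v by (simp add: V.M.add_minus_add V.smult_closed)
        then show ?thesis using c' b v f by (simp add: V.M.minus_self V.smult_closed)
      qed
      also have "\<dots> \<in> ?H" using lsub_minus[OF assms(2) H c'(2)] lsubD(4)[OF H f(1) c(2)] by blast
      finally have "w' \<ominus>\<^bsub>V\<^esub> f \<odot>\<^bsub>V\<^esub> w \<in> W' \<inter> ?H"
        using lsub_minus[OF assms(2) W(2) w'(1)] lsubD(4)[OF W(2) f(1)] w W(3) by blast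
      then have "w' \<ominus>\<^bsub>V\<^esub> f \<odot>\<^bsub>V\<^esub> w \<in> W" using True by blast
      then have "(w' \<ominus>\<^bsub>V\<^esub> f \<odot>\<^bsub>V\<^esub> w) \<oplus>\<^bsub>V\<^esub> f \<odot>\<^bsub>V\<^esub> w \<in> W" using W(1) w f lsubD by metis
      then show False using w' wV f by (simp add: V.M.minus_add_cancel V.smult_closed)
    qed
    moreover have "\<not> W' \<subseteq> ?H" using True W(3) by blast
    ultimately show ?thesis using True by (simp add: d'_def)
  qed
  then show ?case by blast
qed

text \<open>A stand-in for dimension: what matters later is that it is a natural number and grows
  strictly along proper inclusions.\<close>

lemma subspace_measure:
  assumes "field K" "left_module K V" "fg K V"
  obtains d :: "'v set \<Rightarrow> nat"
    where "\<And>W W'. \<lbrakk>lsub K V W; lsub K V W'; W \<subset> W'\<rbrakk> \<Longrightarrow> d W < d W'"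
proof -
  obtain B where B: "finite B" "B \<subseteq> carrier V" "\<And>W. \<lbrakk>lsub K V W; B \<subseteq> W\<rbrakk> \<Longrightarrow> W = carrier V"
    using assms(3) by (auto simp: fg_def)
  have "lhull K V B = carrier V"
    using B lhull_lsub[OF assms(2)] lhull_superset by metis
  then show ?thesis
    using subspace_measure_aux[OF assms(1,2) B(1,2)] that lsubD(1) by metis
qed

text \<open>A finite subset of \<open>U\<close> whose span has the largest measure spans
  \<open>U\<close>, for adding a missing vector would enlarge the span. Such a subset exists because
  the measure of the whole space bounds all others.\<close>

lemma fg_lsub:
  assumes "field K" "left_module K V" "fg K V" "lsub K V U"
  shows "fg K (V\<lparr>carrier := U\<rparr>)"
proof -
  obtain d :: "_ \<Rightarrow> nat" where d: "\<And>W W'. \<lbrakk>lsub K V W; lsub K V W'; W \<subset> W'\<rbrakk> \<Longrightarrow> d W < d W'"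
    using subspace_measure[OF assms(1-3)] by blast
  have dle: "d W \<le> d (carrier V)" if "lsub K V W" for W
    using d[OF that lsub_carrier[OF assms(2)]] lsubD(1)[OF that] by (cases "W = carrier V") (auto simp: psubset_eq)
  let ?P = "\<lambda>B. finite B \<and> B \<subseteq> U"
  have hl: "lsub K V (lhull K V B)" if "B \<subseteq> U" for B
    by (rule lhull_lsub[OF assms(2) order_trans[OF that lsubD(1)[OF assms(4)]]])
  obtain B where B: "finite B" "B \<subseteq> U" "\<And>C. ?P C \<Longrightarrow> d (lhull K V C) \<le> d (lhull K V B)"
    using ex_has_greatest_nat[of ?P "{}" "\<lambda>B. d (lhull K V B)" "Suc (d (carrier V))"] dle hl
    by (auto simp: less_Suc_eq_le)
  have "lhull K V B = U"
  proof (rule ccontr)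
    assume "lhull K V B \<noteq> U"
    moreover have "lhull K V B \<subseteq> U" using lhull_least assms(4) B(2) by blast
    ultimately obtain u where u: "u \<in> U" "u \<notin> lhull K V B" by blast
    have "lhull K V B \<subset> lhull K V (insert u B)"
    proof
      show "lhull K V B \<subseteq> lhull K V (insert u B)" by (auto simp: lhull_def)
      show "lhull K V B \<noteq> lhull K V (insert u B)" using u(2) lhull_superset[of "insert u B" K V] by blast
    qed
    then have "d (lhull K V B) < d (lhull K V (insert u B))" using d hl B(2) u(1) by simp
    then show False using B(3)[of "insert u B"] B(1,2) u(1) by simp
  qed
  then have "W = U" if "lsub K (V\<lparr>carrier := U\<rparr>) W" "B \<subseteq> W" for W
    using that lsub_lsub[OF assms(4)] lhull_least[of K V W B] by auto
  then show ?thesis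
    unfolding fg_def using B(1,2) by (intro exI[of _ B]) auto
qed

lemma fg_image:
  assumes "left_module R M" "left_module R N" "f \<in> mod_hom R M N" "f ` carrier M = carrier N" "fg R M"
  shows "fg R N"
proof -
  obtain B where B: "finite B" "B \<subseteq> carrier M" "\<And>W. \<lbrakk>lsub R M W; B \<subseteq> W\<rbrakk> \<Longrightarrow> W = carrier M"
    using assms(5) by (auto simp: fg_def)
  have "W = carrier N" if W: "lsub R N W" "f ` B \<subseteq> W" for W
  proof -
    have "{x \<in> carrier M. f x \<in> W} = carrier M"
      using lsub_kernel[OF assms(1-3) W(1)] B W(2) by (intro B(3)) auto
    then have "f ` carrier M \<subseteq> W" by auto
    then show ?thesis using assms(4) lsubD(1)[OF W(1)] by simp
  qed
  then show ?thesis
    unfolding fg_def using B(1,2) assms(4) by (intro exI[of _ "f ` B"]) auto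
qed

text \<open>The generators are those of the factors, placed in their coordinates. The preimage of a
  submodule under the inclusion of a factor is a submodule, and it is the whole factor once it
  contains the generators of that factor.\<close>

lemma fg_prodm:
  assumes "ring R" "finite I" "\<And>i. i \<in> I \<Longrightarrow> left_module R (M i)" "\<And>i. i \<in> I \<Longrightarrow> fg R (M i)"
  shows "fg R (prodm I M)"
proof -
  obtain B where B: "\<And>i. i \<in> I \<Longrightarrow> finite (B i)" "\<And>i. i \<in> I \<Longrightarrow> B i \<subseteq> carrier (M i)"
    "\<And>i W. \<lbrakk>i \<in> I; lsub R (M i) W; B i \<subseteq> W\<rbrakk> \<Longrightarrow> W = carrier (M i)"
    using assms(4) unfolding fg_def by metis
  have P: "left_module R (prodm I M)" using left_module_prodm assms by blast
  let ?B = "\<Union>i\<in>I. single I M i ` B i"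
  have "W = carrier (prodm I M)" if W: "lsub R (prodm I M) W" "?B \<subseteq> W" for W
  proof
    show "carrier (prodm I M) \<subseteq> W"
    proof
      fix x assume x: "x \<in> carrier (prodm I M)"
      have "single I M i (x i) \<in> W" if i: "i \<in> I" for i
      proof -
        have "B i \<subseteq> {y \<in> carrier (M i). (\<lambda>x\<in>carrier (M i). single I M i x) y \<in> W}"
          using B(2)[OF i] W(2) i by auto
        then have "{y \<in> carrier (M i). (\<lambda>x\<in>carrier (M i). single I M i x) y \<in> W} = carrier (M i)"
          by (intro B(3)[OF i] lsub_kernel[OF assms(3)[OF i] P single_mod_hom[OF assms(1,3) i] W(1)])
        then have "(\<lambda>x\<in>carrier (M i). single I M i x) (x i) \<in> W" using prodm_mem[OF x i] by blast
        then show ?thesis using prodm_mem[OF x i] by simp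
      qed
      then show "x \<in> W"
        using prodm_decomp[OF assms(1-3) x] lsub_finsum[OF P W(1) assms(2)] by (metis (mono_tags, lifting) Pi_I)
    qed
  qed (rule lsubD(1)[OF W(1)])
  moreover have "finite ?B" using B assms(2) by auto
  moreover have "?B \<subseteq> carrier (prodm I M)"
  proof clarify
    fix i b assume "i \<in> I" "b \<in> B i"
    then show "single I M i b \<in> carrier (prodm I M)" using B(2) by (intro single_closed[OF assms(3)]) auto
  qed
  ultimately show ?thesis unfolding fg_def by (intro exI[of _ ?B]) blast
qed

lemma fg_pairm:
  assumes "left_module R M" "left_module R N" "fg R M" "fg R N"
  shows "fg R (pairm M N)"
proof -
  interpret M: left_module R M by fact
  interpret N: left_module R N by fact
  have P: "left_module R (pairm M N)" using left_module_pairm assms by blast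
  obtain B where B: "finite B" "B \<subseteq> carrier M" "\<And>W. \<lbrakk>lsub R M W; B \<subseteq> W\<rbrakk> \<Longrightarrow> W = carrier M"
    using assms(3) by (auto simp: fg_def)
  obtain C where C: "finite C" "C \<subseteq> carrier N" "\<And>W. \<lbrakk>lsub R N W; C \<subseteq> W\<rbrakk> \<Longrightarrow> W = carrier N"
    using assms(4) by (auto simp: fg_def)
  let ?B = "(\<lambda>b. (b, \<zero>\<^bsub>N\<^esub>)) ` B \<union> Pair \<zero>\<^bsub>M\<^esub> ` C"
  have "W = carrier (pairm M N)" if W: "lsub R (pairm M N) W" "?B \<subseteq> W" for W
  proof
    show "carrier (pairm M N) \<subseteq> W"
    proof
      fix z assume z: "z \<in> carrier (pairm M N)"
      note Wd = lsubD[OF W(1)]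
      have a: "{x \<in> carrier M. (x, \<zero>\<^bsub>N\<^esub>) \<in> W} = carrier M"
        using B W(2) Wd(2) Wd(3)[of "(_, \<zero>\<^bsub>N\<^esub>)" "(_, \<zero>\<^bsub>N\<^esub>)"] Wd(4)[of _ "(_, \<zero>\<^bsub>N\<^esub>)"]
        by (intro B(3)) (auto simp: lsub_def M.smult_closed N.smult_zero_right)
      have b: "{x \<in> carrier N. (\<zero>\<^bsub>M\<^esub>, x) \<in> W} = carrier N"
        using C W(2) Wd(2) Wd(3)[of "(\<zero>\<^bsub>M\<^esub>, _)" "(\<zero>\<^bsub>M\<^esub>, _)"] Wd(4)[of _ "(\<zero>\<^bsub>M\<^esub>, _)"]
        by (intro C(3)) (auto simp: lsub_def N.smult_closed M.smult_zero_right)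
      obtain x y where "z = (x, y)" "x \<in> carrier M" "y \<in> carrier N" using z by auto
      then show "z \<in> W" using a b Wd(3)[of "(x, \<zero>\<^bsub>N\<^esub>)" "(\<zero>\<^bsub>M\<^esub>, y)"] by auto
    qed
  qed (rule lsubD(1)[OF W(1)])
  then show ?thesis
    unfolding fg_def using B(1,2) C(1,2) by (intro exI[of _ ?B]) auto
qed

lemma module_left_module: "Module.module K V \<Longrightarrow> left_module K V"
  unfolding Module.module_def left_module_def left_module_axioms_def module_axioms_def
  by (auto simp: cring_def)

text \<open>The linear combinations of a finite \<open>B\<close> form the smallest subspace that
  contains \<open>B\<close>; hence spanning by sums and generating in the sense of \<open>fg\<close>
  are the same.\<close>

lemma finite_dimensional_iff:
  "finite_dimensional K V \<longleftrightarrow> field K \<and> Module.module K V \<and> fg K V"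
proof (cases "field K \<and> Module.module K V")
  case True
  then interpret V: left_module K V by (auto intro: module_left_module)
  have lm: "left_module K V" by (rule V.left_module_axioms)
  let ?S = "\<lambda>B. {\<Oplus>\<^bsub>V\<^esub>b\<in>B. c b \<odot>\<^bsub>V\<^esub> b | c. c \<in> Pi B (\<lambda>_. carrier K)}"
  have cl: "(\<lambda>b. c b \<odot>\<^bsub>V\<^esub> b) \<in> B \<rightarrow> carrier V" if "B \<subseteq> carrier V" "c \<in> Pi B (\<lambda>_. carrier K)" for B c
    using that by (auto simp: Pi_iff intro!: V.smult_closed)
  have sub: "lsub K V (?S B)" if B: "finite B" "B \<subseteq> carrier V" for B
    unfolding lsub_def
  proof (intro conjI ballI)
    show "?S B \<subseteq> carrier V" using cl[OF B(2)] by auto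
    have "(\<Oplus>\<^bsub>V\<^esub>b\<in>B. \<zero>\<^bsub>K\<^esub> \<odot>\<^bsub>V\<^esub> b) = (\<Oplus>\<^bsub>V\<^esub>b\<in>B. \<zero>\<^bsub>V\<^esub>)"
      using B(2) by (intro V.M.finsum_cong') (auto simp: V.smult_zero_left subset_iff)
    then have "\<zero>\<^bsub>V\<^esub> = (\<Oplus>\<^bsub>V\<^esub>b\<in>B. (\<lambda>_. \<zero>\<^bsub>K\<^esub>) b \<odot>\<^bsub>V\<^esub> b)" by simp
    then show "\<zero>\<^bsub>V\<^esub> \<in> ?S B" by (intro CollectI exI[of _ "\<lambda>_. \<zero>\<^bsub>K\<^esub>"]) auto
  next
    fix x y assume "x \<in> ?S B" "y \<in> ?S B"
    then obtain c d where c: "c \<in> Pi B (\<lambda>_. carrier K)" "x = (\<Oplus>\<^bsub>V\<^esub>b\<in>B. c b \<odot>\<^bsub>V\<^esub> b)"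
      and d: "d \<in> Pi B (\<lambda>_. carrier K)" "y = (\<Oplus>\<^bsub>V\<^esub>b\<in>B. d b \<odot>\<^bsub>V\<^esub> b)" by blast
    have "x \<oplus>\<^bsub>V\<^esub> y = (\<Oplus>\<^bsub>V\<^esub>b\<in>B. c b \<odot>\<^bsub>V\<^esub> b \<oplus>\<^bsub>V\<^esub> d b \<odot>\<^bsub>V\<^esub> b)"
      using V.M.finsum_addf[OF cl[OF B(2) c(1)] cl[OF B(2) d(1)]] c d by simp
    also have "\<dots> = (\<Oplus>\<^bsub>V\<^esub>b\<in>B. (\<lambda>b. c b \<oplus>\<^bsub>K\<^esub> d b) b \<odot>\<^bsub>V\<^esub> b)"
      using B(2) c(1) d(1) by (intro V.M.finsum_cong') (auto simp: V.smult_l_distr subset_iff Pi_iff V.smult_closed)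
    finally show "x \<oplus>\<^bsub>V\<^esub> y \<in> ?S B"
      using c(1) d(1) by (intro CollectI exI[of _ "\<lambda>b. c b \<oplus>\<^bsub>K\<^esub> d b"]) auto
  next
    fix a x assume a: "a \<in> carrier K" and "x \<in> ?S B"
    then obtain c where c: "c \<in> Pi B (\<lambda>_. carrier K)" "x = (\<Oplus>\<^bsub>V\<^esub>b\<in>B. c b \<odot>\<^bsub>V\<^esub> b)" by blast
    have "a \<odot>\<^bsub>V\<^esub> x = (\<Oplus>\<^bsub>V\<^esub>b\<in>B. a \<odot>\<^bsub>V\<^esub> (c b \<odot>\<^bsub>V\<^esub> b))"
      using V.smult_finsum[OF B(1) cl[OF B(2) c(1)] a] c by simp
    also have "\<dots> = (\<Oplus>\<^bsub>V\<^esub>b\<in>B. (\<lambda>b. a \<otimes>\<^bsub>K\<^esub> c b) b \<odot>\<^bsub>V\<^esub> b)"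
      using B(2) c(1) a by (intro V.M.finsum_cong') (auto simp: V.smult_assoc subset_iff Pi_iff V.smult_closed)
    finally show "a \<odot>\<^bsub>V\<^esub> x \<in> ?S B"
      using c(1) a by (intro CollectI exI[of _ "\<lambda>b. a \<otimes>\<^bsub>K\<^esub> c b"]) auto
  qed
  have sup: "B \<subseteq> ?S B" if B: "finite B" "B \<subseteq> carrier V" for B
  proof
    fix x assume x: "x \<in> B"
    let ?c = "\<lambda>b. if x = b then \<one>\<^bsub>K\<^esub> else \<zero>\<^bsub>K\<^esub>"
    have "(\<Oplus>\<^bsub>V\<^esub>b\<in>B. ?c b \<odot>\<^bsub>V\<^esub> b) = (\<Oplus>\<^bsub>V\<^esub>b\<in>B. if x = b then b else \<zero>\<^bsub>V\<^esub>)"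
      using B(2) by (intro V.M.finsum_cong') (auto simp: V.smult_one V.smult_zero_left subset_iff)
    also have "\<dots> = x" using V.M.finsum_singleton[OF x B(1), of "\<lambda>b. b"] B(2) by auto
    finally show "x \<in> ?S B" by (intro CollectI exI[of _ ?c]) auto
  qed
  have small: "?S B \<subseteq> W" if "finite B" "B \<subseteq> W" "lsub K V W" for B W
    using that by (auto intro!: lsub_finsum[OF lm] intro: lsubD(4))
  have eq: "(carrier V = ?S B) \<longleftrightarrow> (\<forall>W. lsub K V W \<and> B \<subseteq> W \<longrightarrow> W = carrier V)" if B: "finite B" "B \<subseteq> carrier V" for B
  proof
    assume *: "carrier V = ?S B"
    show "\<forall>W. lsub K V W \<and> B \<subseteq> W \<longrightarrow> W = carrier V"
    proof (intro allI impI)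
      fix W assume W: "lsub K V W \<and> B \<subseteq> W"
      then have "?S B \<subseteq> W" using small[OF B(1)] by blast
      then show "W = carrier V" using W lsubD(1) * by (metis subset_antisym)
    qed
  next
    assume "\<forall>W. lsub K V W \<and> B \<subseteq> W \<longrightarrow> W = carrier V"
    then show "carrier V = ?S B" using sub[OF B] sup[OF B] by simp
  qed
  have "finite B \<and> B \<subseteq> carrier V \<and> carrier V = ?S B \<longleftrightarrow>
      finite B \<and> B \<subseteq> carrier V \<and> (\<forall>W. lsub K V W \<and> B \<subseteq> W \<longrightarrow> W = carrier V)" for B
    by (intro conj_cong refl eq)
  then show ?thesis unfolding finite_dimensional_def fg_def using True by simp
qed (auto simp: finite_dimensional_def)

subsection \<open>Modules over a finite-dimensional algebra\<close>

context fd_algebra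
begin

abbreviation "homA \<equiv> mod_hom A"
abbreviation mult_A (infixl "\<otimes>\<^sub>A" 70) where "x \<otimes>\<^sub>A y \<equiv> x \<otimes>\<^bsub>A\<^esub> y"
abbreviation add_A (infixl "\<oplus>\<^sub>A" 65) where "x \<oplus>\<^sub>A y \<equiv> x \<oplus>\<^bsub>A\<^esub> y"
abbreviation one_A ("\<one>\<^sub>A") where "\<one>\<^sub>A \<equiv> \<one>\<^bsub>A\<^esub>"
abbreviation zero_A ("\<zero>\<^sub>A") where "\<zero>\<^sub>A \<equiv> \<zero>\<^bsub>A\<^esub>"

sublocale A: ring A by (rule ring_A)
sublocale K: field K by (rule field_K)

text \<open>The structure map of the algebra. Its image is central (\<open>scal_commute\<close>),
  and \<open>underlying\<close> lets \<open>K\<close> act on an \<open>A\<close>-module through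
  it.\<close>

abbreviation scal :: "'k \<Rightarrow> 'a" where "scal c \<equiv> c \<odot>\<^bsub>A\<^esub> \<one>\<^sub>A"

lemma left_module_K_A: "left_module K A"
  by (rule module_left_module[OF module_A])

lemma scal_closed: "c \<in> carrier K \<Longrightarrow> scal c \<in> carrier A"
  using left_module.smult_closed[OF left_module_K_A] by simp

lemma scal_one: "scal \<one>\<^bsub>K\<^esub> = \<one>\<^sub>A"
  using left_module.smult_one[OF left_module_K_A] by simp

lemma scal_zero: "scal \<zero>\<^bsub>K\<^esub> = \<zero>\<^sub>A"
  using left_module.smult_zero_left[OF left_module_K_A] by simp

lemma scal_add: "\<lbrakk>c \<in> carrier K; d \<in> carrier K\<rbrakk> \<Longrightarrow> scal (c \<oplus>\<^bsub>K\<^esub> d) = scal c \<oplus>\<^sub>A scal d"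
  using left_module.smult_l_distr[OF left_module_K_A] by simp

lemma scal_mult: "\<lbrakk>c \<in> carrier K; d \<in> carrier K\<rbrakk> \<Longrightarrow> scal (c \<otimes>\<^bsub>K\<^esub> d) = scal c \<otimes>\<^sub>A scal d"
  using left_module.smult_assoc[OF left_module_K_A] smult_mult_left[of c "\<one>\<^sub>A" "scal d"]
  by (simp add: scal_closed)

lemma scal_smult: "\<lbrakk>c \<in> carrier K; a \<in> carrier A\<rbrakk> \<Longrightarrow> scal c \<otimes>\<^sub>A a = c \<odot>\<^bsub>A\<^esub> a"
  using smult_mult_left[of c "\<one>\<^sub>A" a] by simp

lemma scal_commute: "\<lbrakk>c \<in> carrier K; a \<in> carrier A\<rbrakk> \<Longrightarrow> scal c \<otimes>\<^sub>A a = a \<otimes>\<^sub>A scal c"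
  using smult_mult_left[of c "\<one>\<^sub>A" a] smult_mult_right[of c a "\<one>\<^sub>A"] by simp

abbreviation und where "und M \<equiv> underlying K A M"

lemma und_simps [simp]:
  "carrier (und M) = carrier M" "\<zero>\<^bsub>und M\<^esub> = \<zero>\<^bsub>M\<^esub>" "x \<oplus>\<^bsub>und M\<^esub> y = x \<oplus>\<^bsub>M\<^esub> y" "c \<odot>\<^bsub>und M\<^esub> x = scal c \<odot>\<^bsub>M\<^esub> x"
  by (auto simp: underlying_def)

lemma left_module_und:
  assumes "left_module A M"
  shows "left_module K (und M)"
proof -
  interpret M: left_module A M by fact
  show ?thesis
    by (rule left_moduleI)
      (auto simp: K.ring_axioms M.M.a_assoc scal_closed scal_one scal_zero scal_add scal_mult
         M.smult_closed M.smult_l_distr M.smult_r_distr M.smult_assoc M.smult_one M.smult_zero_left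
         intro: M.M.a_comm)
qed

lemma module_und: "left_module A M \<Longrightarrow> Module.module K (und M)"
  using left_module_und[of M] K.is_cring
  by (simp add: left_module_def left_module_axioms_def Module.module_def module_axioms_def)

lemma fd_module_iff: "fd_module K A M \<longleftrightarrow> left_module A M \<and> fg K (und M)"
  using module_und field_K by (auto simp: fd_module_def finite_dimensional_iff)

lemma fd_left_module: "fd_module K A M \<Longrightarrow> left_module A M"
  by (simp add: fd_module_def)

lemma lsub_und:
  assumes "lsub A M U"
  shows "lsub K (und M) U"
  using assms scal_closed by (simp add: lsub_def)

lemma mod_hom_und: "f \<in> homA M N \<Longrightarrow> f \<in> mod_hom K (und M) (und N)"
  using scal_closed by (simp add: mod_hom_def)

lemma fd_module_lsub:
  assumes "fd_module K A M" "lsub A M U"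
  shows "fd_module K A (M\<lparr>carrier := U\<rparr>)"
proof -
  have "und (M\<lparr>carrier := U\<rparr>) = (und M)\<lparr>carrier := U\<rparr>" by (simp add: underlying_def)
  then show ?thesis
    using assms fg_lsub[OF field_K left_module_und _ lsub_und] left_module_lsub
    by (auto simp: fd_module_iff)
qed

lemma fd_module_image:
  assumes "fd_module K A M" "left_module A N" "f \<in> homA M N" "f ` carrier M = carrier N"
  shows "fd_module K A N"
  using assms fg_image[OF left_module_und left_module_und mod_hom_und, of M N f] by (simp add: fd_module_iff)

text \<open>Forming the underlying space before or after the product gives two records with the same
  subspaces, which is all that \<open>fg\<close> sees.\<close>

lemma fd_module_prodm:
  assumes "finite I" "\<And>i. i \<in> I \<Longrightarrow> fd_module K A (M i)"
  shows "fd_module K A (prodm I M)"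
proof -
  have lm: "left_module A (prodm I M)"
    using assms fd_left_module by (intro left_module_prodm ring_A) blast
  have "fg K (prodm I (\<lambda>i. und (M i)))"
    using assms by (intro fg_prodm K.ring_axioms) (auto simp: fd_module_iff left_module_und)
  moreover have "lsub K (prodm I (\<lambda>i. und (M i))) W \<longleftrightarrow> lsub K (und (prodm I M)) W" for W
    by (simp add: lsub_def)
  ultimately show ?thesis using lm by (simp add: fd_module_iff fg_def)
qed

lemma fd_module_pairm:
  assumes "fd_module K A M" "fd_module K A N"
  shows "fd_module K A (pairm M N)"
proof -
  have "fg K (pairm (und M) (und N))"
    using assms by (intro fg_pairm) (auto simp: fd_module_iff left_module_und)
  moreover have "lsub K (pairm (und M) (und N)) W \<longleftrightarrow> lsub K (und (pairm M N)) W" for W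
    by (simp add: lsub_def)
  ultimately show ?thesis using assms left_module_pairm[of A M N] by (simp add: fd_module_iff fg_def)
qed

abbreviation "AA \<equiv> regular_module A"

lemma AA_simps [simp]:
  "carrier AA = carrier A" "\<zero>\<^bsub>AA\<^esub> = \<zero>\<^sub>A" "x \<oplus>\<^bsub>AA\<^esub> y = x \<oplus>\<^sub>A y" "a \<odot>\<^bsub>AA\<^esub> x = a \<otimes>\<^sub>A x"
  by (auto simp: regular_module_def)

lemma left_module_AA: "left_module A AA"
  by (rule left_moduleI)
    (auto simp: ring_A A.a_assoc A.l_distr A.r_distr A.m_assoc intro: A.a_comm)

lemma fd_module_AA: "fd_module K A AA"
proof -
  have "fg K A" using finite_dimensional_A by (simp add: finite_dimensional_iff)
  moreover have "lsub K A W \<longleftrightarrow> lsub K (und AA) W" for W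
    using scal_smult by (auto simp: lsub_def subset_iff)
  ultimately show ?thesis using left_module_AA by (simp add: fd_module_iff fg_def)
qed

text \<open>An \<open>A\<close>-submodule is a \<open>K\<close>-subspace, so the measure on
  subspaces can be used. It takes the place of length and dimension in all later arguments.\<close>

lemma submodule_measure:
  assumes "fd_module K A M"
  obtains d :: "_ set \<Rightarrow> nat" where "\<And>W W'. \<lbrakk>lsub A M W; lsub A M W'; W \<subset> W'\<rbrakk> \<Longrightarrow> d W < d W'"
  using subspace_measure[OF field_K left_module_und, of M] assms lsub_und by (metis fd_module_iff)

text \<open>An element is determined by its coefficients with respect to a finite spanning set
  arranged as a list. This bound gives every finite-dimensional module a copy in any type into which
  the lists over \<open>K\<close> embed.\<close>

lemma fd_module_lepoll:
  assumes "fd_module K A M"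
  shows "carrier M \<lesssim> lists (carrier K)"
proof -
  obtain B where B: "finite B"
    and Bc: "carrier M = {\<Oplus>\<^bsub>und M\<^esub>b\<in>B. c b \<odot>\<^bsub>und M\<^esub> b | c. c \<in> Pi B (\<lambda>_. carrier K)}"
    and BM: "B \<subseteq> carrier M"
    using assms by (auto simp: fd_module_def finite_dimensional_def)
  obtain bs where bs: "set bs = B" "distinct bs" using B finite_distinct_list by blast
  interpret M: left_module K "und M" using assms left_module_und[of M] by (simp add: fd_module_def)
  let ?f = "\<lambda>l. \<Oplus>\<^bsub>und M\<^esub>b\<in>B. (the (map_of (zip bs l) b)) \<odot>\<^bsub>und M\<^esub> b"
  have "carrier M \<subseteq> ?f ` lists (carrier K)"
  proof
    fix x assume "x \<in> carrier M"
    then obtain c where c: "c \<in> Pi B (\<lambda>_. carrier K)" "x = (\<Oplus>\<^bsub>und M\<^esub>b\<in>B. c b \<odot>\<^bsub>und M\<^esub> b)" using Bc by blast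
    have "the (map_of (zip bs (map c bs)) b) = c b" if "b \<in> B" for b
      using that bs by (simp add: map_of_zip_map)
    then have "(\<Oplus>\<^bsub>und M\<^esub>b\<in>B. c b \<odot>\<^bsub>und M\<^esub> b) = ?f (map c bs)"
      using BM c(1) by (intro M.M.finsum_cong') (auto simp: Pi_iff intro!: M.smult_closed[simplified])
    moreover have "map c bs \<in> lists (carrier K)" using c bs by auto
    ultimately show "x \<in> ?f ` lists (carrier K)" using c by blast
  qed
  then have "carrier M \<lesssim> ?f ` lists (carrier K)" by (rule subset_imp_lepoll)
  then show ?thesis using image_lepoll by (rule lepoll_trans)
qed

end

text \<open>Quotient modules; for the zero submodule this transports a module to another type.\<close>

lemma quotient_module:
  fixes M :: "('a, 'n) module"
  assumes "left_module R M" "lsub R M U" and univ: "carrier M \<lesssim> (UNIV :: 'm set)"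
  obtains N :: "('a, 'm) module" and q where
    "left_module R N" "q \<in> mod_hom R M N" "q ` carrier M = carrier N"
    "\<And>x. x \<in> carrier M \<Longrightarrow> q x = \<zero>\<^bsub>N\<^esub> \<longleftrightarrow> x \<in> U"
proof -
  interpret M: left_module R M by fact
  note U = lsubD[OF assms(2)]
  obtain e :: "'n \<Rightarrow> 'm" where e: "inj_on e (carrier M)" using univ by (auto simp: lepoll_def)
  \<comment> \<open>The quotient is modelled on one chosen representative of each coset, moved to
    the target type by \<open>e\<close>. The choice depends only on the coset, because the
    predicates defining \<open>rp x\<close> and \<open>rp y\<close> coincide for congruent x and
    y.\<close>
  define rp where "rp x = (SOME y. y \<in> carrier M \<and> x \<ominus>\<^bsub>M\<^esub> y \<in> U)" for x
  have minus_sym: "y \<ominus>\<^bsub>M\<^esub> x \<in> U" if "x \<ominus>\<^bsub>M\<^esub> y \<in> U" "x \<in> carrier M" "y \<in> carrier M" for x y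
    using that lsub_minus[OF assms(1,2) U(2) that(1)] M.M.minus_add_minus[of y x y]
    by (metis M.M.add_minus_cancel M.M.l_zero M.M.minus_closed M.M.minus_self M.M.zero_closed M.M.a_comm)
  have rp: "rp x \<in> carrier M" "x \<ominus>\<^bsub>M\<^esub> rp x \<in> U" if "x \<in> carrier M" for x
    using that someI[of "\<lambda>y. y \<in> carrier M \<and> x \<ominus>\<^bsub>M\<^esub> y \<in> U" x] U(2) by (auto simp: rp_def M.M.minus_self)
  have rp_eq: "rp x = rp y \<longleftrightarrow> x \<ominus>\<^bsub>M\<^esub> y \<in> U" if xy: "x \<in> carrier M" "y \<in> carrier M" for x y
  proof
    assume "rp x = rp y"
    then show "x \<ominus>\<^bsub>M\<^esub> y \<in> U"
      using rp[OF xy(1)] rp[OF xy(2)] minus_sym xy U(3) M.M.minus_add_minus[of x "rp x" y] by metis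
  next
    assume *: "x \<ominus>\<^bsub>M\<^esub> y \<in> U"
    have "x \<ominus>\<^bsub>M\<^esub> z \<in> U \<longleftrightarrow> y \<ominus>\<^bsub>M\<^esub> z \<in> U" if "z \<in> carrier M" for z
      using * minus_sym[OF *] xy that U(3) M.M.minus_add_minus[of x y z] M.M.minus_add_minus[of y x z] by metis
    then show "rp x = rp y" unfolding rp_def by meson
  qed
  define q where "q = (\<lambda>x\<in>carrier M. e (rp x))"
  have q_eq: "q x = q y \<longleftrightarrow> x \<ominus>\<^bsub>M\<^esub> y \<in> U" if "x \<in> carrier M" "y \<in> carrier M" for x y
    using that rp rp_eq e by (auto simp: q_def inj_on_eq_iff)
  define g where "g = inv_into (carrier M) q"
  have g: "g (q x) \<in> carrier M" "q (g (q x)) = q x" if "x \<in> carrier M" for x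
    using that by (auto simp: g_def intro: inv_into_into f_inv_into_f)
  \<comment> \<open>The operations are computed on preimages picked by \<open>g\<close>; the facts
    \<open>add\<close> and \<open>smult\<close> below show that the choice of preimage does not
    matter.\<close>
  define N :: "('a, 'm) module" where "N = \<lparr>carrier = q ` carrier M, monoid.mult = undefined, one = undefined,
     ring.zero = q \<zero>\<^bsub>M\<^esub>, ring.add = (\<lambda>x y. q (g x \<oplus>\<^bsub>M\<^esub> g y)), smult = (\<lambda>a x. q (a \<odot>\<^bsub>M\<^esub> g x))\<rparr>"
  have add: "q x \<oplus>\<^bsub>N\<^esub> q y = q (x \<oplus>\<^bsub>M\<^esub> y)" if xy: "x \<in> carrier M" "y \<in> carrier M" for x y
  proof -
    have "(g (q x) \<oplus>\<^bsub>M\<^esub> g (q y)) \<ominus>\<^bsub>M\<^esub> (x \<oplus>\<^bsub>M\<^esub> y) \<in> U"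
      using g[OF xy(1)] g[OF xy(2)] xy q_eq U(3) by (simp add: M.M.add_minus_add)
    then show ?thesis using g xy by (simp add: N_def q_eq)
  qed
  have smult: "a \<odot>\<^bsub>N\<^esub> q x = q (a \<odot>\<^bsub>M\<^esub> x)" if xy: "a \<in> carrier R" "x \<in> carrier M" for a x
  proof -
    have "(a \<odot>\<^bsub>M\<^esub> g (q x)) \<ominus>\<^bsub>M\<^esub> (a \<odot>\<^bsub>M\<^esub> x) \<in> U"
      using g[OF xy(2)] xy q_eq U(4) by (simp add: M.smult_minus[symmetric])
    then show ?thesis using g xy by (simp add: N_def q_eq M.smult_closed)
  qed
  have c: "carrier N = q ` carrier M" and z: "\<zero>\<^bsub>N\<^esub> = q \<zero>\<^bsub>M\<^esub>" by (auto simp: N_def)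
  show ?thesis
  proof
    show "left_module R N"
      by (rule left_moduleI)
        (auto simp: c z add smult M.R.ring_axioms M.smult_closed M.smult_l_distr M.smult_r_distr
          M.smult_assoc M.smult_one M.smult_zero_left M.M.a_assoc M.M.a_comm M.M.a_lcomm)
    have "(\<lambda>x\<in>carrier M. q x) \<in> mod_hom R M N"
      by (rule mod_homI) (auto simp: c add smult M.smult_closed)
    then show "q \<in> mod_hom R M N" by (simp add: q_def restrict_def if_distrib cong: if_cong)
    show "q ` carrier M = carrier N" by (simp add: c)
    show "q x = \<zero>\<^bsub>N\<^esub> \<longleftrightarrow> x \<in> U" if "x \<in> carrier M" for x
      using that by (simp add: z q_eq M.M.minus_eq M.R.zero_closed) (metis M.M.add_minus_cancel M.M.minus_eq M.M.r_zero M.M.zero_closed)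
  qed
qed

section \<open>Injective and projective modules\<close>

context fd_algebra
begin

lemma fd_quotient:
  fixes M :: "('a, 'n) module"
  assumes "fd_module K A M" "lsub A M U" "lists (carrier K) \<lesssim> (UNIV :: 't set)"
  obtains N :: "('a, 't) module" and q where
    "fd_module K A N" "q \<in> homA M N" "q ` carrier M = carrier N"
    "\<And>x. x \<in> carrier M \<Longrightarrow> q x = \<zero>\<^bsub>N\<^esub> \<longleftrightarrow> x \<in> U"
proof -
  obtain N :: "('a, 't) module" and q where *: "left_module A N" "q \<in> homA M N"
    "q ` carrier M = carrier N" "\<And>x. x \<in> carrier M \<Longrightarrow> q x = \<zero>\<^bsub>N\<^esub> \<longleftrightarrow> x \<in> U"
    using quotient_module[OF fd_left_module[OF assms(1)] assms(2)
        lepoll_trans[OF fd_module_lepoll[OF assms(1)] assms(3)]] by metis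
  then show thesis using that fd_module_image[OF assms(1) *(1,2,3)] by metis
qed

lemma fd_transport:
  fixes M :: "('a, 'n) module"
  assumes "fd_module K A M" "lists (carrier K) \<lesssim> (UNIV :: 't set)"
  obtains N :: "('a, 't) module" and q where
    "fd_module K A N" "q \<in> homA M N" "bij_betw q (carrier M) (carrier N)"
proof -
  obtain N :: "('a, 't) module" and q where *: "fd_module K A N" "q \<in> homA M N"
    "q ` carrier M = carrier N" "\<And>x. x \<in> carrier M \<Longrightarrow> q x = \<zero>\<^bsub>N\<^esub> \<longleftrightarrow> x \<in> {\<zero>\<^bsub>M\<^esub>}"
    using fd_quotient[OF assms(1) lsub_zero[OF fd_left_module[OF assms(1)]] assms(2)] by metis
  have "inj_on q (carrier M)"
    unfolding mod_hom_inj_iff[OF fd_left_module[OF assms(1)] fd_left_module[OF *(1)] *(2)]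
    using *(4) by simp
  then show thesis using that[OF *(1,2)] *(3) by (simp add: bij_betw_def)
qed

text \<open>A quantifier cannot range over modules of all types, so the extension property is tested
  against finite-dimensional modules with elements of type \<open>'t\<close>. The module
  \<open>I\<close> itself may live on another type.\<close>

definition inj_in :: "'t itself \<Rightarrow> ('a, 'n) module \<Rightarrow> bool" where
  "inj_in _ I \<longleftrightarrow> left_module A I \<and> (\<forall>(N :: ('a, 't) module) U h. fd_module K A N \<longrightarrow> lsub A N U \<longrightarrow>
     h \<in> homA (N\<lparr>carrier := U\<rparr>) I \<longrightarrow> (\<exists>u\<in>homA N I. \<forall>x\<in>U. u x = h x))"

text \<open>\<open>N\<close> is first copied to the type \<open>'t\<close>, where \<open>M\<close>
  is replaced by its image; the kernel condition is exactly what lets \<open>h\<close> descend to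
  that image. Since \<open>j\<close> may have a kernel, the applications can use it without passing
  to a quotient of \<open>M\<close> first.\<close>

lemma inj_inD:
  fixes I :: "('a, 'i) module" and N :: "('a, 'n) module" and M :: "('a, 'p) module"
  assumes "inj_in (T :: 't itself) I" "lists (carrier K) \<lesssim> (UNIV :: 't set)"
    and "left_module A M" "fd_module K A N" "j \<in> homA M N" "h \<in> homA M I"
    and ker: "\<And>x. \<lbrakk>x \<in> carrier M; j x = \<zero>\<^bsub>N\<^esub>\<rbrakk> \<Longrightarrow> h x = \<zero>\<^bsub>I\<^esub>"
  obtains u where "u \<in> homA N I" "\<And>x. x \<in> carrier M \<Longrightarrow> u (j x) = h x"
proof -
  obtain N' :: "('a, 't) module" and q where q: "fd_module K A N'" "q \<in> homA N N'"
    "bij_betw q (carrier N) (carrier N')"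
    using fd_transport[OF assms(4,2)] by metis
  have lm: "left_module A I" "left_module A N" "left_module A N'"
    using assms q by (auto simp: inj_in_def fd_left_module)
  let ?qj = "compose (carrier M) q j"
  have qj: "?qj \<in> homA M N'" by (rule mod_hom_compose[OF assms(5) q(2) assms(3)])
  let ?U = "?qj ` carrier M"
  have U: "lsub A N' ?U" by (rule lsub_image[OF assms(3) lm(3) qj lsub_carrier[OF assms(3)]])
  have qj': "?qj \<in> homA M (N'\<lparr>carrier := ?U\<rparr>)" by (rule mod_hom_restrict_cod[OF qj]) simp
  have ker': "h x = \<zero>\<^bsub>I\<^esub>" if "x \<in> carrier M" "?qj x = \<zero>\<^bsub>N'\<lparr>carrier := ?U\<rparr>\<^esub>" for x
  proof -
    have "q (j x) = \<zero>\<^bsub>N'\<^esub>" using that by (simp add: compose_def)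
    then have "j x = \<zero>\<^bsub>N\<^esub>"
      using mod_hom_inj_iff[OF lm(2,3) q(2)] q(3) mod_hom_closed[OF assms(5) that(1)]
      by (simp add: bij_betw_def)
    then show ?thesis using ker that(1) by simp
  qed
  obtain h' where h': "h' \<in> homA (N'\<lparr>carrier := ?U\<rparr>) I" "\<And>x. x \<in> carrier M \<Longrightarrow> h' (?qj x) = h x"
    using factor_surj[OF assms(3) left_module_lsub[OF lm(3) U] lm(1) qj' _ assms(6) ker'] by auto
  obtain u where u: "u \<in> homA N' I" "\<forall>x\<in>?U. u x = h' x"
    using assms(1) q(1) U h'(1) unfolding inj_in_def by metis
  show thesis
  proof
    show "compose (carrier N) u q \<in> homA N I" by (rule mod_hom_compose[OF q(2) u(1) lm(2)])
    fix x assume x: "x \<in> carrier M"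
    have "u (?qj x) = h x" using u(2) h'(2) x by auto
    then show "compose (carrier N) u q (j x) = h x"
      using x mod_hom_closed[OF assms(5) x] by (simp add: compose_def)
  qed
qed

text \<open>Any type into which the lists over \<open>K\<close> embed gives the same notion
  (\<open>inj_in_imp_inj_mod\<close>); \<open>'k list\<close> is the one that depends on nothing but
  \<open>K\<close>.\<close>

abbreviation "inj_mod \<equiv> inj_in TYPE('k list)"

lemma lists_univ: "lists (carrier K) \<lesssim> (UNIV :: 'k list set)"
  by (rule subset_imp_lepoll) simp

lemmas inj_modD = inj_inD[where T = "TYPE('k list)", OF _ lists_univ]

lemma inj_mod_left_module: "inj_in T M \<Longrightarrow> left_module A M"
  by (simp add: inj_in_def)

lemma inj_in_imp_inj_mod:
  assumes "inj_in (T :: 't itself) I" "lists (carrier K) \<lesssim> (UNIV :: 't set)"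
  shows "inj_in T' I"
  unfolding inj_in_def
proof (intro conjI allI impI)
  fix N U h assume *: "fd_module K A N" "lsub A N U" "h \<in> homA (N\<lparr>carrier := U\<rparr>) I"
  have lm: "left_module A N" "left_module A (N\<lparr>carrier := U\<rparr>)"
    using * fd_left_module left_module_lsub by blast+
  have ker: "h x = \<zero>\<^bsub>I\<^esub>" if "x \<in> U" "x = \<zero>\<^bsub>N\<^esub>" for x
    using mod_hom_zero[OF lm(2) inj_mod_left_module[OF assms(1)] *(3)] that by simp
  then show "\<exists>u\<in>homA N I. \<forall>x\<in>U. u x = h x"
  proof -
    obtain u where "u \<in> homA N I" "\<And>x. x \<in> U \<Longrightarrow> u ((\<lambda>x\<in>U. x) x) = h x"
      using inj_inD[OF assms lm(2) *(1) mod_hom_incl[OF lm(1) *(2)] *(3)] ker by auto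
    then show ?thesis by auto
  qed
qed (rule inj_mod_left_module[OF assms(1)])

lemma inj_mod_retract:
  assumes "inj_in (T :: 't itself) I" "left_module A J" "r \<in> homA I J" "s \<in> homA J I"
    "\<And>x. x \<in> carrier J \<Longrightarrow> r (s x) = x"
  shows "inj_in T J"
  unfolding inj_in_def
proof (intro conjI allI impI)
  fix N :: "('a, 't) module" and U h
  assume *: "fd_module K A N" "lsub A N U" "h \<in> homA (N\<lparr>carrier := U\<rparr>) J"
  have lm: "left_module A N" "left_module A (N\<lparr>carrier := U\<rparr>)"
    using * fd_left_module left_module_lsub by blast+
  have "compose U s h \<in> homA (N\<lparr>carrier := U\<rparr>) I"
    using mod_hom_compose[OF *(3) assms(4) lm(2)] by simp
  then obtain u where u: "u \<in> homA N I" "\<forall>x\<in>U. u x = compose U s h x"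
    using assms(1) *(1,2) unfolding inj_in_def by metis
  have "compose (carrier N) r u x = h x" if "x \<in> U" for x
    using that u(2) lsubD(5)[OF *(2)] assms(5)[OF mod_hom_closed[OF *(3), of x]] by (simp add: compose_def)
  then show "\<exists>u\<in>homA N J. \<forall>x\<in>U. u x = h x"
    using mod_hom_compose[OF u(1) assms(3) lm(1)] by blast
qed fact

lemma inj_mod_prodm:
  assumes "\<And>i. i \<in> I \<Longrightarrow> inj_in (T :: 't itself) (M i)"
  shows "inj_in T (prodm I M)"
  unfolding inj_in_def
proof (intro conjI allI impI)
  have lmM: "left_module A (M i)" if "i \<in> I" for i using assms[OF that] by (rule inj_mod_left_module)
  then show "left_module A (prodm I M)" by (intro left_module_prodm ring_A)
  fix N :: "('a, 't) module" and U h
  assume *: "fd_module K A N" "lsub A N U" "h \<in> homA (N\<lparr>carrier := U\<rparr>) (prodm I M)"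
  have lm: "left_module A N" "left_module A (N\<lparr>carrier := U\<rparr>)"
    using * fd_left_module left_module_lsub by blast+
  have "\<exists>u\<in>homA N (M i). \<forall>x\<in>U. u x = h x i" if i: "i \<in> I" for i
  proof -
    have "compose U (\<lambda>x\<in>carrier (prodm I M). x i) h \<in> homA (N\<lparr>carrier := U\<rparr>) (M i)"
      using mod_hom_compose[OF *(3) prodm_proj[OF ring_A lmM i] lm(2)] by simp
    then have "\<exists>u\<in>homA N (M i). \<forall>x\<in>U. u x = compose U (\<lambda>x\<in>carrier (prodm I M). x i) h x"
      using assms[OF i] *(1,2) unfolding inj_in_def by blast
    then obtain u where "u \<in> homA N (M i)" "\<forall>x\<in>U. u x = compose U (\<lambda>x\<in>carrier (prodm I M). x i) h x"
      by blast
    then show ?thesis using mod_hom_closed[OF *(3)] by (intro bexI[of _ u]) (auto simp: compose_def)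
  qed
  then obtain u where u: "\<And>i. i \<in> I \<Longrightarrow> u i \<in> homA N (M i)" "\<And>i x. \<lbrakk>i \<in> I; x \<in> U\<rbrakk> \<Longrightarrow> u i x = h x i"
    by metis
  have "(\<lambda>x\<in>carrier N. \<lambda>i\<in>I. u i x) \<in> homA N (prodm I M)"
    by (rule tuple_mod_hom[OF lm(1) u(1)])
  moreover have "(\<lambda>x\<in>carrier N. \<lambda>i\<in>I. u i x) x = h x" if x: "x \<in> U" for x
  proof -
    have "h x \<in> extensional I" using mod_hom_closed[OF *(3), of x] x by (simp add: PiE_def)
    then have "(\<lambda>i\<in>I. u i x) = h x"
      by (intro extensionalityI[of _ I]) (simp_all add: u(2)[OF _ x])
    then show ?thesis using lsubD(5)[OF *(2) x] by simp
  qed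
  ultimately show "\<exists>u\<in>homA N (prodm I M). \<forall>x\<in>U. u x = h x" by blast
qed

section \<open>Maps out of free modules of finite rank\<close>

lemma AA_hom:
  assumes "left_module A M" "y \<in> carrier M"
  shows "(\<lambda>a\<in>carrier A. a \<odot>\<^bsub>M\<^esub> y) \<in> homA AA M"
proof -
  interpret M: left_module A M by fact
  have "(\<lambda>a\<in>carrier AA. a \<odot>\<^bsub>M\<^esub> y) \<in> homA AA M"
    by (rule mod_homI) (use assms(2) in \<open>auto simp: M.smult_closed M.smult_l_distr M.smult_assoc\<close>)
  then show ?thesis by simp
qed

lemma AA_hom_apply: "\<lbrakk>h \<in> homA AA M; a \<in> carrier A\<rbrakk> \<Longrightarrow> h a = a \<odot>\<^bsub>M\<^esub> h \<one>\<^sub>A"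
  using mod_hom_smult[of h A AA M a "\<one>\<^sub>A"] by simp

text \<open>Projectivity of a free module of finite rank: choose preimages under \<open>g\<close> of
  the values of \<open>h\<close> at the unit vectors.\<close>

lemma free_lift:
  assumes "finite I" and lm: "left_module A Y" "left_module A Z"
    and *: "g \<in> homA Y Z" "g ` carrier Y = carrier Z" "h \<in> homA (prodm I (\<lambda>_. AA)) Z"
  obtains u where "u \<in> homA (prodm I (\<lambda>_. AA)) Y" "\<And>x. x \<in> carrier (prodm I (\<lambda>_. AA)) \<Longrightarrow> g (u x) = h x"
proof -
  have P: "left_module A (prodm I (\<lambda>_. AA))"
    by (intro left_module_prodm ring_A left_module_AA)
  let ?s = "single I (\<lambda>_. AA)"
  have s: "?s i a \<in> carrier (prodm I (\<lambda>_. AA))" if "a \<in> carrier A" for i a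
    using single_closed[of I A "\<lambda>_. AA" a i] left_module_AA that by simp
  have "\<exists>y\<in>carrier Y. g y = h (?s i \<one>\<^sub>A)" for i
    using *(2) mod_hom_closed[OF *(3) s[of "\<one>\<^sub>A" i]] by (metis A.one_closed imageE)
  then obtain y where y: "\<And>i. y i \<in> carrier Y" "\<And>i. g (y i) = h (?s i \<one>\<^sub>A)" by metis
  let ?f = "\<lambda>i. \<lambda>a\<in>carrier A. a \<odot>\<^bsub>Y\<^esub> y i"
  let ?u = "\<lambda>x\<in>carrier (prodm I (\<lambda>_. AA)). \<Oplus>\<^bsub>Y\<^esub>i\<in>I. ?f i (x i)"
  have f: "?f i \<in> homA AA Y" for i by (rule AA_hom[OF lm(1) y(1)])
  have u: "?u \<in> homA (prodm I (\<lambda>_. AA)) Y"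
    by (rule copair_mod_hom[OF ring_A assms(1) left_module_AA lm(1) f])
  have "g (?u x) = h x" if x: "x \<in> carrier (prodm I (\<lambda>_. AA))" for x
  proof -
    have xi: "x i \<in> carrier A" if "i \<in> I" for i using prodm_mem[OF x that] by simp
    interpret Z: left_module A Z by fact
    have "g (?u x) = g (\<Oplus>\<^bsub>Y\<^esub>i\<in>I. ?f i (x i))" using x by simp
    also have "\<dots> = (\<Oplus>\<^bsub>Z\<^esub>i\<in>I. g (?f i (x i)))"
      using mod_hom_closed[OF f] xi by (intro mod_hom_finsum[OF lm *(1) assms(1)]) auto
    also have "\<dots> = (\<Oplus>\<^bsub>Z\<^esub>i\<in>I. h (?s i (x i)))"
    proof (intro Z.M.finsum_cong' refl)
      show "(\<lambda>i. h (?s i (x i))) \<in> I \<rightarrow> carrier Z" using s xi mod_hom_closed[OF *(3)] by blast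
      fix i assume i: "i \<in> I"
      have "?s i (x i) = x i \<odot>\<^bsub>prodm I (\<lambda>_. AA)\<^esub> ?s i \<one>\<^sub>A"
        using xi[OF i] by (auto simp: single_def fun_eq_iff)
      then have "h (?s i (x i)) = x i \<odot>\<^bsub>Z\<^esub> h (?s i \<one>\<^sub>A)"
        using mod_hom_smult[OF *(3) xi[OF i] s[OF A.one_closed]] by simp
      then show "g (?f i (x i)) = h (?s i (x i))"
        using xi[OF i] y mod_hom_smult[OF *(1) xi[OF i] y(1)] by simp
    qed
    also have "\<dots> = h (\<Oplus>\<^bsub>prodm I (\<lambda>_. AA)\<^esub>i\<in>I. ?s i (x i))"
      using s xi by (intro mod_hom_finsum[symmetric, OF P lm(2) *(3) assms(1)]) auto
    also have "\<dots> = h x" by (simp only: prodm_decomp[OF ring_A assms(1) left_module_AA x])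
    finally show ?thesis .
  qed
  then show thesis by (rule that[OF u])
qed

text \<open>Vectors that span \<open>M\<close> over \<open>K\<close> generate it over
  \<open>A\<close>. They index the free module, and its unit vectors are sent to them.\<close>

lemma free_cover:
  fixes M :: "('a, 'm) module"
  assumes "fd_module K A M"
  obtains B :: "'m set" and p where "finite B" "p \<in> homA (prodm B (\<lambda>_. AA)) M"
    "p ` carrier (prodm B (\<lambda>_. AA)) = carrier M"
proof -
  have lm: "left_module A M" using assms by (rule fd_left_module)
  interpret M: left_module A M by fact
  obtain B where B: "finite B" "B \<subseteq> carrier M" "\<And>W. \<lbrakk>lsub K (und M) W; B \<subseteq> W\<rbrakk> \<Longrightarrow> W = carrier M"
    using assms by (auto simp: fd_module_iff fg_def)
  let ?F = "prodm B (\<lambda>_. AA)"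
  have F: "left_module A ?F" by (intro left_module_prodm ring_A left_module_AA)
  let ?f = "\<lambda>b. \<lambda>a\<in>carrier A. a \<odot>\<^bsub>M\<^esub> b"
  let ?p = "\<lambda>x\<in>carrier ?F. \<Oplus>\<^bsub>M\<^esub>b\<in>B. ?f b (x b)"
  have f: "?f b \<in> homA AA M" if "b \<in> B" for b using AA_hom[OF lm] B(2) that by blast
  have p: "?p \<in> homA ?F M"
    by (rule copair_mod_hom[OF ring_A B(1) left_module_AA lm f])
  have "b \<in> ?p ` carrier ?F" if b: "b \<in> B" for b
  proof
    have s: "single B (\<lambda>_. AA) b \<one>\<^sub>A \<in> carrier ?F"
      using single_closed[of B A "\<lambda>_. AA" "\<one>\<^sub>A" b] left_module_AA by simp
    have "(\<Oplus>\<^bsub>M\<^esub>i\<in>B. ?f i (single B (\<lambda>_. AA) b \<one>\<^sub>A i)) = ?f b \<one>\<^sub>A"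
      by (rule finsum_single[OF B(1) left_module_AA lm f b]) simp_all
    then show "b = ?p (single B (\<lambda>_. AA) b \<one>\<^sub>A)"
      using s b B(2) by (simp add: M.smult_one subset_iff)
    show "single B (\<lambda>_. AA) b \<one>\<^sub>A \<in> carrier ?F" by (rule s)
  qed
  then have "B \<subseteq> ?p ` carrier ?F" by (rule subsetI)
  then have "?p ` carrier ?F = carrier M"
    by (rule B(3)[OF lsub_und[OF lsub_image[OF F lm p lsub_carrier[OF F]]]])
  then show thesis by (rule that[OF B(1) p])
qed

section \<open>Self-injective algebras\<close>

abbreviation left_ideal :: "'a set \<Rightarrow> bool" where "left_ideal \<equiv> lsub A AA"

lemma left_idealD:
  assumes "left_ideal I"
  shows "I \<subseteq> carrier A" "\<zero>\<^sub>A \<in> I" "\<lbrakk>x \<in> I; y \<in> I\<rbrakk> \<Longrightarrow> x \<oplus>\<^sub>A y \<in> I" "\<lbrakk>a \<in> carrier A; x \<in> I\<rbrakk> \<Longrightarrow> a \<otimes>\<^sub>A x \<in> I"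
    "x \<in> I \<Longrightarrow> x \<in> carrier A"
  using lsubD[OF assms] by auto

lemma left_idealI:
  assumes "\<And>x. x \<in> I \<Longrightarrow> x \<in> carrier A" "\<zero>\<^sub>A \<in> I" "\<And>x y. \<lbrakk>x \<in> I; y \<in> I\<rbrakk> \<Longrightarrow> x \<oplus>\<^sub>A y \<in> I"
    "\<And>a x. \<lbrakk>a \<in> carrier A; x \<in> I\<rbrakk> \<Longrightarrow> a \<otimes>\<^sub>A x \<in> I"
  shows "left_ideal I"
  using assms by (simp add: lsub_def subset_iff)

lemma left_ideal_minus:
  assumes "left_ideal I" "x \<in> I" "y \<in> I"
  shows "x \<ominus>\<^bsub>A\<^esub> y \<in> I"
proof -
  have "\<ominus>\<^bsub>A\<^esub> \<one>\<^sub>A \<otimes>\<^sub>A y \<in> I" using left_idealD(4)[OF assms(1) _ assms(3)] by simp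
  then show ?thesis
    using left_idealD[OF assms(1)] assms(2,3) by (simp add: A.minus_eq A.l_minus)
qed

section \<open>Maximal left ideals and isomorphism classes of simple modules\<close>

definition max_ideal :: "'a set \<Rightarrow> bool" where
  "max_ideal M \<longleftrightarrow> left_ideal M \<and> M \<noteq> carrier A \<and> (\<forall>N. left_ideal N \<and> M \<subseteq> N \<longrightarrow> N = M \<or> N = carrier A)"

lemma max_idealD:
  "\<lbrakk>max_ideal M; left_ideal N; M \<subseteq> N; x \<in> N; x \<notin> M\<rbrakk> \<Longrightarrow> N = carrier A"
  by (auto simp: max_ideal_def)

lemma left_ideal_one: "left_ideal I \<Longrightarrow> \<one>\<^sub>A \<in> I \<Longrightarrow> I = carrier A"
  using left_idealD[of I] by (metis A.r_one subset_antisym subsetI)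

lemma max_ideal_one: "max_ideal M \<Longrightarrow> \<one>\<^sub>A \<notin> M"
  using left_ideal_one by (auto simp: max_ideal_def)

text \<open>The set is the sum of \<open>N\<close> and the principal left ideal generated by
  \<open>x\<close>.\<close>

lemma left_ideal_sum_principal:
  assumes "left_ideal N" "x \<in> carrier A"
  shows "left_ideal {y \<in> carrier A. \<exists>b\<in>carrier A. y \<ominus>\<^bsub>A\<^esub> b \<otimes>\<^sub>A x \<in> N}" (is "left_ideal ?S")
  unfolding lsub_def
proof (intro conjI ballI)
  note N = left_idealD[OF assms(1)]
  show "\<zero>\<^bsub>AA\<^esub> \<in> ?S" using N(2) assms(2) by (auto simp: A.minus_eq intro!: bexI[of _ "\<zero>\<^sub>A"])
  show "?S \<subseteq> carrier AA" by auto
  {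
    fix y z assume "y \<in> ?S" "z \<in> ?S"
    then obtain b c where *: "y \<in> carrier A" "b \<in> carrier A" "y \<ominus>\<^bsub>A\<^esub> b \<otimes>\<^sub>A x \<in> N"
      "z \<in> carrier A" "c \<in> carrier A" "z \<ominus>\<^bsub>A\<^esub> c \<otimes>\<^sub>A x \<in> N" by blast
    then have "(y \<oplus>\<^sub>A z) \<ominus>\<^bsub>A\<^esub> (b \<oplus>\<^sub>A c) \<otimes>\<^sub>A x = (y \<ominus>\<^bsub>A\<^esub> b \<otimes>\<^sub>A x) \<oplus>\<^sub>A (z \<ominus>\<^bsub>A\<^esub> c \<otimes>\<^sub>A x)"
      using assms(2) by (simp add: A.l_distr A.add_minus_add)
    also have "\<dots> \<in> N" using N(3) * by blast
    finally show "y \<oplus>\<^bsub>AA\<^esub> z \<in> ?S" using * by auto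
  }
  {
    fix a y assume a: "a \<in> carrier A" "y \<in> ?S"
    then obtain b where *: "y \<in> carrier A" "b \<in> carrier A" "y \<ominus>\<^bsub>A\<^esub> b \<otimes>\<^sub>A x \<in> N" by blast
    then have "a \<otimes>\<^sub>A y \<ominus>\<^bsub>A\<^esub> (a \<otimes>\<^sub>A b) \<otimes>\<^sub>A x = a \<otimes>\<^sub>A (y \<ominus>\<^bsub>A\<^esub> b \<otimes>\<^sub>A x)"
      using assms(2) a by (simp add: A.r_distr A.minus_eq A.r_minus A.m_assoc)
    also have "\<dots> \<in> N" using N(4) * a by blast
    finally show "a \<odot>\<^bsub>AA\<^esub> y \<in> ?S" using * a by auto
  }
qed

text \<open>By maximality \<open>N\<close> and \<open>x\<close> together generate \<open>A\<close>.
  In terms of the simple module \<open>A/N\<close>: every nonzero element generates it.\<close>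

lemma max_ideal_complement:
  assumes "max_ideal N" "x \<in> carrier A" "x \<notin> N" "y \<in> carrier A"
  obtains b where "b \<in> carrier A" "y \<ominus>\<^bsub>A\<^esub> b \<otimes>\<^sub>A x \<in> N"
proof -
  let ?S = "{y \<in> carrier A. \<exists>b\<in>carrier A. y \<ominus>\<^bsub>A\<^esub> b \<otimes>\<^sub>A x \<in> N}"
  have N: "left_ideal N" using assms(1) by (simp add: max_ideal_def)
  note Nd = left_idealD[OF N]
  have "N \<subseteq> ?S"
  proof
    fix y assume "y \<in> N"
    then have "y \<ominus>\<^bsub>A\<^esub> \<zero>\<^sub>A \<otimes>\<^sub>A x \<in> N" using Nd(5) assms(2) by (simp add: A.minus_eq)
    then show "y \<in> ?S" using Nd(5) \<open>y \<in> N\<close> by blast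
  qed
  moreover have "x \<in> ?S"
  proof -
    have "x \<ominus>\<^bsub>A\<^esub> \<one>\<^sub>A \<otimes>\<^sub>A x \<in> N" using Nd(2) assms(2) by (simp add: A.minus_self)
    then show ?thesis using assms(2) by blast
  qed
  ultimately have "?S = carrier A"
    by (rule max_idealD[OF assms(1) left_ideal_sum_principal[OF N assms(2)] _ _ assms(3)])
  then have "y \<in> ?S" using assms(4) by simp
  then show thesis using that by auto
qed

text \<open>The annihilator of the class of \<open>c\<close> in \<open>A/N\<close>; the quotient of
  \<open>A\<close> by it is the submodule of \<open>A/N\<close> generated by that class.\<close>

definition colon :: "'a set \<Rightarrow> 'a \<Rightarrow> 'a set" where
  "colon N c = {a \<in> carrier A. a \<otimes>\<^sub>A c \<in> N}"

lemma colon_left_ideal: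
  assumes "left_ideal N" "c \<in> carrier A"
  shows "left_ideal (colon N c)"
  by (rule left_idealI)
    (use assms(2) left_idealD(2-4)[OF assms(1)] in \<open>auto simp: colon_def A.l_distr A.m_assoc\<close>)

text \<open>The class of \<open>c\<close> is nonzero, hence generates the simple module
  \<open>A/N\<close>; the quotient of \<open>A\<close> by its annihilator is therefore this simple
  module again.\<close>

lemma colon_max_ideal:
  assumes "max_ideal N" "c \<in> carrier A" "c \<notin> N"
  shows "max_ideal (colon N c)"
  unfolding max_ideal_def
proof (intro conjI allI impI)
  have N: "left_ideal N" using assms(1) by (simp add: max_ideal_def)
  show "left_ideal (colon N c)" using N assms(2) by (rule colon_left_ideal)
  show "colon N c \<noteq> carrier A"
  proof
    assume "colon N c = carrier A"
    then have "\<one>\<^sub>A \<in> colon N c" by simp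
    then show False using assms(2,3) by (simp add: colon_def)
  qed
  fix L assume L: "left_ideal L \<and> colon N c \<subseteq> L"
  show "L = colon N c \<or> L = carrier A"
  proof (cases "L \<subseteq> colon N c")
    case False
    then obtain a where a: "a \<in> L" "a \<notin> colon N c" by blast
    have aA: "a \<in> carrier A" using a(1) L left_idealD(5) by blast
    have "a \<otimes>\<^sub>A c \<notin> N" "a \<otimes>\<^sub>A c \<in> carrier A" using a aA assms(2) by (auto simp: colon_def)
    \<comment> \<open>The class of a c generates \<open>A/N\<close>, so b a c is congruent to c for
      some b. Then 1 - b a annihilates the class of c and lies in \<open>L\<close>, and so does b
      a.\<close>
    then obtain b where b: "b \<in> carrier A" "c \<ominus>\<^bsub>A\<^esub> b \<otimes>\<^sub>A (a \<otimes>\<^sub>A c) \<in> N"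
      by (metis max_ideal_complement[OF assms(1) _ _ assms(2)])
    have "(\<one>\<^sub>A \<ominus>\<^bsub>A\<^esub> b \<otimes>\<^sub>A a) \<otimes>\<^sub>A c = c \<ominus>\<^bsub>A\<^esub> b \<otimes>\<^sub>A (a \<otimes>\<^sub>A c)"
      using b(1) aA assms(2) by (simp add: A.l_distr A.minus_eq A.l_minus A.m_assoc)
    then have "\<one>\<^sub>A \<ominus>\<^bsub>A\<^esub> b \<otimes>\<^sub>A a \<in> L" using b aA L by (auto simp: colon_def)
    moreover have "b \<otimes>\<^sub>A a \<in> L" using L a(1) b(1) left_idealD(4) by blast
    ultimately have "(\<one>\<^sub>A \<ominus>\<^bsub>A\<^esub> b \<otimes>\<^sub>A a) \<oplus>\<^sub>A b \<otimes>\<^sub>A a \<in> L" using L left_idealD(3) by blast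
    then have "\<one>\<^sub>A \<in> L" using b aA by (simp add: A.minus_add_cancel)
    then show ?thesis using L left_ideal_one by blast
  qed (use L in blast)
qed

text \<open>\<open>meqv M N\<close> says that the simple modules \<open>A/M\<close> and \<open>A/N\<close> are isomorphic: \<open>c\<close> is the image of \<open>1\<close>.\<close>

definition meqv :: "'a set \<Rightarrow> 'a set \<Rightarrow> bool" where
  "meqv M N \<longleftrightarrow> (\<exists>c\<in>carrier A. c \<notin> N \<and> M = colon N c)"

text \<open>The inverse isomorphism sends 1 to the class of an element d with d c congruent to 1
  modulo \<open>N\<close>. Right multiplication by d c induces the identity on \<open>A/N\<close>,
  and this gives \<open>key\<close>.\<close>

lemma meqv_sym:
  assumes "max_ideal N" "meqv M N"
  shows "meqv N M"
proof -
  obtain c where c: "c \<in> carrier A" "c \<notin> N" "M = colon N c" using assms(2) by (auto simp: meqv_def)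
  have N: "left_ideal N" using assms(1) by (simp add: max_ideal_def)
  obtain d where d: "d \<in> carrier A" "\<one>\<^sub>A \<ominus>\<^bsub>A\<^esub> d \<otimes>\<^sub>A c \<in> N"
    using max_ideal_complement[OF assms(1) c(1,2) A.one_closed] by metis
  have key: "a \<otimes>\<^sub>A (d \<otimes>\<^sub>A c) \<in> N \<longleftrightarrow> a \<in> N" if a: "a \<in> carrier A" for a
  proof -
    have e: "a \<otimes>\<^sub>A (\<one>\<^sub>A \<ominus>\<^bsub>A\<^esub> d \<otimes>\<^sub>A c) = a \<ominus>\<^bsub>A\<^esub> a \<otimes>\<^sub>A (d \<otimes>\<^sub>A c)"
      using a c d by (simp add: A.r_distr A.minus_eq A.r_minus)
    then have in_N: "a \<ominus>\<^bsub>A\<^esub> a \<otimes>\<^sub>A (d \<otimes>\<^sub>A c) \<in> N" using left_idealD(4)[OF N a d(2)] by simp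
    let ?z = "a \<otimes>\<^sub>A (d \<otimes>\<^sub>A c)"
    have z: "?z \<in> carrier A" using a c d by simp
    show ?thesis
    proof
      assume "?z \<in> N"
      then have "(a \<ominus>\<^bsub>A\<^esub> ?z) \<oplus>\<^sub>A ?z \<in> N" using in_N left_idealD(3)[OF N] by blast
      then show "a \<in> N" using a z by (simp add: A.minus_add_cancel)
    next
      assume "a \<in> N"
      then have "a \<ominus>\<^bsub>A\<^esub> (a \<ominus>\<^bsub>A\<^esub> ?z) \<in> N" using in_N left_ideal_minus[OF N] by blast
      moreover have "a \<ominus>\<^bsub>A\<^esub> (a \<ominus>\<^bsub>A\<^esub> ?z) = ?z" using a z by (simp add: A.minus_eq A.minus_add A.r_neg2)
      ultimately show "?z \<in> N" by simp
    qed
  qed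
  have "d \<notin> M" using key[of "\<one>\<^sub>A"] max_ideal_one[OF assms(1)] c d by (simp add: colon_def)
  moreover have "N = colon M d"
    using c d key left_idealD(1)[OF N] by (auto simp: colon_def A.m_assoc)
  ultimately show ?thesis using d(1) by (auto simp: meqv_def)
qed

text \<open>Composition of the two isomorphisms sends 1 to the class of c e.\<close>

lemma meqv_trans:
  assumes "meqv M N" "meqv N L"
  shows "meqv M L"
proof -
  obtain c where c: "c \<in> carrier A" "c \<notin> N" "M = colon N c" using assms(1) by (auto simp: meqv_def)
  obtain e where e: "e \<in> carrier A" "e \<notin> L" "N = colon L e" using assms(2) by (auto simp: meqv_def)
  have "c \<otimes>\<^sub>A e \<notin> L" using c e by (simp add: colon_def)
  moreover have "M = colon L (c \<otimes>\<^sub>A e)" using c e by (auto simp: colon_def A.m_assoc)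
  ultimately show ?thesis unfolding meqv_def using c(1) e(1) A.m_closed by blast
qed

lemma left_ideal_measure:
  obtains d :: "'a set \<Rightarrow> nat" where "\<And>W W'. \<lbrakk>left_ideal W; left_ideal W'; W \<subset> W'\<rbrakk> \<Longrightarrow> d W < d W'"
  using submodule_measure[OF fd_module_AA] by blast

lemma left_ideal_carrier: "left_ideal (carrier A)"
  using lsub_carrier[OF left_module_AA] by simp

text \<open>Among the proper left ideals above \<open>I\<close>, one of largest measure is maximal;
  the measure takes the place of Zorn's lemma.\<close>

lemma max_ideal_exists:
  assumes "left_ideal I" "\<one>\<^sub>A \<notin> I"
  obtains M where "max_ideal M" "I \<subseteq> M"
proof -
  obtain d :: "'a set \<Rightarrow> nat" where d: "\<And>W W'. \<lbrakk>left_ideal W; left_ideal W'; W \<subset> W'\<rbrakk> \<Longrightarrow> d W < d W'"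
    by (rule left_ideal_measure) blast
  let ?P = "\<lambda>M. left_ideal M \<and> I \<subseteq> M \<and> \<one>\<^sub>A \<notin> M"
  have "d M < Suc (d (carrier A))" if "?P M" for M
  proof -
    have "M \<subset> carrier A" using that left_idealD(1)[of M] A.one_closed by blast
    then show ?thesis using d[OF _ left_ideal_carrier] that by force
  qed
  then obtain M where M: "?P M" "\<And>N. ?P N \<Longrightarrow> d N \<le> d M"
    using ex_has_greatest_nat[of ?P I d "Suc (d (carrier A))"] assms by auto
  have "max_ideal M"
    unfolding max_ideal_def
  proof (intro conjI allI impI)
    show "left_ideal M" using M by simp
    show "M \<noteq> carrier A" using M by auto
    fix N assume N: "left_ideal N \<and> M \<subseteq> N"
    show "N = M \<or> N = carrier A"
    proof (rule ccontr)
      assume *: "\<not> (N = M \<or> N = carrier A)"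
      then have "M \<subset> N" using N by blast
      then have "d M < d N" using d M(1) N by blast
      moreover have "?P N" using N * M(1) left_ideal_one[of N] by blast
      ultimately show False using M(2)[of N] by simp
    qed
  qed
  then show thesis using that M(1) by blast
qed

text \<open>Taken relative to \<open>carrier A\<close>, so that the empty family has meet
  \<open>A\<close>; this is the base case of \<open>max_ideal_over_meet\<close>.\<close>

definition meet :: "'a set set \<Rightarrow> 'a set" where
  "meet F = {a \<in> carrier A. \<forall>M\<in>F. a \<in> M}"

lemma meet_left_ideal:
  assumes "\<And>M. M \<in> F \<Longrightarrow> left_ideal M"
  shows "left_ideal (meet F)"
  by (rule left_idealI) (use left_idealD(2-4)[OF assms] in \<open>auto simp: meet_def\<close>)

text \<open>A simple quotient of \<open>A/meet F\<close> must be one of the composition factors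
  \<open>A/M\<close>. Elementwise: if c lies in \<open>meet F\<close> but not in \<open>N\<close>,
  then a c in \<open>M\<close> forces a c in \<open>N\<close>, so the maximal left ideals
  \<open>colon M c\<close> and \<open>colon N c\<close> coincide, and they are equivalent to
  \<open>M\<close> and to \<open>N\<close>.\<close>

lemma max_ideal_over_meet:
  assumes "finite F" "\<And>M. M \<in> F \<Longrightarrow> max_ideal M" "max_ideal N" "meet F \<subseteq> N"
  shows "\<exists>M\<in>F. meqv M N"
  using assms(1,2,4)
proof (induction F)
  case empty
  then show ?case using max_ideal_one[OF assms(3)] A.one_closed by (auto simp: meet_def)
next
  case (insert M F)
  show ?case
  proof (cases "meet F \<subseteq> N")
    case True
    then show ?thesis using insert by auto
  next
    case False
    then obtain c where c: "c \<in> meet F" "c \<notin> N" by blast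
    have cA: "c \<in> carrier A" using c by (simp add: meet_def)
    have M: "max_ideal M" using insert.prems by simp
    have F: "left_ideal (meet F)" using insert.prems by (intro meet_left_ideal) (auto simp: max_ideal_def)
    have cM: "c \<notin> M" using c insert.prems(2) by (auto simp: meet_def)
    have "colon M c \<subseteq> colon N c"
    proof
      fix a assume "a \<in> colon M c"
      then have a: "a \<in> carrier A" "a \<otimes>\<^sub>A c \<in> M" by (auto simp: colon_def)
      have "a \<otimes>\<^sub>A c \<in> meet F" using left_idealD(4)[OF F a(1) c(1)] .
      then have "a \<otimes>\<^sub>A c \<in> meet (insert M F)" using a by (simp add: meet_def)
      then show "a \<in> colon N c" using insert.prems(2) a by (auto simp: colon_def)
    qed
    moreover have "max_ideal (colon N c)" "max_ideal (colon M c)"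
      using colon_max_ideal assms(3) M cA c(2) cM by blast+
    ultimately have eq: "colon N c = colon M c" unfolding max_ideal_def by auto
    have "meqv (colon M c) M" "meqv (colon M c) N"
      using cA c(2) cM eq by (auto simp: meqv_def)
    then have "meqv M N" using meqv_sym[OF M] meqv_trans by blast
    then show ?thesis by blast
  qed
qed

text \<open>A finite family of maximal left ideals whose meet has least measure has its meet inside
  every maximal left ideal (the meet is the Jacobson radical), so \<open>max_ideal_over_meet\<close>
  applies to each of them.\<close>

lemma finite_simples:
  obtains F where "finite F" "\<And>M. M \<in> F \<Longrightarrow> max_ideal M" "\<And>N. max_ideal N \<Longrightarrow> \<exists>M\<in>F. meqv M N"
proof -
  obtain d :: "'a set \<Rightarrow> nat" where d: "\<And>W W'. \<lbrakk>left_ideal W; left_ideal W'; W \<subset> W'\<rbrakk> \<Longrightarrow> d W < d W'"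
    by (rule left_ideal_measure) blast
  let ?P = "\<lambda>F. finite F \<and> (\<forall>M\<in>F. max_ideal M)"
  have li: "left_ideal (meet F)" if "?P F" for F
    using that by (intro meet_left_ideal) (auto simp: max_ideal_def)
  obtain F where F: "?P F" "\<And>G. ?P G \<Longrightarrow> d (meet F) \<le> d (meet G)"
    using ex_has_least_nat[of ?P "{}" "\<lambda>F. d (meet F)"] by auto
  have "\<exists>M\<in>F. meqv M N" if N: "max_ideal N" for N
  proof -
    have "meet F \<subseteq> N"
    proof (rule ccontr)
      assume "\<not> meet F \<subseteq> N"
      then have "meet (insert N F) \<subset> meet F" by (auto simp: meet_def)
      then have "d (meet (insert N F)) < d (meet F)" using d li F(1) N by simp
      then show False using F(2)[of "insert N F"] F(1) N by simp
    qed
    then show ?thesis using max_ideal_over_meet[of F N] F(1) N by blast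
  qed
  then show thesis using that F(1) by blast
qed

text \<open>The annihilator of the simple module \<open>A/M\<close>.\<close>

definition core :: "'a set \<Rightarrow> 'a set" where
  "core M = {a \<in> carrier A. \<forall>b\<in>carrier A. a \<otimes>\<^sub>A b \<in> M}"

lemma core_left_ideal:
  assumes "left_ideal M"
  shows "left_ideal (core M)"
  by (rule left_idealI)
    (use left_idealD(2-4)[OF assms] in \<open>auto simp: core_def A.l_distr A.m_assoc\<close>)

lemma core_right: "\<lbrakk>a \<in> core M; b \<in> carrier A\<rbrakk> \<Longrightarrow> a \<otimes>\<^sub>A b \<in> core M"
  by (auto simp: core_def A.m_assoc)

lemma core_subset: "core M \<subseteq> M"
proof
  fix a assume "a \<in> core M"
  then have "a \<in> carrier A" "a \<otimes>\<^sub>A \<one>\<^sub>A \<in> M" unfolding core_def by blast+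
  then show "a \<in> M" by simp
qed

text \<open>\<open>core M\<close> is the intersection of the left ideals \<open>colon M b\<close>,
  and finitely many b outside \<open>M\<close> suffice. Each of these left ideals is equivalent to
  \<open>M\<close>, so a maximal left ideal above their meet is too: a simple module is determined
  by its annihilator.\<close>

lemma max_ideal_over_core:
  assumes "max_ideal M" "max_ideal N" "core M \<subseteq> N"
  shows "meqv M N"
proof -
  obtain d :: "'a set \<Rightarrow> nat" where d: "\<And>W W'. \<lbrakk>left_ideal W; left_ideal W'; W \<subset> W'\<rbrakk> \<Longrightarrow> d W < d W'"
    by (rule left_ideal_measure) blast
  have M: "left_ideal M" using assms(1) by (simp add: max_ideal_def)
  let ?P = "\<lambda>B. finite B \<and> B \<subseteq> carrier A - M"
  let ?f = "\<lambda>B. meet (colon M ` B)"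
  have mx: "max_ideal (colon M b)" if "?P B" "b \<in> B" for B b
    using that colon_max_ideal[OF assms(1)] by blast
  have li: "left_ideal (?f B)" if "?P B" for B
    using mx[OF that] by (intro meet_left_ideal) (auto simp: max_ideal_def)
  obtain B where B: "?P B" "\<And>C. ?P C \<Longrightarrow> d (?f B) \<le> d (?f C)"
    using ex_has_least_nat[of ?P "{}" "\<lambda>B. d (?f B)"] by auto
  have "?f B \<subseteq> core M"
  proof
    fix a assume a: "a \<in> ?f B"
    then have aA: "a \<in> carrier A" by (simp add: meet_def)
    have "a \<otimes>\<^sub>A b \<in> M" if b: "b \<in> carrier A" for b
    proof (cases "b \<in> M")
      case True then show ?thesis using left_idealD(4)[OF M aA] by blast
    next
      case False
      then have C: "?P (insert b B)" using B(1) b by blast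
      \<comment> \<open>\<open>B\<close> was chosen with meet of least measure, so one more element
        cannot shrink the meet.\<close>
      have "\<not> ?f (insert b B) \<subset> ?f B"
        using B(2)[OF C] d[OF li[OF C] li[OF B(1)]] by linarith
      then have "a \<in> ?f (insert b B)" using a by (auto simp: meet_def)
      then show ?thesis by (auto simp: meet_def colon_def)
    qed
    then show "a \<in> core M" using aA by (simp add: core_def)
  qed
  then have "\<exists>L\<in>colon M ` B. meqv L N"
    using B(1) mx[OF B(1)] assms(2,3) by (intro max_ideal_over_meet) auto
  then obtain b where b: "b \<in> B" "meqv (colon M b) N" by blast
  have "meqv (colon M b) M" using B(1) b(1) by (auto simp: meqv_def)
  then show ?thesis using b(2) meqv_sym[OF assms(1)] meqv_trans by blast
qed

section \<open>Simple left ideals of a self-injective algebra\<close>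

definition lann :: "'a \<Rightarrow> 'a set" where
  "lann x = {a \<in> carrier A. a \<otimes>\<^sub>A x = \<zero>\<^sub>A}"

lemma lann_left_ideal: "x \<in> carrier A \<Longrightarrow> left_ideal (lann x)"
  by (rule left_idealI) (auto simp: lann_def A.l_distr A.m_assoc)

text \<open>If only 0 killed \<open>core M\<close> from the left, sending x to the family of all x
  a, with a in a finite subset of \<open>core M\<close>, would embed \<open>A\<close> into a power
  of \<open>A\<close>. By injectivity this embedding splits, and the splitting writes 1 as a sum of
  terms a u(e_a), with e_a the unit vectors. These lie in \<open>core M\<close>, which is closed
  under right multiplication, so 1 would lie in \<open>M\<close>.\<close>

lemma lann_core_nonzero:
  assumes "inj_mod AA" "max_ideal M"
  obtains x where "x \<in> carrier A" "x \<noteq> \<zero>\<^sub>A" "\<And>a. a \<in> core M \<Longrightarrow> x \<otimes>\<^sub>A a = \<zero>\<^sub>A"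
proof -
  obtain d :: "'a set \<Rightarrow> nat" where d: "\<And>W W'. \<lbrakk>left_ideal W; left_ideal W'; W \<subset> W'\<rbrakk> \<Longrightarrow> d W < d W'"
    by (rule left_ideal_measure) blast
  have M: "left_ideal M" using assms(2) by (simp add: max_ideal_def)
  note cM = left_idealD[OF core_left_ideal[OF M]]
  let ?l = "\<lambda>X. {x \<in> carrier A. \<forall>a\<in>X. x \<otimes>\<^sub>A a = \<zero>\<^sub>A}"
  let ?P = "\<lambda>X. finite X \<and> X \<subseteq> core M"
  have li: "left_ideal (?l X)" if "?P X" for X
    by (rule left_idealI) (use that cM(5) in \<open>auto simp: A.l_distr A.m_assoc subset_iff\<close>)
  \<comment> \<open>A finite subset of \<open>core M\<close> with left annihilator of least measure
    already has the left annihilator of all of \<open>core M\<close>; this is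
    \<open>kill\<close>.\<close>
  obtain X where X: "?P X" "\<And>Y. ?P Y \<Longrightarrow> d (?l X) \<le> d (?l Y)"
    using ex_has_least_nat[of ?P "{}" "\<lambda>X. d (?l X)"] by auto
  have XA: "a \<in> carrier A" if "a \<in> X" for a using that X(1) cM(5) by blast
  have kill: "x \<otimes>\<^sub>A a = \<zero>\<^sub>A" if x: "x \<in> ?l X" and a: "a \<in> core M" for x a
  proof -
    have C: "?P (insert a X)" using X(1) a by blast
    have "\<not> ?l (insert a X) \<subset> ?l X"
      using X(2)[OF C] d[OF li[OF C] li[OF X(1)]] by linarith
    then have "x \<in> ?l (insert a X)" using x by blast
    then show ?thesis by blast
  qed
  have "\<exists>x\<in>?l X. x \<noteq> \<zero>\<^sub>A"
  proof (rule ccontr)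
    assume nz: "\<not> (\<exists>x\<in>?l X. x \<noteq> \<zero>\<^sub>A)"
    let ?F = "prodm X (\<lambda>_. AA)"
    have F: "fd_module K A ?F" using X(1) fd_module_AA by (intro fd_module_prodm) auto
    let ?j = "\<lambda>x\<in>carrier AA. \<lambda>a\<in>X. (\<lambda>x\<in>carrier A. x \<otimes>\<^sub>A a) x"
    have "(\<lambda>x\<in>carrier A. x \<otimes>\<^sub>A a) \<in> homA AA AA" if "a \<in> X" for a
      using AA_hom[OF left_module_AA, of a] XA[OF that] by simp
    then have j: "?j \<in> homA AA ?F" by (rule tuple_mod_hom[OF left_module_AA])
    have j0: "restrict (\<lambda>x. x) (carrier AA) x = \<zero>\<^bsub>AA\<^esub>" if x: "x \<in> carrier AA" "?j x = \<zero>\<^bsub>?F\<^esub>" for x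
    proof -
      have "x \<otimes>\<^sub>A a = \<zero>\<^sub>A" if "a \<in> X" for a using fun_cong[OF x(2), of a] that x(1) by simp
      then show ?thesis using nz x(1) by auto
    qed
    obtain u where u: "u \<in> homA ?F AA" "\<And>x. x \<in> carrier AA \<Longrightarrow> u (?j x) = restrict (\<lambda>x. x) (carrier AA) x"
      using inj_modD[OF assms(1) left_module_AA F j mod_hom_id[OF left_module_AA] j0] by metis
    let ?s = "single X (\<lambda>_. AA)"
    have s: "?s i a \<in> carrier ?F" if "a \<in> carrier A" for i a
      using single_closed[of X A "\<lambda>_. AA" a i] left_module_AA that by simp
    have FX: "finite X" using X(1) by simp
    let ?v = "\<lambda>a\<in>X. a"
    have v: "?v \<in> carrier ?F" using XA by auto
    have "\<one>\<^sub>A = u (?j \<one>\<^sub>A)" using u(2) by simp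
    also have "?j \<one>\<^sub>A = ?v" using XA by (auto simp: fun_eq_iff)
    also have "u ?v = u (\<Oplus>\<^bsub>?F\<^esub>a\<in>X. ?s a (?v a))"
      by (simp only: prodm_decomp[OF ring_A FX left_module_AA v])
    also have "\<dots> = (\<Oplus>\<^bsub>AA\<^esub>a\<in>X. u (?s a (?v a)))"
      using s XA by (intro mod_hom_finsum[OF fd_left_module[OF F] left_module_AA u(1) FX]) auto
    also have "\<dots> \<in> core M"
    proof (rule lsub_finsum[OF left_module_AA core_left_ideal[OF M] FX], rule Pi_I)
      fix a assume a: "a \<in> X"
      have "?s a a = a \<odot>\<^bsub>?F\<^esub> ?s a \<one>\<^sub>A" using XA[OF a] by (auto simp: single_def fun_eq_iff)
      then have "u (?s a a) = a \<otimes>\<^sub>A u (?s a \<one>\<^sub>A)"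
        using mod_hom_smult[OF u(1) XA[OF a] s[OF A.one_closed, of a]] by simp
      moreover have "u (?s a \<one>\<^sub>A) \<in> carrier A" using mod_hom_closed[OF u(1) s[OF A.one_closed]] by simp
      ultimately show "u (?s a (?v a)) \<in> core M" using core_right a X(1) by auto
    qed
    finally have "\<one>\<^sub>A \<in> M" using core_subset by blast
    then show False using max_ideal_one[OF assms(2)] by blast
  qed
  then show thesis using that kill by blast
qed

text \<open>Take x nonzero with x \<open>core M\<close> = 0 and with A x of least measure. A nonzero
  multiple c x satisfies the same conditions, so it generates the same left ideal; hence A x, which
  is the quotient of \<open>A\<close> by \<open>lann x\<close>, is simple.\<close>

lemma simple_in_lann_core:
  assumes "inj_mod AA" "max_ideal M"
  obtains x where "x \<in> carrier A" "x \<noteq> \<zero>\<^sub>A" "\<And>a. a \<in> core M \<Longrightarrow> x \<otimes>\<^sub>A a = \<zero>\<^sub>A" "max_ideal (lann x)"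
proof -
  obtain d :: "'a set \<Rightarrow> nat" where d: "\<And>W W'. \<lbrakk>left_ideal W; left_ideal W'; W \<subset> W'\<rbrakk> \<Longrightarrow> d W < d W'"
    by (rule left_ideal_measure) blast
  have M: "left_ideal M" using assms(2) by (simp add: max_ideal_def)
  note cM = left_idealD[OF core_left_ideal[OF M]]
  let ?Ax = "\<lambda>x. (\<lambda>a. a \<otimes>\<^sub>A x) ` carrier A"
  have li: "left_ideal (?Ax x)" if x: "x \<in> carrier A" for x
  proof -
    have "(\<lambda>a\<in>carrier A. a \<odot>\<^bsub>AA\<^esub> x) ` carrier AA = ?Ax x" by auto
    then show ?thesis
      using lsub_image[OF left_module_AA left_module_AA AA_hom[OF left_module_AA, of x]
          lsub_carrier[OF left_module_AA]] x by simp
  qed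
  let ?P = "\<lambda>x. x \<in> carrier A \<and> x \<noteq> \<zero>\<^sub>A \<and> (\<forall>a\<in>core M. x \<otimes>\<^sub>A a = \<zero>\<^sub>A)"
  obtain x0 where "?P x0" using lann_core_nonzero[OF assms] by metis
  then obtain x where x: "?P x" "\<And>y. ?P y \<Longrightarrow> d (?Ax x) \<le> d (?Ax y)"
    using ex_has_least_nat[of ?P x0 "\<lambda>x. d (?Ax x)"] by auto
  have "max_ideal (lann x)"
    unfolding max_ideal_def
  proof (intro conjI allI impI)
    show "left_ideal (lann x)" using x lann_left_ideal by blast
    have "\<one>\<^sub>A \<notin> lann x" using x(1) by (simp add: lann_def)
    then show "lann x \<noteq> carrier A" using A.one_closed by blast
    fix L assume L: "left_ideal L \<and> lann x \<subseteq> L"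
    show "L = lann x \<or> L = carrier A"
    proof (cases "L \<subseteq> lann x")
      case False
      then obtain c where c: "c \<in> L" "c \<notin> lann x" by blast
      have cA: "c \<in> carrier A" using c(1) L left_idealD(5) by blast
      have P: "?P (c \<otimes>\<^sub>A x)" using c cA x(1) cM(5) by (auto simp: lann_def A.m_assoc)
      have "?Ax (c \<otimes>\<^sub>A x) \<subseteq> ?Ax x"
        using cA x(1) by (auto simp: A.m_assoc[symmetric])
      \<comment> \<open>Minimality of the measure turns the inclusion into an equality, so x is a
        multiple of c x.\<close>
      then have "?Ax (c \<otimes>\<^sub>A x) = ?Ax x"
        using x(2)[OF P] d[OF li li, of "c \<otimes>\<^sub>A x" x] x(1) P by force
      moreover have "x \<in> ?Ax x" using x(1) by (intro image_eqI[of _ _ "\<one>\<^sub>A"]) auto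
      ultimately obtain b where b: "b \<in> carrier A" "x = b \<otimes>\<^sub>A (c \<otimes>\<^sub>A x)" by auto
      have "(\<one>\<^sub>A \<ominus>\<^bsub>A\<^esub> b \<otimes>\<^sub>A c) \<otimes>\<^sub>A x = x \<ominus>\<^bsub>A\<^esub> b \<otimes>\<^sub>A (c \<otimes>\<^sub>A x)"
        using b(1) cA x(1) by (simp add: A.l_distr A.minus_eq A.l_minus A.m_assoc)
      also have "\<dots> = \<zero>\<^sub>A" using b x(1) by (simp add: A.minus_self)
      finally have "\<one>\<^sub>A \<ominus>\<^bsub>A\<^esub> b \<otimes>\<^sub>A c \<in> L" using L b(1) cA by (auto simp: lann_def)
      moreover have "b \<otimes>\<^sub>A c \<in> L" using L c(1) b(1) left_idealD(4) by blast
      ultimately have "(\<one>\<^sub>A \<ominus>\<^bsub>A\<^esub> b \<otimes>\<^sub>A c) \<oplus>\<^sub>A b \<otimes>\<^sub>A c \<in> L" using L left_idealD(3) by blast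
      then have "\<one>\<^sub>A \<in> L" using b(1) cA by (simp add: A.minus_add_cancel)
      then show ?thesis using L left_ideal_one by blast
    qed (use L in blast)
  qed
  then show thesis using that x(1) by blast
qed

text \<open>An isomorphism from A x to A x' sends x to y = c x'. By injectivity it extends to an
  endomorphism of \<open>A\<close>, a right multiplication, so y = x u(1) is killed from the right
  by \<open>core M\<close> as well as by \<open>core M'\<close>. As y is nonzero the sum of the two
  is proper, and a maximal left ideal above it is equivalent to \<open>M\<close> and to
  \<open>M'\<close>.\<close>

lemma meqv_of_lann:
  assumes "inj_mod AA" "max_ideal M" "max_ideal M'"
    and x: "x \<in> carrier A" "x \<noteq> \<zero>\<^sub>A" "\<And>a. a \<in> core M \<Longrightarrow> x \<otimes>\<^sub>A a = \<zero>\<^sub>A"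
    and x': "x' \<in> carrier A" "\<And>a. a \<in> core M' \<Longrightarrow> x' \<otimes>\<^sub>A a = \<zero>\<^sub>A"
    and "meqv (lann x) (lann x')"
  shows "meqv M M'"
proof -
  have M: "left_ideal M" "left_ideal M'" using assms(2,3) by (auto simp: max_ideal_def)
  note cM = left_idealD[OF core_left_ideal[OF M(1)]] and cM' = left_idealD[OF core_left_ideal[OF M(2)]]
  obtain c where c: "c \<in> carrier A" "c \<notin> lann x'" "lann x = colon (lann x') c"
    using assms(9) by (auto simp: meqv_def)
  define y where "y = c \<otimes>\<^sub>A x'"
  have y: "y \<in> carrier A" "y \<noteq> \<zero>\<^sub>A" using c x' by (auto simp: y_def lann_def)
  have ann: "a \<otimes>\<^sub>A x = \<zero>\<^sub>A \<longleftrightarrow> a \<otimes>\<^sub>A y = \<zero>\<^sub>A" if "a \<in> carrier A" for a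
  proof -
    have "a \<in> lann x \<longleftrightarrow> a \<in> colon (lann x') c" using c(3) by simp
    then show ?thesis using that c(1) x'(1) by (simp add: lann_def colon_def y_def A.m_assoc)
  qed
  let ?j = "\<lambda>a\<in>carrier A. a \<odot>\<^bsub>AA\<^esub> x" and ?h = "\<lambda>a\<in>carrier A. a \<odot>\<^bsub>AA\<^esub> y"
  have j: "?j \<in> homA AA AA" "?h \<in> homA AA AA"
    using AA_hom[OF left_module_AA] x(1) y(1) by simp_all
  obtain u where u: "u \<in> homA AA AA" "\<And>a. a \<in> carrier AA \<Longrightarrow> u (?j a) = ?h a"
    using inj_modD[OF assms(1) left_module_AA fd_module_AA j] ann by auto
  have "y = x \<otimes>\<^sub>A u \<one>\<^sub>A"
    using u(2)[of "\<one>\<^sub>A"] AA_hom_apply[OF u(1) x(1)] x(1) y(1) by simp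
  moreover have u1: "u \<one>\<^sub>A \<in> carrier A" using mod_hom_closed[OF u(1)] by simp
  ultimately have k1: "y \<otimes>\<^sub>A a = \<zero>\<^sub>A" if "a \<in> core M" for a
    using x(3)[OF cM(4)[OF u1 that]] x(1) u1 cM(5)[OF that] by (simp add: A.m_assoc)
  have k2: "y \<otimes>\<^sub>A a = \<zero>\<^sub>A" if "a \<in> core M'" for a
    using x'(2)[OF that] x'(1) c(1) cM'(5)[OF that] by (simp add: y_def A.m_assoc)
  let ?L = "{a \<oplus>\<^sub>A b | a b. a \<in> core M \<and> b \<in> core M'}"
  have "left_ideal ?L"
    unfolding lsub_def
  proof (intro conjI ballI)
    show "?L \<subseteq> carrier AA" using cM(5) cM'(5) by auto
    show "\<zero>\<^bsub>AA\<^esub> \<in> ?L" using cM(2) cM'(2) by (auto intro!: exI[of _ "\<zero>\<^sub>A"])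
    show "z \<oplus>\<^bsub>AA\<^esub> w \<in> ?L" if zw: "z \<in> ?L" "w \<in> ?L" for z w
    proof -
      obtain a b a' b' where "z = a \<oplus>\<^sub>A b" "w = a' \<oplus>\<^sub>A b'" and *: "a \<in> core M" "a' \<in> core M" "b \<in> core M'" "b' \<in> core M'"
        using zw by auto
      then have "z \<oplus>\<^bsub>AA\<^esub> w = (a \<oplus>\<^sub>A a') \<oplus>\<^sub>A (b \<oplus>\<^sub>A b')"
        using cM(5) cM'(5) by (simp add: A.a_ac)
      then show ?thesis using * cM(3) cM'(3) by blast
    qed
    show "r \<odot>\<^bsub>AA\<^esub> z \<in> ?L" if r: "r \<in> carrier A" "z \<in> ?L" for r z
    proof -
      obtain a b where "z = a \<oplus>\<^sub>A b" and *: "a \<in> core M" "b \<in> core M'" using r by auto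
      then have "r \<odot>\<^bsub>AA\<^esub> z = r \<otimes>\<^sub>A a \<oplus>\<^sub>A r \<otimes>\<^sub>A b" using cM(5) cM'(5) r by (simp add: A.r_distr)
      then show ?thesis using * cM(4) cM'(4) r by blast
    qed
  qed
  moreover have "\<one>\<^sub>A \<notin> ?L"
  proof
    assume "\<one>\<^sub>A \<in> ?L"
    then obtain a b where ab: "\<one>\<^sub>A = a \<oplus>\<^sub>A b" "a \<in> core M" "b \<in> core M'" by blast
    have "y = y \<otimes>\<^sub>A (a \<oplus>\<^sub>A b)" unfolding ab(1)[symmetric] using y(1) by simp
    also have "\<dots> = \<zero>\<^sub>A" using y(1) cM(5) cM'(5) ab k1 k2 by (simp add: A.r_distr)
    finally show False using y(2) by simp
  qed
  ultimately obtain N where N: "max_ideal N" "?L \<subseteq> N" by (rule max_ideal_exists)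
  have "core M \<subseteq> ?L"
  proof
    fix a assume "a \<in> core M"
    moreover have "a = a \<oplus>\<^sub>A \<zero>\<^sub>A" using cM(5)[OF calculation] by simp
    ultimately show "a \<in> ?L" using cM'(2) by blast
  qed
  then have 1: "meqv M N" by (intro max_ideal_over_core[OF assms(2) N(1)] order_trans[OF _ N(2)])
  have "core M' \<subseteq> ?L"
  proof
    fix a assume "a \<in> core M'"
    moreover have "a = \<zero>\<^sub>A \<oplus>\<^sub>A a" using cM'(5)[OF calculation] by simp
    ultimately show "a \<in> ?L" using cM(2) by blast
  qed
  then have "meqv M' N" by (intro max_ideal_over_core[OF assms(3) N(1)] order_trans[OF _ N(2)])
  with 1 show ?thesis using meqv_sym[OF N(1)] meqv_trans by blast
qed

text \<open>Choosing for each \<open>M\<close> a simple left ideal killed on the right by the annihilator of \<open>A/M\<close> is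
  injective on isomorphism classes of simple modules. These being finite in number, every simple
  module is a left ideal.\<close>

lemma simple_embeds:
  assumes "inj_mod AA" "max_ideal N"
  obtains y where "y \<in> carrier A" "y \<noteq> \<zero>\<^sub>A" "\<And>a. a \<in> N \<Longrightarrow> a \<otimes>\<^sub>A y = \<zero>\<^sub>A"
proof -
  obtain F where F: "finite F" "\<And>M. M \<in> F \<Longrightarrow> max_ideal M" "\<And>N. max_ideal N \<Longrightarrow> \<exists>M\<in>F. meqv M N"
    by (rule finite_simples) blast
  \<comment> \<open>\<open>r\<close> picks one member of \<open>F\<close> for each equivalence
    class, so that isomorphism becomes equality of representatives.\<close>
  define r where "r N = (SOME M. M \<in> F \<and> meqv M N)" for N
  have r: "r N \<in> F" "meqv (r N) N" if "max_ideal N" for N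
    using someI_ex[of "\<lambda>M. M \<in> F \<and> meqv M N"] F(3)[OF that] by (auto simp: r_def)
  have r_eq: "r N = r N'" if "max_ideal N" "max_ideal N'" "meqv N N'" for N N'
  proof -
    have "meqv M N \<longleftrightarrow> meqv M N'" for M
      using that meqv_sym[OF that(2,3)] meqv_trans by blast
    then show ?thesis by (simp add: r_def)
  qed
  have r_eqD: "meqv N N'" if "max_ideal N" "max_ideal N'" "r N = r N'" for N N'
  proof -
    have "meqv N (r N)" using meqv_sym[OF that(1) r(2)[OF that(1)]] .
    moreover have "meqv (r N) N'" using r(2)[OF that(2)] that(3) by simp
    ultimately show ?thesis by (rule meqv_trans)
  qed
  have "\<exists>x. x \<in> carrier A \<and> x \<noteq> \<zero>\<^sub>A \<and> (\<forall>a\<in>core M. x \<otimes>\<^sub>A a = \<zero>\<^sub>A) \<and> max_ideal (lann x)" if "max_ideal M" for M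
    using simple_in_lann_core[OF assms(1) that] by metis
  then obtain x where x: "\<And>M. max_ideal M \<Longrightarrow> x M \<in> carrier A" "\<And>M. max_ideal M \<Longrightarrow> x M \<noteq> \<zero>\<^sub>A"
    "\<And>M a. \<lbrakk>max_ideal M; a \<in> core M\<rbrakk> \<Longrightarrow> x M \<otimes>\<^sub>A a = \<zero>\<^sub>A" "\<And>M. max_ideal M \<Longrightarrow> max_ideal (lann (x M))"
    by metis
  let ?F = "r ` Collect max_ideal"
  let ?f = "\<lambda>M. r (lann (x M))"
  have sub: "?F \<subseteq> F" using r(1) by auto
  have rr: "r M = M" if MF: "M \<in> ?F" for M
  proof -
    obtain N where N: "max_ideal N" "M = r N" using MF by blast
    then show ?thesis using r_eq[of "r N" N] r[OF N(1)] F(2) by simp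
  qed
  have "inj_on ?f ?F"
  proof (rule inj_onI)
    fix M M' assume M: "M \<in> ?F" "M' \<in> ?F" and eq: "?f M = ?f M'"
    then have mx: "max_ideal M" "max_ideal M'" using sub F(2) by blast+
    have "meqv (lann (x M)) (lann (x M'))" using r_eqD[OF x(4)[OF mx(1)] x(4)[OF mx(2)] eq] .
    then have "meqv M M'"
      by (intro meqv_of_lann[OF assms(1) mx x(1)[OF mx(1)] x(2)[OF mx(1)] x(3)[OF mx(1)]
            x(1)[OF mx(2)] x(3)[OF mx(2)]])
    then have "r M = r M'" by (rule r_eq[OF mx])
    then show "M = M'" by (simp only: rr[OF M(1)] rr[OF M(2)])
  qed
  moreover have "?f ` ?F \<subseteq> ?F" using x(4) sub F(2) by auto
  \<comment> \<open>An injective self-map of a finite set is onto, so the class of \<open>N\<close>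
    is the class of one of the chosen simple left ideals.\<close>
  ultimately have "?f ` ?F = ?F"
    using endo_inj_surj[of ?F ?f] finite_subset[OF sub F(1)] by blast
  moreover have "r N \<in> ?F" using assms(2) by (intro imageI) simp
  ultimately have "r N \<in> ?f ` ?F" by (simp only:)
  then obtain M where M: "M \<in> ?F" "r N = ?f M" by auto
  have mx: "max_ideal M" using M(1) sub F(2) by blast
  have "meqv N (lann (x M))" using r_eqD[OF assms(2) x(4)[OF mx] M(2)] .
  then obtain c where c: "c \<in> carrier A" "c \<notin> lann (x M)" "N = colon (lann (x M)) c"
    by (auto simp: meqv_def)
  show thesis
  proof
    show "c \<otimes>\<^sub>A x M \<in> carrier A" "c \<otimes>\<^sub>A x M \<noteq> \<zero>\<^sub>A" using c x(1)[OF mx] by (auto simp: lann_def)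
    show "a \<otimes>\<^sub>A (c \<otimes>\<^sub>A x M) = \<zero>\<^sub>A" if "a \<in> N" for a
      using that c(1) x(1)[OF mx] unfolding c(3) by (auto simp: colon_def lann_def A.m_assoc)
  qed
qed

text \<open>The annihilator of \<open>x\<close> lies in a maximal left ideal N, so A x has the
  simple quotient A/N. This embeds into \<open>A\<close> by sending 1 to some y, and the composite
  from A x to \<open>A\<close> extends to \<open>M\<close>; it takes \<open>x\<close> to y.\<close>

lemma separating_hom:
  assumes "inj_mod AA" "fd_module K A M" "x \<in> carrier M" "x \<noteq> \<zero>\<^bsub>M\<^esub>"
  obtains h where "h \<in> homA M AA" "h x \<noteq> \<zero>\<^sub>A"
proof -
  have lm: "left_module A M" using assms(2) by (rule fd_left_module)
  interpret M: left_module A M by fact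
  let ?j = "\<lambda>a\<in>carrier A. a \<odot>\<^bsub>M\<^esub> x"
  have j: "?j \<in> homA AA M" by (rule AA_hom[OF lm assms(3)])
  have "left_ideal {a \<in> carrier A. ?j a = \<zero>\<^bsub>M\<^esub>}"
    using lsub_ker[OF left_module_AA lm j] by simp
  moreover have "\<one>\<^sub>A \<notin> {a \<in> carrier A. ?j a = \<zero>\<^bsub>M\<^esub>}" using assms(3,4) by (simp add: M.smult_one)
  ultimately obtain N where N: "max_ideal N" "{a \<in> carrier A. ?j a = \<zero>\<^bsub>M\<^esub>} \<subseteq> N"
    by (rule max_ideal_exists)
  obtain y where y: "y \<in> carrier A" "y \<noteq> \<zero>\<^sub>A" "\<And>a. a \<in> N \<Longrightarrow> a \<otimes>\<^sub>A y = \<zero>\<^sub>A"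
    using simple_embeds[OF assms(1) N(1)] by metis
  let ?h = "\<lambda>a\<in>carrier A. a \<odot>\<^bsub>AA\<^esub> y"
  have h: "?h \<in> homA AA AA" using AA_hom[OF left_module_AA, of y] y(1) by simp
  have "?h a = \<zero>\<^bsub>AA\<^esub>" if "a \<in> carrier AA" "?j a = \<zero>\<^bsub>M\<^esub>" for a
    using that N(2) y(3)[of a] by auto
  then obtain u where u: "u \<in> homA M AA" "\<And>a. a \<in> carrier AA \<Longrightarrow> u (?j a) = ?h a"
    using inj_modD[OF assms(1) left_module_AA assms(2) j h] by metis
  have "u x = y" using u(2)[of "\<one>\<^sub>A"] assms(3) y(1) by (simp add: M.smult_one)
  then show thesis using that u(1) y(2) by blast
qed

text \<open>A finite set of functionals whose common kernel has least measure has kernel zero, since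
  \<open>separating_hom\<close> would cut a nonzero kernel down further. The functionals themselves
  index the coordinates.\<close>

lemma free_embedding:
  fixes M :: "('a, 'm) module"
  assumes "inj_mod AA" "fd_module K A M"
  obtains H :: "('m \<Rightarrow> 'a) set" and j where "finite H" "j \<in> homA M (prodm H (\<lambda>_. AA))" "inj_on j (carrier M)"
proof -
  have lm: "left_module A M" using assms(2) by (rule fd_left_module)
  interpret M: left_module A M by fact
  obtain d :: "_ set \<Rightarrow> nat" where d: "\<And>W W'. \<lbrakk>lsub A M W; lsub A M W'; W \<subset> W'\<rbrakk> \<Longrightarrow> d W < d W'"
    using submodule_measure[OF assms(2)] by blast
  let ?k = "\<lambda>H. {x \<in> carrier M. \<forall>h\<in>H. h x = \<zero>\<^sub>A}"
  let ?P = "\<lambda>H. finite H \<and> H \<subseteq> homA M AA"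
  have li: "lsub A M (?k H)" if "?P H" for H
    unfolding lsub_def
  proof (intro conjI ballI)
    have h: "h \<in> homA M AA" if "h \<in> H" for h using that \<open>?P H\<close> by blast
    show "?k H \<subseteq> carrier M" by auto
    show "\<zero>\<^bsub>M\<^esub> \<in> ?k H" using mod_hom_zero[OF lm left_module_AA h] by simp
    show "x \<oplus>\<^bsub>M\<^esub> y \<in> ?k H" if xy: "x \<in> ?k H" "y \<in> ?k H" for x y
    proof -
      have "f (x \<oplus>\<^bsub>M\<^esub> y) = \<zero>\<^sub>A" if "f \<in> H" for f
        using mod_hom_add[OF h[OF that], of x y] xy that by (metis (mono_tags, lifting) A.l_zero A.zero_closed AA_simps(3) mem_Collect_eq)
      then show ?thesis using xy by simp
    qed
    show "a \<odot>\<^bsub>M\<^esub> x \<in> ?k H" if "a \<in> carrier A" "x \<in> ?k H" for a x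
      using that by (auto simp: mod_hom_smult[OF h] M.smult_closed)
  qed
  obtain H where H: "?P H" "\<And>G. ?P G \<Longrightarrow> d (?k H) \<le> d (?k G)"
    using ex_has_least_nat[of ?P "{}" "\<lambda>H. d (?k H)"] by auto
  have k0: "x = \<zero>\<^bsub>M\<^esub>" if x: "x \<in> ?k H" for x
  proof (rule ccontr)
    assume "x \<noteq> \<zero>\<^bsub>M\<^esub>"
    then obtain h where h: "h \<in> homA M AA" "h x \<noteq> \<zero>\<^sub>A"
      using separating_hom[OF assms] x by blast
    have C: "?P (insert h H)" using H(1) h(1) by blast
    have "\<not> ?k (insert h H) \<subset> ?k H"
      using H(2)[OF C] d[OF li[OF C] li[OF H(1)]] by linarith
    then show False using x h(2) by blast
  qed
  let ?j = "\<lambda>x\<in>carrier M. \<lambda>h\<in>H. h x"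
  have j: "?j \<in> homA M (prodm H (\<lambda>_. AA))"
    by (rule tuple_mod_hom[OF lm]) (use H(1) in blast)
  have P: "left_module A (prodm H (\<lambda>_. AA))" by (intro left_module_prodm ring_A left_module_AA)
  have "inj_on ?j (carrier M)"
    unfolding mod_hom_inj_iff[OF lm P j]
  proof (intro ballI impI)
    fix x assume x: "x \<in> carrier M" "?j x = \<zero>\<^bsub>prodm H (\<lambda>_. AA)\<^esub>"
    have "h x = \<zero>\<^sub>A" if "h \<in> H" for h using fun_cong[OF x(2), of h] that x(1) by simp
    then show "x = \<zero>\<^bsub>M\<^esub>" using k0 x(1) by blast
  qed
  then show thesis using H(1) by (intro that[OF _ j]) simp_all
qed

lemma inj_mod_free:
  assumes "inj_mod AA"
  shows "inj_mod (prodm I (\<lambda>_. AA))"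
  using inj_mod_prodm[of I "TYPE('k list)" "\<lambda>_. AA"] assms by simp

text \<open>The essential half of the coincidence of injective and projective modules:
  \<open>P\<close> embeds into a free module, the embedding splits because \<open>P\<close> is
  injective, and lifts out of the free module restrict to the summand \<open>P\<close>.\<close>

lemma inj_mod_lift:
  fixes P :: "('a, 'm) module"
  assumes AA: "inj_mod AA" and P: "fd_module K A P" "inj_mod P" and lm: "left_module A Y" "left_module A Z"
    and *: "g \<in> homA Y Z" "g ` carrier Y = carrier Z" "h \<in> homA P Z"
  obtains u where "u \<in> homA P Y" "\<And>x. x \<in> carrier P \<Longrightarrow> g (u x) = h x"
proof -
  have lP: "left_module A P" using P(1) by (rule fd_left_module)
  obtain B :: "('m \<Rightarrow> 'a) set" and j where B: "finite B" "j \<in> homA P (prodm B (\<lambda>_. AA))" "inj_on j (carrier P)"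
    by (rule free_embedding[OF AA P(1)])
  let ?F = "prodm B (\<lambda>_. AA)"
  have F: "fd_module K A ?F" using B(1) fd_module_AA by (intro fd_module_prodm) auto
  note lF = fd_left_module[OF F]
  have "restrict (\<lambda>x. x) (carrier P) x = \<zero>\<^bsub>P\<^esub>" if "x \<in> carrier P" "j x = \<zero>\<^bsub>?F\<^esub>" for x
    using that B(3) mod_hom_inj_iff[OF lP lF B(2)] by simp
  then obtain r where r: "r \<in> homA ?F P" "\<And>x. x \<in> carrier P \<Longrightarrow> r (j x) = restrict (\<lambda>x. x) (carrier P) x"
    by (rule inj_modD[OF P(2) lP F B(2) mod_hom_id[OF lP]]) blast+
  obtain v where v: "v \<in> homA ?F Y" "\<And>x. x \<in> carrier ?F \<Longrightarrow> g (v x) = compose (carrier ?F) h r x"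
    by (rule free_lift[OF B(1) lm *(1,2) mod_hom_compose[OF r(1) *(3) lF]]) blast
  show thesis
  proof (rule that[OF mod_hom_compose[OF B(2) v(1) lP]])
    fix x assume x: "x \<in> carrier P"
    note jx = mod_hom_closed[OF B(2) x]
    show "g (compose (carrier P) v j x) = h x"
      unfolding compose_eq[OF x] v(2)[OF jx] compose_eq[OF jx] r(2)[OF x] restrict_apply'[OF x] ..
  qed
qed

end

section \<open>Representations\<close>

lemma rep_homI:
  assumes "\<And>i. i \<in> verts Q \<Longrightarrow> F i \<in> mod_hom R (space X i) (space Y i)"
    and "\<And>\<mu> x. \<lbrakk>\<mu> \<in> arcs Q; x \<in> carrier (space X (tail Q \<mu>)); tail Q \<mu> \<in> verts Q; head Q \<mu> \<in> verts Q\<rbrakk>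
      \<Longrightarrow> arr Y \<mu> (F (tail Q \<mu>) x) = F (head Q \<mu>) (arr X \<mu> x)"
    and "wf_digraph Q"
  shows "(\<lambda>i\<in>verts Q. F i) \<in> rep_hom Q R X Y"
proof -
  interpret wf_digraph Q by fact
  show ?thesis using assms(1,2) by (simp add: rep_hom_def)
qed

lemma rep_hom_at: "\<lbrakk>f \<in> rep_hom Q R X Y; i \<in> verts Q\<rbrakk> \<Longrightarrow> f i \<in> mod_hom R (space X i) (space Y i)"
  by (auto simp: rep_hom_def)

lemma rep_hom_arr: "\<lbrakk>f \<in> rep_hom Q R X Y; \<mu> \<in> arcs Q; x \<in> carrier (space X (tail Q \<mu>))\<rbrakk>
    \<Longrightarrow> f (head Q \<mu>) (arr X \<mu> x) = arr Y \<mu> (f (tail Q \<mu>) x)"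
  by (auto simp: rep_hom_def)

lemma rep_hom_eqI:
  assumes "f \<in> rep_hom Q R X Y" "g \<in> rep_hom Q R X Y"
    and "\<And>i x. \<lbrakk>i \<in> verts Q; x \<in> carrier (space X i)\<rbrakk> \<Longrightarrow> f i x = g i x"
  shows "f = g"
proof (rule extensionalityI[of _ "verts Q"])
  show "f \<in> extensional (verts Q)" "g \<in> extensional (verts Q)"
    using assms(1,2) by (auto simp: rep_hom_def PiE_def)
  show "f i = g i" if "i \<in> verts Q" for i
    by (rule mod_hom_eqI[OF rep_hom_at[OF assms(1) that] rep_hom_at[OF assms(2) that]])
      (rule assms(3)[OF that])
qed

locale quiver_algebra = fd_algebra K A + fin_digraph Q
  for K :: "'k ring" and A :: "('k, 'a) module" and Q :: "('v, 'e) pre_digraph" +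
  assumes acyclic: "acyclic_quiver Q"
begin

abbreviation "V \<equiv> verts Q"
abbreviation "into \<equiv> arrows_into Q"
abbreviation robj :: "('v, 'e, 'a, 'n) rep \<Rightarrow> bool" where "robj X \<equiv> X \<in> Obj (Rep Q K A)"
abbreviation mobj :: "('v, 'e, 'a, 'n) rep \<Rightarrow> bool" where "mobj X \<equiv> X \<in> Obj (Mon Q K A)"
abbreviation rhom :: "('v, 'e, 'a, 'm) rep \<Rightarrow> ('v, 'e, 'a, 'n) rep \<Rightarrow> ('v \<Rightarrow> 'm \<Rightarrow> 'n) set" where
  "rhom \<equiv> rep_hom Q A"
abbreviation zero_at ("\<zero>[_,_]") where "\<zero>[X,i] \<equiv> \<zero>\<^bsub>space X i\<^esub>"
abbreviation sp :: "('v, 'e, 'a, 'n) rep \<Rightarrow> 'v \<Rightarrow> 'n set" where "sp X i \<equiv> carrier (space X i)"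

lemma robj_iff: "robj X \<longleftrightarrow> (\<forall>i\<in>V. fd_module K A (space X i)) \<and>
    (\<forall>\<mu>\<in>arcs Q. arr X \<mu> \<in> homA (space X (tail Q \<mu>)) (space X (head Q \<mu>)))"
  by (simp add: Rep_def mod_cat_def)

lemma mobj_iff: "mobj X \<longleftrightarrow> robj X \<and> monic Q X"
  by (simp add: Mon_def)

lemma robj_fd: "\<lbrakk>robj X; i \<in> V\<rbrakk> \<Longrightarrow> fd_module K A (space X i)"
  by (simp add: robj_iff)

lemma robj_lm: "\<lbrakk>robj X; i \<in> V\<rbrakk> \<Longrightarrow> left_module A (space X i)"
  by (simp add: robj_iff fd_left_module)

lemma robj_arr: "\<lbrakk>robj X; \<mu> \<in> arcs Q\<rbrakk> \<Longrightarrow> arr X \<mu> \<in> homA (space X (tail Q \<mu>)) (space X (head Q \<mu>))"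
  by (simp add: robj_iff)

lemma arr_closed: "\<lbrakk>robj X; \<mu> \<in> arcs Q; x \<in> sp X (tail Q \<mu>)\<rbrakk> \<Longrightarrow> arr X \<mu> x \<in> sp X (head Q \<mu>)"
  by (rule mod_hom_closed[OF robj_arr])

lemma rhom_closed: "\<lbrakk>f \<in> rhom X Y; i \<in> V; x \<in> sp X i\<rbrakk> \<Longrightarrow> f i x \<in> sp Y i"
  by (rule mod_hom_closed[OF rep_hom_at])

lemma rhom_zero: "\<lbrakk>f \<in> rhom X Y; robj X; robj Y; i \<in> V\<rbrakk> \<Longrightarrow> f i \<zero>[X,i] = \<zero>[Y,i]"
  by (rule mod_hom_zero[OF robj_lm robj_lm rep_hom_at])

lemma rhom_add: "\<lbrakk>f \<in> rhom X Y; i \<in> V; x \<in> sp X i; y \<in> sp X i\<rbrakk>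
    \<Longrightarrow> f i (x \<oplus>\<^bsub>space X i\<^esub> y) = f i x \<oplus>\<^bsub>space Y i\<^esub> f i y"
  by (rule mod_hom_add[OF rep_hom_at])

lemma rhom_minus: "\<lbrakk>f \<in> rhom X Y; robj X; robj Y; i \<in> V; x \<in> sp X i; y \<in> sp X i\<rbrakk>
    \<Longrightarrow> f i (x \<ominus>\<^bsub>space X i\<^esub> y) = f i x \<ominus>\<^bsub>space Y i\<^esub> f i y"
  by (rule mod_hom_minus[OF robj_lm robj_lm rep_hom_at])

lemma rhom_inj_iff:
  assumes "f \<in> rhom X Y" "robj X" "robj Y" "i \<in> V"
  shows "inj_on (f i) (sp X i) \<longleftrightarrow> (\<forall>x\<in>sp X i. f i x = \<zero>[Y,i] \<longrightarrow> x = \<zero>[X,i])"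
  by (rule mod_hom_inj_iff[OF robj_lm[OF assms(2,4)] robj_lm[OF assms(3,4)] rep_hom_at[OF assms(1,4)]])

lemma zero_in: "\<lbrakk>robj X; i \<in> V\<rbrakk> \<Longrightarrow> \<zero>[X,i] \<in> sp X i"
  using lsubD(2)[OF lsub_carrier[OF robj_lm]] .

lemma into_iff: "\<mu> \<in> into i \<longleftrightarrow> \<mu> \<in> arcs Q \<and> head Q \<mu> = i"
  by (simp add: arrows_into_def)

lemma into_tail: "\<mu> \<in> into i \<Longrightarrow> tail Q \<mu> \<in> V"
  by (simp add: into_iff)

lemma finite_into: "finite (into i)"
  by (simp add: arrows_into_def)

subsection \<open>The maps \<open>\<delta>\<close>\<close>

abbreviation dmod :: "('v, 'e, 'a, 'n) rep \<Rightarrow> 'v \<Rightarrow> ('a, 'e \<Rightarrow> 'n) module" where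
  "dmod X i \<equiv> prodm (into i) (\<lambda>\<mu>. space X (tail Q \<mu>))"
abbreviation "dsp X i \<equiv> carrier (dmod X i)"
abbreviation dsingle where
  "dsingle X \<mu> x \<equiv> single (into (head Q \<mu>)) (\<lambda>\<mu>. space X (tail Q \<mu>)) \<mu> x"

text \<open>The direct sum of the maps \<open>f (tail Q \<mu>)\<close> between the domains of
  \<delta>_i. It uses \<open>f\<close> only at the sources of arrows into i, so it makes sense for a
  morphism whose component at i is still to be constructed.\<close>

definition push :: "'v \<Rightarrow> ('v \<Rightarrow> 'm \<Rightarrow> 'n) \<Rightarrow> ('e \<Rightarrow> 'm) \<Rightarrow> 'e \<Rightarrow> 'n" where
  "push i f w = (\<lambda>\<mu>\<in>into i. f (tail Q \<mu>) (w \<mu>))"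

lemma delta_domain_eq: "delta_domain Q X i = dsp X i"
  by (simp add: delta_domain_def)

lemma dmod_lm: "robj X \<Longrightarrow> left_module A (dmod X i)"
  using into_tail robj_lm by (intro left_module_prodm ring_A) blast

lemma into_arr_hom: "\<lbrakk>robj X; \<mu> \<in> into i\<rbrakk> \<Longrightarrow> arr X \<mu> \<in> homA (space X (tail Q \<mu>)) (space X i)"
  using robj_arr[of X \<mu>] by (simp add: into_iff)

lemma delta_hom:
  assumes "robj X" "i \<in> V"
  shows "restrict (delta Q X i) (dsp X i) \<in> homA (dmod X i) (space X i)"
  unfolding delta_def
  by (rule copair_mod_hom[OF ring_A finite_into robj_lm[OF assms(1) into_tail] robj_lm[OF assms]
        into_arr_hom[OF assms(1)]])

lemma delta_closed:
  assumes "robj X" "i \<in> V" "w \<in> dsp X i"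
  shows "delta Q X i w \<in> sp X i"
  using mod_hom_closed[OF delta_hom[OF assms(1,2)] assms(3)] assms(3) by simp

lemma delta_zero:
  assumes "robj X" "i \<in> V"
  shows "delta Q X i \<zero>\<^bsub>dmod X i\<^esub> = \<zero>[X,i]"
proof -
  interpret D: left_module A "dmod X i" by (rule dmod_lm[OF assms(1)])
  show ?thesis
    using mod_hom_zero[OF dmod_lm[OF assms(1)] robj_lm[OF assms] delta_hom[OF assms]] D.M.zero_closed
    by (simp only: restrict_apply' if_True)
qed

lemma delta_single:
  assumes "robj X" "\<mu> \<in> arcs Q" "x \<in> sp X (tail Q \<mu>)"
  shows "delta Q X (head Q \<mu>) (dsingle X \<mu> x) = arr X \<mu> x"
  unfolding delta_def
  by (rule finsum_single[OF finite_into robj_lm[OF assms(1) into_tail] robj_lm[OF assms(1)]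
        into_arr_hom[OF assms(1)]]) (use assms(2,3) in \<open>auto simp: into_iff\<close>)

lemma dsingle_closed:
  assumes "robj X" "x \<in> sp X (tail Q \<mu>)"
  shows "dsingle X \<mu> x \<in> dsp X (head Q \<mu>)"
  by (rule single_closed[where M = "\<lambda>\<mu>. space X (tail Q \<mu>)" and i = \<mu>, OF robj_lm[OF assms(1) into_tail] assms(2)])

lemma monic_iff:
  assumes "robj X"
  shows "monic Q X \<longleftrightarrow> (\<forall>i\<in>V. \<forall>w\<in>dsp X i. delta Q X i w = \<zero>[X,i] \<longrightarrow>
    (\<forall>\<mu>\<in>into i. w \<mu> = \<zero>[X,tail Q \<mu>]))"
proof -
  have "inj_on (delta Q X i) (delta_domain Q X i) \<longleftrightarrow> (\<forall>w\<in>dsp X i. delta Q X i w = \<zero>[X,i] \<longrightarrow>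
    (\<forall>\<mu>\<in>into i. w \<mu> = \<zero>[X,tail Q \<mu>]))" if i: "i \<in> V" for i
  proof -
    have z: "(\<forall>\<mu>\<in>into i. w \<mu> = \<zero>[X,tail Q \<mu>]) \<longleftrightarrow> w = \<zero>\<^bsub>dmod X i\<^esub>" if w: "w \<in> dsp X i" for w
    proof
      assume *: "\<forall>\<mu>\<in>into i. w \<mu> = \<zero>[X,tail Q \<mu>]"
      have "w \<in> extensional (into i)" using w by (simp add: PiE_def)
      then show "w = \<zero>\<^bsub>dmod X i\<^esub>" using * by (intro extensionalityI[of _ "into i"]) simp_all
    qed simp
    have "inj_on (delta Q X i) (dsp X i) \<longleftrightarrow>
      inj_on (restrict (delta Q X i) (dsp X i)) (dsp X i)"
      by (intro inj_on_cong) simp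
    then show ?thesis
      unfolding delta_domain_eq mod_hom_inj_iff[OF dmod_lm[OF assms] robj_lm[OF assms i] delta_hom[OF assms i]]
      using z by (simp del: prodm_simps)
  qed
  then show ?thesis by (simp add: monic_def)
qed

lemma monicD:
  "\<lbrakk>robj X; monic Q X; i \<in> V; w \<in> dsp X i; delta Q X i w = \<zero>[X,i]; \<mu> \<in> into i\<rbrakk>
   \<Longrightarrow> w \<mu> = \<zero>[X,tail Q \<mu>]"
  using monic_iff by blast

lemma push_hom:
  assumes "robj X" "\<And>\<mu>. \<mu> \<in> into i \<Longrightarrow> f (tail Q \<mu>) \<in> homA (space X (tail Q \<mu>)) (space Y (tail Q \<mu>))"
  shows "restrict (push i f) (dsp X i) \<in> homA (dmod X i) (dmod Y i)"
proof -
  have lm: "left_module A (space X (tail Q \<mu>))" if "\<mu> \<in> into i" for \<mu>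
    using robj_lm[OF assms(1) into_tail[OF that]] .
  have "(\<lambda>w\<in>dsp X i. \<lambda>\<mu>\<in>into i. (\<lambda>w\<in>dsp X i. f (tail Q \<mu>) (w \<mu>)) w)
    \<in> homA (dmod X i) (dmod Y i)"
  proof (rule tuple_mod_hom[OF dmod_lm[OF assms(1)]])
    fix \<mu> assume \<mu>: "\<mu> \<in> into i"
    have "compose (dsp X i) (f (tail Q \<mu>)) (\<lambda>w\<in>dsp X i. w \<mu>)
      \<in> homA (dmod X i) (space Y (tail Q \<mu>))"
      using mod_hom_compose[OF prodm_proj[OF ring_A lm \<mu>] assms(2)[OF \<mu>] dmod_lm[OF assms(1)]] by simp
    then show "(\<lambda>w\<in>dsp X i. f (tail Q \<mu>) (w \<mu>)) \<in> homA (dmod X i) (space Y (tail Q \<mu>))"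
      by (simp add: compose_def cong: restrict_cong)
  qed
  then show ?thesis by (simp add: push_def cong: restrict_cong)
qed

lemma push_closed:
  assumes "\<And>\<mu>. \<mu> \<in> into i \<Longrightarrow> f (tail Q \<mu>) \<in> homA (space X (tail Q \<mu>)) (space Y (tail Q \<mu>))"
    "w \<in> dsp X i"
  shows "push i f w \<in> dsp Y i"
  using mod_hom_closed[OF assms(1) prodm_mem[OF assms(2)]] by (simp add: push_def)

lemma delta_push_gen:
  assumes "robj X" "robj Y" "i \<in> V"
    and f: "\<And>\<mu>. \<mu> \<in> into i \<Longrightarrow> f (tail Q \<mu>) \<in> homA (space X (tail Q \<mu>)) (space Y (tail Q \<mu>))"
    and g: "g \<in> homA (space X i) (space Y i)"
    and comm: "\<And>\<mu> x. \<lbrakk>\<mu> \<in> into i; x \<in> sp X (tail Q \<mu>)\<rbrakk> \<Longrightarrow> g (arr X \<mu> x) = arr Y \<mu> (f (tail Q \<mu>) x)"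
    and w: "w \<in> dsp X i"
  shows "g (delta Q X i w) = delta Q Y i (push i f w)"
proof -
  interpret Y: left_module A "space Y i" by (rule robj_lm[OF assms(2,3)])
  have "g (delta Q X i w) = (\<Oplus>\<^bsub>space Y i\<^esub>\<mu>\<in>into i. g (arr X \<mu> (w \<mu>)))"
    unfolding delta_def
    using mod_hom_closed[OF into_arr_hom[OF assms(1)] prodm_mem[OF w]]
    by (intro mod_hom_finsum[OF robj_lm[OF assms(1,3)] robj_lm[OF assms(2,3)] g finite_into]) auto
  also have "\<dots> = delta Q Y i (push i f w)"
    unfolding delta_def push_def
    using mod_hom_closed[OF into_arr_hom[OF assms(2)] mod_hom_closed[OF f prodm_mem[OF w]]]
    by (intro Y.M.finsum_cong') (auto simp: comm prodm_mem[OF w])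
  finally show ?thesis .
qed

text \<open>Evaluating on families concentrated at one arrow recovers that arrow from \<delta>.
  Compatibility with all arrows into i thus amounts to the single equation g \<delta> = \<delta> f,
  and components of morphisms are constructed in this form: \<open>g\<close> is the candidate at i,
  and \<open>f\<close> holds the components already chosen.\<close>

lemma delta_push_conv:
  assumes "robj X" "robj Y"
    and f: "\<And>\<mu>. \<mu> \<in> into i \<Longrightarrow> f (tail Q \<mu>) \<in> homA (space X (tail Q \<mu>)) (space Y (tail Q \<mu>))"
    and comm: "\<And>w. w \<in> dsp X i \<Longrightarrow> g (delta Q X i w) = delta Q Y i (push i f w)"
    and \<mu>: "\<mu> \<in> into i" "x \<in> sp X (tail Q \<mu>)"
  shows "g (arr X \<mu> x) = arr Y \<mu> (f (tail Q \<mu>) x)"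
proof -
  have a: "\<mu> \<in> arcs Q" "head Q \<mu> = i" using \<mu>(1) by (auto simp: into_iff)
  have "push i f (dsingle X \<mu> x) = dsingle Y \<mu> (f (tail Q \<mu>) x)"
    using mod_hom_zero[OF robj_lm[OF assms(1) into_tail] robj_lm[OF assms(2) into_tail] f] a(2)
    by (auto simp: push_def single_def fun_eq_iff)
  then show ?thesis
    using comm[of "dsingle X \<mu> x"] dsingle_closed[OF assms(1) \<mu>(2)] delta_single[OF assms(1) a(1) \<mu>(2)]
      delta_single[OF assms(2) a(1) mod_hom_closed[OF f[OF \<mu>(1)] \<mu>(2)]] a(2)
    by simp
qed

lemma rhom_into: "\<lbrakk>f \<in> rhom X Y; \<mu> \<in> into i\<rbrakk>
    \<Longrightarrow> f (tail Q \<mu>) \<in> homA (space X (tail Q \<mu>)) (space Y (tail Q \<mu>))"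
  by (rule rep_hom_at[OF _ into_tail])

lemma delta_push:
  assumes "robj X" "robj Y" "f \<in> rhom X Y" "i \<in> V" "w \<in> dsp X i"
  shows "f i (delta Q X i w) = delta Q Y i (push i f w)"
  by (rule delta_push_gen[OF assms(1,2,4) rhom_into[OF assms(3)] rep_hom_at[OF assms(3,4)] _ assms(5)])
    (use rep_hom_arr[OF assms(3)] in \<open>auto simp: into_iff\<close>)

lemma rhom_push_closed: "\<lbrakk>f \<in> rhom X Y; w \<in> dsp X i\<rbrakk> \<Longrightarrow> push i f w \<in> dsp Y i"
  by (rule push_closed[OF rhom_into])

subsection \<open>Recursion along the arrows\<close>

text \<open>A cycle of this finite relation would be a nonempty closed walk.\<close>

lemma wf_arrows: "wf {(tail Q \<mu>, head Q \<mu>) | \<mu>. \<mu> \<in> arcs Q}" (is "wf ?R")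
proof (rule finite_acyclic_wf)
  have "?R = (\<lambda>\<mu>. (tail Q \<mu>, head Q \<mu>)) ` arcs Q" by auto
  then show "finite ?R" by simp
  have "\<exists>p. p \<noteq> [] \<and> awalk u p v" if "(u, v) \<in> ?R\<^sup>+" for u v
    using that
  proof (induction rule: trancl_induct)
    case (base y)
    then obtain \<mu> where "\<mu> \<in> arcs Q" "u = tail Q \<mu>" "y = head Q \<mu>" by auto
    then have "awalk u [\<mu>] y" using arc_implies_awalk by simp
    then show ?case by blast
  next
    case (step y z)
    then obtain p \<mu> where "p \<noteq> []" "awalk u p y" "\<mu> \<in> arcs Q" "y = tail Q \<mu>" "z = head Q \<mu>" by auto
    moreover have "awalk y [\<mu>] z" using calculation arc_implies_awalk by auto
    ultimately have "awalk u (p @ [\<mu>]) z" by (intro awalk_appendI)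
    then show ?case by blast
  qed
  then show "acyclic ?R" using acyclic by (auto simp: acyclic_def acyclic_quiver_def)
qed

text \<open>Vertices without incoming arrows are the base of the induction; there the second premise
  holds vacuously.\<close>

lemma vertex_induct [consumes 1]:
  assumes "i \<in> V" "\<And>i. \<lbrakk>i \<in> V; \<And>\<mu>. \<mu> \<in> into i \<Longrightarrow> P (tail Q \<mu>)\<rbrakk> \<Longrightarrow> P i"
  shows "P i"
proof -
  have "i \<in> V \<longrightarrow> P i"
    using wf_arrows
  proof (induction i rule: wf_induct_rule)
    case (less i)
    show ?case
    proof
      assume "i \<in> V"
      show "P i"
      proof (rule assms(2)[OF \<open>i \<in> V\<close>])
        fix \<mu> assume "\<mu> \<in> into i"
        then have "(tail Q \<mu>, i) \<in> {(tail Q \<mu>, head Q \<mu>) | \<mu>. \<mu> \<in> arcs Q}" "tail Q \<mu> \<in> V"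
          by (auto simp: into_iff)
        then show "P (tail Q \<mu>)" using less by blast
      qed
    qed
  qed
  then show ?thesis using assms(1) by blast
qed

text \<open>Morphisms are built along the arrows: once components are fixed at all sources of arrows
  into i, one at i has to be found that is compatible with them. \<open>P\<close> carries whatever
  else the components must satisfy.\<close>

lemma rep_hom_recursion:
  fixes X :: "('v, 'e, 'a, 'm) rep" and Y :: "('v, 'e, 'a, 'n) rep"
  assumes step: "\<And>i f. \<lbrakk>i \<in> V; \<And>\<mu>. \<mu> \<in> into i \<Longrightarrow> f (tail Q \<mu>) \<in> homA (space X (tail Q \<mu>)) (space Y (tail Q \<mu>));
      \<And>\<mu>. \<mu> \<in> into i \<Longrightarrow> P (tail Q \<mu>) (f (tail Q \<mu>))\<rbrakk>
    \<Longrightarrow> \<exists>g\<in>homA (space X i) (space Y i). P i g \<and>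
        (\<forall>\<mu>\<in>into i. \<forall>x\<in>sp X (tail Q \<mu>). g (arr X \<mu> x) = arr Y \<mu> (f (tail Q \<mu>) x))"
  obtains f where "f \<in> rhom X Y" "\<And>i. i \<in> V \<Longrightarrow> P i (f i)"
proof -
  let ?ok = "\<lambda>i g. g \<in> homA (space X i) (space Y i) \<and> P i g"
  \<comment> \<open>Choice along a well-founded relation demands a value for every vertex and every
    past. The guards make the requirement vacuous where the past is no partial morphism; the
    induction after the choice discharges them.\<close>
  let ?W = "\<lambda>f i g. i \<in> V \<longrightarrow> (\<forall>\<mu>\<in>into i. ?ok (tail Q \<mu>) (f (tail Q \<mu>))) \<longrightarrow>
    ?ok i g \<and> (\<forall>\<mu>\<in>into i. \<forall>x\<in>sp X (tail Q \<mu>). g (arr X \<mu> x) = arr Y \<mu> (f (tail Q \<mu>) x))"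
  have "\<exists>f. \<forall>i. ?W f i (f i)"
  proof (rule dependent_wf_choice[OF wf_arrows])
    fix f g :: "'v \<Rightarrow> 'm \<Rightarrow> 'n" and i r
    assume eq: "\<And>z. (z, i) \<in> {(tail Q \<mu>, head Q \<mu>) |\<mu>. \<mu> \<in> arcs Q} \<Longrightarrow> f z = g z"
    have "f (tail Q \<mu>) = g (tail Q \<mu>)" if "\<mu> \<in> into i" for \<mu>
      using that by (intro eq) (auto simp: into_iff)
    then show "?W f i r = ?W g i r" by simp
  next
    fix i and f :: "'v \<Rightarrow> 'm \<Rightarrow> 'n"
    show "\<exists>r. ?W f i r"
    proof (cases "i \<in> V \<and> (\<forall>\<mu>\<in>into i. ?ok (tail Q \<mu>) (f (tail Q \<mu>)))")
      case True
      then have "\<exists>g\<in>homA (space X i) (space Y i). P i g \<and>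
        (\<forall>\<mu>\<in>into i. \<forall>x\<in>sp X (tail Q \<mu>). g (arr X \<mu> x) = arr Y \<mu> (f (tail Q \<mu>) x))"
        by (intro step) simp_all
      then show ?thesis by blast
    qed blast
  qed
  then obtain f where f: "\<And>i. ?W f i (f i)" by blast
  have ok: "?ok i (f i)" if "i \<in> V" for i
    using that
  proof (induction rule: vertex_induct)
    case (1 i)
    then show ?case using f[of i] by simp
  qed
  let ?f = "\<lambda>i\<in>V. f i"
  have "?f \<in> rhom X Y"
  proof (rule rep_homI)
    fix \<mu> x assume \<mu>: "\<mu> \<in> arcs Q" "x \<in> sp X (tail Q \<mu>)" "head Q \<mu> \<in> V"
    have "?ok (tail Q \<nu>) (f (tail Q \<nu>))" if "\<nu> \<in> into (head Q \<mu>)" for \<nu>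
      by (rule ok[OF into_tail[OF that]])
    moreover have "\<mu> \<in> into (head Q \<mu>)" using \<mu> by (simp add: into_iff)
    ultimately show "arr Y \<mu> (f (tail Q \<mu>) x) = f (head Q \<mu>) (arr X \<mu> x)"
      using f[of "head Q \<mu>"] \<mu> by simp
  qed (use ok wf_digraph_axioms in auto)
  then show thesis by (rule that) (simp add: ok)
qed

subsection \<open>Factoring morphisms of representations\<close>

text \<open>The factorisations at the vertices commute with the arrows because every element of
  \<open>N\<close> comes from \<open>M\<close>.\<close>

lemma rep_factor_surj:
  assumes "robj M" "robj N" "robj L"
    and q: "q \<in> rhom M N" "\<And>i. i \<in> V \<Longrightarrow> q i ` sp M i = sp N i"
    and h: "h \<in> rhom M L" "\<And>i x. \<lbrakk>i \<in> V; x \<in> sp M i; q i x = \<zero>[N,i]\<rbrakk> \<Longrightarrow> h i x = \<zero>[L,i]"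
  obtains u where "u \<in> rhom N L" "\<And>i x. \<lbrakk>i \<in> V; x \<in> sp M i\<rbrakk> \<Longrightarrow> u i (q i x) = h i x"
proof -
  have "\<exists>u\<in>homA (space N i) (space L i). \<forall>x\<in>sp M i. u (q i x) = h i x" if i: "i \<in> V" for i
  proof -
    obtain u where "u \<in> homA (space N i) (space L i)" "\<And>x. x \<in> sp M i \<Longrightarrow> u (q i x) = h i x"
      by (rule factor_surj[OF robj_lm[OF assms(1) i] robj_lm[OF assms(2) i] robj_lm[OF assms(3) i]
            rep_hom_at[OF q(1) i] q(2)[OF i] rep_hom_at[OF h(1) i] h(2)[OF i]]) blast+
    then show ?thesis by blast
  qed
  then obtain u where u: "\<And>i. i \<in> V \<Longrightarrow> u i \<in> homA (space N i) (space L i)"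
    "\<And>i x. \<lbrakk>i \<in> V; x \<in> sp M i\<rbrakk> \<Longrightarrow> u i (q i x) = h i x" by metis
  have "(\<lambda>i\<in>V. u i) \<in> rhom N L"
  proof (rule rep_homI[OF u(1) _ wf_digraph_axioms])
    fix \<mu> y assume \<mu>: "\<mu> \<in> arcs Q" "y \<in> sp N (tail Q \<mu>)" "tail Q \<mu> \<in> V" "head Q \<mu> \<in> V"
    obtain x where x: "x \<in> sp M (tail Q \<mu>)" "y = q (tail Q \<mu>) x" using q(2)[OF \<mu>(3)] \<mu>(2) by blast
    have "u (head Q \<mu>) (arr N \<mu> y) = u (head Q \<mu>) (q (head Q \<mu>) (arr M \<mu> x))"
      using rep_hom_arr[OF q(1) \<mu>(1) x(1)] x(2) by simp
    also have "\<dots> = h (head Q \<mu>) (arr M \<mu> x)" by (rule u(2)[OF \<mu>(4) arr_closed[OF assms(1) \<mu>(1) x(1)]])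
    also have "\<dots> = arr L \<mu> (u (tail Q \<mu>) y)"
      using rep_hom_arr[OF h(1) \<mu>(1) x(1)] u(2)[OF \<mu>(3) x(1)] x(2) by simp
    finally show "arr L \<mu> (u (tail Q \<mu>) y) = u (head Q \<mu>) (arr N \<mu> y)" by simp
  qed
  then show thesis by (rule that) (simp add: u(2))
qed

text \<open>Commutation with the arrows may be checked after applying the injective maps
  \<open>j\<close>, where it is the commutation of \<open>h\<close>.\<close>

lemma rep_factor_inj:
  assumes "robj M" "robj N" "robj L"
    and j: "j \<in> rhom M N" "\<And>i. i \<in> V \<Longrightarrow> inj_on (j i) (sp M i)"
    and h: "h \<in> rhom L N" "\<And>i. i \<in> V \<Longrightarrow> h i ` sp L i \<subseteq> j i ` sp M i"
  obtains u where "u \<in> rhom L M" "\<And>i x. \<lbrakk>i \<in> V; x \<in> sp L i\<rbrakk> \<Longrightarrow> j i (u i x) = h i x"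
proof -
  have "\<exists>u\<in>homA (space L i) (space M i). \<forall>x\<in>sp L i. j i (u x) = h i x" if i: "i \<in> V" for i
  proof -
    obtain u where "u \<in> homA (space L i) (space M i)" "\<And>x. x \<in> sp L i \<Longrightarrow> j i (u x) = h i x"
      by (rule factor_inj[OF robj_lm[OF assms(1) i] robj_lm[OF assms(2) i] robj_lm[OF assms(3) i]
            rep_hom_at[OF j(1) i] j(2)[OF i] rep_hom_at[OF h(1) i] h(2)[OF i]]) blast+
    then show ?thesis by blast
  qed
  then obtain u where u: "\<And>i. i \<in> V \<Longrightarrow> u i \<in> homA (space L i) (space M i)"
    "\<And>i x. \<lbrakk>i \<in> V; x \<in> sp L i\<rbrakk> \<Longrightarrow> j i (u i x) = h i x" by metis
  have "(\<lambda>i\<in>V. u i) \<in> rhom L M"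
  proof (rule rep_homI[OF u(1) _ wf_digraph_axioms])
    fix \<mu> y assume \<mu>: "\<mu> \<in> arcs Q" "y \<in> sp L (tail Q \<mu>)" "tail Q \<mu> \<in> V" "head Q \<mu> \<in> V"
    have uy: "u (tail Q \<mu>) y \<in> sp M (tail Q \<mu>)" "arr L \<mu> y \<in> sp L (head Q \<mu>)"
      using mod_hom_closed[OF u(1)[OF \<mu>(3)] \<mu>(2)] arr_closed[OF assms(3) \<mu>(1,2)] by auto
    have "j (head Q \<mu>) (arr M \<mu> (u (tail Q \<mu>) y)) = j (head Q \<mu>) (u (head Q \<mu>) (arr L \<mu> y))"
      using rep_hom_arr[OF j(1) \<mu>(1) uy(1)] u(2)[OF \<mu>(3,2)] rep_hom_arr[OF h(1) \<mu>(1,2)] u(2)[OF \<mu>(4) uy(2)] by simp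
    then show "arr M \<mu> (u (tail Q \<mu>) y) = u (head Q \<mu>) (arr L \<mu> y)"
      using j(2)[OF \<mu>(4)] arr_closed[OF assms(1) \<mu>(1) uy(1)] mod_hom_closed[OF u(1)[OF \<mu>(4)] uy(2)]
      by (simp add: inj_on_eq_iff)
  qed
  then show thesis by (rule that) (simp add: u(2))
qed

subsection \<open>Subrepresentations and quotients\<close>

definition subrep :: "('v, 'e, 'a, 'n) rep \<Rightarrow> ('v \<Rightarrow> 'n set) \<Rightarrow> bool" where
  "subrep X U \<longleftrightarrow> (\<forall>i\<in>V. lsub A (space X i) (U i)) \<and> (\<forall>\<mu>\<in>arcs Q. \<forall>x\<in>U (tail Q \<mu>). arr X \<mu> x \<in> U (head Q \<mu>))"

definition sub_rep :: "('v, 'e, 'a, 'n) rep \<Rightarrow> ('v \<Rightarrow> 'n set) \<Rightarrow> ('v, 'e, 'a, 'n) rep" where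
  "sub_rep X U = \<lparr>space = (\<lambda>i. (space X i)\<lparr>carrier := U i\<rparr>), arr = (\<lambda>\<mu>. restrict (arr X \<mu>) (U (tail Q \<mu>)))\<rparr>"

lemma sub_rep_simps [simp]:
  "space (sub_rep X U) i = (space X i)\<lparr>carrier := U i\<rparr>"
  "arr (sub_rep X U) \<mu> = restrict (arr X \<mu>) (U (tail Q \<mu>))"
  by (auto simp: sub_rep_def)

lemma subrepD: "\<lbrakk>subrep X U; i \<in> V\<rbrakk> \<Longrightarrow> lsub A (space X i) (U i)"
  by (simp add: subrep_def)

lemma sub_rep_robj:
  assumes "robj X" "subrep X U"
  shows "robj (sub_rep X U)"
  unfolding robj_iff
proof (intro conjI ballI)
  fix i assume i: "i \<in> V"
  then show "fd_module K A (space (sub_rep X U) i)"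
    using fd_module_lsub[OF robj_fd[OF assms(1) i] subrepD[OF assms(2) i]] by simp
next
  fix \<mu> assume \<mu>: "\<mu> \<in> arcs Q"
  have "restrict (arr X \<mu>) (U (tail Q \<mu>)) \<in>
    homA ((space X (tail Q \<mu>))\<lparr>carrier := U (tail Q \<mu>)\<rparr>) ((space X (head Q \<mu>))\<lparr>carrier := U (head Q \<mu>)\<rparr>)"
    using mod_hom_restrict_dom[OF robj_arr[OF assms(1) \<mu>] subrepD[OF assms(2)]] \<mu> assms(2)
    by (intro mod_hom_restrict_cod) (auto simp: subrep_def)
  then show "arr (sub_rep X U) \<mu> \<in> homA (space (sub_rep X U) (tail Q \<mu>)) (space (sub_rep X U) (head Q \<mu>))"
    by simp
qed

definition sub_incl :: "('v \<Rightarrow> 'n set) \<Rightarrow> 'v \<Rightarrow> 'n \<Rightarrow> 'n" where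
  "sub_incl U = (\<lambda>i\<in>V. \<lambda>x\<in>U i. x)"

lemma sub_incl_rhom:
  assumes "robj X" "subrep X U"
  shows "sub_incl U \<in> rhom (sub_rep X U) X"
  unfolding sub_incl_def
  using assms(2) mod_hom_incl[OF robj_lm[OF assms(1)] subrepD[OF assms(2)]]
  by (intro rep_homI wf_digraph_axioms) (auto simp: subrep_def)

lemma sub_incl_apply: "\<lbrakk>i \<in> V; x \<in> U i\<rbrakk> \<Longrightarrow> sub_incl U i x = x"
  by (simp add: sub_incl_def)

text \<open>Followed by the inclusion, \<delta> of the subrepresentation is \<delta> of
  \<open>X\<close> on families with members in \<open>U\<close>. So monic representations are closed
  under subobjects; quotients need the condition in \<open>quotient_monic\<close>.\<close>

lemma sub_rep_mobj:
  assumes "mobj X" "subrep X U"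
  shows "mobj (sub_rep X U)"
proof -
  have X: "robj X" "monic Q X" using assms(1) by (auto simp: mobj_iff)
  note S = sub_rep_robj[OF X(1) assms(2)] and I = sub_incl_rhom[OF X(1) assms(2)]
  have "w \<mu> = \<zero>[(sub_rep X U),tail Q \<mu>]"
    if i: "i \<in> V" and w: "w \<in> dsp (sub_rep X U) i"
      "delta Q (sub_rep X U) i w = \<zero>[(sub_rep X U),i]" and \<mu>: "\<mu> \<in> into i" for i w \<mu>
  proof -
    have "delta Q X i (push i (sub_incl U) w) = \<zero>[X,i]"
      using delta_push[OF S X(1) I i w(1)] rhom_zero[OF I S X(1) i] w(2) by simp
    then have "push i (sub_incl U) w \<mu> = \<zero>[X,tail Q \<mu>]"
      by (rule monicD[OF X i rhom_push_closed[OF I w(1)] _ \<mu>])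
    moreover have "w \<mu> \<in> U (tail Q \<mu>)" using prodm_mem[OF w(1) \<mu>] by simp
    ultimately show ?thesis using \<mu> into_tail[OF \<mu>] by (simp add: push_def sub_incl_apply)
  qed
  then show ?thesis using S monic_iff[OF S] by (simp add: mobj_iff)
qed

text \<open>The quotient is formed vertexwise and directly in a prescribed type \<open>'t\<close>;
  the arrows descend by \<open>factor_surj\<close>.\<close>

lemma rep_quotient:
  fixes X :: "('v, 'e, 'a, 'n) rep"
  assumes "robj X" "subrep X U" "lists (carrier K) \<lesssim> (UNIV :: 't set)"
  obtains Z :: "('v, 'e, 'a, 't) rep" and q where "robj Z" "q \<in> rhom X Z"
    "\<And>i. i \<in> V \<Longrightarrow> q i ` sp X i = sp Z i" "\<And>i x. \<lbrakk>i \<in> V; x \<in> sp X i\<rbrakk> \<Longrightarrow> q i x = \<zero>[Z,i] \<longleftrightarrow> x \<in> U i"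
proof -
  have "\<exists>N q. fd_module K A (N :: ('a, 't) module) \<and> q \<in> homA (space X i) N \<and> q ` sp X i = carrier N \<and>
    (\<forall>x\<in>sp X i. q x = \<zero>\<^bsub>N\<^esub> \<longleftrightarrow> x \<in> U i)" if i: "i \<in> V" for i
  proof -
    obtain N :: "('a, 't) module" and q where "fd_module K A N" "q \<in> homA (space X i) N"
      "q ` sp X i = carrier N" "\<And>x. x \<in> sp X i \<Longrightarrow> q x = \<zero>\<^bsub>N\<^esub> \<longleftrightarrow> x \<in> U i"
      by (rule fd_quotient[OF robj_fd[OF assms(1) i] subrepD[OF assms(2) i] assms(3)]) blast
    then show ?thesis by blast
  qed
  then obtain N :: "'v \<Rightarrow> ('a, 't) module" and q where N: "\<And>i. i \<in> V \<Longrightarrow> fd_module K A (N i)"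
    "\<And>i. i \<in> V \<Longrightarrow> q i \<in> homA (space X i) (N i)" "\<And>i. i \<in> V \<Longrightarrow> q i ` sp X i = carrier (N i)"
    "\<And>i x. \<lbrakk>i \<in> V; x \<in> sp X i\<rbrakk> \<Longrightarrow> q i x = \<zero>\<^bsub>N i\<^esub> \<longleftrightarrow> x \<in> U i"
    by metis
  have "\<exists>a\<in>homA (N (tail Q \<mu>)) (N (head Q \<mu>)). \<forall>x\<in>sp X (tail Q \<mu>). a (q (tail Q \<mu>) x) = q (head Q \<mu>) (arr X \<mu> x)"
    if \<mu>: "\<mu> \<in> arcs Q" for \<mu>
  proof -
    have t: "tail Q \<mu> \<in> V" "head Q \<mu> \<in> V" using \<mu> by auto
    let ?h = "compose (sp X (tail Q \<mu>)) (q (head Q \<mu>)) (arr X \<mu>)"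
    have h: "?h \<in> homA (space X (tail Q \<mu>)) (N (head Q \<mu>))"
      by (rule mod_hom_compose[OF robj_arr[OF assms(1) \<mu>] N(2)[OF t(2)] robj_lm[OF assms(1) t(1)]])
    have ker: "?h x = \<zero>\<^bsub>N (head Q \<mu>)\<^esub>" if x: "x \<in> sp X (tail Q \<mu>)" "q (tail Q \<mu>) x = \<zero>\<^bsub>N (tail Q \<mu>)\<^esub>" for x
    proof -
      have "arr X \<mu> x \<in> U (head Q \<mu>)" using N(4)[OF t(1) x(1)] x(2) assms(2) \<mu> by (simp add: subrep_def)
      then show ?thesis using N(4)[OF t(2) arr_closed[OF assms(1) \<mu> x(1)]] x(1) by (simp add: compose_def)
    qed
    obtain a where "a \<in> homA (N (tail Q \<mu>)) (N (head Q \<mu>))"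
      "\<And>x. x \<in> sp X (tail Q \<mu>) \<Longrightarrow> a (q (tail Q \<mu>) x) = ?h x"
      by (rule factor_surj[OF robj_lm[OF assms(1) t(1)] fd_left_module[OF N(1)[OF t(1)]]
            fd_left_module[OF N(1)[OF t(2)]] N(2)[OF t(1)] N(3)[OF t(1)] h ker]) blast+
    then show ?thesis by (intro bexI[of _ a]) (auto simp: compose_def)
  qed
  then obtain a where a: "\<And>\<mu>. \<mu> \<in> arcs Q \<Longrightarrow> a \<mu> \<in> homA (N (tail Q \<mu>)) (N (head Q \<mu>))"
    "\<And>\<mu> x. \<lbrakk>\<mu> \<in> arcs Q; x \<in> sp X (tail Q \<mu>)\<rbrakk> \<Longrightarrow> a \<mu> (q (tail Q \<mu>) x) = q (head Q \<mu>) (arr X \<mu> x)"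
    by metis
  show thesis
  proof (rule that[of "\<lparr>space = N, arr = a\<rparr>" "\<lambda>i\<in>V. q i"])
    show "robj \<lparr>space = N, arr = a\<rparr>" using N(1) a(1) by (simp add: robj_iff)
    show "(\<lambda>i\<in>V. q i) \<in> rhom X \<lparr>space = N, arr = a\<rparr>"
      by (rule rep_homI) (simp_all add: N(2) a(2) wf_digraph_axioms)
  qed (simp_all add: N(3,4))
qed

text \<open>The condition says that a family sent by \<delta>_i into the kernel of \<open>q\<close>
  consists of elements of the kernel: injectivity of \<delta>_i on the quotient, read in
  \<open>X\<close>.\<close>

lemma quotient_monic:
  assumes "robj X" "robj Z" "q \<in> rhom X Z" "\<And>i. i \<in> V \<Longrightarrow> q i ` sp X i = sp Z i"
    and M: "\<And>i w \<mu>. \<lbrakk>i \<in> V; w \<in> dsp X i; q i (delta Q X i w) = \<zero>[Z,i]; \<mu> \<in> into i\<rbrakk>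
      \<Longrightarrow> q (tail Q \<mu>) (w \<mu>) = \<zero>[Z,tail Q \<mu>]"
  shows "mobj Z"
proof -
  have "w' \<mu> = \<zero>[Z,tail Q \<mu>]"
    if i: "i \<in> V" and w': "w' \<in> dsp Z i" "delta Q Z i w' = \<zero>[Z,i]" and \<mu>: "\<mu> \<in> into i" for i w' \<mu>
  proof -
    have "\<exists>x\<in>sp X (tail Q \<nu>). q (tail Q \<nu>) x = w' \<nu>" if \<nu>: "\<nu> \<in> into i" for \<nu>
    proof -
      have "w' \<nu> \<in> q (tail Q \<nu>) ` sp X (tail Q \<nu>)"
        using prodm_mem[OF w'(1) \<nu>] assms(4)[OF into_tail[OF \<nu>]] by simp
      then show ?thesis by (metis imageE)
    qed
    then obtain x where x: "\<And>\<nu>. \<nu> \<in> into i \<Longrightarrow> x \<nu> \<in> sp X (tail Q \<nu>)" "\<And>\<nu>. \<nu> \<in> into i \<Longrightarrow> q (tail Q \<nu>) (x \<nu>) = w' \<nu>"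
      by metis
    let ?w = "\<lambda>\<nu>\<in>into i. x \<nu>"
    have w: "?w \<in> dsp X i" using x(1) by simp
    have "push i q ?w = w'"
    proof (rule extensionalityI[of _ "into i"])
      show "w' \<in> extensional (into i)" using w'(1) by (simp add: PiE_def)
    qed (simp_all add: push_def x(2))
    then have "q i (delta Q X i ?w) = \<zero>[Z,i]" using delta_push[OF assms(1-3) i w] w'(2) by simp
    then show ?thesis using M[OF i w _ \<mu>] x(2)[OF \<mu>] \<mu> by simp
  qed
  then show ?thesis using assms(2) monic_iff[OF assms(2)] by (simp add: mobj_iff)
qed

lemma subrep_zero: "robj X \<Longrightarrow> subrep X (\<lambda>i. {\<zero>[X,i]})"
  using mod_hom_zero[OF robj_lm robj_lm robj_arr] by (auto simp: subrep_def lsub_zero robj_lm)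

text \<open>The quotient by zero serves as an isomorphic copy with elements of another type.\<close>

lemma rep_transport:
  fixes X :: "('v, 'e, 'a, 'n) rep"
  assumes "mobj X" "lists (carrier K) \<lesssim> (UNIV :: 't set)"
  obtains Z :: "('v, 'e, 'a, 't) rep" and q where "mobj Z" "q \<in> rhom X Z"
    "\<And>i. i \<in> V \<Longrightarrow> bij_betw (q i) (sp X i) (sp Z i)"
proof -
  have X: "robj X" "monic Q X" using assms(1) by (auto simp: mobj_iff)
  obtain Z :: "('v, 'e, 'a, 't) rep" and q where Z: "robj Z" "q \<in> rhom X Z"
    "\<And>i. i \<in> V \<Longrightarrow> q i ` sp X i = sp Z i" "\<And>i x. \<lbrakk>i \<in> V; x \<in> sp X i\<rbrakk> \<Longrightarrow> q i x = \<zero>[Z,i] \<longleftrightarrow> x \<in> {\<zero>[X,i]}"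
    by (rule rep_quotient[OF X(1) subrep_zero[OF X(1)] assms(2)]) blast
  have "mobj Z"
  proof (rule quotient_monic[OF X(1) Z(1-3)])
    fix i w \<mu> assume *: "i \<in> V" "w \<in> dsp X i" "q i (delta Q X i w) = \<zero>[Z,i]" "\<mu> \<in> into i"
    have "delta Q X i w = \<zero>[X,i]" using Z(4)[OF *(1) delta_closed[OF X(1) *(1,2)]] *(3) by simp
    then have "w \<mu> = \<zero>[X,tail Q \<mu>]" by (rule monicD[OF X *(1,2) _ *(4)])
    then show "q (tail Q \<mu>) (w \<mu>) = \<zero>[Z,tail Q \<mu>]"
      using rhom_zero[OF Z(2) X(1) Z(1) into_tail[OF *(4)]] by simp
  qed
  moreover have "bij_betw (q i) (sp X i) (sp Z i)" if i: "i \<in> V" for i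
    unfolding bij_betw_def rhom_inj_iff[OF Z(2) X(1) Z(1) i] using Z(3,4)[OF i] by simp
  ultimately show thesis using Z(2) that by blast
qed

subsection \<open>Direct sums of two representations\<close>

text \<open>Its elements are pairs, so it becomes an object of the category only after transport
  (\<open>rep_transport\<close>).\<close>

definition pair_rep :: "('v, 'e, 'a, 'm) rep \<Rightarrow> ('v, 'e, 'a, 'n) rep \<Rightarrow> ('v, 'e, 'a, 'm \<times> 'n) rep" where
  "pair_rep X Y = \<lparr>space = (\<lambda>i. pairm (space X i) (space Y i)),
     arr = (\<lambda>\<mu>. \<lambda>z\<in>sp X (tail Q \<mu>) \<times> sp Y (tail Q \<mu>). (arr X \<mu> (fst z), arr Y \<mu> (snd z)))\<rparr>"

lemma pair_rep_simps [simp]: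
  "space (pair_rep X Y) i = pairm (space X i) (space Y i)"
  "arr (pair_rep X Y) \<mu> = (\<lambda>z\<in>sp X (tail Q \<mu>) \<times> sp Y (tail Q \<mu>). (arr X \<mu> (fst z), arr Y \<mu> (snd z)))"
  by (auto simp: pair_rep_def)

definition "pair_fst X Y = (\<lambda>i\<in>V. \<lambda>z\<in>sp X i \<times> sp Y i. fst z)"
definition "pair_snd X Y = (\<lambda>i\<in>V. \<lambda>z\<in>sp X i \<times> sp Y i. snd z)"

lemma pair_rep_robj:
  assumes "robj X" "robj Y"
  shows "robj (pair_rep X Y)"
  unfolding robj_iff
proof (intro conjI ballI)
  fix i assume i: "i \<in> V"
  then show "fd_module K A (space (pair_rep X Y) i)"
    using fd_module_pairm[OF robj_fd[OF assms(1) i] robj_fd[OF assms(2) i]] by simp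
next
  fix \<mu> assume \<mu>: "\<mu> \<in> arcs Q"
  have t: "tail Q \<mu> \<in> V" using \<mu> by simp
  interpret P: left_module A "pairm (space X (tail Q \<mu>)) (space Y (tail Q \<mu>))"
    by (rule left_module_pairm[OF robj_lm[OF assms(1) t] robj_lm[OF assms(2) t]])
  note a = robj_arr[OF assms(1) \<mu>] robj_arr[OF assms(2) \<mu>]
  have "(\<lambda>z\<in>carrier (pairm (space X (tail Q \<mu>)) (space Y (tail Q \<mu>))). (arr X \<mu> (fst z), arr Y \<mu> (snd z)))
    \<in> homA (pairm (space X (tail Q \<mu>)) (space Y (tail Q \<mu>))) (pairm (space X (head Q \<mu>)) (space Y (head Q \<mu>)))"
  proof (intro mod_homI conjI)
    fix z y assume z: "z \<in> carrier (pairm (space X (tail Q \<mu>)) (space Y (tail Q \<mu>)))"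
    then show "(arr X \<mu> (fst z), arr Y \<mu> (snd z)) \<in> carrier (pairm (space X (head Q \<mu>)) (space Y (head Q \<mu>)))"
      by (auto intro: mod_hom_closed[OF a(1)] mod_hom_closed[OF a(2)])
    assume y: "y \<in> carrier (pairm (space X (tail Q \<mu>)) (space Y (tail Q \<mu>)))"
    show "z \<oplus>\<^bsub>pairm (space X (tail Q \<mu>)) (space Y (tail Q \<mu>))\<^esub> y \<in> carrier (pairm (space X (tail Q \<mu>)) (space Y (tail Q \<mu>)))"
      by (rule P.M.a_closed[OF z y])
  qed (auto simp: mod_hom_add[OF a(1)] mod_hom_add[OF a(2)] mod_hom_smult[OF a(1)] mod_hom_smult[OF a(2)]
        left_module.smult_closed[OF robj_lm[OF assms(1) t]] left_module.smult_closed[OF robj_lm[OF assms(2) t]])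
  then show "arr (pair_rep X Y) \<mu> \<in> homA (space (pair_rep X Y) (tail Q \<mu>)) (space (pair_rep X Y) (head Q \<mu>))"
    by simp
qed

lemma pair_fst_rhom:
  assumes "robj X" "robj Y"
  shows "pair_fst X Y \<in> rhom (pair_rep X Y) X"
  unfolding pair_fst_def
proof (rule rep_homI[OF _ _ wf_digraph_axioms])
  fix i assume i: "i \<in> V"
  interpret P: left_module A "pairm (space X i) (space Y i)"
    by (rule left_module_pairm[OF robj_lm[OF assms(1) i] robj_lm[OF assms(2) i]])
  have "(\<lambda>z\<in>carrier (pairm (space X i) (space Y i)). fst z) \<in> homA (pairm (space X i) (space Y i)) (space X i)"
    by (intro mod_homI conjI P.M.a_closed P.smult_closed) auto
  then show "(\<lambda>z\<in>sp X i \<times> sp Y i. fst z) \<in> homA (space (pair_rep X Y) i) (space X i)" by simp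
qed (use arr_closed[OF assms(1)] arr_closed[OF assms(2)] in auto)

lemma pair_snd_rhom:
  assumes "robj X" "robj Y"
  shows "pair_snd X Y \<in> rhom (pair_rep X Y) Y"
  unfolding pair_snd_def
proof (rule rep_homI[OF _ _ wf_digraph_axioms])
  fix i assume i: "i \<in> V"
  interpret P: left_module A "pairm (space X i) (space Y i)"
    by (rule left_module_pairm[OF robj_lm[OF assms(1) i] robj_lm[OF assms(2) i]])
  have "(\<lambda>z\<in>carrier (pairm (space X i) (space Y i)). snd z) \<in> homA (pairm (space X i) (space Y i)) (space Y i)"
    by (intro mod_homI conjI P.M.a_closed P.smult_closed) auto
  then show "(\<lambda>z\<in>sp X i \<times> sp Y i. snd z) \<in> homA (space (pair_rep X Y) i) (space Y i)" by simp
qed (use arr_closed[OF assms(1)] arr_closed[OF assms(2)] in auto)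

lemma pair_tuple_rhom:
  assumes "f \<in> rhom W X" "g \<in> rhom W Y" "robj W"
  shows "(\<lambda>i\<in>V. \<lambda>x\<in>sp W i. (f i x, g i x)) \<in> rhom W (pair_rep X Y)"
proof (rule rep_homI[OF _ _ wf_digraph_axioms])
  fix i assume i: "i \<in> V"
  interpret W: left_module A "space W i" by (rule robj_lm[OF assms(3) i])
  note fg = rep_hom_at[OF assms(1) i] rep_hom_at[OF assms(2) i]
  show "(\<lambda>x\<in>sp W i. (f i x, g i x)) \<in> homA (space W i) (space (pair_rep X Y) i)"
    by (rule mod_homI)
      (auto simp: mod_hom_closed[OF fg(1)] mod_hom_closed[OF fg(2)] mod_hom_add[OF fg(1)] mod_hom_add[OF fg(2)]
        mod_hom_smult[OF fg(1)] mod_hom_smult[OF fg(2)] W.smult_closed)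
next
  fix \<mu> x assume *: "\<mu> \<in> arcs Q" "x \<in> sp W (tail Q \<mu>)" "tail Q \<mu> \<in> V"
  then show "arr (pair_rep X Y) \<mu> ((\<lambda>x\<in>sp W (tail Q \<mu>). (f (tail Q \<mu>) x, g (tail Q \<mu>) x)) x) =
    (\<lambda>x\<in>sp W (head Q \<mu>). (f (head Q \<mu>) x, g (head Q \<mu>) x)) (arr W \<mu> x)"
    using rep_hom_arr[OF assms(1) *(1,2)] rep_hom_arr[OF assms(2) *(1,2)] arr_closed[OF assms(3) *(1,2)]
      rhom_closed[OF assms(1) *(3,2)] rhom_closed[OF assms(2) *(3,2)] by simp
qed

lemma delta_pair:
  assumes "robj X" "robj Y" "i \<in> V" "w \<in> dsp (pair_rep X Y) i"
  shows "delta Q (pair_rep X Y) i w = (delta Q X i (\<lambda>\<mu>\<in>into i. fst (w \<mu>)), delta Q Y i (\<lambda>\<mu>\<in>into i. snd (w \<mu>)))"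
proof -
  note P = pair_rep_robj[OF assms(1,2)]
  have mem: "w \<mu> \<in> sp X (tail Q \<mu>) \<times> sp Y (tail Q \<mu>)" if "\<mu> \<in> into i" for \<mu>
    using prodm_mem[OF assms(4) that] by simp
  have d: "delta Q (pair_rep X Y) i w \<in> sp X i \<times> sp Y i" using delta_closed[OF P assms(3,4)] by simp
  have "push i (pair_fst X Y) w = (\<lambda>\<mu>\<in>into i. fst (w \<mu>))" "push i (pair_snd X Y) w = (\<lambda>\<mu>\<in>into i. snd (w \<mu>))"
    using mem into_tail by (auto simp: push_def fun_eq_iff pair_fst_def pair_snd_def)
  then show ?thesis
    using delta_push[OF P assms(1) pair_fst_rhom[OF assms(1,2)] assms(3,4)]
      delta_push[OF P assms(2) pair_snd_rhom[OF assms(1,2)] assms(3,4)] d assms(3)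
    by (auto simp: pair_fst_def pair_snd_def prod_eq_iff)
qed

lemma pair_rep_mobj:
  assumes "mobj X" "mobj Y"
  shows "mobj (pair_rep X Y)"
proof -
  have X: "robj X" "monic Q X" and Y: "robj Y" "monic Q Y" using assms by (auto simp: mobj_iff)
  note P = pair_rep_robj[OF X(1) Y(1)]
  have "w \<mu> = \<zero>[(pair_rep X Y),tail Q \<mu>]"
    if i: "i \<in> V" and w: "w \<in> dsp (pair_rep X Y) i"
      "delta Q (pair_rep X Y) i w = \<zero>[(pair_rep X Y),i]" and \<mu>: "\<mu> \<in> into i" for i w \<mu>
  proof -
    have mem: "w \<nu> \<in> sp X (tail Q \<nu>) \<times> sp Y (tail Q \<nu>)" if "\<nu> \<in> into i" for \<nu>
      using prodm_mem[OF w(1) that] by simp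
    have c: "(\<lambda>\<mu>\<in>into i. fst (w \<mu>)) \<in> dsp X i" "(\<lambda>\<mu>\<in>into i. snd (w \<mu>)) \<in> dsp Y i"
      using mem by (auto simp: mem_Times_iff)
    have "delta Q X i (\<lambda>\<mu>\<in>into i. fst (w \<mu>)) = \<zero>[X,i]" "delta Q Y i (\<lambda>\<mu>\<in>into i. snd (w \<mu>)) = \<zero>[Y,i]"
      using delta_pair[OF X(1) Y(1) i w(1)] w(2) by auto
    then show ?thesis
      using monicD[OF X i c(1) _ \<mu>] monicD[OF Y i c(2) _ \<mu>] \<mu> by (simp add: prod_eq_iff)
  qed
  then show ?thesis using P monic_iff[OF P] by (simp add: mobj_iff)
qed

end

section \<open>The exact structure on monic representations\<close>

context quiver_algebra
begin

lemma sub_rep_sp: "sp (sub_rep X U) i = U i"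
  by simp

lemma push_surj:
  assumes "w \<in> dsp Y i" "\<And>\<mu>. \<mu> \<in> into i \<Longrightarrow> w \<mu> \<in> f (tail Q \<mu>) ` sp X (tail Q \<mu>)"
  obtains x where "x \<in> dsp X i" "push i f x = w"
proof -
  have "\<exists>y\<in>sp X (tail Q \<mu>). w \<mu> = f (tail Q \<mu>) y" if "\<mu> \<in> into i" for \<mu>
    using assms(2)[OF that] by (metis imageE)
  then obtain x where x: "\<And>\<mu>. \<mu> \<in> into i \<Longrightarrow> x \<mu> \<in> sp X (tail Q \<mu>)" "\<And>\<mu>. \<mu> \<in> into i \<Longrightarrow> w \<mu> = f (tail Q \<mu>) (x \<mu>)"
    by metis
  have "push i f (\<lambda>\<mu>\<in>into i. x \<mu>) = w"
  proof (rule extensionalityI[of _ "into i"])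
    show "w \<in> extensional (into i)" using assms(1) by (simp add: PiE_def)
  qed (simp_all add: push_def x(2))
  moreover have "(\<lambda>\<mu>\<in>into i. x \<mu>) \<in> dsp X i" using x(1) by simp
  ultimately show thesis using that by metis
qed

text \<open>This and the following operations agree with those of the category
  (\<open>C_simps\<close>), but allow different element types, since free representations and direct
  sums have their own.\<close>

definition rcomp :: "('v, 'e, 'a, 'm) rep \<Rightarrow> ('v \<Rightarrow> 'n \<Rightarrow> 'p) \<Rightarrow> ('v \<Rightarrow> 'm \<Rightarrow> 'n) \<Rightarrow> 'v \<Rightarrow> 'm \<Rightarrow> 'p" where
  "rcomp X g f = (\<lambda>i\<in>V. \<lambda>x\<in>sp X i. g i (f i x))"

definition rplus :: "('v, 'e, 'a, 'm) rep \<Rightarrow> ('v, 'e, 'a, 'n) rep \<Rightarrow> ('v \<Rightarrow> 'm \<Rightarrow> 'n) \<Rightarrow> ('v \<Rightarrow> 'm \<Rightarrow> 'n) \<Rightarrow> 'v \<Rightarrow> 'm \<Rightarrow> 'n" where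
  "rplus X Y f g = (\<lambda>i\<in>V. \<lambda>x\<in>sp X i. f i x \<oplus>\<^bsub>space Y i\<^esub> g i x)"

definition rminus :: "('v, 'e, 'a, 'm) rep \<Rightarrow> ('v, 'e, 'a, 'n) rep \<Rightarrow> ('v \<Rightarrow> 'm \<Rightarrow> 'n) \<Rightarrow> ('v \<Rightarrow> 'm \<Rightarrow> 'n) \<Rightarrow> 'v \<Rightarrow> 'm \<Rightarrow> 'n" where
  "rminus X Y f g = (\<lambda>i\<in>V. \<lambda>x\<in>sp X i. f i x \<ominus>\<^bsub>space Y i\<^esub> g i x)"

definition rzero :: "('v, 'e, 'a, 'm) rep \<Rightarrow> ('v, 'e, 'a, 'n) rep \<Rightarrow> 'v \<Rightarrow> 'm \<Rightarrow> 'n" where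
  "rzero X Y = (\<lambda>i\<in>V. \<lambda>x\<in>sp X i. \<zero>[Y,i])"

definition rid :: "('v, 'e, 'a, 'm) rep \<Rightarrow> 'v \<Rightarrow> 'm \<Rightarrow> 'm" where
  "rid X = (\<lambda>i\<in>V. \<lambda>x\<in>sp X i. x)"

lemma rcomp_apply [simp]: "\<lbrakk>i \<in> V; x \<in> sp X i\<rbrakk> \<Longrightarrow> rcomp X g f i x = g i (f i x)"
  by (simp add: rcomp_def)

lemma rplus_apply [simp]: "\<lbrakk>i \<in> V; x \<in> sp X i\<rbrakk> \<Longrightarrow> rplus X Y f g i x = f i x \<oplus>\<^bsub>space Y i\<^esub> g i x"
  by (simp add: rplus_def)

lemma rminus_apply [simp]: "\<lbrakk>i \<in> V; x \<in> sp X i\<rbrakk> \<Longrightarrow> rminus X Y f g i x = f i x \<ominus>\<^bsub>space Y i\<^esub> g i x"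
  by (simp add: rminus_def)

lemma rzero_apply [simp]: "\<lbrakk>i \<in> V; x \<in> sp X i\<rbrakk> \<Longrightarrow> rzero X Y i x = \<zero>[Y,i]"
  by (simp add: rzero_def)

lemma rid_apply [simp]: "\<lbrakk>i \<in> V; x \<in> sp X i\<rbrakk> \<Longrightarrow> rid X i x = x"
  by (simp add: rid_def)

lemma rcomp_rhom:
  assumes "f \<in> rhom X Y" "g \<in> rhom Y Z" "robj X"
  shows "rcomp X g f \<in> rhom X Z"
  unfolding rcomp_def
proof (rule rep_homI[OF _ _ wf_digraph_axioms])
  fix i assume i: "i \<in> V"
  show "(\<lambda>x\<in>sp X i. g i (f i x)) \<in> homA (space X i) (space Z i)"
    using mod_hom_compose[OF rep_hom_at[OF assms(1) i] rep_hom_at[OF assms(2) i] robj_lm[OF assms(3) i]]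
    by (simp add: compose_def)
next
  fix \<mu> x assume *: "\<mu> \<in> arcs Q" "x \<in> sp X (tail Q \<mu>)" "tail Q \<mu> \<in> V"
  then show "arr Z \<mu> ((\<lambda>x\<in>sp X (tail Q \<mu>). g (tail Q \<mu>) (f (tail Q \<mu>) x)) x) =
    (\<lambda>x\<in>sp X (head Q \<mu>). g (head Q \<mu>) (f (head Q \<mu>) x)) (arr X \<mu> x)"
    using rep_hom_arr[OF assms(1) *(1,2)] rep_hom_arr[OF assms(2) *(1) rhom_closed[OF assms(1) *(3,2)]]
      arr_closed[OF assms(3) *(1,2)] by simp
qed

lemma rplus_rhom:
  assumes "f \<in> rhom X Y" "g \<in> rhom X Y" "robj X" "robj Y"
  shows "rplus X Y f g \<in> rhom X Y"
  unfolding rplus_def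
proof (rule rep_homI[OF _ _ wf_digraph_axioms])
  fix i assume i: "i \<in> V"
  show "(\<lambda>x\<in>sp X i. f i x \<oplus>\<^bsub>space Y i\<^esub> g i x) \<in> homA (space X i) (space Y i)"
    by (rule mod_hom_plus[OF rep_hom_at[OF assms(1) i] rep_hom_at[OF assms(2) i] robj_lm[OF assms(3) i] robj_lm[OF assms(4) i]])
next
  fix \<mu> x assume *: "\<mu> \<in> arcs Q" "x \<in> sp X (tail Q \<mu>)" "tail Q \<mu> \<in> V"
  then show "arr Y \<mu> ((\<lambda>x\<in>sp X (tail Q \<mu>). f (tail Q \<mu>) x \<oplus>\<^bsub>space Y (tail Q \<mu>)\<^esub> g (tail Q \<mu>) x) x) =
    (\<lambda>x\<in>sp X (head Q \<mu>). f (head Q \<mu>) x \<oplus>\<^bsub>space Y (head Q \<mu>)\<^esub> g (head Q \<mu>) x) (arr X \<mu> x)"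
    using rep_hom_arr[OF assms(1) *(1,2)] rep_hom_arr[OF assms(2) *(1,2)] arr_closed[OF assms(3) *(1,2)]
      mod_hom_add[OF robj_arr[OF assms(4) *(1)] rhom_closed[OF assms(1) *(3,2)] rhom_closed[OF assms(2) *(3,2)]]
    by simp
qed

lemma rminus_rhom:
  assumes "f \<in> rhom X Y" "g \<in> rhom X Y" "robj X" "robj Y"
  shows "rminus X Y f g \<in> rhom X Y"
  unfolding rminus_def
proof (rule rep_homI[OF _ _ wf_digraph_axioms])
  fix i assume i: "i \<in> V"
  show "(\<lambda>x\<in>sp X i. f i x \<ominus>\<^bsub>space Y i\<^esub> g i x) \<in> homA (space X i) (space Y i)"
    by (rule mod_hom_diff[OF rep_hom_at[OF assms(1) i] rep_hom_at[OF assms(2) i] robj_lm[OF assms(3) i] robj_lm[OF assms(4) i]])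
next
  fix \<mu> x assume *: "\<mu> \<in> arcs Q" "x \<in> sp X (tail Q \<mu>)" "tail Q \<mu> \<in> V" "head Q \<mu> \<in> V"
  then show "arr Y \<mu> ((\<lambda>x\<in>sp X (tail Q \<mu>). f (tail Q \<mu>) x \<ominus>\<^bsub>space Y (tail Q \<mu>)\<^esub> g (tail Q \<mu>) x) x) =
    (\<lambda>x\<in>sp X (head Q \<mu>). f (head Q \<mu>) x \<ominus>\<^bsub>space Y (head Q \<mu>)\<^esub> g (head Q \<mu>) x) (arr X \<mu> x)"
    using rep_hom_arr[OF assms(1) *(1,2)] rep_hom_arr[OF assms(2) *(1,2)] arr_closed[OF assms(3) *(1,2)]
      mod_hom_minus[OF robj_lm[OF assms(4) *(3)] robj_lm[OF assms(4) *(4)] robj_arr[OF assms(4) *(1)]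
        rhom_closed[OF assms(1) *(3,2)] rhom_closed[OF assms(2) *(3,2)]]
    by simp
qed

lemma rzero_rhom:
  assumes "robj X" "robj Y"
  shows "rzero X Y \<in> rhom X Y"
  unfolding rzero_def
  using mod_hom_const_zero[OF robj_lm[OF assms(1)] robj_lm[OF assms(2)]]
    mod_hom_zero[OF robj_lm[OF assms(2)] robj_lm[OF assms(2)] robj_arr[OF assms(2)]] arr_closed[OF assms(1)]
  by (intro rep_homI wf_digraph_axioms) simp_all

lemma rid_rhom:
  assumes "robj X"
  shows "rid X \<in> rhom X X"
  unfolding rid_def
  using mod_hom_id[OF robj_lm[OF assms]] arr_closed[OF assms]
  by (intro rep_homI wf_digraph_axioms) simp_all

text \<open>The inverse arises as the factorisation of the identity of \<open>X\<close> through
  \<open>q\<close>, so its compatibility with the arrows is part of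
  \<open>rep_factor_surj\<close>.\<close>

lemma rhom_inverse:
  assumes "q \<in> rhom X Y" "robj X" "robj Y" "\<And>i. i \<in> V \<Longrightarrow> bij_betw (q i) (sp X i) (sp Y i)"
  obtains p where "p \<in> rhom Y X" "\<And>i x. \<lbrakk>i \<in> V; x \<in> sp X i\<rbrakk> \<Longrightarrow> p i (q i x) = x"
    "\<And>i y. \<lbrakk>i \<in> V; y \<in> sp Y i\<rbrakk> \<Longrightarrow> q i (p i y) = y" "\<And>i. i \<in> V \<Longrightarrow> bij_betw (p i) (sp Y i) (sp X i)"
proof -
  have surj: "q i ` sp X i = sp Y i" if "i \<in> V" for i using assms(4)[OF that] by (simp add: bij_betw_def)
  have ker: "rid X i x = \<zero>[X,i]" if "i \<in> V" "x \<in> sp X i" "q i x = \<zero>[Y,i]" for i x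
    using assms(4)[OF that(1)] rhom_inj_iff[OF assms(1-3) that(1)] that by (simp add: bij_betw_def)
  obtain p where p: "p \<in> rhom Y X" "\<And>i x. \<lbrakk>i \<in> V; x \<in> sp X i\<rbrakk> \<Longrightarrow> p i (q i x) = rid X i x"
    by (rule rep_factor_surj[OF assms(2,3,2,1) surj rid_rhom[OF assms(2)] ker]) blast+
  have pq: "p i (q i x) = x" if "i \<in> V" "x \<in> sp X i" for i x using p(2)[OF that] that by simp
  have qp: "q i (p i y) = y" if iy: "i \<in> V" "y \<in> sp Y i" for i y
  proof -
    obtain x where "x \<in> sp X i" "y = q i x" using surj[OF iy(1)] iy(2) by blast
    then show ?thesis using pq iy(1) by simp
  qed
  have "bij_betw (p i) (sp Y i) (sp X i)" if i: "i \<in> V" for i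
    by (rule bij_betw_byWitness[where f' = "q i"])
      (use i pq qp rhom_closed[OF p(1) i] rhom_closed[OF assms(1) i] in auto)
  then show thesis using that[OF p(1)] pq qp by blast
qed

lemma subrep_image:
  assumes "f \<in> rhom X Y" "robj X" "robj Y"
  shows "subrep Y (\<lambda>i. f i ` sp X i)"
  unfolding subrep_def
proof (intro conjI ballI)
  fix i assume i: "i \<in> V"
  show "lsub A (space Y i) (f i ` sp X i)"
    by (rule lsub_image[OF robj_lm[OF assms(2) i] robj_lm[OF assms(3) i] rep_hom_at[OF assms(1) i]
          lsub_carrier[OF robj_lm[OF assms(2) i]]])
next
  fix \<mu> y assume \<mu>: "\<mu> \<in> arcs Q" and "y \<in> f (tail Q \<mu>) ` sp X (tail Q \<mu>)"
  then obtain x where x: "x \<in> sp X (tail Q \<mu>)" "y = f (tail Q \<mu>) x" by blast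
  show "arr Y \<mu> y \<in> f (head Q \<mu>) ` sp X (head Q \<mu>)"
    using rep_hom_arr[OF assms(1) \<mu> x(1)] arr_closed[OF assms(2) \<mu> x(1)] x(2) by (metis imageI)
qed

lemma subrep_ker:
  assumes "g \<in> rhom Y Z" "robj Y" "robj Z"
  shows "subrep Y (\<lambda>i. {y \<in> sp Y i. g i y = \<zero>[Z,i]})"
  unfolding subrep_def
proof (intro conjI ballI)
  fix i assume i: "i \<in> V"
  show "lsub A (space Y i) {y \<in> sp Y i. g i y = \<zero>[Z,i]}"
    by (rule lsub_ker[OF robj_lm[OF assms(2) i] robj_lm[OF assms(3) i] rep_hom_at[OF assms(1) i]])
next
  fix \<mu> y assume \<mu>: "\<mu> \<in> arcs Q" and y: "y \<in> {y \<in> sp Y (tail Q \<mu>). g (tail Q \<mu>) y = \<zero>[Z,tail Q \<mu>]}"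
  have "tail Q \<mu> \<in> V" "head Q \<mu> \<in> V" using \<mu> by auto
  then show "arr Y \<mu> y \<in> {y \<in> sp Y (head Q \<mu>). g (head Q \<mu>) y = \<zero>[Z,head Q \<mu>]}"
    using rep_hom_arr[OF assms(1) \<mu>, of y] arr_closed[OF assms(2) \<mu>, of y] y
      mod_hom_zero[OF robj_lm[OF assms(3)] robj_lm[OF assms(3)] robj_arr[OF assms(3) \<mu>]] by simp
qed

end

text \<open>\<open>T\<close> fixes the element type of the objects, and \<open>universe\<close>
  makes it large enough for copies of all finite-dimensional modules.\<close>

locale mon_category = quiver_algebra K A Q
  for K :: "'k ring" and A :: "('k, 'a) module" and Q :: "('v, 'e) pre_digraph" +
  fixes T :: "'m itself"
  assumes universe: "lists (carrier K) \<lesssim> (UNIV :: 'm set)"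
begin

abbreviation C :: "(('v, 'e, 'a, 'm) rep, 'v \<Rightarrow> 'm \<Rightarrow> 'm) cat" where "C \<equiv> Mon Q K A"
abbreviation E :: "(('v, 'e, 'a, 'm) rep, 'v \<Rightarrow> 'm \<Rightarrow> 'm) seqs" where "E \<equiv> Mon_exact Q K A"

lemma C_simps [simp]:
  "Hom C = rep_hom Q A"
  "Comp C X Y Z g f = rcomp X g f"
  "Ident C X = rid X"
  "Hplus C X Y f g = rplus X Y f g"
  "Hzero C X Y = rzero X Y"
  by (simp_all add: Mon_def Rep_def mod_cat_def rcomp_def compose_def rid_def rplus_def rzero_def)

lemma mobjD: "mobj (X :: ('v, 'e, 'a, 'n) rep) \<Longrightarrow> robj X" "mobj X \<Longrightarrow> monic Q X"
  by (auto simp: mobj_iff)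

lemma rcomp_eq_iff:
  assumes "f \<in> rhom X Y" "g \<in> rhom Y Z" "robj X" "h \<in> rhom X Z"
  shows "rcomp X g f = h \<longleftrightarrow> (\<forall>i\<in>V. \<forall>x\<in>sp X i. g i (f i x) = h i x)"
proof
  assume "\<forall>i\<in>V. \<forall>x\<in>sp X i. g i (f i x) = h i x"
  then show "rcomp X g f = h"
    by (intro rep_hom_eqI[OF rcomp_rhom[OF assms(1-3)] assms(4)]) simp
next
  assume "rcomp X g f = h"
  then show "\<forall>i\<in>V. \<forall>x\<in>sp X i. g i (f i x) = h i x" by (metis rcomp_apply)
qed

lemma preadditive: "preadditive_category C"
proof (intro preadditive_category.intro category.intro preadditive_category_axioms.intro)
  fix X Y :: "('v, 'e, 'a, 'm) rep" and f
  assume X: "mobj X" and Y: "mobj Y"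
  note r = mobjD(1)[OF X] mobjD(1)[OF Y]
  {
    assume f: "f \<in> Hom C X Y"
    show "Comp C X Y Y (Ident C Y) f = f"
      using f r rhom_closed[of f X Y] by (simp add: rcomp_eq_iff[OF _ rid_rhom])
    show "Comp C X X Y f (Ident C X) = f"
      using f r by (simp add: rcomp_eq_iff[OF rid_rhom])
  }
  have ag: "abelian_group (space Y i)" if "i \<in> V" for i
    using robj_lm[OF r(2) that] by (simp add: left_module_def)
  have zero: "rzero X Y \<in> rhom X Y" by (rule rzero_rhom[OF r])
  have l_zero: "rplus X Y (rzero X Y) f = f" if f: "f \<in> rhom X Y" for f
    using abelian_groupE(5)[OF ag] rhom_closed[OF f]
    by (intro rep_hom_eqI[of _ Q A X Y] rplus_rhom f rzero_rhom r) simp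
  have inv: "\<exists>g\<in>rhom X Y. rplus X Y g f = rzero X Y" if f: "f \<in> rhom X Y" for f
  proof
    show m: "rminus X Y (rzero X Y) f \<in> rhom X Y" by (intro rminus_rhom f rzero_rhom r)
    show "rplus X Y (rminus X Y (rzero X Y) f) f = rzero X Y"
      using abelian_group.minus_add_cancel[OF ag] rhom_closed[OF f] zero_in[OF r(2)]
      by (intro rep_hom_eqI[of _ Q A X Y] rplus_rhom m f rzero_rhom r) simp
  qed
  have comm: "rplus X Y f g = rplus X Y g f" if f: "f \<in> rhom X Y" and g: "g \<in> rhom X Y" for f g
    using abelian_groupE(4)[OF ag] rhom_closed[OF f] rhom_closed[OF g]
    by (intro rep_hom_eqI[of _ Q A X Y] rplus_rhom f g r) simp
  have assoc: "rplus X Y (rplus X Y f g) h = rplus X Y f (rplus X Y g h)"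
    if f: "f \<in> rhom X Y" and g: "g \<in> rhom X Y" and h: "h \<in> rhom X Y" for f g h
    using abelian_groupE(3)[OF ag] rhom_closed[OF f] rhom_closed[OF g] rhom_closed[OF h]
    by (intro rep_hom_eqI[of _ Q A X Y] rplus_rhom f g h r) simp
  show "comm_group \<lparr>carrier = Hom C X Y, monoid.mult = Hplus C X Y, one = Hzero C X Y\<rparr>"
    by (rule comm_groupI; unfold partial_object.simps monoid.simps C_simps)
      (fact zero l_zero inv | erule (2) assoc | erule (1) comm | erule (1) rplus_rhom[OF _ _ r] | erule l_zero inv)+
next
  fix X :: "('v, 'e, 'a, 'm) rep"
  assume "mobj X"
  then show "Ident C X \<in> Hom C X X" by (simp add: rid_rhom[OF mobjD(1)])
next
  fix X Y Z :: "('v, 'e, 'a, 'm) rep" and f g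
  assume *: "mobj X" "mobj Y" "mobj Z" "f \<in> Hom C X Y" "g \<in> Hom C Y Z"
  then show "Comp C X Y Z g f \<in> Hom C X Z" using rcomp_rhom[OF _ _ mobjD(1)[OF *(1)]] by simp
next
  fix W X Y Z :: "('v, 'e, 'a, 'm) rep" and f g h
  assume *: "mobj W" "mobj X" "mobj Y" "mobj Z" "f \<in> Hom C W X" "g \<in> Hom C X Y" "h \<in> Hom C Y Z"
  then have f: "f \<in> rhom W X" and g: "g \<in> rhom X Y" and h: "h \<in> rhom Y Z" by auto
  note r = mobjD(1)[OF *(1)] mobjD(1)[OF *(2)]
  show "Comp C W X Z (Comp C X Y Z h g) f = Comp C W Y Z h (Comp C W X Y g f)"
    using rhom_closed[OF f]
    by (simp, intro rep_hom_eqI[of _ Q A W Z] rcomp_rhom[OF f] rcomp_rhom[OF _ h] rcomp_rhom[OF g h] rcomp_rhom[OF f g] r) simp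
next
  fix X Y Z :: "('v, 'e, 'a, 'm) rep" and f g h
  assume *: "mobj X" "mobj Y" "mobj Z" "f \<in> Hom C X Y" "g \<in> Hom C Y Z" "h \<in> Hom C Y Z"
  then have f: "f \<in> rhom X Y" and g: "g \<in> rhom Y Z" and h: "h \<in> rhom Y Z" by auto
  note r = mobjD(1)[OF *(1)] mobjD(1)[OF *(2)] mobjD(1)[OF *(3)]
  show "Comp C X Y Z (Hplus C Y Z g h) f = Hplus C X Z (Comp C X Y Z g f) (Comp C X Y Z h f)"
    using rhom_closed[OF f]
    by (simp, intro rep_hom_eqI[of _ Q A X Z] rplus_rhom rcomp_rhom[OF f] f g h r) simp
next
  fix X Y Z :: "('v, 'e, 'a, 'm) rep" and f g h
  assume *: "mobj X" "mobj Y" "mobj Z" "f \<in> Hom C X Y" "g \<in> Hom C X Y" "h \<in> Hom C Y Z"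
  then have f: "f \<in> rhom X Y" and g: "g \<in> rhom X Y" and h: "h \<in> rhom Y Z" by auto
  note r = mobjD(1)[OF *(1)] mobjD(1)[OF *(2)] mobjD(1)[OF *(3)]
  show "Comp C X Y Z h (Hplus C X Y f g) = Hplus C X Z (Comp C X Y Z h f) (Comp C X Y Z h g)"
    using rhom_closed[OF f] rhom_closed[OF g] mod_hom_add[OF rep_hom_at[OF h]]
    by (simp, intro rep_hom_eqI[of _ Q A X Z] rplus_rhom rcomp_rhom[OF _ h] f g h r) simp
qed

text \<open>In a zero object the identity coincides with the zero morphism, which is evaluated at
  each element.\<close>

lemma zero_object_iff:
  assumes "mobj (X :: ('v, 'e, 'a, 'm) rep)"
  shows "zero_object C X \<longleftrightarrow> (\<forall>i\<in>V. sp X i = {\<zero>[X,i]})"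
proof
  note r = mobjD(1)[OF assms]
  assume "zero_object C X"
  then have "\<exists>!f. f \<in> rhom X X" using assms by (simp add: zero_object_def)
  then have "rid X = rzero X X" using rid_rhom[OF r] rzero_rhom[OF r r] by blast
  then have "x = \<zero>[X,i]" if "i \<in> V" "x \<in> sp X i" for i x
    using that by (metis rid_apply rzero_apply)
  then show "\<forall>i\<in>V. sp X i = {\<zero>[X,i]}" using zero_in[OF r] by blast
next
  note r = mobjD(1)[OF assms]
  assume z: "\<forall>i\<in>V. sp X i = {\<zero>[X,i]}"
  show "zero_object C X"
    unfolding zero_object_def
  proof (intro conjI ballI ex1I)
    fix Y assume "mobj (Y :: ('v, 'e, 'a, 'm) rep)"
    then have Y: "robj Y" by (rule mobjD(1))
    show "rzero X Y \<in> Hom C X Y" "rzero Y X \<in> Hom C Y X" using rzero_rhom r Y by auto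
    show "f = rzero X Y" if "f \<in> Hom C X Y" for f
    proof (rule rep_hom_eqI[of _ Q A X Y])
      show f: "f \<in> rhom X Y" using that by simp
      show "f i x = rzero X Y i x" if "i \<in> V" "x \<in> sp X i" for i x
        using rhom_zero[OF f r Y that(1)] z that by simp
    qed (rule rzero_rhom[OF r Y])
    show "f = rzero Y X" if "f \<in> Hom C Y X" for f
    proof (rule rep_hom_eqI[of _ Q A Y X])
      show f: "f \<in> rhom Y X" using that by simp
      show "f i x = rzero Y X i x" if "i \<in> V" "x \<in> sp Y i" for i x
        using rhom_closed[OF f that] z that by simp
    qed (rule rzero_rhom[OF Y r])
  qed (use assms in simp)
qed

lemma zero_object_exists: "\<exists>X. zero_object C X"
proof -
  define Z :: "('a, 'm) module" where "Z = \<lparr>carrier = {undefined}, monoid.mult = undefined, one = undefined,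
    ring.zero = undefined, ring.add = (\<lambda>_ _. undefined), smult = (\<lambda>_ _. undefined)\<rparr>"
  define X :: "('v, 'e, 'a, 'm) rep" where "X = \<lparr>space = (\<lambda>_. Z), arr = (\<lambda>_. \<lambda>x\<in>carrier Z. x)\<rparr>"
  have lm: "left_module A Z" by (rule left_moduleI) (auto simp: Z_def ring_A)
  have "fg K (und Z)" unfolding fg_def by (intro exI[of _ "{}"]) (auto simp: lsub_def Z_def)
  then have "fd_module K A Z" using lm by (simp add: fd_module_iff)
  then have X: "robj X" using mod_hom_id[OF lm] by (simp add: robj_iff X_def)
  have "w \<mu> = undefined" if "w \<in> dsp X i" "\<mu> \<in> into i" for w i \<mu>
    using prodm_mem[OF that] by (simp add: X_def Z_def)
  then have "mobj X" using X monic_iff[OF X] by (simp add: mobj_iff) (simp add: X_def Z_def)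
  then show ?thesis using zero_object_iff[of X] by (auto simp: X_def Z_def)
qed

lemma biproduct_iff:
  fixes X Y B :: "('v, 'e, 'a, 'm) rep"
  assumes "mobj X" "mobj Y" "mobj B" "i\<^sub>1 \<in> rhom X B" "i\<^sub>2 \<in> rhom Y B" "p\<^sub>1 \<in> rhom B X" "p\<^sub>2 \<in> rhom B Y"
  shows "is_biproduct C X Y B i\<^sub>1 i\<^sub>2 p\<^sub>1 p\<^sub>2 \<longleftrightarrow>
    (\<forall>i\<in>V. (\<forall>x\<in>sp X i. p\<^sub>1 i (i\<^sub>1 i x) = x \<and> p\<^sub>2 i (i\<^sub>1 i x) = \<zero>[Y,i]) \<and>
      (\<forall>y\<in>sp Y i. p\<^sub>2 i (i\<^sub>2 i y) = y \<and> p\<^sub>1 i (i\<^sub>2 i y) = \<zero>[X,i]) \<and>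
      (\<forall>b\<in>sp B i. i\<^sub>1 i (p\<^sub>1 i b) \<oplus>\<^bsub>space B i\<^esub> i\<^sub>2 i (p\<^sub>2 i b) = b))"
proof -
  note X = mobjD(1)[OF assms(1)] and Y = mobjD(1)[OF assms(2)] and B = mobjD(1)[OF assms(3)]
  have "rplus B B (rcomp B i\<^sub>1 p\<^sub>1) (rcomp B i\<^sub>2 p\<^sub>2) = rid B \<longleftrightarrow>
    (\<forall>i\<in>V. \<forall>b\<in>sp B i. i\<^sub>1 i (p\<^sub>1 i b) \<oplus>\<^bsub>space B i\<^esub> i\<^sub>2 i (p\<^sub>2 i b) = b)" (is "?l = ?r \<longleftrightarrow> ?R")
  proof
    assume "?l = ?r"
    then have "?l i b = ?r i b" for i b by simp
    then show ?R by (metis rplus_apply rcomp_apply rid_apply)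
  next
    assume ?R
    then show "?l = ?r"
      by (intro rep_hom_eqI[of _ Q A B B] rplus_rhom rcomp_rhom[OF assms(6,4)] rcomp_rhom[OF assms(7,5)] rid_rhom B) simp
  qed
  then show ?thesis
    using assms rcomp_eq_iff[OF assms(4,6) X rid_rhom[OF X]] rcomp_eq_iff[OF assms(5,7) Y rid_rhom[OF Y]]
      rcomp_eq_iff[OF assms(4,7) X rzero_rhom[OF X Y]] rcomp_eq_iff[OF assms(5,6) Y rzero_rhom[OF Y X]]
    unfolding is_biproduct_def by (simp, blast)
qed

text \<open>The representation of pairs is the biproduct; the isomorphism q carries it to the type
  \<open>'m\<close>.\<close>

lemma biproduct_exists:
  fixes X Y :: "('v, 'e, 'a, 'm) rep"
  assumes "mobj X" "mobj Y"
  shows "\<exists>B i\<^sub>1 i\<^sub>2 p\<^sub>1 p\<^sub>2. is_biproduct C X Y B i\<^sub>1 i\<^sub>2 p\<^sub>1 p\<^sub>2"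
proof -
  note X = mobjD(1)[OF assms(1)] and Y = mobjD(1)[OF assms(2)]
  let ?P = "pair_rep X Y"
  note P = pair_rep_robj[OF X Y]
  obtain B :: "('v, 'e, 'a, 'm) rep" and q where B: "mobj B" "q \<in> rhom ?P B" "\<And>i. i \<in> V \<Longrightarrow> bij_betw (q i) (sp ?P i) (sp B i)"
    by (rule rep_transport[OF pair_rep_mobj[OF assms] universe]) blast
  note Br = mobjD(1)[OF B(1)]
  obtain p where p: "p \<in> rhom B ?P" "\<And>i x. \<lbrakk>i \<in> V; x \<in> sp ?P i\<rbrakk> \<Longrightarrow> p i (q i x) = x"
    "\<And>i y. \<lbrakk>i \<in> V; y \<in> sp B i\<rbrakk> \<Longrightarrow> q i (p i y) = y" "\<And>i. i \<in> V \<Longrightarrow> bij_betw (p i) (sp B i) (sp ?P i)"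
    by (rule rhom_inverse[OF B(2) P Br B(3)]) blast+
  let ?j1 = "\<lambda>i\<in>V. \<lambda>x\<in>sp X i. (rid X i x, rzero X Y i x)" and ?j2 = "\<lambda>i\<in>V. \<lambda>y\<in>sp Y i. (rzero Y X i y, rid Y i y)"
  have j: "?j1 \<in> rhom X ?P" "?j2 \<in> rhom Y ?P"
    by (intro pair_tuple_rhom rid_rhom rzero_rhom X Y)+
  let ?i1 = "rcomp X q ?j1" and ?i2 = "rcomp Y q ?j2"
    and ?p1 = "rcomp B (pair_fst X Y) p" and ?p2 = "rcomp B (pair_snd X Y) p"
  have i: "?i1 \<in> rhom X B" "?i2 \<in> rhom Y B" by (rule rcomp_rhom[OF j(1) B(2) X], rule rcomp_rhom[OF j(2) B(2) Y])
  have pr: "?p1 \<in> rhom B X" "?p2 \<in> rhom B Y"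
    by (rule rcomp_rhom[OF p(1) pair_fst_rhom[OF X Y] Br], rule rcomp_rhom[OF p(1) pair_snd_rhom[OF X Y] Br])
  have pi: "?p1 i (q i z) = fst z" "?p2 i (q i z) = snd z" if "i \<in> V" "z \<in> sp ?P i" for i z
    using that p(2)[OF that] rhom_closed[OF B(2) that] by (auto simp: pair_fst_def pair_snd_def)
  have "is_biproduct C X Y B ?i1 ?i2 ?p1 ?p2"
    unfolding biproduct_iff[OF assms B(1) i pr]
  proof (intro ballI conjI)
    fix i assume iV: "i \<in> V"
    note z = zero_in[OF X iV] zero_in[OF Y iV]
    fix x assume x: "x \<in> sp X i"
    show "?p1 i (?i1 i x) = x" "?p2 i (?i1 i x) = \<zero>[Y,i]"
      using x iV z pi[OF iV, of "(x, \<zero>[Y,i])"] by (simp_all del: rcomp_apply add: rcomp_apply[of i x X])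
  next
    fix i assume iV: "i \<in> V"
    note z = zero_in[OF X iV] zero_in[OF Y iV]
    fix y assume y: "y \<in> sp Y i"
    show "?p2 i (?i2 i y) = y" "?p1 i (?i2 i y) = \<zero>[X,i]"
      using y iV z pi[OF iV, of "(\<zero>[X,i], y)"] by (simp_all del: rcomp_apply add: rcomp_apply[of i y Y])
  next
    fix i b assume iV: "i \<in> V" and b: "b \<in> sp B i"
    define z where "z = p i b"
    have z: "z \<in> sp ?P i" "b = q i z" using rhom_closed[OF p(1) iV b] p(3)[OF iV b] by (auto simp: z_def)
    then have fz: "fst z \<in> sp X i" "snd z \<in> sp Y i" by auto
    note zz = zero_in[OF X iV] zero_in[OF Y iV]
    have "q i (fst z, \<zero>[Y,i]) \<oplus>\<^bsub>space B i\<^esub> q i (\<zero>[X,i], snd z) =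
      q i ((fst z, \<zero>[Y,i]) \<oplus>\<^bsub>space ?P i\<^esub> (\<zero>[X,i], snd z))"
      using fz zz by (intro rhom_add[OF B(2) iV, symmetric]) auto
    also have "\<dots> = q i z"
    proof -
      interpret x: left_module A "space X i" by (rule robj_lm[OF X iV])
      interpret y: left_module A "space Y i" by (rule robj_lm[OF Y iV])
      show ?thesis using fz by simp
    qed
    finally show "?i1 i (?p1 i b) \<oplus>\<^bsub>space B i\<^esub> ?i2 i (?p2 i b) = b"
      unfolding z(2) pi[OF iV z(1)] using iV fz by simp
  qed
  then show ?thesis by blast
qed

lemma additive: "additive_category C"
  using preadditive zero_object_exists biproduct_exists
  by (simp add: additive_category_def additive_category_axioms_def)

section \<open>Vertexwise descriptions of conflations, deflations and inflations, and the axioms of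
  an exact category\<close>

lemma E_iff:
  "E X f Y g Z \<longleftrightarrow> mobj X \<and> mobj Y \<and> mobj Z \<and> f \<in> rhom X Y \<and> g \<in> rhom Y Z \<and>
    (\<forall>i\<in>V. inj_on (f i) (sp X i) \<and> f i ` sp X i = {y \<in> sp Y i. g i y = \<zero>[Z,i]} \<and> g i ` sp Y i = sp Z i)"
  by (simp add: Mon_exact_def short_exact_def)

text \<open>The kernel of a vertexwise surjection is a subrepresentation of a monic representation,
  hence monic, so every vertexwise surjection completes to a conflation.\<close>

lemma deflation_iff:
  fixes Y Z :: "('v, 'e, 'a, 'm) rep"
  shows "deflation E Y g Z \<longleftrightarrow> mobj Y \<and> mobj Z \<and> g \<in> rhom Y Z \<and> (\<forall>i\<in>V. g i ` sp Y i = sp Z i)"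
proof
  assume *: "mobj Y \<and> mobj Z \<and> g \<in> rhom Y Z \<and> (\<forall>i\<in>V. g i ` sp Y i = sp Z i)"
  then have r: "robj Y" "robj Z" and g: "g \<in> rhom Y Z" using mobjD(1) by blast+
  let ?U = "\<lambda>i. {y \<in> sp Y i. g i y = \<zero>[Z,i]}"
  have U: "subrep Y ?U" by (rule subrep_ker[OF g r])
  have "mobj (sub_rep Y ?U)" using * sub_rep_mobj[OF _ U] by blast
  moreover have "sub_incl ?U \<in> rhom (sub_rep Y ?U) Y" by (rule sub_incl_rhom[OF r(1) U])
  moreover have "inj_on (sub_incl ?U i) (sp (sub_rep Y ?U) i)" "sub_incl ?U i ` sp (sub_rep Y ?U) i = ?U i"
    if "i \<in> V" for i using that by (auto simp: inj_on_def sub_incl_apply)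
  ultimately have "E (sub_rep Y ?U) (sub_incl ?U) Y g Z"
    unfolding E_iff using * by blast
  then show "deflation E Y g Z" by (auto simp: deflation_def)
qed (unfold deflation_def E_iff, blast)

text \<open>The last clause says that the cokernel is monic: a family sent by \<delta>_i into the
  image of \<open>f\<close> consists of elements of the image. It is the only difference from
  vertexwise injectivity, and all arguments about inflations have to carry it along.\<close>

lemma inflation_iff:
  fixes X Y :: "('v, 'e, 'a, 'm) rep"
  shows "inflation E X f Y \<longleftrightarrow> mobj X \<and> mobj Y \<and> f \<in> rhom X Y \<and> (\<forall>i\<in>V. inj_on (f i) (sp X i)) \<and>
    (\<forall>i\<in>V. \<forall>w\<in>dsp Y i. delta Q Y i w \<in> f i ` sp X i \<longrightarrow> (\<forall>\<mu>\<in>into i. w \<mu> \<in> f (tail Q \<mu>) ` sp X (tail Q \<mu>)))"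
    (is "_ \<longleftrightarrow> ?R")
proof
  assume "inflation E X f Y"
  then obtain g Z where *: "E X f Y g Z" by (auto simp: inflation_def)
  then have m: "mobj X" "mobj Y" "mobj Z" and g: "g \<in> rhom Y Z"
    and e: "\<And>i. i \<in> V \<Longrightarrow> f i ` sp X i = {y \<in> sp Y i. g i y = \<zero>[Z,i]}" by (auto simp: E_iff)
  note r = mobjD(1)[OF m(2)] mobjD(1)[OF m(3)]
  have "w \<mu> \<in> f (tail Q \<mu>) ` sp X (tail Q \<mu>)"
    if i: "i \<in> V" and w: "w \<in> dsp Y i" "delta Q Y i w \<in> f i ` sp X i" and \<mu>: "\<mu> \<in> into i" for i w \<mu>
  proof -
    have "delta Q Z i (push i g w) = \<zero>[Z,i]"
      using delta_push[OF r g i w(1)] w(2) e[OF i] by simp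
    then have "push i g w \<mu> = \<zero>[Z,tail Q \<mu>]"
      by (rule monicD[OF r(2) mobjD(2)[OF m(3)] i rhom_push_closed[OF g w(1)] _ \<mu>])
    then have "g (tail Q \<mu>) (w \<mu>) = \<zero>[Z,tail Q \<mu>]" using \<mu> by (simp add: push_def)
    then show ?thesis using e[OF into_tail[OF \<mu>]] prodm_mem[OF w(1) \<mu>] by simp
  qed
  then show ?R using * by (auto simp: E_iff)
next
  assume R: ?R
  then have m: "mobj X" "mobj Y" and f: "f \<in> rhom X Y" by auto
  note r = mobjD(1)[OF m(1)] mobjD(1)[OF m(2)]
  let ?U = "\<lambda>i. f i ` sp X i"
  obtain Z :: "('v, 'e, 'a, 'm) rep" and q where Z: "robj Z" "q \<in> rhom Y Z"
    "\<And>i. i \<in> V \<Longrightarrow> q i ` sp Y i = sp Z i" "\<And>i x. \<lbrakk>i \<in> V; x \<in> sp Y i\<rbrakk> \<Longrightarrow> q i x = \<zero>[Z,i] \<longleftrightarrow> x \<in> ?U i"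
    by (rule rep_quotient[OF r(2) subrep_image[OF f r] universe]) blast
  have "mobj Z"
  proof (rule quotient_monic[OF r(2) Z(1-3)])
    fix i w \<mu> assume *: "i \<in> V" "w \<in> dsp Y i" "q i (delta Q Y i w) = \<zero>[Z,i]" "\<mu> \<in> into i"
    have "delta Q Y i w \<in> ?U i" using Z(4)[OF *(1) delta_closed[OF r(2) *(1,2)]] *(3) by simp
    then have "w \<mu> \<in> ?U (tail Q \<mu>)" using R * by blast
    then show "q (tail Q \<mu>) (w \<mu>) = \<zero>[Z,tail Q \<mu>]"
      using Z(4)[OF into_tail[OF *(4)] prodm_mem[OF *(2,4)]] by simp
  qed
  moreover have "f i ` sp X i = {y \<in> sp Y i. q i y = \<zero>[Z,i]}" if i: "i \<in> V" for i
    using Z(4)[OF i] rhom_closed[OF f i] by auto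
  ultimately have "E X f Y q Z" using R Z by (simp add: E_iff)
  then show "inflation E X f Y" by (auto simp: inflation_def)
qed

text \<open>The kernel is formed at each vertex; \<open>rep_factor_inj\<close> makes the vertexwise
  factorisations into a morphism, and injectivity of \<open>f\<close> makes it unique.\<close>

lemma conflation_kernel:
  assumes "E X f Y g Z"
  shows "is_kernel C X f Y g Z"
proof -
  have m: "mobj X" "mobj Y" "mobj Z" and f: "f \<in> rhom X Y" and g: "g \<in> rhom Y Z"
    and e: "\<And>i. i \<in> V \<Longrightarrow> inj_on (f i) (sp X i)" "\<And>i. i \<in> V \<Longrightarrow> f i ` sp X i = {y \<in> sp Y i. g i y = \<zero>[Z,i]}"
    using assms by (auto simp: E_iff)
  note X = mobjD(1)[OF m(1)] and Y = mobjD(1)[OF m(2)] and Z = mobjD(1)[OF m(3)]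
  have gf: "rcomp X g f = rzero X Z"
    unfolding rcomp_eq_iff[OF f g X rzero_rhom[OF X Z]] using e(2) by auto
  have "\<exists>!u. u \<in> rhom W X \<and> rcomp W f u = h"
    if W: "mobj W" and h: "h \<in> rhom W Y" and gh: "rcomp W g h = rzero W Z"
    for W :: "('v, 'e, 'a, 'm) rep" and h
  proof -
    note Wr = mobjD(1)[OF W]
    have im: "h i ` sp W i \<subseteq> f i ` sp X i" if i: "i \<in> V" for i
      using gh rcomp_eq_iff[OF h g Wr rzero_rhom[OF Wr Z]] i e(2)[OF i] rhom_closed[OF h i] by auto
    obtain u where u: "u \<in> rhom W X" "\<And>i x. \<lbrakk>i \<in> V; x \<in> sp W i\<rbrakk> \<Longrightarrow> f i (u i x) = h i x"
      by (rule rep_factor_inj[OF X Y Wr f e(1) h im]) blast+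
    show ?thesis
    proof (intro ex1I conjI)
      show "u \<in> rhom W X" by (rule u(1))
      show "rcomp W f u = h" unfolding rcomp_eq_iff[OF u(1) f Wr h] using u(2) by simp
      fix v assume v: "v \<in> rhom W X \<and> rcomp W f v = h"
      then have v': "v \<in> rhom W X" "\<forall>i\<in>V. \<forall>x\<in>sp W i. f i (v i x) = h i x"
        using rcomp_eq_iff[OF _ f Wr h] by auto
      show "v = u"
      proof (rule rep_hom_eqI[OF v'(1) u(1)])
        fix i x assume i: "i \<in> V" "x \<in> sp W i"
        then have "f i (v i x) = f i (u i x)" using v'(2) u(2) by simp
        then show "v i x = u i x" using e(1)[OF i(1)] rhom_closed[OF v'(1) i] rhom_closed[OF u(1) i] by (simp add: inj_on_eq_iff)
      qed
    qed
  qed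
  then show ?thesis unfolding is_kernel_def using m f g gf by simp
qed

lemma conflation_cokernel:
  assumes "E X f Y g Z"
  shows "is_cokernel C X f Y g Z"
proof -
  have m: "mobj X" "mobj Y" "mobj Z" and f: "f \<in> rhom X Y" and g: "g \<in> rhom Y Z"
    and e: "\<And>i. i \<in> V \<Longrightarrow> f i ` sp X i = {y \<in> sp Y i. g i y = \<zero>[Z,i]}" "\<And>i. i \<in> V \<Longrightarrow> g i ` sp Y i = sp Z i"
    using assms by (auto simp: E_iff)
  note X = mobjD(1)[OF m(1)] and Y = mobjD(1)[OF m(2)] and Z = mobjD(1)[OF m(3)]
  have gf: "rcomp X g f = rzero X Z"
    unfolding rcomp_eq_iff[OF f g X rzero_rhom[OF X Z]] using e(1) by auto
  have "\<exists>!u. u \<in> rhom Z W \<and> rcomp Y u g = h"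
    if W: "mobj W" and h: "h \<in> rhom Y W" and hf: "rcomp X h f = rzero X W"
    for W :: "('v, 'e, 'a, 'm) rep" and h
  proof -
    note Wr = mobjD(1)[OF W]
    have ker: "h i y = \<zero>[W,i]" if i: "i \<in> V" and y: "y \<in> sp Y i" "g i y = \<zero>[Z,i]" for i y
    proof -
      obtain x where "x \<in> sp X i" "y = f i x" using e(1)[OF i] y by blast
      then show ?thesis using hf rcomp_eq_iff[OF f h X rzero_rhom[OF X Wr]] i by simp
    qed
    obtain u where u: "u \<in> rhom Z W" "\<And>i y. \<lbrakk>i \<in> V; y \<in> sp Y i\<rbrakk> \<Longrightarrow> u i (g i y) = h i y"
      by (rule rep_factor_surj[OF Y Z Wr g e(2) h ker]) blast+
    show ?thesis
    proof (intro ex1I conjI)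
      show "u \<in> rhom Z W" by (rule u(1))
      show "rcomp Y u g = h" unfolding rcomp_eq_iff[OF g u(1) Y h] using u(2) by simp
      fix v assume v: "v \<in> rhom Z W \<and> rcomp Y v g = h"
      then have v': "v \<in> rhom Z W" "\<forall>i\<in>V. \<forall>y\<in>sp Y i. v i (g i y) = h i y"
        using rcomp_eq_iff[OF g _ Y h] by auto
      show "v = u"
      proof (rule rep_hom_eqI[OF v'(1) u(1)])
        fix i z assume i: "i \<in> V" "z \<in> sp Z i"
        then obtain y where "y \<in> sp Y i" "z = g i y" using e(2) by blast
        then show "v i z = u i z" using v'(2) u(2) i(1) by simp
      qed
    qed
  qed
  then show ?thesis unfolding is_cokernel_def using m f g gf by simp
qed

lemma is_iso_bij:
  assumes "is_iso C X Y f"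
  shows "mobj X" "mobj Y" "f \<in> rhom X Y" "\<And>i. i \<in> V \<Longrightarrow> bij_betw (f i) (sp X i) (sp Y i)"
proof -
  obtain g where m: "mobj X" "mobj Y" and f: "f \<in> rhom X Y" and g: "g \<in> rhom Y X" and
    e: "rcomp X g f = rid X" "rcomp Y f g = rid Y"
    using assms by (auto simp: is_iso_def)
  show "mobj X" "mobj Y" "f \<in> rhom X Y" by fact+
  have e': "g i (f i x) = x" if "i \<in> V" "x \<in> sp X i" for i x
    using that e(1) by (metis rcomp_apply rid_apply)
  have e'': "f i (g i x) = x" if "i \<in> V" "x \<in> sp Y i" for i x
    using that e(2) by (metis rcomp_apply rid_apply)
  show "bij_betw (f i) (sp X i) (sp Y i)" if i: "i \<in> V" for i
    by (rule bij_betw_byWitness[where f' = "g i"])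
      (use i e' e'' rhom_closed[OF f i] rhom_closed[OF g i] in auto)
qed

lemma conflation_iso:
  assumes "E X f Y g Z" "is_iso C X X' a" "is_iso C Y Y' b" "is_iso C Z Z' c"
    "f' \<in> Hom C X' Y'" "g' \<in> Hom C Y' Z'"
    "Comp C X X' Y' f' a = Comp C X Y Y' b f" "Comp C Y Y' Z' g' b = Comp C Y Z Z' c g"
  shows "E X' f' Y' g' Z'"
proof -
  note a = is_iso_bij[OF assms(2)] and b = is_iso_bij[OF assms(3)] and c = is_iso_bij[OF assms(4)]
  have f: "f \<in> rhom X Y" and g: "g \<in> rhom Y Z" using assms(1) by (auto simp: E_iff)
  have f': "f' \<in> rhom X' Y'" and g': "g' \<in> rhom Y' Z'" using assms(5,6) by auto
  have e1: "f' i (a i x) = b i (f i x)" if "i \<in> V" "x \<in> sp X i" for i x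
    using assms(7) that by (metis C_simps(2) rcomp_apply)
  have e2: "g' i (b i x) = c i (g i x)" if "i \<in> V" "x \<in> sp Y i" for i x
    using assms(8) that by (metis C_simps(2) rcomp_apply)
  have "inj_on (f' i) (sp X' i) \<and> f' i ` sp X' i = {y \<in> sp Y' i. g' i y = \<zero>[Z',i]} \<and> g' i ` sp Y' i = sp Z' i"
    if i: "i \<in> V" for i
  proof (intro conjI)
    have E: "inj_on (f i) (sp X i)" "f i ` sp X i = {y \<in> sp Y i. g i y = \<zero>[Z,i]}" "g i ` sp Y i = sp Z i"
      using assms(1) i by (auto simp: E_iff)
    have im: "sp X' i = a i ` sp X i" "sp Y' i = b i ` sp Y i" "sp Z' i = c i ` sp Z i"
      using a(4)[OF i] b(4)[OF i] c(4)[OF i] by (auto simp: bij_betw_def)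
    show "inj_on (f' i) (sp X' i)"
      unfolding im(1)
    proof (rule inj_onI, elim imageE)
      fix x y u v assume *: "f' i x = f' i y" "x = a i u" "u \<in> sp X i" "y = a i v" "v \<in> sp X i"
      then have "b i (f i u) = b i (f i v)" using e1[OF i] by simp
      then have "f i u = f i v"
        by (rule inj_onD[OF bij_betw_imp_inj_on[OF b(4)[OF i]] _ rhom_closed[OF f i *(3)] rhom_closed[OF f i *(5)]])
      then show "x = y" using E(1) * by (simp add: inj_on_eq_iff)
    qed
    have fX: "f' i ` sp X' i = b i ` f i ` sp X i"
      unfolding im(1) image_image using e1[OF i] by (intro image_cong) simp_all
    have c0: "c i z = \<zero>[Z',i] \<longleftrightarrow> z = \<zero>[Z,i]" if "z \<in> sp Z i" for z
      using c(4)[OF i] rhom_inj_iff[OF c(3) mobjD(1)[OF c(1)] mobjD(1)[OF c(2)] i] that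
        rhom_zero[OF c(3) mobjD(1)[OF c(1)] mobjD(1)[OF c(2)] i] by (auto simp: bij_betw_def)
    show "f' i ` sp X' i = {y \<in> sp Y' i. g' i y = \<zero>[Z',i]}"
      unfolding fX E(2) im(2) using e2[OF i] c0 rhom_closed[OF g i] zero_in[OF mobjD(1)[OF c(1)] i] by auto
    have "g' i ` sp Y' i = c i ` g i ` sp Y i"
      unfolding im(2) image_image using e2[OF i] by (intro image_cong) simp_all
    then show "g' i ` sp Y' i = sp Z' i" unfolding E(3) im(3) .
  qed
  then show ?thesis using a b c f' g' by (simp add: E_iff)
qed

text \<open>For the clause on \<delta>: a family w with \<delta> w in the image of g f lifts along
  \<open>g\<close>; since \<open>g\<close> is injective, \<delta> of the lift lies in the image of
  \<open>f\<close>, so the lift consists of elements of that image.\<close>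

lemma inflation_Comp:
  assumes "inflation E X f Y" "inflation E Y g Z"
  shows "inflation E X (Comp C X Y Z g f) Z"
proof -
  note F = assms(1)[unfolded inflation_iff] and G = assms(2)[unfolded inflation_iff]
  have f: "f \<in> rhom X Y" and g: "g \<in> rhom Y Z" and m: "mobj X" "mobj Y" "mobj Z" using F G by auto
  note X = mobjD(1)[OF m(1)] and Y = mobjD(1)[OF m(2)] and Z = mobjD(1)[OF m(3)]
  have im: "rcomp X g f i ` sp X i = g i ` f i ` sp X i" if "i \<in> V" for i
    unfolding image_image using that by (intro image_cong) simp_all
  have "inj_on (rcomp X g f i) (sp X i)" if i: "i \<in> V" for i
  proof -
    have "inj_on (f i) (sp X i)" "inj_on (g i) (sp Y i)" using F G i by auto
    then show ?thesis using rhom_closed[OF f i] i by (auto simp: inj_on_def)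
  qed
  moreover have "w \<mu> \<in> rcomp X g f (tail Q \<mu>) ` sp X (tail Q \<mu>)"
    if i: "i \<in> V" and w: "w \<in> dsp Z i" "delta Q Z i w \<in> rcomp X g f i ` sp X i" and \<mu>: "\<mu> \<in> into i" for i w \<mu>
  proof -
    obtain x where x: "x \<in> sp X i" "delta Q Z i w = g i (f i x)" using w(2) im[OF i] by auto
    then have "delta Q Z i w \<in> g i ` sp Y i" using rhom_closed[OF f i] by blast
    then have "\<forall>\<mu>\<in>into i. w \<mu> \<in> g (tail Q \<mu>) ` sp Y (tail Q \<mu>)" using G i w(1) by blast
    then have "\<forall>\<mu>\<in>into i. \<exists>y\<in>sp Y (tail Q \<mu>). w \<mu> = g (tail Q \<mu>) y" by blast
    then obtain y where y: "\<And>\<mu>. \<mu> \<in> into i \<Longrightarrow> y \<mu> \<in> sp Y (tail Q \<mu>)" "\<And>\<mu>. \<mu> \<in> into i \<Longrightarrow> w \<mu> = g (tail Q \<mu>) (y \<mu>)"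
      by metis
    let ?y = "\<lambda>\<mu>\<in>into i. y \<mu>"
    have yc: "?y \<in> dsp Y i" using y(1) by simp
    have "push i g ?y = w"
    proof (rule extensionalityI[of _ "into i"])
      show "w \<in> extensional (into i)" using w(1) by (simp add: PiE_def)
    qed (simp_all add: push_def y(2))
    then have "g i (delta Q Y i ?y) = g i (f i x)" using delta_push[OF Y Z g i yc] x(2) by simp
    moreover have "inj_on (g i) (sp Y i)" using G i by blast
    ultimately have "delta Q Y i ?y = f i x"
      using delta_closed[OF Y i yc] rhom_closed[OF f i x(1)] inj_onD by metis
    then have "?y \<mu> \<in> f (tail Q \<mu>) ` sp X (tail Q \<mu>)" using F i yc x(1) \<mu> by (metis imageI)
    then show ?thesis using im[OF into_tail[OF \<mu>]] y(2)[OF \<mu>] \<mu> by auto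
  qed
  ultimately show ?thesis using m rcomp_rhom[OF f g X] by (simp add: inflation_iff del: prodm_simps)
qed

lemma deflation_Comp:
  assumes "deflation E X f Y" "deflation E Y g Z"
  shows "deflation E X (Comp C X Y Z g f) Z"
proof -
  have f: "f \<in> rhom X Y" and g: "g \<in> rhom Y Z" and m: "mobj X" "mobj Y" "mobj Z"
    and s: "\<And>i. i \<in> V \<Longrightarrow> f i ` sp X i = sp Y i" "\<And>i. i \<in> V \<Longrightarrow> g i ` sp Y i = sp Z i"
    using assms by (auto simp: deflation_iff)
  have "rcomp X g f i ` sp X i = g i ` f i ` sp X i" if "i \<in> V" for i
    unfolding image_image using that by (intro image_cong) simp_all
  then show ?thesis using m s rcomp_rhom[OF f g mobjD(1)[OF m(1)]] by (simp add: deflation_iff)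
qed

lemma Ident_inflation: "mobj X \<Longrightarrow> inflation E X (Ident C X) X"
  using rid_rhom[OF mobjD(1), of X] by (auto simp: inflation_iff inj_on_def image_iff into_tail dest: PiE_mem)

lemma Ident_deflation: "mobj X \<Longrightarrow> deflation E X (Ident C X) X"
  using rid_rhom[OF mobjD(1), of X] by (auto simp: deflation_iff image_iff)

lemma biproduct:
  fixes X Y :: "('v, 'e, 'a, 'm) rep"
  assumes "mobj X" "mobj Y"
  obtains B :: "('v, 'e, 'a, 'm) rep" and i\<^sub>1 i\<^sub>2 p\<^sub>1 p\<^sub>2 where
    "mobj B" "i\<^sub>1 \<in> rhom X B" "i\<^sub>2 \<in> rhom Y B" "p\<^sub>1 \<in> rhom B X" "p\<^sub>2 \<in> rhom B Y"
    "\<And>i x. \<lbrakk>i \<in> V; x \<in> sp X i\<rbrakk> \<Longrightarrow> p\<^sub>1 i (i\<^sub>1 i x) = x" "\<And>i x. \<lbrakk>i \<in> V; x \<in> sp X i\<rbrakk> \<Longrightarrow> p\<^sub>2 i (i\<^sub>1 i x) = \<zero>[Y,i]"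
    "\<And>i y. \<lbrakk>i \<in> V; y \<in> sp Y i\<rbrakk> \<Longrightarrow> p\<^sub>2 i (i\<^sub>2 i y) = y" "\<And>i y. \<lbrakk>i \<in> V; y \<in> sp Y i\<rbrakk> \<Longrightarrow> p\<^sub>1 i (i\<^sub>2 i y) = \<zero>[X,i]"
    "\<And>i b. \<lbrakk>i \<in> V; b \<in> sp B i\<rbrakk> \<Longrightarrow> i\<^sub>1 i (p\<^sub>1 i b) \<oplus>\<^bsub>space B i\<^esub> i\<^sub>2 i (p\<^sub>2 i b) = b"
proof -
  obtain B i\<^sub>1 i\<^sub>2 p\<^sub>1 p\<^sub>2 where *: "is_biproduct C X Y B i\<^sub>1 i\<^sub>2 p\<^sub>1 p\<^sub>2" using biproduct_exists[OF assms] by blast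
  then have h: "mobj B" "i\<^sub>1 \<in> rhom X B" "i\<^sub>2 \<in> rhom Y B" "p\<^sub>1 \<in> rhom B X" "p\<^sub>2 \<in> rhom B Y"
    by (simp_all add: is_biproduct_def)
  show thesis by (rule that[OF h]) (use *[unfolded biproduct_iff[OF assms h]] in blast)+
qed

text \<open>The pullback of \<open>g\<close> and \<open>c\<close> is the kernel of the deflation \<open>(g, -c)\<close>, and dually.\<close>

lemma deflation_pullback:
  assumes "deflation E Y g Z" "mobj Z'" "c \<in> Hom C Z' Z"
  shows "\<exists>Y' g' b. is_pullback C Y Z Y' Z' g c g' b \<and> deflation E Y' g' Z'"
proof -
  have m: "mobj Y" "mobj Z" and g: "g \<in> rhom Y Z" and s: "\<And>i. i \<in> V \<Longrightarrow> g i ` sp Y i = sp Z i"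
    using assms(1) by (auto simp: deflation_iff)
  have c: "c \<in> rhom Z' Z" using assms(3) by simp
  note Y = mobjD(1)[OF m(1)] and Z = mobjD(1)[OF m(2)] and Z' = mobjD(1)[OF assms(2)]
  obtain B :: "('v, 'e, 'a, 'm) rep" and i\<^sub>1 i\<^sub>2 p\<^sub>1 p\<^sub>2 where
    B: "mobj B" and i: "i\<^sub>1 \<in> rhom Y B" "i\<^sub>2 \<in> rhom Z' B" and p: "p\<^sub>1 \<in> rhom B Y" "p\<^sub>2 \<in> rhom B Z'"
    and e1: "\<And>i x. \<lbrakk>i \<in> V; x \<in> sp Y i\<rbrakk> \<Longrightarrow> p\<^sub>1 i (i\<^sub>1 i x) = x" "\<And>i x. \<lbrakk>i \<in> V; x \<in> sp Y i\<rbrakk> \<Longrightarrow> p\<^sub>2 i (i\<^sub>1 i x) = \<zero>[Z',i]"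
    and e2: "\<And>i y. \<lbrakk>i \<in> V; y \<in> sp Z' i\<rbrakk> \<Longrightarrow> p\<^sub>2 i (i\<^sub>2 i y) = y" "\<And>i y. \<lbrakk>i \<in> V; y \<in> sp Z' i\<rbrakk> \<Longrightarrow> p\<^sub>1 i (i\<^sub>2 i y) = \<zero>[Y,i]"
    and e: "\<And>i b. \<lbrakk>i \<in> V; b \<in> sp B i\<rbrakk> \<Longrightarrow> i\<^sub>1 i (p\<^sub>1 i b) \<oplus>\<^bsub>space B i\<^esub> i\<^sub>2 i (p\<^sub>2 i b) = b"
    by (rule biproduct[OF m(1) assms(2)]) blast
  note Br = mobjD(1)[OF B]
  \<comment> \<open>\<open>B\<close> is only an isomorphic copy of the representation of pairs, so
    the pair (y, z) has to be handled through the injections and projections.\<close>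
  have pr: "i\<^sub>1 j y \<oplus>\<^bsub>space B j\<^esub> i\<^sub>2 j z \<in> sp B j" "p\<^sub>1 j (i\<^sub>1 j y \<oplus>\<^bsub>space B j\<^esub> i\<^sub>2 j z) = y" "p\<^sub>2 j (i\<^sub>1 j y \<oplus>\<^bsub>space B j\<^esub> i\<^sub>2 j z) = z"
    if j: "j \<in> V" and y: "y \<in> sp Y j" "z \<in> sp Z' j" for j y z
  proof -
    interpret Bj: left_module A "space B j" by (rule robj_lm[OF Br j])
    interpret Yj: left_module A "space Y j" by (rule robj_lm[OF Y j])
    interpret Zj: left_module A "space Z' j" by (rule robj_lm[OF Z' j])
    note m = rhom_closed[OF i(1) j y(1)] rhom_closed[OF i(2) j y(2)]
    show "i\<^sub>1 j y \<oplus>\<^bsub>space B j\<^esub> i\<^sub>2 j z \<in> sp B j" by (rule Bj.M.a_closed[OF m])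
    show "p\<^sub>1 j (i\<^sub>1 j y \<oplus>\<^bsub>space B j\<^esub> i\<^sub>2 j z) = y" "p\<^sub>2 j (i\<^sub>1 j y \<oplus>\<^bsub>space B j\<^esub> i\<^sub>2 j z) = z"
      using rhom_add[OF p(1) j m] rhom_add[OF p(2) j m]
      by (simp_all add: e1 e2 j y)
  qed
  let ?d = "rminus B Z (rcomp B g p\<^sub>1) (rcomp B c p\<^sub>2)"
  have d: "?d \<in> rhom B Z" by (rule rminus_rhom[OF rcomp_rhom[OF p(1) g Br] rcomp_rhom[OF p(2) c Br] Br Z])
  have d0: "?d j b = \<zero>[Z,j] \<longleftrightarrow> g j (p\<^sub>1 j b) = c j (p\<^sub>2 j b)" if j: "j \<in> V" "b \<in> sp B j" for j b
  proof -
    interpret Zj: left_module A "space Z j" by (rule robj_lm[OF Z j(1)])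
    show ?thesis
      using j Zj.M.minus_eq_zero_iff[OF rhom_closed[OF g j(1) rhom_closed[OF p(1) j]] rhom_closed[OF c j(1) rhom_closed[OF p(2) j]]]
      by simp
  qed
  have "z \<in> ?d j ` sp B j" if j: "j \<in> V" and z: "z \<in> sp Z j" for j z
  proof -
    interpret Zj: left_module A "space Z j" by (rule robj_lm[OF Z j])
    obtain y where y: "y \<in> sp Y j" "g j y = z" using z unfolding s[OF j, symmetric] by (metis imageE)
    note iy = rhom_closed[OF i(1) j y(1)]
    have "?d j (i\<^sub>1 j y) = z" using e1[OF j y(1)] rhom_zero[OF c Z' Z j] iy y z j by (simp add: Zj.M.minus_eq)
    then show ?thesis using iy by blast
  qed
  then have "deflation E B ?d Z" using B m(2) d rhom_closed[OF d] by (auto simp only: deflation_iff)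
  then obtain Y' k where Ek: "E Y' k B ?d Z" unfolding deflation_def by blast
  then have Y': "mobj Y'" and k: "k \<in> rhom Y' B" and im: "\<And>j. j \<in> V \<Longrightarrow> k j ` sp Y' j = {b \<in> sp B j. ?d j b = \<zero>[Z,j]}"
    unfolding E_iff by blast+
  note Y'r = mobjD(1)[OF Y']
  let ?b = "rcomp Y' p\<^sub>1 k" and ?g' = "rcomp Y' p\<^sub>2 k"
  have b: "?b \<in> rhom Y' Y" and g': "?g' \<in> rhom Y' Z'" by (rule rcomp_rhom[OF k p(1) Y'r], rule rcomp_rhom[OF k p(2) Y'r])
  have gc: "g j (p\<^sub>1 j (k j y)) = c j (p\<^sub>2 j (k j y))" if "j \<in> V" "y \<in> sp Y' j" for j y
    using im[OF that(1)] that(2) d0[OF that(1)] by blast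
  have sq: "rcomp Y' g ?b = rcomp Y' c ?g'"
    unfolding rcomp_eq_iff[OF b g Y'r rcomp_rhom[OF g' c Y'r]] using gc by simp
  have un: "\<exists>!u. u \<in> rhom W Y' \<and> rcomp W ?b u = h \<and> rcomp W ?g' u = h'"
    if W: "mobj W" and h: "h \<in> rhom W Y" "h' \<in> rhom W Z'" and eq: "rcomp W g h = rcomp W c h'"
    for W :: "('v, 'e, 'a, 'm) rep" and h h'
  proof -
    note Wr = mobjD(1)[OF W]
    let ?t = "rplus W B (rcomp W i\<^sub>1 h) (rcomp W i\<^sub>2 h')"
    have t: "?t \<in> rhom W B" by (rule rplus_rhom[OF rcomp_rhom[OF h(1) i(1) Wr] rcomp_rhom[OF h(2) i(2) Wr] Wr Br])
    note hc = rhom_closed[OF h(1)] rhom_closed[OF h(2)]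
    have "rcomp W ?d ?t = rzero W Z"
      unfolding rcomp_eq_iff[OF t d Wr rzero_rhom[OF Wr Z]]
    proof (intro ballI)
      fix j x assume jx: "j \<in> V" "x \<in> sp W j"
      have "g j (h j x) = c j (h' j x)" using eq jx by (metis rcomp_apply)
      then show "?d j (?t j x) = rzero W Z j x"
        using d0[OF jx(1) rhom_closed[OF t jx]] pr(2,3)[OF jx(1) hc[OF jx]] jx by (simp del: rminus_apply)
    qed
    then have "\<exists>!u. u \<in> rhom W Y' \<and> rcomp W k u = ?t"
      using conflation_kernel[OF Ek] W t unfolding is_kernel_def C_simps by blast
    \<comment> \<open>The two triangles of the pullback are the two coordinates of one equation
      between maps into \<open>B\<close>, so its universal property is that of the kernel
      \<open>k\<close>.\<close>
    moreover have "rcomp W ?b u = h \<and> rcomp W ?g' u = h' \<longleftrightarrow> rcomp W k u = ?t" if u: "u \<in> rhom W Y'" for u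
      unfolding rcomp_eq_iff[OF u b Wr h(1)] rcomp_eq_iff[OF u g' Wr h(2)] rcomp_eq_iff[OF u k Wr t] ball_conj_distrib[symmetric]
    proof (intro ball_cong refl)
      fix j x assume jx: "j \<in> V" "x \<in> sp W j"
      note ux = rhom_closed[OF u jx]
      show "?b j (u j x) = h j x \<and> ?g' j (u j x) = h' j x \<longleftrightarrow> k j (u j x) = ?t j x"
        using e[OF jx(1) rhom_closed[OF k jx(1) ux]] pr(2,3)[OF jx(1) hc[OF jx]] ux jx by auto
    qed
    ultimately show ?thesis by (metis (no_types, lifting))
  qed
  have "z \<in> ?g' j ` sp Y' j" if j: "j \<in> V" and z: "z \<in> sp Z' j" for j z
  proof -
    obtain y where y: "y \<in> sp Y j" "g j y = c j z" using s[OF j] rhom_closed[OF c j z] by (metis imageE)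
    have "i\<^sub>1 j y \<oplus>\<^bsub>space B j\<^esub> i\<^sub>2 j z \<in> k j ` sp Y' j"
      unfolding im[OF j] using pr[OF j y(1) z] d0[OF j pr(1)[OF j y(1) z]] y(2) by simp
    then obtain y' where "y' \<in> sp Y' j" "k j y' = i\<^sub>1 j y \<oplus>\<^bsub>space B j\<^esub> i\<^sub>2 j z" by (metis imageE)
    then show ?thesis using pr(3)[OF j y(1) z] j by (intro image_eqI[of _ _ y']) simp_all
  qed
  then have "deflation E Y' ?g' Z'"
    using Y' assms(2) g' rhom_closed[OF g'] by (auto simp only: deflation_iff)
  moreover have "is_pullback C Y Z Y' Z' g c ?g' ?b"
    unfolding is_pullback_def using m assms(2) Y' g c g' b sq un by simp
  ultimately show ?thesis by blast
qed

text \<open>The pushout is the cokernel of j = (f, -a) from \<open>X\<close> to the biproduct of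
  \<open>Y\<close> and \<open>X'\<close>. Its universal property is formal; the work lies in the
  clause on \<delta> from \<open>inflation_iff\<close>, once for j and once for the new map.\<close>

lemma inflation_pushout:
  assumes "inflation E X f Y" "mobj X'" "a \<in> Hom C X X'"
  shows "\<exists>Y' f' b. is_pushout C X Y X' Y' f a f' b \<and> inflation E X' f' Y'"
proof -
  note F = assms(1)[unfolded inflation_iff]
  have m: "mobj X" "mobj Y" and f: "f \<in> rhom X Y" and finj: "\<And>i. i \<in> V \<Longrightarrow> inj_on (f i) (sp X i)"
    using F by auto
  have a: "a \<in> rhom X X'" using assms(3) by simp
  note X = mobjD(1)[OF m(1)] and Y = mobjD(1)[OF m(2)] and X' = mobjD(1)[OF assms(2)]
  obtain B :: "('v, 'e, 'a, 'm) rep" and i\<^sub>1 i\<^sub>2 p\<^sub>1 p\<^sub>2 where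
    B: "mobj B" and i: "i\<^sub>1 \<in> rhom Y B" "i\<^sub>2 \<in> rhom X' B" and p: "p\<^sub>1 \<in> rhom B Y" "p\<^sub>2 \<in> rhom B X'"
    and e1: "\<And>i x. \<lbrakk>i \<in> V; x \<in> sp Y i\<rbrakk> \<Longrightarrow> p\<^sub>1 i (i\<^sub>1 i x) = x" "\<And>i x. \<lbrakk>i \<in> V; x \<in> sp Y i\<rbrakk> \<Longrightarrow> p\<^sub>2 i (i\<^sub>1 i x) = \<zero>[X',i]"
    and e2: "\<And>i y. \<lbrakk>i \<in> V; y \<in> sp X' i\<rbrakk> \<Longrightarrow> p\<^sub>2 i (i\<^sub>2 i y) = y" "\<And>i y. \<lbrakk>i \<in> V; y \<in> sp X' i\<rbrakk> \<Longrightarrow> p\<^sub>1 i (i\<^sub>2 i y) = \<zero>[Y,i]"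
    and e: "\<And>i b. \<lbrakk>i \<in> V; b \<in> sp B i\<rbrakk> \<Longrightarrow> i\<^sub>1 i (p\<^sub>1 i b) \<oplus>\<^bsub>space B i\<^esub> i\<^sub>2 i (p\<^sub>2 i b) = b"
    by (rule biproduct[OF m(2) assms(2)]) blast
  note Br = mobjD(1)[OF B]
  let ?j = "rminus X B (rcomp X i\<^sub>1 f) (rcomp X i\<^sub>2 a)"
  have j: "?j \<in> rhom X B" by (rule rminus_rhom[OF rcomp_rhom[OF f i(1) X] rcomp_rhom[OF a i(2) X] X Br])
  have jv: "?j v x = i\<^sub>1 v (f v x) \<ominus>\<^bsub>space B v\<^esub> i\<^sub>2 v (a v x)" if "v \<in> V" "x \<in> sp X v" for v x using that by simp
  have pj: "p\<^sub>1 v (?j v x) = f v x" "p\<^sub>2 v (?j v x) = \<ominus>\<^bsub>space X' v\<^esub> a v x" if v: "v \<in> V" and x: "x \<in> sp X v" for v x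
  proof -
    interpret Yv: left_module A "space Y v" by (rule robj_lm[OF Y v])
    interpret X'v: left_module A "space X' v" by (rule robj_lm[OF X' v])
    note fx = rhom_closed[OF f v x] and ax = rhom_closed[OF a v x]
    note m = rhom_closed[OF i(1) v fx] rhom_closed[OF i(2) v ax]
    show "p\<^sub>1 v (?j v x) = f v x" "p\<^sub>2 v (?j v x) = \<ominus>\<^bsub>space X' v\<^esub> a v x"
      unfolding jv[OF v x] rhom_minus[OF p(1) Br Y v m]
        rhom_minus[OF p(2) Br X' v m]
      using e1[OF v fx] e2[OF v ax] fx ax by (simp_all add: Yv.M.minus_eq X'v.M.minus_eq)
  qed
  \<comment> \<open>If the first coordinate of \<delta> w lies in the image of \<open>f\<close>, the
    clause for \<open>f\<close> lifts the first coordinates of the members of w to \<open>X\<close>.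
    Both verifications of the clause start from this.\<close>
  have lift: "\<exists>y\<in>dsp X v. push v f y = push v p\<^sub>1 w"
    if v: "v \<in> V" and w: "w \<in> dsp B v" and x: "x \<in> sp X v" "p\<^sub>1 v (delta Q B v w) = f v x" for v w x
  proof -
    note pw = rhom_push_closed[OF p(1) w]
    have "delta Q Y v (push v p\<^sub>1 w) \<in> f v ` sp X v" using delta_push[OF Br Y p(1) v w] x by (metis imageI)
    then have "push v p\<^sub>1 w \<mu> \<in> f (tail Q \<mu>) ` sp X (tail Q \<mu>)" if "\<mu> \<in> into v" for \<mu> using F v pw that by blast
    then show ?thesis by (rule push_surj[OF pw _ bexI[rotated]])
  qed
  \<comment> \<open>The family lifted to \<open>X\<close> is mapped by j to a family with the same
    \<delta> as w; since \<open>B\<close> is monic, that family is w.\<close>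
  have "w \<mu> \<in> ?j (tail Q \<mu>) ` sp X (tail Q \<mu>)"
    if v: "v \<in> V" and w: "w \<in> dsp B v" "delta Q B v w \<in> ?j v ` sp X v" and \<mu>: "\<mu> \<in> into v" for v w \<mu>
  proof -
    obtain x where x: "x \<in> sp X v" "delta Q B v w = ?j v x" using w(2) by blast
    obtain y where y: "y \<in> dsp X v" "push v f y = push v p\<^sub>1 w"
      using lift[OF v w(1) x(1)] pj(1)[OF v x(1)] x(2) by metis
    have "f v (delta Q X v y) = f v x"
      unfolding delta_push[OF X Y f v y(1)] y(2) delta_push[OF Br Y p(1) v w(1), symmetric] x(2) by (rule pj(1)[OF v x(1)])
    then have "delta Q X v y = x" using finj[OF v] delta_closed[OF X v y(1)] x(1) by (simp add: inj_on_eq_iff)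
    then have "delta Q B v (push v ?j y) = delta Q B v w" using delta_push[OF X Br j v y(1)] x(2) by (simp only:)
    then have "push v ?j y = w"
      using mobjD(2)[OF B] v rhom_push_closed[OF j y(1)] w(1) unfolding monic_def delta_domain_eq inj_on_def by blast
    then have "w \<mu> = ?j (tail Q \<mu>) (y \<mu>)" using \<mu> by (auto simp only: push_def restrict_apply')
    then show ?thesis using prodm_mem[OF y(1) \<mu>] by (rule image_eqI)
  qed
  moreover have jinj: "inj_on (?j v) (sp X v)" if "v \<in> V" for v
    by (rule inj_onI) (metis pj(1)[OF that] inj_onD[OF finj[OF that]])
  ultimately have "inflation E X ?j B" unfolding inflation_iff using m(1) B j by blast
  then obtain q Y' where Eq: "E X ?j B q Y'" unfolding inflation_def by blast
  then have Y': "mobj Y'" and q: "q \<in> rhom B Y'" and ker: "\<And>v. v \<in> V \<Longrightarrow> ?j v ` sp X v = {b \<in> sp B v. q v b = \<zero>[Y',v]}"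
    and qs: "\<And>v. v \<in> V \<Longrightarrow> q v ` sp B v = sp Y' v"
    unfolding E_iff by blast+
  note Y'r = mobjD(1)[OF Y']
  have qj: "q v (?j v x) = \<zero>[Y',v]" if "v \<in> V" "x \<in> sp X v" for v x using ker[OF that(1)] that(2) by blast
  have qeq: "\<exists>x\<in>sp X v. b \<ominus>\<^bsub>space B v\<^esub> b' = ?j v x"
    if v: "v \<in> V" and b: "b \<in> sp B v" "b' \<in> sp B v" "q v b = q v b'" for v b b'
  proof -
    interpret Bv: left_module A "space B v" by (rule robj_lm[OF Br v])
    interpret Y'v: left_module A "space Y' v" by (rule robj_lm[OF Y'r v])
    have "q v (b \<ominus>\<^bsub>space B v\<^esub> b') = \<zero>[Y',v]"
      using rhom_minus[OF q Br Y'r v b(1,2)] b(3)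
        Y'v.M.minus_self[OF rhom_closed[OF q v b(2)]] by simp
    then show ?thesis using ker[OF v] Bv.M.minus_closed[OF b(1,2)] by blast
  qed
  let ?b = "rcomp Y q i\<^sub>1" and ?f' = "rcomp X' q i\<^sub>2"
  have b: "?b \<in> rhom Y Y'" and f': "?f' \<in> rhom X' Y'" by (rule rcomp_rhom[OF i(1) q Y], rule rcomp_rhom[OF i(2) q X'])
  have sq: "rcomp X ?b f = rcomp X ?f' a"
    unfolding rcomp_eq_iff[OF f b X rcomp_rhom[OF a f' X]]
  proof (intro ballI)
    fix v x assume v: "v \<in> V" and x: "x \<in> sp X v"
    interpret Y'v: left_module A "space Y' v" by (rule robj_lm[OF Y'r v])
    note fx = rhom_closed[OF f v x] and ax = rhom_closed[OF a v x]
    note m = rhom_closed[OF i(1) v fx] rhom_closed[OF i(2) v ax]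
    have "q v (i\<^sub>1 v (f v x)) \<ominus>\<^bsub>space Y' v\<^esub> q v (i\<^sub>2 v (a v x)) = \<zero>[Y',v]"
      using rhom_minus[OF q Br Y'r v m] qj[OF v x] jv[OF v x] by simp
    then show "?b v (f v x) = rcomp X ?f' a v x"
      using Y'v.M.minus_eq_zero_iff[OF rhom_closed[OF q v m(1)] rhom_closed[OF q v m(2)]] v x fx ax by simp
  qed
  have i20: "x' = \<zero>[X',v]" if v: "v \<in> V" and x: "x \<in> sp X v" "x' \<in> sp X' v" "i\<^sub>2 v x' = ?j v x" for v x x'
  proof -
    have "f v x = f v \<zero>[X,v]"
      using pj(1)[OF v x(1)] e2(2)[OF v x(2)] rhom_zero[OF f X Y v] unfolding x(3)[symmetric] by simp
    then have x0: "x = \<zero>[X,v]" using inj_onD[OF finj[OF v] _ x(1) zero_in[OF X v]] by blast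
    show ?thesis
      using e2(1)[OF v x(2)] rhom_zero[OF p(2) Br X' v] unfolding x(3) x0 rhom_zero[OF j X Br v] by (simp only:)
  qed
  have f'0: "x' = \<zero>[X',v]" if v: "v \<in> V" and x': "x' \<in> sp X' v" "?f' v x' = \<zero>[Y',v]" for v x'
  proof -
    have "i\<^sub>2 v x' \<in> ?j v ` sp X v" unfolding ker[OF v] using rhom_closed[OF i(2) v x'(1)] x' v by simp
    then show ?thesis using i20[OF v _ x'(1)] by blast
  qed
  \<comment> \<open>Lift w to z in the biproduct and subtract the image under j of a family y in
    \<open>X\<close>, so that the first coordinate becomes zero. The remainder comes from
    \<open>X'\<close> and is still sent by \<open>q\<close> to w, because \<open>q\<close> kills the
    image of j.\<close>
  have "w \<mu> \<in> ?f' (tail Q \<mu>) ` sp X' (tail Q \<mu>)"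
    if v: "v \<in> V" and w: "w \<in> dsp Y' v" "delta Q Y' v w \<in> ?f' v ` sp X' v" and \<mu>: "\<mu> \<in> into v" for v w \<mu>
  proof -
    obtain x' where x': "x' \<in> sp X' v" "delta Q Y' v w = q v (i\<^sub>2 v x')" using w(2) v by auto
    have "w \<nu> \<in> q (tail Q \<nu>) ` sp B (tail Q \<nu>)" if "\<nu> \<in> into v" for \<nu>
      using prodm_mem[OF w(1) that] qs[OF into_tail[OF that]] by blast
    then obtain z where z: "z \<in> dsp B v" "push v q z = w" by (rule push_surj[OF w(1)]) blast
    note dz = delta_closed[OF Br v z(1)] and ix = rhom_closed[OF i(2) v x'(1)]
    obtain x where x: "x \<in> sp X v" "delta Q B v z \<ominus>\<^bsub>space B v\<^esub> i\<^sub>2 v x' = ?j v x"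
      using qeq[OF v dz ix] delta_push[OF Br Y'r q v z(1)] z(2) x'(2) by metis
    interpret Yv: left_module A "space Y v" by (rule robj_lm[OF Y v])
    have "p\<^sub>1 v (delta Q B v z) = f v x"
      using rhom_minus[OF p(1) Br Y v dz ix]
        rhom_closed[OF p(1) v dz] e2(2)[OF v x'(1)] unfolding x(2) pj(1)[OF v x(1)] by (simp add: Yv.M.minus_eq)
    then obtain y where y: "y \<in> dsp X v" "push v f y = push v p\<^sub>1 z" using lift[OF v z(1) x(1)] by blast
    let ?t = "tail Q \<mu>"
    note t = into_tail[OF \<mu>]
    note y\<mu> = prodm_mem[OF y(1) \<mu>] and z\<mu> = prodm_mem[OF z(1) \<mu>]
    note jy = rhom_closed[OF j t y\<mu>]
    interpret Bt: left_module A "space B ?t" by (rule robj_lm[OF Br t])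
    interpret Yt: left_module A "space Y ?t" by (rule robj_lm[OF Y t])
    interpret Y't: left_module A "space Y' ?t" by (rule robj_lm[OF Y'r t])
    let ?z = "z \<mu> \<ominus>\<^bsub>space B ?t\<^esub> ?j ?t (y \<mu>)"
    note zc = Bt.M.minus_closed[OF z\<mu> jy]
    have "f ?t (y \<mu>) = p\<^sub>1 ?t (z \<mu>)" using fun_cong[OF y(2), of \<mu>] \<mu> by (simp add: push_def)
    then have "p\<^sub>1 ?t ?z = \<zero>[Y,?t]"
      unfolding rhom_minus[OF p(1) Br Y t z\<mu> jy] pj(1)[OF t y\<mu>]
      by (simp only: Yt.M.minus_self[OF rhom_closed[OF p(1) t z\<mu>]])
    then have "i\<^sub>2 ?t (p\<^sub>2 ?t ?z) = ?z"
      using e[OF t zc] rhom_zero[OF i(1) Y Br t] Bt.M.l_zero[OF rhom_closed[OF i(2) t rhom_closed[OF p(2) t zc]]] by (simp only:)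
    then have "?f' ?t (p\<^sub>2 ?t ?z) = q ?t ?z" using t rhom_closed[OF p(2) t zc] by simp
    also have "\<dots> = q ?t (z \<mu>)"
      unfolding rhom_minus[OF q Br Y'r t z\<mu> jy] qj[OF t y\<mu>]
      using rhom_closed[OF q t z\<mu>] by (simp add: Y't.M.minus_eq)
    also have "\<dots> = w \<mu>" using fun_cong[OF z(2), of \<mu>] \<mu> by (simp add: push_def)
    finally show ?thesis using rhom_closed[OF p(2) t zc] by (metis imageI)
  qed
  moreover have "inj_on (?f' v) (sp X' v)" if v: "v \<in> V" for v
    unfolding rhom_inj_iff[OF f' X' Y'r v] using f'0[OF v] by blast
  ultimately have infl: "inflation E X' ?f' Y'" unfolding inflation_iff using assms(2) Y' f' by blast
  have un: "\<exists>!u. u \<in> rhom Y' W \<and> rcomp Y u ?b = h \<and> rcomp X' u ?f' = h'"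
    if W: "mobj W" and h: "h \<in> rhom Y W" "h' \<in> rhom X' W" and eq: "rcomp X h f = rcomp X h' a"
    for W :: "('v, 'e, 'a, 'm) rep" and h h'
  proof -
    note Wr = mobjD(1)[OF W]
    let ?k = "rplus B W (rcomp B h p\<^sub>1) (rcomp B h' p\<^sub>2)"
    have k: "?k \<in> rhom B W" by (rule rplus_rhom[OF rcomp_rhom[OF p(1) h(1) Br] rcomp_rhom[OF p(2) h(2) Br] Br Wr])
    have kv: "?k v b = h v (p\<^sub>1 v b) \<oplus>\<^bsub>space W v\<^esub> h' v (p\<^sub>2 v b)" if "v \<in> V" "b \<in> sp B v" for v b using that by simp
    have ki: "?k v (i\<^sub>1 v y) = h v y" "?k v (i\<^sub>2 v x') = h' v x'"
      if v: "v \<in> V" and y: "y \<in> sp Y v" "x' \<in> sp X' v" for v y x'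
    proof -
      interpret Wv: left_module A "space W v" by (rule robj_lm[OF Wr v])
      show "?k v (i\<^sub>1 v y) = h v y" "?k v (i\<^sub>2 v x') = h' v x'"
        unfolding kv[OF v rhom_closed[OF i(1) v y(1)]] kv[OF v rhom_closed[OF i(2) v y(2)]] e1[OF v y(1)] e2[OF v y(2)]
          rhom_zero[OF h(1) Y Wr v] rhom_zero[OF h(2) X' Wr v]
        using rhom_closed[OF h(1) v y(1)] rhom_closed[OF h(2) v y(2)] by simp_all
    qed
    have "rcomp X ?k ?j = rzero X W"
      unfolding rcomp_eq_iff[OF j k X rzero_rhom[OF X Wr]]
    proof (intro ballI)
      fix v x assume v: "v \<in> V" and x: "x \<in> sp X v"
      interpret Wv: left_module A "space W v" by (rule robj_lm[OF Wr v])
      note ax = rhom_closed[OF a v x]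
      have "h v (f v x) = h' v (a v x)" using eq v x by (metis rcomp_apply)
      then show "?k v (?j v x) = rzero X W v x"
        unfolding kv[OF v rhom_closed[OF j v x]] pj[OF v x]
          mod_hom_neg[OF robj_lm[OF X' v] robj_lm[OF Wr v] rep_hom_at[OF h(2) v] ax]
        using Wv.M.r_neg[OF rhom_closed[OF h(2) v ax]] v x by simp
    qed
    then have "\<exists>!u. u \<in> rhom Y' W \<and> rcomp B u q = ?k"
      using conflation_cokernel[OF Eq] W k unfolding is_cokernel_def C_simps by blast
    moreover have "rcomp Y u ?b = h \<and> rcomp X' u ?f' = h' \<longleftrightarrow> rcomp B u q = ?k" if u: "u \<in> rhom Y' W" for u
      unfolding rcomp_eq_iff[OF b u Y h(1)] rcomp_eq_iff[OF f' u X' h(2)] rcomp_eq_iff[OF q u Br k]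
    proof (intro iffI conjI ballI)
      fix v c assume *: "(\<forall>v\<in>V. \<forall>x\<in>sp Y v. u v (?b v x) = h v x) \<and> (\<forall>v\<in>V. \<forall>x\<in>sp X' v. u v (?f' v x) = h' v x)"
        and v: "v \<in> V" and c: "c \<in> sp B v"
      note pc = rhom_closed[OF p(1) v c] rhom_closed[OF p(2) v c]
      note ic = rhom_closed[OF i(1) v pc(1)] rhom_closed[OF i(2) v pc(2)]
      have "u v (q v (i\<^sub>1 v (p\<^sub>1 v c) \<oplus>\<^bsub>space B v\<^esub> i\<^sub>2 v (p\<^sub>2 v c))) = ?k v c"
        unfolding rhom_add[OF q v ic] kv[OF v c]
          rhom_add[OF u v rhom_closed[OF q v ic(1)] rhom_closed[OF q v ic(2)]]
        using * v pc by simp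
      then show "u v (q v c) = ?k v c" unfolding e[OF v c] .
    next
      fix v y assume *: "\<forall>v\<in>V. \<forall>b\<in>sp B v. u v (q v b) = ?k v b" and v: "v \<in> V"
      { assume y: "y \<in> sp Y v"
        then show "u v (?b v y) = h v y"
          using * v rhom_closed[OF i(1) v y] ki(1)[OF v y zero_in[OF X' v]] by simp }
      { assume y: "y \<in> sp X' v"
        then show "u v (?f' v y) = h' v y"
          using * v rhom_closed[OF i(2) v y] ki(2)[OF v zero_in[OF Y v] y] by simp }
    qed
    ultimately show ?thesis by (metis (no_types, lifting))
  qed
  have "is_pushout C X Y X' Y' f a ?f' ?b"
    unfolding is_pushout_def using m assms(2) Y' f a f' b sq un by simp
  then show ?thesis using infl by blast
qed

theorem exact: "exact_category C E"
proof (rule exact_category.intro[OF additive exact_category_axioms.intro])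
  fix X Y Z X' Y' Z' :: "('v, 'e, 'a, 'm) rep" and f g a b c f' g' :: "'v \<Rightarrow> 'm \<Rightarrow> 'm"
  show "E X f Y g Z \<Longrightarrow> is_kernel C X f Y g Z" by (rule conflation_kernel)
  show "E X f Y g Z \<Longrightarrow> is_cokernel C X f Y g Z" by (rule conflation_cokernel)
  show "\<lbrakk>E X f Y g Z; is_iso C X X' a; is_iso C Y Y' b; is_iso C Z Z' c;
        f' \<in> Hom C X' Y'; g' \<in> Hom C Y' Z';
        Comp C X X' Y' f' a = Comp C X Y Y' b f; Comp C Y Y' Z' g' b = Comp C Y Z Z' c g\<rbrakk>
      \<Longrightarrow> E X' f' Y' g' Z'" by (rule conflation_iso)
  show "mobj X \<Longrightarrow> inflation E X (Ident C X) X" by (rule Ident_inflation)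
  show "mobj X \<Longrightarrow> deflation E X (Ident C X) X" by (rule Ident_deflation)
  show "\<lbrakk>inflation E X f Y; inflation E Y g Z\<rbrakk> \<Longrightarrow> inflation E X (Comp C X Y Z g f) Z" by (rule inflation_Comp)
  show "\<lbrakk>deflation E X f Y; deflation E Y g Z\<rbrakk> \<Longrightarrow> deflation E X (Comp C X Y Z g f) Z" by (rule deflation_Comp)
  show "\<lbrakk>inflation E X f Y; mobj X'; a \<in> Hom C X X'\<rbrakk>
      \<Longrightarrow> \<exists>Y' f' b. is_pushout C X Y X' Y' f a f' b \<and> inflation E X' f' Y'" by (rule inflation_pushout)
  show "\<lbrakk>deflation E Y g Z; mobj Z'; c \<in> Hom C Z' Z\<rbrakk>
      \<Longrightarrow> \<exists>Y' g' b. is_pullback C Y Z Y' Z' g c g' b \<and> deflation E Y' g' Z'" by (rule deflation_pullback)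
qed

end

section \<open>Projective and injective monic representations\<close>

locale self_injective_quiver = mon_category K A Q T
  for K :: "'k ring" and A :: "('k, 'a) module" and Q :: "('v, 'e) pre_digraph" and T :: "'m itself" +
  assumes AA_inj: "inj_in TYPE('k list) (regular_module A)"
begin

text \<open>Vertexwise injectivity. It turns out to describe the projective as well as the injective
  objects (\<open>projective_iff_good\<close>, \<open>injective_iff_good\<close>).\<close>

abbreviation good :: "('v, 'e, 'a, 'n) rep \<Rightarrow> bool" where "good X \<equiv> \<forall>i\<in>V. inj_mod (space X i)"

lemma delta_push_mod_hom:
  assumes "robj X" "robj Y" "i \<in> V"
    "\<And>\<mu>. \<mu> \<in> into i \<Longrightarrow> f (tail Q \<mu>) \<in> homA (space X (tail Q \<mu>)) (space Y (tail Q \<mu>))"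
  shows "(\<lambda>w\<in>dsp X i. delta Q Y i (push i f w)) \<in> homA (dmod X i) (space Y i)"
proof -
  have "compose (dsp X i) (restrict (delta Q Y i) (dsp Y i)) (restrict (push i f) (dsp X i))
    \<in> homA (dmod X i) (space Y i)"
    by (rule mod_hom_compose[OF push_hom[OF assms(1,4)] delta_hom[OF assms(2,3)] dmod_lm[OF assms(1)]])
  moreover have "compose (dsp X i) (restrict (delta Q Y i) (dsp Y i)) (restrict (push i f) (dsp X i))
    = (\<lambda>w\<in>dsp X i. delta Q Y i (push i f w))"
    unfolding compose_def using push_closed[OF assms(4)] by (intro restrict_ext) simp
  ultimately show ?thesis by (simp only:)
qed

lemma dmod_zeroI:
  assumes "w \<in> dsp X i" "\<And>\<mu>. \<mu> \<in> into i \<Longrightarrow> w \<mu> = \<zero>[X,tail Q \<mu>]"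
  shows "w = \<zero>\<^bsub>dmod X i\<^esub>"
proof (rule extensionalityI[of _ "into i"])
  show "w \<in> extensional (into i)" using assms(1) by (simp add: PiE_def)
qed (simp_all add: assms(2))

text \<open>Since \<delta>_i of \<open>Y\<close> is injective, the components at the sources
  prescribe the component at i on the image of \<delta>_i, and injectivity of the target extends it
  to the whole module at i.\<close>

lemma extend_delta:
  assumes "mobj Y" "robj I" "i \<in> V" "inj_mod (space I i)"
    "\<And>\<mu>. \<mu> \<in> into i \<Longrightarrow> u (tail Q \<mu>) \<in> homA (space Y (tail Q \<mu>)) (space I (tail Q \<mu>))"
  obtains a where "a \<in> homA (space Y i) (space I i)"
    "\<And>w. w \<in> dsp Y i \<Longrightarrow> a (delta Q Y i w) = delta Q I i (push i u w)"
proof -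
  note Y = mobjD(1)[OF assms(1)]
  let ?j = "restrict (delta Q Y i) (dsp Y i)"
  let ?h = "\<lambda>w\<in>dsp Y i. delta Q I i (push i u w)"
  have h: "?h \<in> homA (dmod Y i) (space I i)" by (rule delta_push_mod_hom[OF Y assms(2,3,5)])
  have ker: "?h w = \<zero>[I,i]" if w: "w \<in> dsp Y i" "?j w = \<zero>[Y,i]" for w
  proof -
    have "delta Q Y i w = \<zero>[Y,i]" using w by simp
    then have "w = \<zero>\<^bsub>dmod Y i\<^esub>"
      using dmod_zeroI[OF w(1)] monicD[OF Y mobjD(2)[OF assms(1)] assms(3) w(1)] by blast
    then show ?thesis using mod_hom_zero[OF dmod_lm[OF Y] robj_lm[OF assms(2,3)] h] by (simp only:)
  qed
  obtain a where a: "a \<in> homA (space Y i) (space I i)" "\<And>w. w \<in> dsp Y i \<Longrightarrow> a (?j w) = ?h w"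
    by (rule inj_modD[OF assms(4) dmod_lm[OF Y] robj_fd[OF Y assms(3)] delta_hom[OF Y assms(3)] h ker]) blast+
  show thesis
  proof (rule that[OF a(1)])
    fix w assume w: "w \<in> dsp Y i"
    show "a (delta Q Y i w) = delta Q I i (push i u w)"
      using a(2)[OF w] by (simp only: restrict_apply' [OF w])
  qed
qed

lemma push_push:
  assumes "\<And>\<mu>. \<mu> \<in> into i \<Longrightarrow> u (tail Q \<mu>) (f (tail Q \<mu>) (w \<mu>)) = h (tail Q \<mu>) (w \<mu>)"
  shows "push i u (push i f w) = push i h w"
  using assms by (auto simp: push_def)

lemma rep_hom_of_delta:
  assumes "robj X" "robj Y"
    and "\<And>\<mu>. \<mu> \<in> into i \<Longrightarrow> f (tail Q \<mu>) \<in> homA (space X (tail Q \<mu>)) (space Y (tail Q \<mu>))"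
    and "\<And>w. w \<in> dsp X i \<Longrightarrow> g (delta Q X i w) = delta Q Y i (push i f w)"
  shows "\<forall>\<mu>\<in>into i. \<forall>x\<in>sp X (tail Q \<mu>). g (arr X \<mu> x) = arr Y \<mu> (f (tail Q \<mu>) x)"
  using delta_push_conv[OF assms] by blast

text \<open>At vertex i the map a has the prescribed values on the image of \<delta> but need not
  restrict to h along f. The defect h - a f vanishes on \<delta> of X, and by the clause on \<delta>
  this image contains the kernel of the map from X_i to the cokernel of \<delta>_i of Y. So the
  defect extends over that cokernel, and adding the extension leaves the values on the image of
  \<delta> unchanged.\<close>

lemma good_injective:
  fixes I :: "('v, 'e, 'a, 'm) rep"
  assumes "mobj I" "good I"
  shows "injective_object C E I"
  unfolding injective_object_def
proof (intro conjI allI impI ballI)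
  show "mobj I" by fact
  note I = mobjD(1)[OF assms(1)]
  fix X f Y h
  assume "inflation E X f Y" and "h \<in> Hom C X I"
  then have h: "h \<in> rhom X I" and m: "mobj X" "mobj Y" and f: "f \<in> rhom X Y"
    and finj: "\<And>i. i \<in> V \<Longrightarrow> inj_on (f i) (sp X i)"
    and M: "\<And>i w \<mu>. \<lbrakk>i \<in> V; w \<in> dsp Y i; delta Q Y i w \<in> f i ` sp X i; \<mu> \<in> into i\<rbrakk>
      \<Longrightarrow> w \<mu> \<in> f (tail Q \<mu>) ` sp X (tail Q \<mu>)"
    unfolding inflation_iff by auto
  note X = mobjD(1)[OF m(1)] and Y = mobjD(1)[OF m(2)]
  obtain u where u: "u \<in> rhom Y I" "\<And>i. i \<in> V \<Longrightarrow> \<forall>x\<in>sp X i. u i (f i x) = h i x"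
  proof (rule rep_hom_recursion[of Y I "\<lambda>i g. \<forall>x\<in>sp X i. g (f i x) = h i x"])
    fix i u
    assume i: "i \<in> V" and u: "\<And>\<mu>. \<mu> \<in> into i \<Longrightarrow> u (tail Q \<mu>) \<in> homA (space Y (tail Q \<mu>)) (space I (tail Q \<mu>))"
      and uf: "\<And>\<mu>. \<mu> \<in> into i \<Longrightarrow> \<forall>x\<in>sp X (tail Q \<mu>). u (tail Q \<mu>) (f (tail Q \<mu>) x) = h (tail Q \<mu>) x"
    note lX = robj_lm[OF X i] and lY = robj_lm[OF Y i] and lI = robj_lm[OF I i]
    interpret Ii: left_module A "space I i" by (rule lI)
    note fi = rep_hom_at[OF f i] and hi = rep_hom_at[OF h i]
    have inj: "inj_mod (space I i)" using assms(2) i by blast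
    obtain a where a: "a \<in> homA (space Y i) (space I i)"
      "\<And>w. w \<in> dsp Y i \<Longrightarrow> a (delta Q Y i w) = delta Q I i (push i u w)"
      by (rule extend_delta[OF m(2) I i inj u]) blast+
    have pp: "push i u (push i f w) = push i h w" if w: "w \<in> dsp X i" for w
      using uf prodm_mem[OF w] by (intro push_push) blast
    have af: "compose (sp X i) a (f i) \<in> homA (space X i) (space I i)" by (rule mod_hom_compose[OF fi a(1) lX])
    let ?e = "\<lambda>x\<in>sp X i. h i x \<ominus>\<^bsub>space I i\<^esub> compose (sp X i) a (f i) x"
    have e: "?e \<in> homA (space X i) (space I i)" by (rule mod_hom_diff[OF hi af lX lI])
    have e0: "?e (delta Q X i w) = \<zero>[I,i]" if w: "w \<in> dsp X i" for w
    proof -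
      have "h i (delta Q X i w) = a (f i (delta Q X i w))"
        using delta_push[OF X I h i w] delta_push[OF X Y f i w] a(2)[OF rhom_push_closed[OF f w]] pp[OF w] by simp
      then show ?thesis
        using delta_closed[OF X i w] rhom_closed[OF h i delta_closed[OF X i w]] by (simp add: compose_def Ii.M.minus_self)
    qed
    let ?D = "restrict (delta Q Y i) (dsp Y i) ` dsp Y i"
    have D: "lsub A (space Y i) ?D"
      by (rule lsub_image[OF dmod_lm[OF Y] lY delta_hom[OF Y i] lsub_carrier[OF dmod_lm[OF Y]]])
    obtain N :: "('a, 'm) module" and q where q: "fd_module K A N" "q \<in> homA (space Y i) N"
      "q ` sp Y i = carrier N" "\<And>x. x \<in> sp Y i \<Longrightarrow> q x = \<zero>\<^bsub>N\<^esub> \<longleftrightarrow> x \<in> ?D"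
      by (rule fd_quotient[OF robj_fd[OF Y i] D universe]) blast
    let ?j = "compose (sp X i) q (f i)"
    have j: "?j \<in> homA (space X i) N" by (rule mod_hom_compose[OF fi q(2) lX])
    have ker: "?e x = \<zero>[I,i]" if x: "x \<in> sp X i" "?j x = \<zero>\<^bsub>N\<^esub>" for x
    proof -
      have "q (f i x) = \<zero>\<^bsub>N\<^esub>" using x by (simp add: compose_def)
      then have "f i x \<in> ?D" using q(4)[OF rhom_closed[OF f i x(1)]] by blast
      then obtain w where w: "w \<in> dsp Y i" "delta Q Y i w = f i x"
        by (elim imageE) (simp only: restrict_apply' if_True)
      have wf: "w \<mu> \<in> f (tail Q \<mu>) ` sp X (tail Q \<mu>)" if "\<mu> \<in> into i" for \<mu>
        using M[OF i w(1) _ that] w(2) x(1) by simp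
      obtain y where y: "y \<in> dsp X i" "push i f y = w" by (rule push_surj[OF w(1) wf])
      have "f i (delta Q X i y) = f i x" using delta_push[OF X Y f i y(1)] y(2) w(2) by simp
      then have "delta Q X i y = x"
        by (rule inj_onD[OF finj[OF i] _ delta_closed[OF X i y(1)] x(1)])
      then show ?thesis using e0[OF y(1)] by simp
    qed
    obtain b where b: "b \<in> homA N (space I i)" "\<And>x. x \<in> sp X i \<Longrightarrow> b (?j x) = ?e x"
      by (rule inj_modD[OF inj lX q(1) j e ker]) blast+
    have bq: "compose (sp Y i) b q \<in> homA (space Y i) (space I i)" by (rule mod_hom_compose[OF q(2) b(1) lY])
    let ?g = "\<lambda>y\<in>sp Y i. a y \<oplus>\<^bsub>space I i\<^esub> compose (sp Y i) b q y"
    have g: "?g \<in> homA (space Y i) (space I i)" by (rule mod_hom_plus[OF a(1) bq lY lI])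
    have "?g (f i x) = h i x" if x: "x \<in> sp X i" for x
    proof -
      note fx = rhom_closed[OF f i x]
      have "b (q (f i x)) = h i x \<ominus>\<^bsub>space I i\<^esub> a (f i x)" using b(2)[OF x] x by (simp add: compose_def)
      then show ?thesis
        using fx rhom_closed[OF h i x] mod_hom_closed[OF a(1) fx] Ii.M.minus_add_cancel
        by (simp add: compose_def) (metis Ii.M.a_comm Ii.M.minus_closed)
    qed
    moreover have "\<forall>\<mu>\<in>into i. \<forall>x\<in>sp Y (tail Q \<mu>). ?g (arr Y \<mu> x) = arr I \<mu> (u (tail Q \<mu>) x)"
    proof (rule rep_hom_of_delta[OF Y I u])
      fix w assume w: "w \<in> dsp Y i"
      have "q (delta Q Y i w) = \<zero>\<^bsub>N\<^esub>"
        using q(4)[OF delta_closed[OF Y i w]] w by (metis imageI restrict_apply')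
      then show "?g (delta Q Y i w) = delta Q I i (push i u w)"
        using delta_closed[OF Y i w] a(2)[OF w] mod_hom_zero[OF fd_left_module[OF q(1)] lI b(1)]
          mod_hom_closed[OF a(1) delta_closed[OF Y i w]] by (simp add: compose_def)
    qed
    ultimately show "\<exists>g\<in>homA (space Y i) (space I i). (\<forall>x\<in>sp X i. g (f i x) = h i x) \<and>
        (\<forall>\<mu>\<in>into i. \<forall>x\<in>sp Y (tail Q \<mu>). g (arr Y \<mu> x) = arr I \<mu> (u (tail Q \<mu>) x))"
      using g by blast
  qed blast
  have "rcomp X u f = h" unfolding rcomp_eq_iff[OF f u(1) X h] using u(2) by blast
  then show "\<exists>u\<in>Hom C Y I. Comp C X Y I u f = h" using u(1) by auto
qed

text \<open>The domain of \<delta>_i of \<open>P\<close> is injective, so \<delta>_i has a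
  retraction r, along which the map forced on the image of \<delta>_i is extended. The remaining
  error kills that image and is lifted through g by \<open>inj_mod_lift\<close>; subtracting from
  the lift its composite with \<delta> r makes it vanish on the image of \<delta>_i as well.\<close>

lemma good_projective:
  fixes P :: "('v, 'e, 'a, 'm) rep"
  assumes "mobj P" "good P"
  shows "projective_object C E P"
  unfolding projective_object_def
proof (intro conjI allI impI ballI)
  show "mobj P" by fact
  note P = mobjD(1)[OF assms(1)]
  fix Y g Z h
  assume "deflation E Y g Z" and "h \<in> Hom C P Z"
  then have h: "h \<in> rhom P Z" and m: "mobj Y" "mobj Z" and g: "g \<in> rhom Y Z"
    and surj: "\<And>i. i \<in> V \<Longrightarrow> g i ` sp Y i = sp Z i"
    unfolding deflation_iff by auto
  note Y = mobjD(1)[OF m(1)] and Z = mobjD(1)[OF m(2)]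
  obtain u where u: "u \<in> rhom P Y" "\<And>i. i \<in> V \<Longrightarrow> \<forall>x\<in>sp P i. g i (u i x) = h i x"
  proof (rule rep_hom_recursion[of P Y "\<lambda>i u. \<forall>x\<in>sp P i. g i (u x) = h i x"])
    fix i u
    assume i: "i \<in> V" and u: "\<And>\<mu>. \<mu> \<in> into i \<Longrightarrow> u (tail Q \<mu>) \<in> homA (space P (tail Q \<mu>)) (space Y (tail Q \<mu>))"
      and gu: "\<And>\<mu>. \<mu> \<in> into i \<Longrightarrow> \<forall>x\<in>sp P (tail Q \<mu>). g (tail Q \<mu>) (u (tail Q \<mu>) x) = h (tail Q \<mu>) x"
    note lP = robj_lm[OF P i] and lY = robj_lm[OF Y i] and lZ = robj_lm[OF Z i] and lD = dmod_lm[OF P]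
    interpret Yi: left_module A "space Y i" by (rule lY)
    interpret Zi: left_module A "space Z i" by (rule lZ)
    note gi = rep_hom_at[OF g i] and hi = rep_hom_at[OF h i]
    have pr: "inj_mod (space P i)" using assms(2) i by blast
    have injD: "inj_mod (dmod P i)" using assms(2) into_tail by (intro inj_mod_prodm) blast
    let ?j = "restrict (delta Q P i) (dsp P i)"
    have ker: "(\<lambda>w\<in>dsp P i. w) w = \<zero>\<^bsub>dmod P i\<^esub>" if w: "w \<in> dsp P i" "?j w = \<zero>[P,i]" for w
    proof -
      have "delta Q P i w = \<zero>[P,i]" using w by simp
      then have "w = \<zero>\<^bsub>dmod P i\<^esub>"
        using dmod_zeroI[OF w(1)] monicD[OF P mobjD(2)[OF assms(1)] i w(1)] by blast
      then show ?thesis using w(1) by (simp only: restrict_apply')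
    qed
    obtain r where r: "r \<in> homA (space P i) (dmod P i)"
      "\<And>w. w \<in> dsp P i \<Longrightarrow> r (?j w) = (\<lambda>w\<in>dsp P i. w) w"
      by (rule inj_modD[OF injD lD robj_fd[OF P i] delta_hom[OF P i] mod_hom_id[OF lD] ker]) blast+
    have rd: "r (delta Q P i w) = w" if w: "w \<in> dsp P i" for w
      using r(2)[OF w] by (simp only: restrict_apply'[OF w])
    note rc = mod_hom_closed[OF r(1)]
    let ?a0 = "\<lambda>w\<in>dsp P i. delta Q Y i (push i u w)"
    let ?a = "compose (sp P i) ?a0 r"
    have a: "?a \<in> homA (space P i) (space Y i)"
      by (rule mod_hom_compose[OF r(1) delta_push_mod_hom[OF P Y i u] lP])
    have av: "?a x = delta Q Y i (push i u (r x))" if "x \<in> sp P i" for x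
      using that by (simp only: compose_eq restrict_apply'[OF rc])
    note ac = mod_hom_closed[OF a]
    have ga: "compose (sp P i) (g i) ?a \<in> homA (space P i) (space Z i)" by (rule mod_hom_compose[OF a gi lP])
    let ?e = "\<lambda>x\<in>sp P i. h i x \<ominus>\<^bsub>space Z i\<^esub> compose (sp P i) (g i) ?a x"
    have e: "?e \<in> homA (space P i) (space Z i)" by (rule mod_hom_diff[OF hi ga lP lZ])
    have ev: "?e x = h i x \<ominus>\<^bsub>space Z i\<^esub> g i (?a x)" if "x \<in> sp P i" for x
      using that by (simp only: restrict_apply' compose_eq)
    have ad: "?a (delta Q P i w) = delta Q Y i (push i u w)" if w: "w \<in> dsp P i" for w
      using av[OF delta_closed[OF P i w]] rd[OF w] by simp
    have pp: "push i g (push i u w) = push i h w" if w: "w \<in> dsp P i" for w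
      using gu prodm_mem[OF w] by (intro push_push) blast
    have e0: "?e (delta Q P i w) = \<zero>[Z,i]" if w: "w \<in> dsp P i" for w
    proof -
      have "h i (delta Q P i w) = g i (?a (delta Q P i w))"
        using delta_push[OF P Z h i w] delta_push[OF Y Z g i push_closed[OF u w]] pp[OF w] ad[OF w] by simp
      then show ?thesis
        using ev[OF delta_closed[OF P i w]] rhom_closed[OF h i delta_closed[OF P i w]] by (simp add: Zi.M.minus_self)
    qed
    obtain l where l: "l \<in> homA (space P i) (space Y i)" "\<And>x. x \<in> sp P i \<Longrightarrow> g i (l x) = ?e x"
      by (rule inj_mod_lift[OF AA_inj robj_fd[OF P i] pr robj_lm[OF Y i] robj_lm[OF Z i] gi surj[OF i] e]) blast+
    let ?d = "compose (sp P i) ?j r"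
    have d: "?d \<in> homA (space P i) (space P i)" by (rule mod_hom_compose[OF r(1) delta_hom[OF P i] lP])
    have dv: "?d x = delta Q P i (r x)" if "x \<in> sp P i" for x
      using that by (simp only: compose_eq restrict_apply'[OF rc])
    have ld: "compose (sp P i) l ?d \<in> homA (space P i) (space Y i)" by (rule mod_hom_compose[OF d l(1) lP])
    let ?l = "\<lambda>x\<in>sp P i. l x \<ominus>\<^bsub>space Y i\<^esub> compose (sp P i) l ?d x"
    have l': "?l \<in> homA (space P i) (space Y i)" by (rule mod_hom_diff[OF l(1) ld lP lY])
    have lv: "?l x = l x \<ominus>\<^bsub>space Y i\<^esub> l (delta Q P i (r x))" if "x \<in> sp P i" for x
      using that dv[OF that] by (simp only: restrict_apply' compose_eq)
    \<comment> \<open>The subtracted term is sent by g to the error at a point of the image of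
      \<delta>, where the error is zero.\<close>
    have gl: "g i (?l x) = ?e x" if x: "x \<in> sp P i" for x
    proof -
      note c = delta_closed[OF P i rc[OF x]]
      have "g i (?l x) = g i (l x) \<ominus>\<^bsub>space Z i\<^esub> g i (l (delta Q P i (r x)))"
        unfolding lv[OF x]
        by (rule mod_hom_minus[OF lY lZ gi mod_hom_closed[OF l(1) x] mod_hom_closed[OF l(1) c]])
      also have "\<dots> = ?e x \<ominus>\<^bsub>space Z i\<^esub> \<zero>[Z,i]"
        unfolding l(2)[OF x] l(2)[OF c] e0[OF rc[OF x]] ..
      also have "\<dots> = ?e x"
        using mod_hom_closed[OF e x] Zi.M.add_minus_cancel[of "?e x" "\<zero>[Z,i]"] by (simp only: Zi.M.r_zero Zi.M.zero_closed)
      finally show ?thesis .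
    qed
    have l0: "?l (delta Q P i w) = \<zero>[Y,i]" if w: "w \<in> dsp P i" for w
      unfolding lv[OF delta_closed[OF P i w]] rd[OF w]
      by (rule Yi.M.minus_self[OF mod_hom_closed[OF l(1) delta_closed[OF P i w]]])
    let ?u = "\<lambda>x\<in>sp P i. ?a x \<oplus>\<^bsub>space Y i\<^esub> ?l x"
    have u': "?u \<in> homA (space P i) (space Y i)" by (rule mod_hom_plus[OF a l' lP lY])
    have "g i (?u x) = h i x" if x: "x \<in> sp P i" for x
    proof -
      have "g i (?u x) = g i (?a x) \<oplus>\<^bsub>space Z i\<^esub> g i (?l x)"
        using mod_hom_add[OF gi ac[OF x] mod_hom_closed[OF l' x]] by (simp only: restrict_apply'[OF x])
      also have "\<dots> = g i (?a x) \<oplus>\<^bsub>space Z i\<^esub> (h i x \<ominus>\<^bsub>space Z i\<^esub> g i (?a x))"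
        unfolding gl[OF x] ev[OF x] ..
      also have "\<dots> = h i x"
        using mod_hom_closed[OF gi ac[OF x]] rhom_closed[OF h i x]
        by (metis Zi.M.a_comm Zi.M.minus_add_cancel Zi.M.minus_closed)
      finally show ?thesis .
    qed
    moreover have "\<forall>\<mu>\<in>into i. \<forall>x\<in>sp P (tail Q \<mu>). ?u (arr P \<mu> x) = arr Y \<mu> (u (tail Q \<mu>) x)"
    proof (rule rep_hom_of_delta[OF P Y u])
      fix w assume w: "w \<in> dsp P i"
      have "?u (delta Q P i w) = ?a (delta Q P i w) \<oplus>\<^bsub>space Y i\<^esub> ?l (delta Q P i w)"
        by (simp only: restrict_apply'[OF delta_closed[OF P i w]])
      also have "\<dots> = delta Q Y i (push i u w)"
        unfolding l0[OF w] ad[OF w]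
        by (rule Yi.M.r_zero[OF delta_closed[OF Y i push_closed[OF u w]]])
      finally show "?u (delta Q P i w) = delta Q Y i (push i u w)" .
    qed
    ultimately show "\<exists>u'\<in>homA (space P i) (space Y i). (\<forall>x\<in>sp P i. g i (u' x) = h i x) \<and>
        (\<forall>\<mu>\<in>into i. \<forall>x\<in>sp P (tail Q \<mu>). u' (arr P \<mu> x) = arr Y \<mu> (u (tail Q \<mu>) x))"
      using u' by blast
  qed blast
  have "rcomp P g u = h" unfolding rcomp_eq_iff[OF u(1) g P h] using u(2) by blast
  then show "\<exists>u\<in>Hom C P Y. Comp C P Y Z g u = h" using u(1) by auto
qed

end

section \<open>Free representations\<close>

context quiver_algebra
begin

text \<open>Paths are split at their last arrow, since \<delta>_j collects what enters j through the
  arrows into j.\<close>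

lemma awalk_snoc: "awalk v (p @ [\<mu>]) j \<longleftrightarrow> \<mu> \<in> into j \<and> awalk v p (tail Q \<mu>)"
proof
  assume "awalk v (p @ [\<mu>]) j"
  then have "awalk v p (awlast v p)" "awalk (awlast v p) [\<mu>] j" by (simp_all only: awalk_append_iff)
  moreover from this(2) have "\<mu> \<in> arcs Q" "awlast v p = tail Q \<mu>" "head Q \<mu> = j"
    by (simp_all only: awalk_simps)
  ultimately show "\<mu> \<in> into j \<and> awalk v p (tail Q \<mu>)" by (simp add: into_iff)
next
  assume *: "\<mu> \<in> into j \<and> awalk v p (tail Q \<mu>)"
  then have "awalk (tail Q \<mu>) [\<mu>] j" using arc_implies_awalk[of \<mu>] by (auto simp only: into_iff)
  then show "awalk v (p @ [\<mu>]) j" using * awalk_appendI by blast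
qed

text \<open>All paths ending at j, each with its starting vertex, which selects the module to be
  placed on the path.\<close>

definition idx :: "'v \<Rightarrow> ('v \<times> 'e list) set" where
  "idx j = {(v, p). awalk v p j}"

lemma idx_nil: "(v, []) \<in> idx j \<longleftrightarrow> v = j \<and> j \<in> V"
  by (auto simp: idx_def awalk_simps)

lemma idx_snoc: "(v, p @ [\<mu>]) \<in> idx j \<longleftrightarrow> \<mu> \<in> into j \<and> (v, p) \<in> idx (tail Q \<mu>)"
  by (simp only: idx_def mem_Collect_eq case_prod_conv awalk_snoc)

lemma idx_fst: "z \<in> idx j \<Longrightarrow> fst z \<in> V"
  by (auto simp: idx_def awalk_def)

lemma idx_cases:
  assumes "z \<in> idx j"
  obtains "z = (j, [])" | v p \<mu> where "z = (v, p @ [\<mu>])" "\<mu> \<in> into j" "(v, p) \<in> idx (tail Q \<mu>)"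
proof (cases "snd z" rule: rev_cases)
  case Nil
  then have "z = (fst z, [])" by (simp add: prod_eq_iff)
  then have "z = (j, [])" using assms idx_nil by metis
  then show thesis by (rule that(1))
next
  case (snoc p \<mu>)
  then have "z = (fst z, p @ [\<mu>])" by (simp add: prod_eq_iff)
  then show thesis using that(2) assms idx_snoc by metis
qed

text \<open>A nontrivial path to i is a path to the source of an arrow into i, followed by that
  arrow. Acyclicity enters through the induction.\<close>

lemma idx_finite: "j \<in> V \<Longrightarrow> finite (idx j)"
proof (induction rule: vertex_induct)
  case (1 i)
  have "idx i \<subseteq> insert (i, []) (\<Union>\<mu>\<in>into i. (\<lambda>z. (fst z, snd z @ [\<mu>])) ` idx (tail Q \<mu>))"
  proof
    fix z assume "z \<in> idx i"
    then show "z \<in> insert (i, []) (\<Union>\<mu>\<in>into i. (\<lambda>z. (fst z, snd z @ [\<mu>])) ` idx (tail Q \<mu>))"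
    proof (cases rule: idx_cases)
      case (2 v p \<mu>)
      then have "z \<in> (\<lambda>z. (fst z, snd z @ [\<mu>])) ` idx (tail Q \<mu>)" by (intro image_eqI[of _ _ "(v, p)"]) simp_all
      then show ?thesis using 2(2) by blast
    qed simp
  qed
  moreover have "finite (\<Union>\<mu>\<in>into i. (\<lambda>z. (fst z, snd z @ [\<mu>])) ` idx (tail Q \<mu>))"
    using 1 finite_into by blast
  ultimately show ?case by (meson finite_insert finite_subset)
qed

lemma awalk_into_no_return: "\<mu> \<in> into i \<Longrightarrow> \<not> awalk i p (tail Q \<mu>)"
proof
  assume "\<mu> \<in> into i" "awalk i p (tail Q \<mu>)"
  then have "awalk i (p @ [\<mu>]) i" unfolding awalk_snoc by blast
  then show False using acyclic unfolding acyclic_quiver_def by blast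
qed

text \<open>The direct sum of all \<open>m_v (J v)\<close> in coordinates: the tensor product of the
  space of P(v) at j with \<open>J v\<close> is replaced by one copy of \<open>J v\<close> for every
  path from v to j. An arrow moves the coordinate at a path to the coordinate at the path prolonged
  by the arrow; the remaining coordinates are zero.\<close>

definition free_rep :: "('v \<Rightarrow> ('a, 'n) module) \<Rightarrow> ('v, 'e, 'a, 'v \<times> 'e list \<Rightarrow> 'n) rep" where
  "free_rep J = \<lparr>space = (\<lambda>j. prodm (idx j) (\<lambda>z. J (fst z))),
     arr = (\<lambda>\<mu>. \<lambda>x\<in>carrier (prodm (idx (tail Q \<mu>)) (\<lambda>z. J (fst z))). \<lambda>z\<in>idx (head Q \<mu>).
       if snd z \<noteq> [] \<and> last (snd z) = \<mu> then x (fst z, butlast (snd z)) else \<zero>\<^bsub>J (fst z)\<^esub>)\<rparr>"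

lemma free_rep_space: "space (free_rep J) j = prodm (idx j) (\<lambda>z. J (fst z))"
  by (simp add: free_rep_def)

lemma free_rep_arr:
  "arr (free_rep J) \<mu> = (\<lambda>x\<in>sp (free_rep J) (tail Q \<mu>). \<lambda>z\<in>idx (head Q \<mu>).
     if snd z \<noteq> [] \<and> last (snd z) = \<mu> then x (fst z, butlast (snd z)) else \<zero>\<^bsub>J (fst z)\<^esub>)"
  by (simp add: free_rep_def)

end

context self_injective_quiver
begin

section \<open>The free representation on a family of modules and its universal properties\<close>

context
  fixes J :: "'v \<Rightarrow> ('a, 'n) module"
  assumes J: "\<And>v. v \<in> V \<Longrightarrow> fd_module K A (J v)"
begin

abbreviation "FJ \<equiv> free_rep J"

lemma J_lm: "v \<in> V \<Longrightarrow> left_module A (J v)"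
  by (rule fd_left_module[OF J])

lemma J_lm_idx: "z \<in> idx j \<Longrightarrow> left_module A (J (fst z))"
  by (rule J_lm[OF idx_fst])

lemma FJ_mem: "\<lbrakk>x \<in> sp FJ j; z \<in> idx j\<rbrakk> \<Longrightarrow> x z \<in> carrier (J (fst z))"
  using prodm_mem[of x "idx j" "\<lambda>z. J (fst z)" z] by (simp only: free_rep_space)

lemma FJ_eqI:
  assumes "x \<in> sp FJ j" "y \<in> sp FJ j" "\<And>z. z \<in> idx j \<Longrightarrow> x z = y z"
  shows "x = y"
  by (rule extensionalityI[of _ "idx j"]) (use assms in \<open>auto simp: free_rep_space PiE_def\<close>)

lemma FJ_proj: "z \<in> idx j \<Longrightarrow> (\<lambda>x\<in>sp FJ j. x z) \<in> homA (space FJ j) (J (fst z))"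
  unfolding free_rep_space
  using prodm_proj[OF ring_A, of "idx j" "\<lambda>z. J (fst z)" z] J_lm_idx by blast

lemma FJ_fd: "j \<in> V \<Longrightarrow> fd_module K A (space FJ j)"
  unfolding free_rep_space by (rule fd_module_prodm[OF idx_finite J[OF idx_fst]])

lemma FJ_lm: "j \<in> V \<Longrightarrow> left_module A (space FJ j)"
  by (rule fd_left_module[OF FJ_fd])

lemma FJ_tuple:
  assumes "left_module A M" "\<And>z. z \<in> idx j \<Longrightarrow> h z \<in> homA M (J (fst z))"
  shows "(\<lambda>x\<in>carrier M. \<lambda>z\<in>idx j. h z x) \<in> homA M (space FJ j)"
  unfolding free_rep_space by (rule tuple_mod_hom[OF assms])

lemma FJ_arr_apply:
  assumes "x \<in> sp FJ (tail Q \<mu>)" "z \<in> idx (head Q \<mu>)"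
  shows "arr FJ \<mu> x z = (if snd z \<noteq> [] \<and> last (snd z) = \<mu> then x (fst z, butlast (snd z)) else \<zero>\<^bsub>J (fst z)\<^esub>)"
  unfolding free_rep_arr restrict_apply'[OF assms(1)] restrict_apply'[OF assms(2)] ..

lemma FJ_butlast:
  assumes "z \<in> idx j" "snd z \<noteq> []"
  shows "last (snd z) \<in> into j" "(fst z, butlast (snd z)) \<in> idx (tail Q (last (snd z)))"
  using assms(1)
  by (cases rule: idx_cases; use assms(2) in simp)+

lemma FJ_robj: "robj FJ"
  unfolding robj_iff
proof (intro conjI ballI)
  fix \<mu> assume \<mu>: "\<mu> \<in> arcs Q"
  have t: "tail Q \<mu> \<in> V" using \<mu> by simp
  let ?h = "\<lambda>z. \<lambda>x\<in>sp FJ (tail Q \<mu>). if snd z \<noteq> [] \<and> last (snd z) = \<mu> then x (fst z, butlast (snd z)) else \<zero>\<^bsub>J (fst z)\<^esub>"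
  have "(\<lambda>x\<in>sp FJ (tail Q \<mu>). \<lambda>z\<in>idx (head Q \<mu>). ?h z x) \<in> homA (space FJ (tail Q \<mu>)) (space FJ (head Q \<mu>))"
  proof (rule FJ_tuple[OF FJ_lm[OF t]])
    fix z assume z: "z \<in> idx (head Q \<mu>)"
    show "?h z \<in> homA (space FJ (tail Q \<mu>)) (J (fst z))"
    proof (cases "snd z \<noteq> [] \<and> last (snd z) = \<mu>")
      case True
      then have "(fst z, butlast (snd z)) \<in> idx (tail Q \<mu>)" using FJ_butlast(2)[OF z] by blast
      from FJ_proj[OF this] show ?thesis unfolding if_P[OF True] fst_conv .
    next
      case False
      show ?thesis unfolding if_not_P[OF False] by (rule mod_hom_const_zero[OF FJ_lm[OF t] J_lm_idx[OF z]])
    qed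
  qed
  moreover have "(\<lambda>x\<in>sp FJ (tail Q \<mu>). \<lambda>z\<in>idx (head Q \<mu>). ?h z x) = arr FJ \<mu>"
    unfolding free_rep_arr by (intro restrict_ext) simp
  ultimately show "arr FJ \<mu> \<in> homA (space FJ (tail Q \<mu>)) (space FJ (head Q \<mu>))" by (simp only:)
qed (rule FJ_fd)

text \<open>The coordinate at a nontrivial path receives a contribution only from its last arrow,
  and the coordinate at the trivial path receives none.\<close>

lemma FJ_delta:
  assumes "i \<in> V" "w \<in> dsp FJ i" "z \<in> idx i"
  shows "delta Q FJ i w z = (if snd z = [] then \<zero>\<^bsub>J (fst z)\<^esub> else w (last (snd z)) (fst z, butlast (snd z)))"
proof -
  interpret Jz: left_module A "J (fst z)" by (rule J_lm_idx[OF assms(3)])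
  have wm: "w \<mu> \<in> sp FJ (tail Q \<mu>)" if "\<mu> \<in> into i" for \<mu> using prodm_mem[OF assms(2) that] .
  have ac: "arr FJ \<mu> (w \<mu>) \<in> sp FJ i" if "\<mu> \<in> into i" for \<mu>
    using mod_hom_closed[OF into_arr_hom[OF FJ_robj that] wm[OF that]] .
  have dc: "delta Q FJ i w \<in> sp FJ i" by (rule delta_closed[OF FJ_robj assms(1,2)])
  have "delta Q FJ i w z = (\<lambda>x\<in>sp FJ i. x z) (delta Q FJ i w)" using dc by simp
  also have "\<dots> = (\<Oplus>\<^bsub>J (fst z)\<^esub>\<mu>\<in>into i. (\<lambda>x\<in>sp FJ i. x z) (arr FJ \<mu> (w \<mu>)))"
    unfolding delta_def
    by (rule mod_hom_finsum[OF FJ_lm[OF assms(1)] Jz.left_module_axioms FJ_proj[OF assms(3)] finite_into])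
      (use ac in blast)
  also have "\<dots> = (\<Oplus>\<^bsub>J (fst z)\<^esub>\<mu>\<in>into i. if snd z \<noteq> [] \<and> last (snd z) = \<mu> then w \<mu> (fst z, butlast (snd z)) else \<zero>\<^bsub>J (fst z)\<^esub>)"
  proof (rule Jz.M.finsum_cong')
    show "(\<lambda>\<mu>. if snd z \<noteq> [] \<and> last (snd z) = \<mu> then w \<mu> (fst z, butlast (snd z)) else \<zero>\<^bsub>J (fst z)\<^esub>) \<in> into i \<rightarrow> carrier (J (fst z))"
      using FJ_mem[OF wm FJ_butlast(2)[OF assms(3)]] by auto
    fix \<mu> assume \<mu>: "\<mu> \<in> into i"
    then have "z \<in> idx (head Q \<mu>)" using assms(3) by (simp add: into_iff)
    then show "(\<lambda>x\<in>sp FJ i. x z) (arr FJ \<mu> (w \<mu>)) = (if snd z \<noteq> [] \<and> last (snd z) = \<mu> then w \<mu> (fst z, butlast (snd z)) else \<zero>\<^bsub>J (fst z)\<^esub>)"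
      using FJ_arr_apply[OF wm[OF \<mu>]] ac[OF \<mu>] by simp
  qed simp
  also have "\<dots> = (if snd z = [] then \<zero>\<^bsub>J (fst z)\<^esub> else w (last (snd z)) (fst z, butlast (snd z)))"
  proof (cases "snd z = []")
    case False
    note b = FJ_butlast[OF assms(3) False]
    have m: "w (last (snd z)) (fst z, butlast (snd z)) \<in> carrier (J (fst z))"
      using FJ_mem[OF wm[OF b(1)] b(2)] by simp
    have "(\<Oplus>\<^bsub>J (fst z)\<^esub>\<mu>\<in>into i. if snd z \<noteq> [] \<and> last (snd z) = \<mu> then w \<mu> (fst z, butlast (snd z)) else \<zero>\<^bsub>J (fst z)\<^esub>)
      = (\<Oplus>\<^bsub>J (fst z)\<^esub>\<mu>\<in>into i. if last (snd z) = \<mu> then w (last (snd z)) (fst z, butlast (snd z)) else \<zero>\<^bsub>J (fst z)\<^esub>)"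
      using m False by (intro Jz.M.finsum_cong') auto
    also have "\<dots> = w (last (snd z)) (fst z, butlast (snd z))"
      using Jz.M.finsum_singleton[OF b(1) finite_into, of "\<lambda>_. w (last (snd z)) (fst z, butlast (snd z))"] m by simp
    finally show ?thesis using False by simp
  qed (simp add: Jz.M.finsum_zero)
  finally show ?thesis .
qed

text \<open>At every vertex \<open>i\<close> the maps \<open>frho\<close>, \<open>fpi\<close>, \<open>delta\<close> and \<open>fiota\<close> exhibit \<open>FJ\<close> as the direct sum of
  the domain of \<open>\<delta>\<close> and \<open>J i\<close>.\<close>

definition frho :: "'v \<Rightarrow> ('v \<times> 'e list \<Rightarrow> 'n) \<Rightarrow> 'e \<Rightarrow> 'v \<times> 'e list \<Rightarrow> 'n" where
  "frho i x = (\<lambda>\<mu>\<in>into i. \<lambda>z\<in>idx (tail Q \<mu>). x (fst z, snd z @ [\<mu>]))"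

definition fpi :: "'v \<Rightarrow> ('v \<times> 'e list \<Rightarrow> 'n) \<Rightarrow> 'n" where
  "fpi i x = x (i, [])"

definition fiota :: "'v \<Rightarrow> 'n \<Rightarrow> 'v \<times> 'e list \<Rightarrow> 'n" where
  "fiota i y = single (idx i) (\<lambda>z. J (fst z)) (i, []) y"

lemma frho_hom:
  assumes "i \<in> V"
  shows "restrict (frho i) (sp FJ i) \<in> homA (space FJ i) (dmod FJ i)"
proof -
  let ?h = "\<lambda>\<mu>. \<lambda>x\<in>sp FJ i. \<lambda>z\<in>idx (tail Q \<mu>). (\<lambda>x\<in>sp FJ i. x (fst z, snd z @ [\<mu>])) x"
  have "?h \<mu> \<in> homA (space FJ i) (space FJ (tail Q \<mu>))" if \<mu>: "\<mu> \<in> into i" for \<mu>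
  proof (rule FJ_tuple[OF FJ_lm[OF assms]])
    fix z assume "z \<in> idx (tail Q \<mu>)"
    then have "(fst z, snd z @ [\<mu>]) \<in> idx i" using \<mu> by (simp add: idx_snoc)
    from FJ_proj[OF this] show "(\<lambda>x\<in>sp FJ i. x (fst z, snd z @ [\<mu>])) \<in> homA (space FJ i) (J (fst z))" by simp
  qed
  then have "(\<lambda>x\<in>sp FJ i. \<lambda>\<mu>\<in>into i. ?h \<mu> x) \<in> homA (space FJ i) (dmod FJ i)"
    by (rule tuple_mod_hom[OF FJ_lm[OF assms]])
  moreover have "(\<lambda>x\<in>sp FJ i. \<lambda>\<mu>\<in>into i. ?h \<mu> x) = restrict (frho i) (sp FJ i)"
    unfolding frho_def by (intro restrict_ext) (simp cong: restrict_cong)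
  ultimately show ?thesis by (simp only:)
qed

lemma frho_closed: "\<lbrakk>i \<in> V; x \<in> sp FJ i\<rbrakk> \<Longrightarrow> frho i x \<in> dsp FJ i"
  using mod_hom_closed[OF frho_hom] by (simp only: restrict_apply')

lemma fpi_hom: "i \<in> V \<Longrightarrow> restrict (fpi i) (sp FJ i) \<in> homA (space FJ i) (J i)"
  using FJ_proj[of "(i, [])" i] by (simp add: fpi_def idx_nil cong: restrict_cong)

lemma fpi_closed: "\<lbrakk>i \<in> V; x \<in> sp FJ i\<rbrakk> \<Longrightarrow> fpi i x \<in> carrier (J i)"
  using mod_hom_closed[OF fpi_hom] by (simp only: restrict_apply')

lemma fiota_hom:
  assumes "i \<in> V"
  shows "restrict (fiota i) (carrier (J i)) \<in> homA (J i) (space FJ i)"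
proof -
  have "(i, []) \<in> idx i" using assms by (simp add: idx_nil)
  then show ?thesis
    unfolding free_rep_space fiota_def
    using single_mod_hom[OF ring_A, of "idx i" "\<lambda>z. J (fst z)" "(i, [])"] J_lm_idx by simp
qed

lemma fiota_closed: "\<lbrakk>i \<in> V; y \<in> carrier (J i)\<rbrakk> \<Longrightarrow> fiota i y \<in> sp FJ i"
  using mod_hom_closed[OF fiota_hom] by (simp only: restrict_apply')

lemma fpi_fiota: "\<lbrakk>i \<in> V; y \<in> carrier (J i)\<rbrakk> \<Longrightarrow> fpi i (fiota i y) = y"
  by (simp add: fpi_def fiota_def single_def idx_nil)

lemma frho_fiota:
  assumes "i \<in> V" "y \<in> carrier (J i)"
  shows "frho i (fiota i y) = \<zero>\<^bsub>dmod FJ i\<^esub>"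
  by (auto simp: frho_def fiota_def single_def free_rep_space fun_eq_iff idx_snoc)

lemma frho_delta:
  assumes "i \<in> V" "w \<in> dsp FJ i"
  shows "frho i (delta Q FJ i w) = w"
proof (rule extensionalityI[of _ "into i"])
  show "w \<in> extensional (into i)" using assms(2) by (simp add: PiE_def)
  fix \<mu> assume \<mu>: "\<mu> \<in> into i"
  have w\<mu>: "w \<mu> \<in> sp FJ (tail Q \<mu>)" by (rule prodm_mem[OF assms(2) \<mu>])
  have "(\<lambda>z\<in>idx (tail Q \<mu>). delta Q FJ i w (fst z, snd z @ [\<mu>])) = w \<mu>"
  proof (rule extensionalityI[of _ "idx (tail Q \<mu>)"])
    show "w \<mu> \<in> extensional (idx (tail Q \<mu>))" using w\<mu> by (simp add: free_rep_space PiE_def)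
    fix z assume z: "z \<in> idx (tail Q \<mu>)"
    then have "(fst z, snd z @ [\<mu>]) \<in> idx i" using \<mu> by (simp add: idx_snoc)
    from FJ_delta[OF assms this] z
    show "(\<lambda>z\<in>idx (tail Q \<mu>). delta Q FJ i w (fst z, snd z @ [\<mu>])) z = w \<mu> z" by simp
  qed simp
  then show "frho i (delta Q FJ i w) \<mu> = w \<mu>" using \<mu> by (simp add: frho_def)
qed (simp add: frho_def)

lemma fpi_delta:
  assumes "i \<in> V" "w \<in> dsp FJ i"
  shows "fpi i (delta Q FJ i w) = \<zero>\<^bsub>J i\<^esub>"
  using FJ_delta[OF assms, of "(i, [])"] assms(1) by (simp add: fpi_def idx_nil)

text \<open>A path to i either has a last arrow or is trivial; \<open>frho\<close> collects the
  coordinates of the first kind and \<open>fpi\<close> the one of the second.\<close>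

lemma FJ_decomp:
  assumes "i \<in> V" "x \<in> sp FJ i"
  shows "delta Q FJ i (frho i x) \<oplus>\<^bsub>space FJ i\<^esub> fiota i (fpi i x) = x"
proof (rule FJ_eqI[of _ i])
  interpret Fi: left_module A "space FJ i" by (rule FJ_lm[OF assms(1)])
  note c = delta_closed[OF FJ_robj assms(1) frho_closed[OF assms]] fiota_closed[OF assms(1) fpi_closed[OF assms]]
  show "delta Q FJ i (frho i x) \<oplus>\<^bsub>space FJ i\<^esub> fiota i (fpi i x) \<in> sp FJ i" by (rule Fi.M.a_closed[OF c])
  show "x \<in> sp FJ i" by fact
  fix z assume z: "z \<in> idx i"
  interpret Jz: left_module A "J (fst z)" by (rule J_lm_idx[OF z])
  have xz: "x z \<in> carrier (J (fst z))" by (rule FJ_mem[OF assms(2) z])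
  have "(delta Q FJ i (frho i x) \<oplus>\<^bsub>space FJ i\<^esub> fiota i (fpi i x)) z =
      delta Q FJ i (frho i x) z \<oplus>\<^bsub>J (fst z)\<^esub> fiota i (fpi i x) z"
    using z by (simp add: free_rep_space)
  also have "\<dots> = x z"
    using z
  proof (cases rule: idx_cases)
    case 1
    then show ?thesis
      using FJ_delta[OF assms(1) frho_closed[OF assms] z] Jz.M.l_zero[OF xz] z by (simp add: fiota_def single_def fpi_def)
  next
    case (2 v p \<mu>)
    then show ?thesis
      using FJ_delta[OF assms(1) frho_closed[OF assms] z] Jz.M.r_zero[OF xz] z by (simp add: fiota_def single_def frho_def)
  qed
  finally show "(delta Q FJ i (frho i x) \<oplus>\<^bsub>space FJ i\<^esub> fiota i (fpi i x)) z = x z" .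
qed

text \<open>\<open>frho\<close> is a linear left inverse of \<delta>.\<close>

lemma FJ_mobj: "mobj FJ"
proof -
  have "w \<mu> = \<zero>[FJ,tail Q \<mu>]"
    if i: "i \<in> V" and w: "w \<in> dsp FJ i" "delta Q FJ i w = \<zero>[FJ,i]" and \<mu>: "\<mu> \<in> into i" for i w \<mu>
  proof -
    have "w = restrict (frho i) (sp FJ i) \<zero>[FJ,i]"
      using frho_delta[OF i w(1)] w(2) zero_in[OF FJ_robj i] by simp
    also have "\<dots> = \<zero>\<^bsub>dmod FJ i\<^esub>" by (rule mod_hom_zero[OF FJ_lm[OF i] dmod_lm[OF FJ_robj] frho_hom[OF i]])
    finally show ?thesis using \<mu> by simp
  qed
  then show ?thesis using FJ_robj monic_iff[OF FJ_robj] by (simp add: mobj_iff)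
qed

text \<open>The module at i is the direct sum of the image of \<delta>_i, where a morphism is
  determined by its components at the sources, and of \<open>J i\<close>, where it may be chosen
  freely.\<close>

lemma FJ_lift:
  fixes X :: "('v, 'e, 'a, 'x) rep"
  assumes "robj X" "\<And>i. i \<in> V \<Longrightarrow> e i \<in> homA (J i) (space X i)"
  obtains f where "f \<in> rhom FJ X" "\<And>i y. \<lbrakk>i \<in> V; y \<in> carrier (J i)\<rbrakk> \<Longrightarrow> f i (fiota i y) = e i y"
proof (rule rep_hom_recursion[of FJ X "\<lambda>i f. \<forall>y\<in>carrier (J i). f (fiota i y) = e i y"])
  fix i f
  assume i: "i \<in> V" and f: "\<And>\<mu>. \<mu> \<in> into i \<Longrightarrow> f (tail Q \<mu>) \<in> homA (space FJ (tail Q \<mu>)) (space X (tail Q \<mu>))"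
  interpret Xi: left_module A "space X i" by (rule robj_lm[OF assms(1) i])
  let ?d = "\<lambda>w\<in>dsp FJ i. delta Q X i (push i f w)"
  have d: "?d \<in> homA (dmod FJ i) (space X i)" by (rule delta_push_mod_hom[OF FJ_robj assms(1) i f])
  let ?a = "compose (sp FJ i) ?d (restrict (frho i) (sp FJ i))"
  and ?b = "compose (sp FJ i) (e i) (restrict (fpi i) (sp FJ i))"
  have a: "?a \<in> homA (space FJ i) (space X i)" by (rule mod_hom_compose[OF frho_hom[OF i] d FJ_lm[OF i]])
  have b: "?b \<in> homA (space FJ i) (space X i)" by (rule mod_hom_compose[OF fpi_hom[OF i] assms(2)[OF i] FJ_lm[OF i]])
  have av: "?a x = ?d (frho i x)" "?b x = e i (fpi i x)" if "x \<in> sp FJ i" for x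
    using that by (simp_all only: compose_eq restrict_apply')
  let ?g = "\<lambda>x\<in>sp FJ i. ?a x \<oplus>\<^bsub>space X i\<^esub> ?b x"
  have g: "?g \<in> homA (space FJ i) (space X i)" by (rule mod_hom_plus[OF a b FJ_lm[OF i] robj_lm[OF assms(1) i]])
  have gv: "?g x = ?d (frho i x) \<oplus>\<^bsub>space X i\<^esub> e i (fpi i x)" if "x \<in> sp FJ i" for x
    unfolding restrict_apply'[OF that] av[OF that] ..
  have "?g (fiota i y) = e i y" if y: "y \<in> carrier (J i)" for y
  proof -
    have "?g (fiota i y) = ?d \<zero>\<^bsub>dmod FJ i\<^esub> \<oplus>\<^bsub>space X i\<^esub> e i y"
      unfolding gv[OF fiota_closed[OF i y]] frho_fiota[OF i y] fpi_fiota[OF i y] ..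
    also have "?d \<zero>\<^bsub>dmod FJ i\<^esub> = \<zero>[X,i]" by (rule mod_hom_zero[OF dmod_lm[OF FJ_robj] Xi.left_module_axioms d])
    also have "\<zero>[X,i] \<oplus>\<^bsub>space X i\<^esub> e i y = e i y" by (rule Xi.M.l_zero[OF mod_hom_closed[OF assms(2)[OF i] y]])
    finally show ?thesis .
  qed
  moreover have "\<forall>\<mu>\<in>into i. \<forall>x\<in>sp FJ (tail Q \<mu>). ?g (arr FJ \<mu> x) = arr X \<mu> (f (tail Q \<mu>) x)"
  proof (rule rep_hom_of_delta[OF FJ_robj assms(1) f])
    fix w assume w: "w \<in> dsp FJ i"
    have "?g (delta Q FJ i w) = ?d w \<oplus>\<^bsub>space X i\<^esub> e i \<zero>\<^bsub>J i\<^esub>"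
      unfolding gv[OF delta_closed[OF FJ_robj i w]] frho_delta[OF i w] fpi_delta[OF i w] ..
    also have "e i \<zero>\<^bsub>J i\<^esub> = \<zero>[X,i]" by (rule mod_hom_zero[OF J_lm[OF i] Xi.left_module_axioms assms(2)[OF i]])
    also have "?d w \<oplus>\<^bsub>space X i\<^esub> \<zero>[X,i] = ?d w" by (rule Xi.M.r_zero[OF mod_hom_closed[OF d w]])
    also have "?d w = delta Q X i (push i f w)" by (rule restrict_apply'[OF w])
    finally show "?g (delta Q FJ i w) = delta Q X i (push i f w)" .
  qed
  ultimately show "\<exists>g\<in>homA (space FJ i) (space X i). (\<forall>y\<in>carrier (J i). g (fiota i y) = e i y) \<and>
      (\<forall>\<mu>\<in>into i. \<forall>x\<in>sp FJ (tail Q \<mu>). g (arr FJ \<mu> x) = arr X \<mu> (f (tail Q \<mu>) x))"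
    using g by blast
qed (use that in blast)

text \<open>By induction along the arrows the two morphisms agree on the image of \<delta>_i, and by
  assumption they agree on the complement \<open>J i\<close>.\<close>

lemma FJ_unique:
  fixes X :: "('v, 'e, 'a, 'x) rep"
  assumes "robj X" "f \<in> rhom FJ X" "g \<in> rhom FJ X"
    and eq: "\<And>i y. \<lbrakk>i \<in> V; y \<in> carrier (J i)\<rbrakk> \<Longrightarrow> f i (fiota i y) = g i (fiota i y)"
  shows "f = g"
proof (rule rep_hom_eqI[OF assms(2,3)])
  fix i x assume iV: "i \<in> V" and x: "x \<in> sp FJ i"
  have "\<forall>x\<in>sp FJ i. f i x = g i x"
    using iV
  proof (induction rule: vertex_induct)
    case (1 i)
    show ?case
    proof
      fix x assume x: "x \<in> sp FJ i"
      note rx = frho_closed[OF 1(1) x] and ix = fpi_closed[OF 1(1) x]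
      have h: "h i x = delta Q X i (push i h (frho i x)) \<oplus>\<^bsub>space X i\<^esub> h i (fiota i (fpi i x))" if h: "h \<in> rhom FJ X" for h
      proof -
        have "h i x = h i (delta Q FJ i (frho i x) \<oplus>\<^bsub>space FJ i\<^esub> fiota i (fpi i x))"
          unfolding FJ_decomp[OF 1(1) x] ..
        also have "\<dots> = h i (delta Q FJ i (frho i x)) \<oplus>\<^bsub>space X i\<^esub> h i (fiota i (fpi i x))"
          by (rule rhom_add[OF h 1(1) delta_closed[OF FJ_robj 1(1) rx] fiota_closed[OF 1(1) ix]])
        also have "h i (delta Q FJ i (frho i x)) = delta Q X i (push i h (frho i x))"
          by (rule delta_push[OF FJ_robj assms(1) h 1(1) rx])
        finally show ?thesis .
      qed
      have "push i f (frho i x) = push i g (frho i x)"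
        unfolding push_def
      proof (rule restrict_ext)
        fix \<mu> assume "\<mu> \<in> into i"
        then show "f (tail Q \<mu>) (frho i x \<mu>) = g (tail Q \<mu>) (frho i x \<mu>)"
          using 1(2)[of \<mu>] prodm_mem[OF rx, of \<mu>] by blast
      qed
      then show "f i x = g i x" using h[OF assms(2)] h[OF assms(3)] eq[OF 1(1) ix] by (simp only:)
    qed
  qed
  then show "f i x = g i x" using x by blast
qed

lemma FJ_good: "(\<And>v. v \<in> V \<Longrightarrow> inj_mod (J v)) \<Longrightarrow> good FJ"
  unfolding free_rep_space using idx_fst by (intro ballI inj_mod_prodm) blast

text \<open>An extension of the components at the sources exists because the module of the free
  representation at i is injective. Its coordinate in \<open>J i\<close> may be replaced by
  \<open>c i\<close> without a change on the image of \<delta>_i, since both vanish there.\<close>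

lemma FJ_colift:
  fixes X :: "('v, 'e, 'a, 'm) rep"
  assumes "mobj X" "\<And>v. v \<in> V \<Longrightarrow> inj_mod (J v)" "\<And>i. i \<in> V \<Longrightarrow> c i \<in> homA (space X i) (J i)"
    and c0: "\<And>i w. \<lbrakk>i \<in> V; w \<in> dsp X i\<rbrakk> \<Longrightarrow> c i (delta Q X i w) = \<zero>\<^bsub>J i\<^esub>"
  obtains f where "f \<in> rhom X FJ" "\<And>i x. \<lbrakk>i \<in> V; x \<in> sp X i\<rbrakk> \<Longrightarrow> fpi i (f i x) = c i x"
proof (rule rep_hom_recursion[of X FJ "\<lambda>i f. \<forall>x\<in>sp X i. fpi i (f x) = c i x"])
  note X = mobjD(1)[OF assms(1)]
  fix i f
  assume i: "i \<in> V" and f: "\<And>\<mu>. \<mu> \<in> into i \<Longrightarrow> f (tail Q \<mu>) \<in> homA (space X (tail Q \<mu>)) (space FJ (tail Q \<mu>))"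
  interpret Fi: left_module A "space FJ i" by (rule FJ_lm[OF i])
  interpret Ji: left_module A "J i" by (rule J_lm[OF i])
  note lX = robj_lm[OF X i]
  have injF: "inj_mod (space FJ i)" using FJ_good[OF assms(2)] i by blast
  obtain a where a: "a \<in> homA (space X i) (space FJ i)"
    "\<And>w. w \<in> dsp X i \<Longrightarrow> a (delta Q X i w) = delta Q FJ i (push i f w)"
    by (rule extend_delta[OF assms(1) FJ_robj i injF f]) blast+
  let ?p = "restrict (fpi i) (sp FJ i)" and ?j = "restrict (fiota i) (carrier (J i))"
  have pa: "compose (sp X i) ?p a \<in> homA (space X i) (J i)" by (rule mod_hom_compose[OF a(1) fpi_hom[OF i] lX])
  let ?k = "\<lambda>x\<in>sp X i. c i x \<ominus>\<^bsub>J i\<^esub> compose (sp X i) ?p a x"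
  have k: "?k \<in> homA (space X i) (J i)" by (rule mod_hom_diff[OF assms(3)[OF i] pa lX J_lm[OF i]])
  have kv: "?k x = c i x \<ominus>\<^bsub>J i\<^esub> fpi i (a x)" if x: "x \<in> sp X i" for x
    unfolding restrict_apply'[OF x] compose_eq[OF x] restrict_apply'[OF mod_hom_closed[OF a(1) x]] ..
  have jk: "compose (sp X i) ?j ?k \<in> homA (space X i) (space FJ i)" by (rule mod_hom_compose[OF k fiota_hom[OF i] lX])
  let ?g = "\<lambda>x\<in>sp X i. a x \<oplus>\<^bsub>space FJ i\<^esub> compose (sp X i) ?j ?k x"
  have g: "?g \<in> homA (space X i) (space FJ i)" by (rule mod_hom_plus[OF a(1) jk lX FJ_lm[OF i]])
  have gv: "?g x = a x \<oplus>\<^bsub>space FJ i\<^esub> fiota i (?k x)" if x: "x \<in> sp X i" for x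
    unfolding restrict_apply'[OF x, of "\<lambda>x. a x \<oplus>\<^bsub>space FJ i\<^esub> compose (sp X i) ?j ?k x"] compose_eq[OF x]
      restrict_apply'[OF mod_hom_closed[OF k x]] ..
  have "fpi i (?g x) = c i x" if x: "x \<in> sp X i" for x
  proof -
    note ax = mod_hom_closed[OF a(1) x] and kx = mod_hom_closed[OF k x] and cx = mod_hom_closed[OF assms(3)[OF i] x]
    have "fpi i (a x \<oplus>\<^bsub>space FJ i\<^esub> fiota i (?k x)) = fpi i (a x) \<oplus>\<^bsub>J i\<^esub> fpi i (fiota i (?k x))"
      using mod_hom_add[OF fpi_hom[OF i] ax fiota_closed[OF i kx]] ax fiota_closed[OF i kx] Fi.M.a_closed[OF ax fiota_closed[OF i kx]]
      by (simp only: restrict_apply')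
    also have "\<dots> = fpi i (a x) \<oplus>\<^bsub>J i\<^esub> (c i x \<ominus>\<^bsub>J i\<^esub> fpi i (a x))" unfolding fpi_fiota[OF i kx] unfolding kv[OF x] ..
    also have "\<dots> = c i x" using cx fpi_closed[OF i ax] by (metis Ji.M.a_comm Ji.M.minus_add_cancel Ji.M.minus_closed)
    finally show ?thesis unfolding gv[OF x] .
  qed
  moreover have "\<forall>\<mu>\<in>into i. \<forall>x\<in>sp X (tail Q \<mu>). ?g (arr X \<mu> x) = arr FJ \<mu> (f (tail Q \<mu>) x)"
  proof (rule rep_hom_of_delta[OF X FJ_robj f])
    fix w assume w: "w \<in> dsp X i"
    note dw = delta_closed[OF X i w] and pw = push_closed[OF f w]
    have "fpi i (delta Q FJ i (push i f w)) = \<zero>\<^bsub>J i\<^esub>" by (rule fpi_delta[OF i pw])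
    then have "?k (delta Q X i w) = \<zero>\<^bsub>J i\<^esub> \<ominus>\<^bsub>J i\<^esub> \<zero>\<^bsub>J i\<^esub>" unfolding kv[OF dw] c0[OF i w] a(2)[OF w] by (simp only:)
    then have "?k (delta Q X i w) = \<zero>\<^bsub>J i\<^esub>" unfolding Ji.M.minus_self[OF Ji.M.zero_closed] .
    then have "?g (delta Q X i w) = a (delta Q X i w) \<oplus>\<^bsub>space FJ i\<^esub> fiota i \<zero>\<^bsub>J i\<^esub>" unfolding gv[OF dw] by (simp only:)
    also have "fiota i \<zero>\<^bsub>J i\<^esub> = \<zero>[FJ,i]"
      using mod_hom_zero[OF J_lm[OF i] FJ_lm[OF i] fiota_hom[OF i]] by (simp only: restrict_apply' Ji.M.zero_closed)
    also have "a (delta Q X i w) \<oplus>\<^bsub>space FJ i\<^esub> \<zero>[FJ,i] = a (delta Q X i w)"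
      by (rule Fi.M.r_zero[OF mod_hom_closed[OF a(1) dw]])
    finally show "?g (delta Q X i w) = delta Q FJ i (push i f w)" unfolding a(2)[OF w] .
  qed
  ultimately show "\<exists>g\<in>homA (space X i) (space FJ i). (\<forall>x\<in>sp X i. fpi i (g x) = c i x) \<and>
      (\<forall>\<mu>\<in>into i. \<forall>x\<in>sp X (tail Q \<mu>). g (arr X \<mu> x) = arr FJ \<mu> (f (tail Q \<mu>) x))"
    using g by blast
qed (use that in blast)

end

section \<open>The Frobenius property\<close>

lemma inj_mod_iso:
  assumes "inj_mod M" "left_module A M" "left_module A N" "q \<in> homA M N" "bij_betw q (carrier M) (carrier N)"
  shows "inj_mod N"
proof (rule inj_mod_retract[OF assms(1,3,4) mod_hom_inv[OF assms(4,5,2,3)]])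
  fix x assume "x \<in> carrier N"
  then show "q ((\<lambda>y\<in>carrier N. inv_into (carrier M) q y) x) = x"
    using assms(5) by (simp add: bij_betw_def f_inv_into_f)
qed

lemma good_iso:
  assumes "good X" "robj X" "robj Y" "q \<in> rhom X Y" "\<And>i. i \<in> V \<Longrightarrow> bij_betw (q i) (sp X i) (sp Y i)"
  shows "good Y"
proof
  fix i assume i: "i \<in> V"
  show "inj_mod (space Y i)"
    by (rule inj_mod_iso[OF _ robj_lm[OF assms(2) i] robj_lm[OF assms(3) i] rep_hom_at[OF assms(4) i] assms(5)[OF i]])
      (use assms(1) i in blast)
qed

text \<open>A free cover copied to the type \<open>'m\<close>; free modules of this kind are
  injective because \<open>A\<close> is.\<close>

lemma injective_cover:
  fixes M :: "('a, 'n) module"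
  assumes "fd_module K A M"
  shows "\<exists>(N :: ('a, 'm) module) p. fd_module K A N \<and> inj_mod N \<and> p \<in> homA N M \<and> p ` carrier N = carrier M"
proof -
  obtain B :: "'n set" and p where B: "finite B" "p \<in> homA (prodm B (\<lambda>_. AA)) M"
    "p ` carrier (prodm B (\<lambda>_. AA)) = carrier M"
    by (rule free_cover[OF assms])
  let ?F = "prodm B (\<lambda>_. AA)"
  have F: "fd_module K A ?F" using B(1) fd_module_AA by (intro fd_module_prodm) auto
  note lF = fd_left_module[OF F]
  obtain N :: "('a, 'm) module" and q where N: "fd_module K A N" "q \<in> homA ?F N" "bij_betw q (carrier ?F) (carrier N)"
    by (rule fd_transport[OF F universe])
  note lN = fd_left_module[OF N(1)]
  have i: "inj_mod N" by (rule inj_mod_iso[OF inj_mod_free[OF AA_inj] lF lN N(2,3)])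
  let ?r = "\<lambda>y\<in>carrier N. inv_into (carrier ?F) q y"
  have r: "?r \<in> homA N ?F" by (rule mod_hom_inv[OF N(2,3) lF lN])
  have "?r ` carrier N = carrier ?F"
    using bij_betw_imp_surj_on[OF bij_betw_inv_into[OF N(3)]] by simp
  then have "p ` ?r ` carrier N = carrier M" using B(3) by (simp only:)
  moreover have "compose (carrier N) p ?r ` carrier N = p ` ?r ` carrier N"
    unfolding image_image by (intro image_cong refl) (simp only: compose_eq)
  ultimately have "compose (carrier N) p ?r ` carrier N = carrier M" by (simp only:)
  then show ?thesis using N(1) i mod_hom_compose[OF r B(2) lN] by blast
qed

text \<open>A free module into which \<open>M\<close> embeds, copied to the type \<open>'m\<close>;
  no minimal hull is meant.\<close>

lemma injective_hull:
  fixes M :: "('a, 'n) module"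
  assumes "fd_module K A M"
  shows "\<exists>(N :: ('a, 'm) module) j. fd_module K A N \<and> inj_mod N \<and> j \<in> homA M N \<and> inj_on j (carrier M)"
proof -
  obtain H :: "('n \<Rightarrow> 'a) set" and j where H: "finite H" "j \<in> homA M (prodm H (\<lambda>_. AA))" "inj_on j (carrier M)"
    by (rule free_embedding[OF AA_inj assms])
  let ?F = "prodm H (\<lambda>_. AA)"
  have F: "fd_module K A ?F" using H(1) fd_module_AA by (intro fd_module_prodm) auto
  note lF = fd_left_module[OF F]
  obtain N :: "('a, 'm) module" and q where N: "fd_module K A N" "q \<in> homA ?F N" "bij_betw q (carrier ?F) (carrier N)"
    by (rule fd_transport[OF F universe])
  have i: "inj_mod N" by (rule inj_mod_iso[OF inj_mod_free[OF AA_inj] lF fd_left_module[OF N(1)] N(2,3)])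
  have "inj_on (compose (carrier M) q j) (carrier M)"
  proof (rule inj_onI)
    fix x y assume xy: "x \<in> carrier M" "y \<in> carrier M" "compose (carrier M) q j x = compose (carrier M) q j y"
    then have "q (j x) = q (j y)" by (simp only: compose_eq)
    then have "j x = j y"
      by (rule inj_onD[OF bij_betw_imp_inj_on[OF N(3)] _ mod_hom_closed[OF H(2) xy(1)] mod_hom_closed[OF H(2) xy(2)]])
    then show "x = y" by (rule inj_onD[OF H(3) _ xy(1,2)])
  qed
  then show ?thesis using N(1) i mod_hom_compose[OF H(2) N(2) fd_left_module[OF assms]] by blast
qed

text \<open>Cover each module of \<open>X\<close> by an injective one and take the free
  representation on these covers: its summand \<open>J i\<close> is already mapped onto the module
  of \<open>X\<close> at i.\<close>

lemma good_cover:
  fixes X :: "('v, 'e, 'a, 'm) rep"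
  assumes "mobj X"
  obtains P p where "mobj P" "good P" "deflation E P p X"
proof -
  note X = mobjD(1)[OF assms]
  have "\<exists>(N :: ('a, 'm) module) p. fd_module K A N \<and> inj_mod N \<and> p \<in> homA N (space X i) \<and> p ` carrier N = sp X i"
    if "i \<in> V" for i
    by (rule injective_cover[OF robj_fd[OF X that]])
  then obtain J :: "'v \<Rightarrow> ('a, 'm) module" and e where J: "\<And>i. i \<in> V \<Longrightarrow> fd_module K A (J i)"
    "\<And>i. i \<in> V \<Longrightarrow> inj_mod (J i)" "\<And>i. i \<in> V \<Longrightarrow> e i \<in> homA (J i) (space X i)" "\<And>i. i \<in> V \<Longrightarrow> e i ` carrier (J i) = sp X i"
    by metis
  let ?F = "free_rep J"
  obtain f where f: "f \<in> rhom ?F X" "\<And>i y. \<lbrakk>i \<in> V; y \<in> carrier (J i)\<rbrakk> \<Longrightarrow> f i (fiota J i y) = e i y"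
    by (rule FJ_lift[where J = J, OF J(1) X J(3)]) blast+
  obtain P :: "('v, 'e, 'a, 'm) rep" and q where P: "mobj P" "q \<in> rhom ?F P" "\<And>i. i \<in> V \<Longrightarrow> bij_betw (q i) (sp ?F i) (sp P i)"
    by (rule rep_transport[OF FJ_mobj[where J = J, OF J(1)] universe]) blast+
  have Fr: "robj ?F" by (rule FJ_robj[where J = J], rule J(1))
  note Pr = mobjD(1)[OF P(1)]
  have gP: "good P" by (rule good_iso[OF FJ_good[where J = J, OF J(1,2)] Fr Pr P(2,3)])
  obtain r where r: "r \<in> rhom P ?F" "\<And>i x. \<lbrakk>i \<in> V; x \<in> sp ?F i\<rbrakk> \<Longrightarrow> r i (q i x) = x"
    "\<And>i y. \<lbrakk>i \<in> V; y \<in> sp P i\<rbrakk> \<Longrightarrow> q i (r i y) = y" "\<And>i. i \<in> V \<Longrightarrow> bij_betw (r i) (sp P i) (sp ?F i)"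
    by (rule rhom_inverse[OF P(2) Fr Pr P(3)]) blast+
  have fr: "rcomp P f r \<in> rhom P X" by (rule rcomp_rhom[OF r(1) f(1) Pr])
  have "rcomp P f r i ` sp P i = sp X i" if i: "i \<in> V" for i
  proof
    show "rcomp P f r i ` sp P i \<subseteq> sp X i" using rhom_closed[OF fr i] by blast
    show "sp X i \<subseteq> rcomp P f r i ` sp P i"
    proof
      fix x assume "x \<in> sp X i"
      then obtain y where y: "y \<in> carrier (J i)" "x = e i y" using J(4)[OF i] by blast
      note c = fiota_closed[where J = J, OF J(1) i y(1)]
      have qc: "q i (fiota J i y) \<in> sp P i" by (rule rhom_closed[OF P(2) i c])
      have "rcomp P f r i (q i (fiota J i y)) = x"
        using rcomp_apply[OF i qc, of f r] r(2)[OF i c] f(2)[OF i y(1)] y(2) by simp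
      then show "x \<in> rcomp P f r i ` sp P i" using qc by blast
    qed
  qed
  then have "deflation E P (rcomp P f r) X" using P(1) assms fr by (simp add: deflation_iff)
  then show thesis by (rule that[OF P(1) gP])
qed

text \<open>Embed the cokernel of each \<delta>_i into an injective module \<open>J i\<close>, so
  that the resulting map \<open>c i\<close> has the image of \<delta>_i as kernel. The colift f of
  these maps then satisfies \<open>key\<close>: an element whose coordinate in \<open>J i\<close>
  vanishes is \<delta> of a family in \<open>X\<close>. Both injectivity and the clause on \<delta>
  rest on this.\<close>

lemma good_hull:
  fixes X :: "('v, 'e, 'a, 'm) rep"
  assumes "mobj X"
  obtains I j where "mobj I" "good I" "inflation E X j I"
proof -
  note X = mobjD(1)[OF assms]
  let ?D = "\<lambda>i. restrict (delta Q X i) (dsp X i) ` dsp X i"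
  have "\<exists>(N :: ('a, 'm) module) c. fd_module K A N \<and> inj_mod N \<and> c \<in> homA (space X i) N \<and>
      (\<forall>x\<in>sp X i. c x = \<zero>\<^bsub>N\<^esub> \<longleftrightarrow> x \<in> ?D i)" if i: "i \<in> V" for i
  proof -
    have D: "lsub A (space X i) (?D i)"
      by (rule lsub_image[OF dmod_lm[OF X] robj_lm[OF X i] delta_hom[OF X i] lsub_carrier[OF dmod_lm[OF X]]])
    obtain M :: "('a, 'm) module" and q where q: "fd_module K A M" "q \<in> homA (space X i) M"
      "q ` sp X i = carrier M" "\<And>x. x \<in> sp X i \<Longrightarrow> q x = \<zero>\<^bsub>M\<^esub> \<longleftrightarrow> x \<in> ?D i"
      by (rule fd_quotient[OF robj_fd[OF X i] D universe]) blast
    obtain N :: "('a, 'm) module" and j where j: "fd_module K A N" "inj_mod N" "j \<in> homA M N" "inj_on j (carrier M)"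
      using injective_hull[OF q(1)] by blast
    have "compose (sp X i) j q x = \<zero>\<^bsub>N\<^esub> \<longleftrightarrow> x \<in> ?D i" if x: "x \<in> sp X i" for x
      unfolding compose_eq[OF x] q(4)[OF x, symmetric]
      using mod_hom_inj_iff[OF fd_left_module[OF q(1)] fd_left_module[OF j(1)] j(3)] j(4) mod_hom_closed[OF q(2) x]
        mod_hom_zero[OF fd_left_module[OF q(1)] fd_left_module[OF j(1)] j(3)] by metis
    then show ?thesis using j(1,2) mod_hom_compose[OF q(2) j(3) robj_lm[OF X i]] by blast
  qed
  then obtain J :: "'v \<Rightarrow> ('a, 'm) module" and c where J: "\<And>i. i \<in> V \<Longrightarrow> fd_module K A (J i)"
    "\<And>i. i \<in> V \<Longrightarrow> inj_mod (J i)" "\<And>i. i \<in> V \<Longrightarrow> c i \<in> homA (space X i) (J i)"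
    "\<And>i x. \<lbrakk>i \<in> V; x \<in> sp X i\<rbrakk> \<Longrightarrow> c i x = \<zero>\<^bsub>J i\<^esub> \<longleftrightarrow> x \<in> ?D i"
    by metis
  let ?F = "free_rep J"
  have c0: "c i (delta Q X i w) = \<zero>\<^bsub>J i\<^esub>" if "i \<in> V" "w \<in> dsp X i" for i w
  proof -
    have "delta Q X i w \<in> ?D i" using that(2) by (metis imageI restrict_apply')
    then show ?thesis using J(4)[OF that(1) delta_closed[OF X that]] by blast
  qed
  have cD: "\<exists>w\<in>dsp X i. x = delta Q X i w" if "i \<in> V" "x \<in> sp X i" "c i x = \<zero>\<^bsub>J i\<^esub>" for i x
  proof -
    have "x \<in> ?D i" using J(4)[OF that(1,2)] that(3) by blast
    then show ?thesis by (elim imageE) (metis restrict_apply')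
  qed
  obtain f where f: "f \<in> rhom X ?F" "\<And>i x. \<lbrakk>i \<in> V; x \<in> sp X i\<rbrakk> \<Longrightarrow> fpi i (f i x) = c i x"
    by (rule FJ_colift[where J = J, OF J(1) assms J(2,3) c0]) blast+
  have Fr: "robj ?F" and Fm: "mobj ?F" 
    by (rule FJ_robj[where J = J], rule J(1), assumption, rule FJ_mobj[where J = J], rule J(1), assumption)
  obtain I :: "('v, 'e, 'a, 'm) rep" and q where I: "mobj I" "q \<in> rhom ?F I" "\<And>i. i \<in> V \<Longrightarrow> bij_betw (q i) (sp ?F i) (sp I i)"
    by (rule rep_transport[OF Fm universe]) blast+
  note Ir = mobjD(1)[OF I(1)]
  have gI: "good I" by (rule good_iso[OF FJ_good[where J = J, OF J(1,2)] Fr Ir I(2,3)])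
  have qf: "rcomp X q f \<in> rhom X I" by (rule rcomp_rhom[OF f(1) I(2) X])
  have qinj: "x = y" if "i \<in> V" "x \<in> sp ?F i" "y \<in> sp ?F i" "q i x = q i y" for i x y
    using inj_onD[OF bij_betw_imp_inj_on[OF I(3)[OF that(1)]] that(4,2,3)] .
  have key: "\<exists>w\<in>dsp X i. x = delta Q X i w \<and> delta Q ?F i (push i f w) = f i x"
    if i: "i \<in> V" and x: "x \<in> sp X i" "fpi i (f i x) = \<zero>\<^bsub>J i\<^esub>" for i x
  proof -
    have "c i x = \<zero>\<^bsub>J i\<^esub>" using f(2)[OF i x(1)] x(2) by simp
    then obtain w where "w \<in> dsp X i" "x = delta Q X i w" using cD[OF i x(1)] by blast
    then show ?thesis using delta_push[OF X Fr f(1) i] by (intro bexI[of _ w]) simp_all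
  qed
  \<comment> \<open>If f kills x, then x = \<delta> w by \<open>key\<close>; as the free
    representation is monic, f kills the members of w, and these are zero by induction.\<close>
  have f0: "\<forall>x\<in>sp X i. f i x = \<zero>[?F,i] \<longrightarrow> x = \<zero>[X,i]" if "i \<in> V" for i
    using that
  proof (induction rule: vertex_induct)
    case (1 i)
    show ?case
    proof (intro ballI impI)
      fix x assume x: "x \<in> sp X i" "f i x = \<zero>[?F,i]"
      have "fpi i \<zero>[?F,i] = \<zero>\<^bsub>J i\<^esub>"
        using mod_hom_zero[OF FJ_lm[where J = J, OF J(1) 1(1)] J_lm[where J = J, OF J(1) 1(1)] fpi_hom[where J = J, OF J(1) 1(1)]]
        by (simp only: restrict_apply'[OF zero_in[OF Fr 1(1)]])
      then obtain w where w: "w \<in> dsp X i" "x = delta Q X i w" "delta Q ?F i (push i f w) = f i x"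
        using key[OF 1(1) x(1)] x(2) by metis
      have d0: "delta Q ?F i (push i f w) = \<zero>[?F,i]" using w(3) x(2) by (rule trans)
      have pw: "push i f w \<in> dsp ?F i" by (rule rhom_push_closed[OF f(1) w(1)])
      have "w \<mu> = \<zero>[X,tail Q \<mu>]" if \<mu>: "\<mu> \<in> into i" for \<mu>
      proof -
        have "push i f w \<mu> = \<zero>[?F,tail Q \<mu>]"
          by (rule monicD[OF Fr mobjD(2)[OF Fm] 1(1) pw d0 \<mu>])
        then show ?thesis using 1(2)[OF \<mu>] prodm_mem[OF w(1) \<mu>] \<mu> by (simp add: push_def)
      qed
      then have "w = \<zero>\<^bsub>dmod X i\<^esub>" by (rule dmod_zeroI[OF w(1)])
      then show "x = \<zero>[X,i]" unfolding w(2) using delta_zero[OF X 1(1)] by (simp only:)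
    qed
  qed
  have inj: "inj_on (rcomp X q f i) (sp X i)" if i: "i \<in> V" for i
  proof (rule inj_onI)
    fix x y assume xy: "x \<in> sp X i" "y \<in> sp X i" "rcomp X q f i x = rcomp X q f i y"
    have "q i (f i x) = q i (f i y)" using xy i by simp
    then have e: "f i x = f i y" by (rule qinj[OF i rhom_closed[OF f(1) i xy(1)] rhom_closed[OF f(1) i xy(2)]])
    have "inj_on (f i) (sp X i)" unfolding rhom_inj_iff[OF f(1) X Fr i] by (rule f0[OF i])
    then show "x = y" by (rule inj_onD[OF _ e xy(1,2)])
  qed
  have M: "w' \<mu> \<in> rcomp X q f (tail Q \<mu>) ` sp X (tail Q \<mu>)"
    if i: "i \<in> V" and w': "w' \<in> dsp I i" "delta Q I i w' \<in> rcomp X q f i ` sp X i" and \<mu>: "\<mu> \<in> into i" for i w' \<mu>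
  proof -
    obtain x where x: "x \<in> sp X i" "delta Q I i w' = q i (f i x)" using w'(2) i by auto
    obtain w where w: "w \<in> dsp ?F i" "push i q w = w'"
    proof (rule push_surj[OF w'(1), of q ?F])
      fix \<nu> assume \<nu>: "\<nu> \<in> into i"
      show "w' \<nu> \<in> q (tail Q \<nu>) ` sp ?F (tail Q \<nu>)"
        using prodm_mem[OF w'(1) \<nu>] bij_betw_imp_surj_on[OF I(3)[OF into_tail[OF \<nu>]]] by simp
    qed blast
    have "q i (delta Q ?F i w) = q i (f i x)" using delta_push[OF Fr Ir I(2) i w(1)] w(2) x(2) by simp
    then have d: "delta Q ?F i w = f i x"
      by (rule qinj[OF i delta_closed[OF Fr i w(1)] rhom_closed[OF f(1) i x(1)]])
    then have "fpi i (f i x) = \<zero>\<^bsub>J i\<^esub>" using fpi_delta[where J = J, OF J(1) i w(1)] by simp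
    then obtain y where y: "y \<in> dsp X i" "delta Q ?F i (push i f y) = f i x"
      using key[OF i x(1)] by blast
    have "push i f y = w"
      using frho_delta[where J = J, OF J(1) i rhom_push_closed[OF f(1) y(1)]] frho_delta[where J = J, OF J(1) i w(1)] y(2) d by simp
    then have "w \<mu> = f (tail Q \<mu>) (y \<mu>)" using \<mu> by (auto simp: push_def)
    then have e: "w' \<mu> = rcomp X q f (tail Q \<mu>) (y \<mu>)"
      unfolding w(2)[symmetric] rcomp_apply[OF into_tail[OF \<mu>] prodm_mem[OF y(1) \<mu>]] using \<mu> by (simp add: push_def)
    show ?thesis unfolding e by (rule imageI[OF prodm_mem[OF y(1) \<mu>]])
  qed
  have "inflation E X (rcomp X q f) I"
    unfolding inflation_iff using assms I(1) qf inj M by blast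
  then show thesis by (rule that[OF I(1) gI])
qed

text \<open>A projective object is a retract of its good cover, and at each vertex a retract of an
  injective module is injective.\<close>

lemma projective_good:
  fixes X :: "('v, 'e, 'a, 'm) rep"
  assumes "projective_object C E X"
  shows "mobj X" "good X"
proof -
  show m: "mobj X" using assms by (simp add: projective_object_def)
  note X = mobjD(1)[OF m]
  obtain P p where P: "mobj P" "good P" "deflation E P p X" by (rule good_cover[OF m])
  note Pr = mobjD(1)[OF P(1)]
  have p: "p \<in> rhom P X" using P(3) by (simp add: deflation_iff)
  have "\<exists>u\<in>Hom C X P. Comp C X P X p u = rid X"
    using assms P(3) rid_rhom[OF X] unfolding projective_object_def C_simps(1) by blast
  then obtain s where s: "s \<in> rhom X P" "rcomp X p s = rid X" by auto
  have ps: "p i (s i x) = x" if "i \<in> V" "x \<in> sp X i" for i x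
    using s(2) rcomp_eq_iff[OF s(1) p X rid_rhom[OF X]] that by simp
  show "good X"
  proof
    fix i assume i: "i \<in> V"
    have Pi: "inj_mod (space P i)" using P(2) i by blast
    show "inj_mod (space X i)"
      by (rule inj_mod_retract[OF Pi robj_lm[OF X i] rep_hom_at[OF p i] rep_hom_at[OF s(1) i] ps[OF i]])
  qed
qed

lemma injective_good:
  fixes X :: "('v, 'e, 'a, 'm) rep"
  assumes "injective_object C E X"
  shows "mobj X" "good X"
proof -
  show m: "mobj X" using assms by (simp add: injective_object_def)
  note X = mobjD(1)[OF m]
  obtain I j where I: "mobj I" "good I" "inflation E X j I" by (rule good_hull[OF m])
  note Ir = mobjD(1)[OF I(1)]
  have j: "j \<in> rhom X I" using I(3) by (simp add: inflation_iff)
  have "\<exists>u\<in>Hom C I X. Comp C X I X u j = rid X"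
    using assms I(3) rid_rhom[OF X] unfolding injective_object_def C_simps(1) by blast
  then obtain r where r: "r \<in> rhom I X" "rcomp X r j = rid X" by auto
  have rj: "r i (j i x) = x" if "i \<in> V" "x \<in> sp X i" for i x
    using r(2) rcomp_eq_iff[OF j r(1) X rid_rhom[OF X]] that by simp
  show "good X"
  proof
    fix i assume i: "i \<in> V"
    have Ii: "inj_mod (space I i)" using I(2) i by blast
    show "inj_mod (space X i)"
      by (rule inj_mod_retract[OF Ii robj_lm[OF X i] rep_hom_at[OF r(1) i] rep_hom_at[OF j i] rj[OF i]])
  qed
qed

lemma projective_iff_good: "projective_object C E X \<longleftrightarrow> mobj X \<and> good X"
  using projective_good good_projective by blast

lemma injective_iff_good: "injective_object C E X \<longleftrightarrow> mobj X \<and> good X"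
  using injective_good good_injective by blast

theorem frobenius: "frobenius_category C E"
proof (intro frobenius_category.intro exact frobenius_category_axioms.intro)
  fix X :: "('v, 'e, 'a, 'm) rep" assume X: "mobj X"
  show "\<exists>P p. projective_object C E P \<and> deflation E P p X"
    using good_cover[OF X] projective_iff_good by metis
  show "\<exists>I i. injective_object C E I \<and> inflation E X i I"
    using good_hull[OF X] injective_iff_good by metis
  show "projective_object C E X \<longleftrightarrow> injective_object C E X"
    by (simp only: projective_iff_good injective_iff_good)
qed

end

section \<open>Tensor products with finite-dimensional vector spaces\<close>

text \<open>All laws are pushed forward from \<open>M\<close>. In this way the tensor product, given
  as a bare record, inherits its module structure from a power of the module.\<close>

lemma left_module_image:
  assumes "left_module R M" "f \<in> mod_hom R M N" "f ` carrier M = carrier N" "f \<zero>\<^bsub>M\<^esub> = \<zero>\<^bsub>N\<^esub>"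
  shows "left_module R N"
proof -
  interpret M: left_module R M by fact
  have c: "carrier N = f ` carrier M" using assms(3) by simp
  have s: "\<exists>x\<in>carrier M. y = f x" if "y \<in> carrier N" for y using that c by auto
  note add = mod_hom_add[OF assms(2), symmetric] and sm = mod_hom_smult[OF assms(2), symmetric]
  show ?thesis
  proof (rule left_moduleI[OF M.R.ring_axioms])
    show "\<zero>\<^bsub>N\<^esub> \<in> carrier N" using assms(3,4) M.M.zero_closed by (metis imageI)
    fix y assume "y \<in> carrier N"
    then obtain x where x: "x \<in> carrier M" "y = f x" using s by blast
    show "\<zero>\<^bsub>N\<^esub> \<oplus>\<^bsub>N\<^esub> y = y"
      unfolding x(2) assms(4)[symmetric] add[OF M.M.zero_closed x(1)] M.M.l_zero[OF x(1)] ..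
    show "\<one>\<^bsub>R\<^esub> \<odot>\<^bsub>N\<^esub> y = y" unfolding x(2) sm[OF M.R.one_closed x(1)] M.smult_one[OF x(1)] ..
    show "\<zero>\<^bsub>R\<^esub> \<odot>\<^bsub>N\<^esub> y = \<zero>\<^bsub>N\<^esub>" unfolding x(2) sm[OF M.R.zero_closed x(1)] M.smult_zero_left[OF x(1)] by (rule assms(4))
    {
      fix a assume a: "a \<in> carrier R"
      show "a \<odot>\<^bsub>N\<^esub> y \<in> carrier N" unfolding x(2) sm[OF a x(1)] c by (rule imageI[OF M.smult_closed[OF a x(1)]])
      fix b assume b: "b \<in> carrier R"
      note ax = M.smult_closed[OF a x(1)] and bx = M.smult_closed[OF b x(1)]
      show "(a \<oplus>\<^bsub>R\<^esub> b) \<odot>\<^bsub>N\<^esub> y = (a \<odot>\<^bsub>N\<^esub> y) \<oplus>\<^bsub>N\<^esub> (b \<odot>\<^bsub>N\<^esub> y)"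
        unfolding x(2) sm[OF a x(1)] sm[OF b x(1)] add[OF ax bx] sm[OF M.R.a_closed[OF a b] x(1)] M.smult_l_distr[OF a b x(1)] ..
      show "(a \<otimes>\<^bsub>R\<^esub> b) \<odot>\<^bsub>N\<^esub> y = a \<odot>\<^bsub>N\<^esub> (b \<odot>\<^bsub>N\<^esub> y)"
        unfolding x(2) sm[OF b x(1)] sm[OF a bx] sm[OF M.R.m_closed[OF a b] x(1)] M.smult_assoc[OF a b x(1)] ..
    }
    fix z assume "z \<in> carrier N"
    then obtain w where w: "w \<in> carrier M" "z = f w" using s by blast
    show "y \<oplus>\<^bsub>N\<^esub> z \<in> carrier N" unfolding x(2) w(2) add[OF x(1) w(1)] c by (rule imageI[OF M.M.a_closed[OF x(1) w(1)]])
    show "y \<oplus>\<^bsub>N\<^esub> z = z \<oplus>\<^bsub>N\<^esub> y" unfolding x(2) w(2) add[OF x(1) w(1)] add[OF w(1) x(1)] M.M.a_comm[OF x(1) w(1)] ..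
    {
      fix a assume a: "a \<in> carrier R"
      show "a \<odot>\<^bsub>N\<^esub> (y \<oplus>\<^bsub>N\<^esub> z) = (a \<odot>\<^bsub>N\<^esub> y) \<oplus>\<^bsub>N\<^esub> (a \<odot>\<^bsub>N\<^esub> z)"
        unfolding x(2) w(2) sm[OF a x(1)] sm[OF a w(1)] add[OF x(1) w(1)] sm[OF a M.M.a_closed[OF x(1) w(1)]]
          add[OF M.smult_closed[OF a x(1)] M.smult_closed[OF a w(1)]] M.smult_r_distr[OF a x(1) w(1)] ..
    }
    fix u assume "u \<in> carrier N"
    then obtain v where v: "v \<in> carrier M" "u = f v" using s by blast
    show "y \<oplus>\<^bsub>N\<^esub> z \<oplus>\<^bsub>N\<^esub> u = y \<oplus>\<^bsub>N\<^esub> (z \<oplus>\<^bsub>N\<^esub> u)"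
      unfolding x(2) w(2) v(2) add[OF x(1) w(1)] add[OF w(1) v(1)] add[OF M.M.a_closed[OF x(1) w(1)] v(1)]
        add[OF x(1) M.M.a_closed[OF w(1) v(1)]] M.M.a_assoc[OF x(1) w(1) v(1)] ..
  qed
qed

context fd_algebra
begin

lemma free_space_simps [simp]:
  "carrier (free_space K B) = B \<rightarrow>\<^sub>E carrier K"
  "x \<oplus>\<^bsub>free_space K B\<^esub> y = (\<lambda>b\<in>B. x b \<oplus>\<^bsub>K\<^esub> y b)"
  "c \<odot>\<^bsub>free_space K B\<^esub> x = (\<lambda>b\<in>B. c \<otimes>\<^bsub>K\<^esub> x b)"
  by (simp_all add: free_space_def)

definition unitv :: "'b set \<Rightarrow> 'b \<Rightarrow> 'b \<Rightarrow> 'k" where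
  "unitv B b = (\<lambda>b'\<in>B. if b' = b then \<one>\<^bsub>K\<^esub> else \<zero>\<^bsub>K\<^esub>)"

context
  fixes B :: "'b set" and M :: "('a, 'm) module"
  assumes finB: "finite B" and lmM: "left_module A M"
begin

interpretation M: left_module A M by (rule lmM)

abbreviation "PB \<equiv> prodm B (\<lambda>_. M)"
abbreviation "FG \<equiv> tensor_free (free_space K B) (und M)"
abbreviation "TR \<equiv> tensor_relations K (free_space K B) (und M)"
abbreviation "VT \<equiv> (B \<rightarrow>\<^sub>E carrier K) \<times> carrier M"

lemma PB_lm: "left_module A PB"
  by (rule left_module_prodm[OF ring_A lmM])

interpretation P: left_module A "prodm B (\<lambda>_. M)" by (rule PB_lm)

lemma FG_eq: "FG = free_Abelian_group VT"
  by (simp add: tensor_free_def)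

lemma FG_carrier: "c \<in> carrier FG \<longleftrightarrow> Poly_Mapping.keys c \<subseteq> VT"
  by (simp add: FG_eq)

text \<open>The coordinates of the tensor of a vector and an element of \<open>M\<close>: with basis
  \<open>B\<close> the tensor product is to become the power of \<open>M\<close> indexed by
  \<open>B\<close>.\<close>

definition pure :: "('b \<Rightarrow> 'k) \<times> 'm \<Rightarrow> 'b \<Rightarrow> 'm" where
  "pure z = (\<lambda>b\<in>B. scal (fst z b) \<odot>\<^bsub>M\<^esub> snd z)"

lemma pure_closed: "z \<in> VT \<Longrightarrow> pure z \<in> carrier PB"
  by (auto simp: pure_def intro!: M.smult_closed[OF scal_closed] elim: PiE_mem)

text \<open>The homomorphism provided by the universal property of the free abelian group. Its
  kernel will turn out to be exactly the group of relations (\<open>TR_iff\<close>), which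
  identifies the tensor product with \<open>PB\<close>.\<close>

definition teval :: "(('b \<Rightarrow> 'k) \<times> 'm \<Rightarrow>\<^sub>0 int) \<Rightarrow> 'b \<Rightarrow> 'm" where
  "teval = (SOME h. h \<in> hom FG (add_monoid PB) \<and> (\<forall>z\<in>VT. h (frag_of z) = pure z))"

lemma teval: "teval \<in> hom FG (add_monoid PB)" "z \<in> VT \<Longrightarrow> teval (frag_of z) = pure z"
proof -
  have "\<exists>h. h \<in> hom FG (add_monoid PB) \<and> (\<forall>z\<in>VT. h (frag_of z) = pure z)"
  proof -
    obtain h where "h \<in> hom (free_Abelian_group VT) (add_monoid PB)" "\<And>z. z \<in> VT \<Longrightarrow> h (frag_of z) = pure z"
    proof (rule comm_group.free_Abelian_group_universal[OF P.M.a_comm_group, of pure VT])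
      show "pure ` VT \<subseteq> carrier (add_monoid PB)" using pure_closed by auto
    qed blast
    then show ?thesis unfolding FG_eq by blast
  qed
  from someI_ex[OF this] show "teval \<in> hom FG (add_monoid PB)" "z \<in> VT \<Longrightarrow> teval (frag_of z) = pure z"
    unfolding teval_def by blast+
qed

lemma teval_closed: "c \<in> carrier FG \<Longrightarrow> teval c \<in> carrier PB"
  using hom_in_carrier[OF teval(1)] by simp

lemma FG_closed:
  "\<lbrakk>c \<in> carrier FG; d \<in> carrier FG\<rbrakk> \<Longrightarrow> c + d \<in> carrier FG"
  "\<lbrakk>c \<in> carrier FG; d \<in> carrier FG\<rbrakk> \<Longrightarrow> c - d \<in> carrier FG"
  "0 \<in> carrier FG" "z \<in> VT \<Longrightarrow> frag_of z \<in> carrier FG"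
  unfolding FG_carrier using keys_add[of c d] keys_diff[of c d] by auto

lemma teval_add: "\<lbrakk>c \<in> carrier FG; d \<in> carrier FG\<rbrakk> \<Longrightarrow> teval (c + d) = teval c \<oplus>\<^bsub>PB\<^esub> teval d"
  using hom_mult[OF teval(1), of c d] by (simp add: FG_eq)

lemma teval_diff:
  assumes "c \<in> carrier FG" "d \<in> carrier FG"
  shows "teval (c - d) = teval c \<ominus>\<^bsub>PB\<^esub> teval d"
proof -
  note cl = teval_closed[OF FG_closed(2)[OF assms]] teval_closed[OF assms(2)]
  have "teval c = teval ((c - d) + d)" by simp
  also have "\<dots> = teval (c - d) \<oplus>\<^bsub>PB\<^esub> teval d" by (rule teval_add[OF FG_closed(2)[OF assms] assms(2)])
  finally show ?thesis using P.M.add_minus_cancel[OF cl] by (simp only:)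
qed

lemma teval_zero: "teval 0 = \<zero>\<^bsub>PB\<^esub>"
  using teval_diff[OF FG_closed(3,3)] P.M.minus_self[OF teval_closed[OF FG_closed(3)]] by simp

lemma FG_induct [consumes 1, case_names zero diff of]:
  assumes "c \<in> carrier FG" "Q 0" "\<And>c d. \<lbrakk>c \<in> carrier FG; d \<in> carrier FG; Q c; Q d\<rbrakk> \<Longrightarrow> Q (c - d)"
    "\<And>z. z \<in> VT \<Longrightarrow> Q (frag_of z)"
  shows "Q c"
  using assms(1) unfolding FG_carrier
  by (rule free_Abelian_group_induct[of c VT Q]) (use assms(2-4) FG_carrier in auto)

definition relators :: "(('b \<Rightarrow> 'k) \<times> 'm \<Rightarrow>\<^sub>0 int) set" where
  "relators = {frag_of (v \<oplus>\<^bsub>free_space K B\<^esub> w, t) - frag_of (v, t) - frag_of (w, t) | v w t.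
         v \<in> carrier (free_space K B) \<and> w \<in> carrier (free_space K B) \<and> t \<in> carrier (und M)} \<union>
      {frag_of (v, t \<oplus>\<^bsub>und M\<^esub> u) - frag_of (v, t) - frag_of (v, u) | v t u.
         v \<in> carrier (free_space K B) \<and> t \<in> carrier (und M) \<and> u \<in> carrier (und M)} \<union>
      {frag_of (c \<odot>\<^bsub>free_space K B\<^esub> v, t) - frag_of (v, c \<odot>\<^bsub>und M\<^esub> t) | c v t.
         c \<in> carrier K \<and> v \<in> carrier (free_space K B) \<and> t \<in> carrier (und M)}"

lemma TR_eq: "TR = generate FG relators"
  by (simp only: tensor_relations_def relators_def)

lemma relatorI:
  "\<lbrakk>v \<in> B \<rightarrow>\<^sub>E carrier K; w \<in> B \<rightarrow>\<^sub>E carrier K; t \<in> carrier M\<rbrakk>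
    \<Longrightarrow> frag_of (\<lambda>b\<in>B. v b \<oplus>\<^bsub>K\<^esub> w b, t) - frag_of (v, t) - frag_of (w, t) \<in> relators"
  "\<lbrakk>v \<in> B \<rightarrow>\<^sub>E carrier K; t \<in> carrier M; u \<in> carrier M\<rbrakk>
    \<Longrightarrow> frag_of (v, t \<oplus>\<^bsub>M\<^esub> u) - frag_of (v, t) - frag_of (v, u) \<in> relators"
  "\<lbrakk>c \<in> carrier K; v \<in> B \<rightarrow>\<^sub>E carrier K; t \<in> carrier M\<rbrakk>
    \<Longrightarrow> frag_of (\<lambda>b\<in>B. c \<otimes>\<^bsub>K\<^esub> v b, t) - frag_of (v, scal c \<odot>\<^bsub>M\<^esub> t) \<in> relators"
  unfolding relators_def free_space_simps und_simps by blast+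

lemma vadd_closed: "\<lbrakk>v \<in> B \<rightarrow>\<^sub>E carrier K; w \<in> B \<rightarrow>\<^sub>E carrier K\<rbrakk> \<Longrightarrow> (\<lambda>b\<in>B. v b \<oplus>\<^bsub>K\<^esub> w b) \<in> B \<rightarrow>\<^sub>E carrier K"
  by (auto intro!: K.a_closed)

lemma vsmult_closed: "\<lbrakk>c \<in> carrier K; v \<in> B \<rightarrow>\<^sub>E carrier K\<rbrakk> \<Longrightarrow> (\<lambda>b\<in>B. c \<otimes>\<^bsub>K\<^esub> v b) \<in> B \<rightarrow>\<^sub>E carrier K"
  by (auto intro!: K.m_closed)

lemma smul_closed: "\<lbrakk>c \<in> carrier K; t \<in> carrier M\<rbrakk> \<Longrightarrow> scal c \<odot>\<^bsub>M\<^esub> t \<in> carrier M"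
  by (rule M.smult_closed[OF scal_closed])

lemma relators_FG: "relators \<subseteq> carrier FG"
proof
  fix r assume "r \<in> relators"
  then consider (1) v w t where "v \<in> B \<rightarrow>\<^sub>E carrier K" "w \<in> B \<rightarrow>\<^sub>E carrier K" "t \<in> carrier M"
      "r = frag_of (\<lambda>b\<in>B. v b \<oplus>\<^bsub>K\<^esub> w b, t) - frag_of (v, t) - frag_of (w, t)"
    | (2) v t u where "v \<in> B \<rightarrow>\<^sub>E carrier K" "t \<in> carrier M" "u \<in> carrier M"
      "r = frag_of (v, t \<oplus>\<^bsub>M\<^esub> u) - frag_of (v, t) - frag_of (v, u)"
    | (3) c v t where "c \<in> carrier K" "v \<in> B \<rightarrow>\<^sub>E carrier K" "t \<in> carrier M"
      "r = frag_of (\<lambda>b\<in>B. c \<otimes>\<^bsub>K\<^esub> v b, t) - frag_of (v, scal c \<odot>\<^bsub>M\<^esub> t)"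
    unfolding relators_def free_space_simps und_simps by blast
  then show "r \<in> carrier FG"
  proof cases
    case 1
    then show ?thesis using vadd_closed by (simp only: FG_closed mem_Sigma_iff)
  next
    case 2
    then show ?thesis using M.M.a_closed by (simp only: FG_closed mem_Sigma_iff)
  next
    case 3
    then show ?thesis using vsmult_closed smul_closed by (simp only: FG_closed mem_Sigma_iff)
  qed
qed

lemma relators_teval:
  assumes "r \<in> relators"
  shows "teval r = \<zero>\<^bsub>PB\<^esub>"
proof -
  have z3: "x \<ominus>\<^bsub>PB\<^esub> y \<ominus>\<^bsub>PB\<^esub> z = \<zero>\<^bsub>PB\<^esub>" if "y \<in> carrier PB" "z \<in> carrier PB" "x = y \<oplus>\<^bsub>PB\<^esub> z" for x y z
    using that P.M.add_minus_cancel[OF that(2,1)] P.M.minus_self[OF that(2)] P.M.a_comm[OF that(1,2)] by (simp only:)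
  consider (1) v w t where "v \<in> B \<rightarrow>\<^sub>E carrier K" "w \<in> B \<rightarrow>\<^sub>E carrier K" "t \<in> carrier M"
      "r = frag_of (\<lambda>b\<in>B. v b \<oplus>\<^bsub>K\<^esub> w b, t) - frag_of (v, t) - frag_of (w, t)"
    | (2) v t u where "v \<in> B \<rightarrow>\<^sub>E carrier K" "t \<in> carrier M" "u \<in> carrier M"
      "r = frag_of (v, t \<oplus>\<^bsub>M\<^esub> u) - frag_of (v, t) - frag_of (v, u)"
    | (3) c v t where "c \<in> carrier K" "v \<in> B \<rightarrow>\<^sub>E carrier K" "t \<in> carrier M"
      "r = frag_of (\<lambda>b\<in>B. c \<otimes>\<^bsub>K\<^esub> v b, t) - frag_of (v, scal c \<odot>\<^bsub>M\<^esub> t)"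
    using assms unfolding relators_def free_space_simps und_simps by blast
  then show ?thesis
  proof cases
    case 1
    have m: "(\<lambda>b\<in>B. v b \<oplus>\<^bsub>K\<^esub> w b, t) \<in> VT" "(v, t) \<in> VT" "(w, t) \<in> VT" using 1 vadd_closed by blast+
    note f = FG_closed(4)[OF m(1)] FG_closed(4)[OF m(2)] FG_closed(4)[OF m(3)]
    have vb: "v b \<in> carrier K" "w b \<in> carrier K" if "b \<in> B" for b using 1(1,2) that by auto
    have "pure (\<lambda>b\<in>B. v b \<oplus>\<^bsub>K\<^esub> w b, t) = pure (v, t) \<oplus>\<^bsub>PB\<^esub> pure (w, t)"
      using vb 1(3) by (auto simp: pure_def fun_eq_iff scal_add scal_closed M.smult_l_distr)
    then show ?thesis
      unfolding 1(4) teval_diff[OF FG_closed(2)[OF f(1,2)] f(3)] teval_diff[OF f(1,2)] teval(2)[OF m(1)] teval(2)[OF m(2)] teval(2)[OF m(3)]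
      by (rule z3[OF pure_closed[OF m(2)] pure_closed[OF m(3)]])
  next
    case 2
    have m: "(v, t \<oplus>\<^bsub>M\<^esub> u) \<in> VT" "(v, t) \<in> VT" "(v, u) \<in> VT" using 2 M.M.a_closed by blast+
    note f = FG_closed(4)[OF m(1)] FG_closed(4)[OF m(2)] FG_closed(4)[OF m(3)]
    have vb: "v b \<in> carrier K" if "b \<in> B" for b using 2(1) that by auto
    have "pure (v, t \<oplus>\<^bsub>M\<^esub> u) = pure (v, t) \<oplus>\<^bsub>PB\<^esub> pure (v, u)"
      using vb 2(2,3) by (auto simp: pure_def fun_eq_iff scal_closed M.smult_r_distr)
    then show ?thesis
      unfolding 2(4) teval_diff[OF FG_closed(2)[OF f(1,2)] f(3)] teval_diff[OF f(1,2)] teval(2)[OF m(1)] teval(2)[OF m(2)] teval(2)[OF m(3)]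
      by (rule z3[OF pure_closed[OF m(2)] pure_closed[OF m(3)]])
  next
    case 3
    have m: "(\<lambda>b\<in>B. c \<otimes>\<^bsub>K\<^esub> v b, t) \<in> VT" "(v, scal c \<odot>\<^bsub>M\<^esub> t) \<in> VT" using 3 vsmult_closed smul_closed by blast+
    have "pure (\<lambda>b\<in>B. c \<otimes>\<^bsub>K\<^esub> v b, t) = pure (v, scal c \<odot>\<^bsub>M\<^esub> t)"
    proof -
      \<comment> \<open>Balance of the tensors comes down to the commutation of scalars of
        \<open>K\<close> inside \<open>A\<close>.\<close>
      have "scal (c \<otimes>\<^bsub>K\<^esub> v b) \<odot>\<^bsub>M\<^esub> t = scal (v b) \<odot>\<^bsub>M\<^esub> (scal c \<odot>\<^bsub>M\<^esub> t)" if "b \<in> B" for b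
      proof -
        have vb: "v b \<in> carrier K" using 3(2) that by auto
        have "scal (c \<otimes>\<^bsub>K\<^esub> v b) = scal (v b) \<otimes>\<^sub>A scal c"
          using scal_mult[OF 3(1) vb] scal_commute[OF 3(1) scal_closed[OF vb]] by simp
        then show ?thesis using M.smult_assoc[OF scal_closed[OF vb] scal_closed[OF 3(1)] 3(3)] by simp
      qed
      then show ?thesis by (auto simp: pure_def fun_eq_iff)
    qed
    then show ?thesis
      unfolding 3(4) teval_diff[OF FG_closed(4)[OF m(1)] FG_closed(4)[OF m(2)]] teval(2)[OF m(1)] teval(2)[OF m(2)]
      using P.M.minus_self[OF pure_closed[OF m(2)]] by simp
  qed
qed

lemma TR_subgroup: "subgroup TR FG"
  unfolding TR_eq
  using group.generate_is_subgroup[OF group_free_Abelian_group, of relators VT] relators_FG by (simp add: FG_eq)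

lemma TR_closed:
  "0 \<in> TR" "\<lbrakk>c \<in> TR; d \<in> TR\<rbrakk> \<Longrightarrow> c + d \<in> TR" "\<lbrakk>c \<in> TR; d \<in> TR\<rbrakk> \<Longrightarrow> c - d \<in> TR" "r \<in> relators \<Longrightarrow> r \<in> TR"
  "c \<in> TR \<Longrightarrow> c \<in> carrier FG"
proof -
  interpret S: subgroup TR FG by (rule TR_subgroup)
  show z: "0 \<in> TR" using S.one_closed by (simp add: FG_eq)
  show mem: "c \<in> TR \<Longrightarrow> c \<in> carrier FG" for c by (rule S.mem_carrier)
  show add: "\<lbrakk>c \<in> TR; d \<in> TR\<rbrakk> \<Longrightarrow> c + d \<in> TR" for c d using S.m_closed[of c d] by (simp add: FG_eq)
  show "c - d \<in> TR" if "c \<in> TR" "d \<in> TR" for c d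
    using add[OF that(1), of "- d"] S.m_inv_closed[OF that(2)] mem[OF that(2)] by (simp add: FG_eq)
  show "r \<in> relators \<Longrightarrow> r \<in> TR" unfolding TR_eq by (rule generate.incl)
qed

lemma TR_teval:
  assumes "c \<in> TR"
  shows "teval c = \<zero>\<^bsub>PB\<^esub>"
proof -
  interpret gh: group_hom FG "add_monoid PB" teval
    using teval(1) group_free_Abelian_group[of VT] P.M.a_group by (simp add: group_hom_def group_hom_axioms_def FG_eq)
  have "generate FG relators \<subseteq> kernel FG (add_monoid PB) teval"
    by (rule group.generate_subgroup_incl[OF gh.G.group_axioms _ gh.subgroup_kernel])
      (use relators_FG relators_teval in \<open>auto simp: kernel_def\<close>)
  then show ?thesis using assms unfolding TR_eq kernel_def by auto
qed

text \<open>For \<open>S\<close> = \<open>B\<close> a section of \<open>teval\<close>: the sum over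
  b of the unit vector at b tensored with \<open>x b\<close>. The parameter \<open>S\<close> allows
  induction over subsets of the basis.\<close>

definition sect :: "'b set \<Rightarrow> ('b \<Rightarrow> 'm) \<Rightarrow> ('b \<Rightarrow> 'k) \<times> 'm \<Rightarrow>\<^sub>0 int" where
  "sect S x = (\<Sum>b\<in>S. frag_of (unitv B b, x b))"

lemma unitv_closed: "unitv B b \<in> B \<rightarrow>\<^sub>E carrier K"
  by (simp add: unitv_def)

lemma sect_FG:
  assumes "S \<subseteq> B" "\<And>b. b \<in> B \<Longrightarrow> x b \<in> carrier M"
  shows "sect S x \<in> carrier FG"
  unfolding sect_def FG_eq
  by (rule sum_closed_free_Abelian_group) (use assms unitv_closed in auto)

text \<open>Modulo the relations a vector is the sum of its multiples of unit vectors, and each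
  coefficient moves across the tensor sign.\<close>

lemma pure_TR:
  assumes "v \<in> B \<rightarrow>\<^sub>E carrier K" "t \<in> carrier M"
  shows "frag_of (v, t) - sect B (pure (v, t)) \<in> TR"
proof -
  let ?v = "\<lambda>S. \<lambda>b\<in>B. if b \<in> S then v b else \<zero>\<^bsub>K\<^esub>"
  have vS: "?v S \<in> B \<rightarrow>\<^sub>E carrier K" for S using assms(1) by auto
  have "frag_of (?v S, t) - sect S (pure (v, t)) \<in> TR" if "finite S" "S \<subseteq> B" for S
    using that
  proof (induction S)
    case empty
    define o' where "o' = ?v {}"
    have o: "o' \<in> B \<rightarrow>\<^sub>E carrier K" unfolding o'_def by (rule vS)
    \<comment> \<open>The zero vector o satisfies o + o = o, so additivity in the first argument
      makes its tensor with t a relation.\<close>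
    have "frag_of (\<lambda>b\<in>B. o' b \<oplus>\<^bsub>K\<^esub> o' b, t) - frag_of (o', t) - frag_of (o', t) \<in> TR"
      by (rule TR_closed(4)[OF relatorI(1)[OF o o assms(2)]])
    moreover have "(\<lambda>b\<in>B. o' b \<oplus>\<^bsub>K\<^esub> o' b) = o'" by (auto simp: o'_def fun_eq_iff)
    ultimately have "- frag_of (o', t) \<in> TR" by simp
    then have "0 - - frag_of (o', t) \<in> TR" by (rule TR_closed(3)[OF TR_closed(1)])
    then show ?case unfolding sect_def sum.empty o'_def[symmetric] by simp
  next
    case (insert s S)
    have s: "s \<in> B" and vs: "v s \<in> carrier K" using insert.prems assms(1) by auto
    let ?w = "\<lambda>b\<in>B. v s \<otimes>\<^bsub>K\<^esub> unitv B s b"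
    have w: "?w \<in> B \<rightarrow>\<^sub>E carrier K" by (rule vsmult_closed[OF vs unitv_closed])
    have "(\<lambda>b\<in>B. ?v S b \<oplus>\<^bsub>K\<^esub> ?w b) = ?v (insert s S)"
      using PiE_mem[OF assms(1)] insert.hyps vs by (auto simp: fun_eq_iff unitv_def)
    then have 1: "frag_of (?v (insert s S), t) - frag_of (?v S, t) - frag_of (?w, t) \<in> TR"
      using TR_closed(4)[OF relatorI(1)[OF vS w assms(2), of S]] by simp
    have 2: "frag_of (?w, t) - frag_of (unitv B s, scal (v s) \<odot>\<^bsub>M\<^esub> t) \<in> TR"
      by (rule TR_closed(4)[OF relatorI(3)[OF vs unitv_closed assms(2)]])
    have 3: "frag_of (?v S, t) - sect S (pure (v, t)) \<in> TR"
      by (rule insert.IH) (use insert.prems insert.hyps in auto)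
    have "frag_of (?v (insert s S), t) - sect (insert s S) (pure (v, t)) =
      (frag_of (?v (insert s S), t) - frag_of (?v S, t) - frag_of (?w, t))
      + (frag_of (?w, t) - frag_of (unitv B s, scal (v s) \<odot>\<^bsub>M\<^esub> t)) + (frag_of (?v S, t) - sect S (pure (v, t)))"
      using insert.hyps s by (simp add: sect_def pure_def)
    then show ?case using TR_closed(2)[OF TR_closed(2)[OF 1 2] 3] by (simp only:)
  qed
  from this[OF finB subset_refl] have "frag_of (?v B, t) - sect B (pure (v, t)) \<in> TR" .
  moreover have "?v B = v" by (rule extensionalityI[of _ B]) (use assms(1) in \<open>auto simp: PiE_def\<close>)
  ultimately show ?thesis by (simp only:)
qed

text \<open>Modulo the relations \<open>sect\<close> is additive, coordinate by coordinate. The form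
  with differences fits the induction \<open>FG_induct\<close>.\<close>

lemma sect_diff_TR:
  assumes "x \<in> carrier PB" "y \<in> carrier PB"
  shows "sect B x - sect B y - sect B (x \<ominus>\<^bsub>PB\<^esub> y) \<in> TR"
proof -
  let ?d = "x \<ominus>\<^bsub>PB\<^esub> y"
  have d: "?d \<in> carrier PB" using assms by (rule P.M.minus_closed)
  have e: "?d \<oplus>\<^bsub>PB\<^esub> y = x" using assms by (rule P.M.minus_add_cancel)
  have "sect S x - sect S y - sect S ?d \<in> TR" if "finite S" "S \<subseteq> B" for S
    using that
  proof (induction S)
    case empty
    then show ?case using TR_closed(1) by (simp add: sect_def)
  next
    case (insert b S)
    have b: "b \<in> B" using insert.prems by simp
    have m: "?d b \<in> carrier M" "y b \<in> carrier M" using prodm_mem[OF d b] prodm_mem[OF assms(2) b] .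
    have "x b = ?d b \<oplus>\<^bsub>M\<^esub> y b" using fun_cong[OF e, of b] b by simp
    then have 1: "frag_of (unitv B b, x b) - frag_of (unitv B b, ?d b) - frag_of (unitv B b, y b) \<in> TR"
      using TR_closed(4)[OF relatorI(2)[OF unitv_closed m]] by (simp only:)
    have 2: "sect S x - sect S y - sect S ?d \<in> TR" using insert by simp
    have "sect (insert b S) x - sect (insert b S) y - sect (insert b S) ?d =
      (frag_of (unitv B b, x b) - frag_of (unitv B b, ?d b) - frag_of (unitv B b, y b)) + (sect S x - sect S y - sect S ?d)"
      using insert.hyps by (simp add: sect_def)
    then show ?case using TR_closed(2)[OF 1 2] by (simp only:)
  qed
  from this[OF finB subset_refl] show ?thesis .
qed

text \<open>Every element is congruent to the section of its value, so the kernel of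
  \<open>teval\<close> cannot exceed the relations.\<close>

lemma sect_teval_TR: "c \<in> carrier FG \<Longrightarrow> c - sect B (teval c) \<in> TR"
proof (induction rule: FG_induct)
  case zero
  have "\<zero>\<^bsub>PB\<^esub> \<ominus>\<^bsub>PB\<^esub> \<zero>\<^bsub>PB\<^esub> = \<zero>\<^bsub>PB\<^esub>" by (rule P.M.minus_self[OF P.M.zero_closed])
  then have "0 - (sect B \<zero>\<^bsub>PB\<^esub> - sect B \<zero>\<^bsub>PB\<^esub> - sect B \<zero>\<^bsub>PB\<^esub>) \<in> TR"
    using TR_closed(3)[OF TR_closed(1) sect_diff_TR[OF P.M.zero_closed P.M.zero_closed]] by (simp only:)
  then have "sect B \<zero>\<^bsub>PB\<^esub> \<in> TR" by (simp only: diff_self diff_0 minus_minus)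
  then show ?case unfolding teval_zero by (rule TR_closed(3)[OF TR_closed(1)])
next
  case (diff c d)
  have 1: "(c - sect B (teval c)) - (d - sect B (teval d)) \<in> TR" by (rule TR_closed(3)[OF diff(3,4)])
  have 2: "sect B (teval c) - sect B (teval d) - sect B (teval (c - d)) \<in> TR"
    unfolding teval_diff[OF diff(1,2)] by (rule sect_diff_TR[OF teval_closed[OF diff(1)] teval_closed[OF diff(2)]])
  have "c - d - sect B (teval (c - d)) =
    ((c - sect B (teval c)) - (d - sect B (teval d))) + (sect B (teval c) - sect B (teval d) - sect B (teval (c - d)))"
    by simp
  then show ?case using TR_closed(2)[OF 1 2] by (simp only:)
next
  case (of z)
  obtain v t where "z = (v, t)" "v \<in> B \<rightarrow>\<^sub>E carrier K" "t \<in> carrier M" using of by blast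
  then show ?case using pure_TR[of v t] teval(2)[OF of] by simp
qed

lemma TR_iff: "c \<in> TR \<longleftrightarrow> c \<in> carrier FG \<and> teval c = \<zero>\<^bsub>PB\<^esub>"
proof
  assume "c \<in> TR"
  then show "c \<in> carrier FG \<and> teval c = \<zero>\<^bsub>PB\<^esub>" using TR_closed(5) TR_teval by blast
next
  assume c: "c \<in> carrier FG \<and> teval c = \<zero>\<^bsub>PB\<^esub>"
  have "0 - sect B (teval 0) \<in> TR" by (rule sect_teval_TR[OF FG_closed(3)])
  then have "c - sect B (teval c) - (0 - sect B (teval 0)) \<in> TR" using TR_closed(3)[OF sect_teval_TR] c by blast
  then show "c \<in> TR" using c teval_zero by (simp del: prodm_simps)
qed

lemma teval_sect:
  assumes "x \<in> carrier PB"
  shows "teval (sect B x) = x"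
proof -
  have x: "x b \<in> carrier M" if "b \<in> B" for b using prodm_mem[OF assms that] .
  have "teval (sect S x) = (\<lambda>b\<in>B. if b \<in> S then x b else \<zero>\<^bsub>M\<^esub>)" if "finite S" "S \<subseteq> B" for S
    using that
  proof (induction S)
    case empty
    then show ?case using teval_zero by (simp add: sect_def)
  next
    case (insert s S)
    have s: "s \<in> B" using insert.prems by simp
    have m: "(unitv B s, x s) \<in> VT" using unitv_closed x[OF s] by blast
    have "teval (sect (insert s S) x) = teval (frag_of (unitv B s, x s) + sect S x)"
      using insert.hyps by (simp add: sect_def)
    also have "\<dots> = pure (unitv B s, x s) \<oplus>\<^bsub>PB\<^esub> teval (sect S x)"
      using teval_add[OF FG_closed(4)[OF m] sect_FG[of S x]] teval(2)[OF m] insert.prems x by simp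
    also have "\<dots> = (\<lambda>b\<in>B. if b \<in> insert s S then x b else \<zero>\<^bsub>M\<^esub>)"
      using insert x s by (auto simp: fun_eq_iff pure_def unitv_def scal_one scal_zero M.smult_one M.smult_zero_left)
    finally show ?case .
  qed
  from this[OF finB subset_refl] show ?thesis
    using assms by (auto simp: PiE_def intro!: extensionalityI[of _ B])
qed

text \<open>The tensor product of the space with basis \<open>B\<close> and \<open>M\<close> is identified with \<open>M\<^sup>B\<close>: its elements are
  the fibres of \<open>teval\<close>.\<close>

definition fibre :: "('b \<Rightarrow> 'm) \<Rightarrow> (('b \<Rightarrow> 'k) \<times> 'm \<Rightarrow>\<^sub>0 int) set" where
  "fibre x = {c \<in> carrier FG. teval c = x}"

lemma coset_fibre:
  assumes "c \<in> carrier FG"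
  shows "TR #>\<^bsub>FG\<^esub> c = fibre (teval c)"
proof -
  have "TR #>\<^bsub>FG\<^esub> c = {r + c | r. r \<in> TR}" by (auto simp: r_coset_def FG_eq)
  also have "\<dots> = fibre (teval c)"
  proof (intro equalityI subsetI)
    fix z assume "z \<in> {r + c | r. r \<in> TR}"
    then obtain r where r: "z = r + c" "r \<in> carrier FG" "teval r = \<zero>\<^bsub>PB\<^esub>" using TR_iff by blast
    then show "z \<in> fibre (teval c)"
      using teval_add[OF r(2) assms] P.M.l_zero[OF teval_closed[OF assms]] FG_closed(1)[OF r(2) assms]
      unfolding fibre_def by (simp del: prodm_simps)
  next
    fix z assume z: "z \<in> fibre (teval c)"
    then have "z - c \<in> TR"
      unfolding TR_iff fibre_def
      using teval_diff[of z c] P.M.minus_self[OF teval_closed[OF assms]] FG_closed(2)[OF _ assms] assms by auto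
    moreover have "z = (z - c) + c" by simp
    ultimately show "z \<in> {r + c | r. r \<in> TR}" by blast
  qed
  finally show ?thesis .
qed

lemma fibre_sect: "x \<in> carrier PB \<Longrightarrow> sect B x \<in> fibre x"
  using sect_FG[of B x] prodm_mem[of x B] teval_sect unfolding fibre_def by blast

abbreviation "TM \<equiv> tensor_module K A (free_space K B) M"

lemma TM_carrier: "carrier TM = fibre ` carrier PB"
proof -
  have "carrier TM = (\<lambda>c. TR #>\<^bsub>FG\<^esub> c) ` carrier FG"
    by (simp add: tensor_module_def Let_def tensor_group_def carrier_FactGroup)
  also have "\<dots> = (\<lambda>c. fibre (teval c)) ` carrier FG" by (intro image_cong refl) (rule coset_fibre)
  also have "\<dots> = fibre ` carrier PB"
  proof -
    have "teval ` carrier FG = carrier PB"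
    proof
      show "teval ` carrier FG \<subseteq> carrier PB" using teval_closed by blast
      show "carrier PB \<subseteq> teval ` carrier FG"
      proof
        fix x assume x: "x \<in> carrier PB"
        then have "sect B x \<in> carrier FG" using fibre_sect unfolding fibre_def by blast
        then show "x \<in> teval ` carrier FG" using teval_sect[OF x] by (metis imageI)
      qed
    qed
    then show ?thesis by (metis image_image)
  qed
  finally show ?thesis .
qed

lemma fibre_inj:
  assumes "x \<in> carrier PB" "fibre x = fibre y"
  shows "x = y"
  using fibre_sect[OF assms(1)] teval_sect[OF assms(1)] assms(2) unfolding fibre_def by auto

lemma TM_zero: "\<zero>\<^bsub>TM\<^esub> = fibre \<zero>\<^bsub>PB\<^esub>"
proof -
  have "\<zero>\<^bsub>TM\<^esub> = TR" by (simp add: tensor_module_def Let_def tensor_group_def)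
  then show ?thesis unfolding fibre_def using TR_iff by blast
qed

lemma TM_add:
  assumes "x \<in> carrier PB" "y \<in> carrier PB"
  shows "fibre x \<oplus>\<^bsub>TM\<^esub> fibre y = fibre (x \<oplus>\<^bsub>PB\<^esub> y)"
proof -
  have "fibre x \<oplus>\<^bsub>TM\<^esub> fibre y = {z + w | z w. z \<in> fibre x \<and> w \<in> fibre y}"
    by (auto simp: tensor_module_def Let_def tensor_group_def set_mult_def FG_eq)
  also have "\<dots> = fibre (x \<oplus>\<^bsub>PB\<^esub> y)"
  proof (intro equalityI subsetI)
    fix u assume "u \<in> {z + w | z w. z \<in> fibre x \<and> w \<in> fibre y}"
    then show "u \<in> fibre (x \<oplus>\<^bsub>PB\<^esub> y)" unfolding fibre_def using teval_add FG_closed(1) by auto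
  next
    fix u assume u: "u \<in> fibre (x \<oplus>\<^bsub>PB\<^esub> y)"
    note sx = fibre_sect[OF assms(1)]
    then have s: "sect B x \<in> carrier FG" and uF: "u \<in> carrier FG" "teval u = x \<oplus>\<^bsub>PB\<^esub> y"
      using u unfolding fibre_def by blast+
    have "teval (u - sect B x) = (y \<oplus>\<^bsub>PB\<^esub> x) \<ominus>\<^bsub>PB\<^esub> x"
      unfolding teval_diff[OF uF(1) s] uF(2) teval_sect[OF assms(1)] P.M.a_comm[OF assms] ..
    also have "\<dots> = y" by (rule P.M.add_minus_cancel[OF assms(2,1)])
    finally have "u - sect B x \<in> fibre y" unfolding fibre_def using FG_closed(2)[OF uF(1) s] by blast
    moreover have "u = sect B x + (u - sect B x)" by simp
    ultimately show "u \<in> {z + w | z w. z \<in> fibre x \<and> w \<in> fibre y}" using sx by blast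
  qed
  finally show ?thesis .
qed

end

text \<open>A map \<open>F\<close> between the powers computes the tensor product of \<phi> and
  \<psi> once it respects zero and differences and has the right values on pure tensors, as these
  generate. It serves both for the action of \<open>A\<close> and for the arrows of
  \<open>m_i(P)\<close>.\<close>

lemma tensor_map_fibre:
  fixes M :: "('a, 'm) module"
  assumes B: "finite B" and B': "finite B'" and M: "left_module A M"
    and \<phi>: "\<And>v. v \<in> B \<rightarrow>\<^sub>E carrier K \<Longrightarrow> \<phi> v \<in> B' \<rightarrow>\<^sub>E carrier K" and \<psi>: "\<And>t. t \<in> carrier M \<Longrightarrow> \<psi> t \<in> carrier M"
    and F: "\<And>x y. \<lbrakk>x \<in> carrier (prodm B (\<lambda>_. M)); y \<in> carrier (prodm B (\<lambda>_. M))\<rbrakk>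
      \<Longrightarrow> F (x \<ominus>\<^bsub>prodm B (\<lambda>_. M)\<^esub> y) = F x \<ominus>\<^bsub>prodm B' (\<lambda>_. M)\<^esub> F y"
    and F0: "F \<zero>\<^bsub>prodm B (\<lambda>_. M)\<^esub> = \<zero>\<^bsub>prodm B' (\<lambda>_. M)\<^esub>"
    and Fp: "\<And>v t. \<lbrakk>v \<in> B \<rightarrow>\<^sub>E carrier K; t \<in> carrier M\<rbrakk> \<Longrightarrow> F (pure B M (v, t)) = pure B' M (\<phi> v, \<psi> t)"
    and x: "x \<in> carrier (prodm B (\<lambda>_. M))"
  shows "tensor_map K (free_space K B) (und M) (free_space K B') (und M) \<phi> \<psi> (fibre B M x) = fibre B' M (F x)"
proof -
  let ?fe = "frag_extend (\<lambda>(v, t). frag_of (\<phi> v, \<psi> t))"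
  let ?F1 = "tensor_free (free_space K B) (und M)" and ?F2 = "tensor_free (free_space K B') (und M)"
  have key: "?fe c \<in> carrier ?F2 \<and> teval B' M (?fe c) = F (teval B M c)" if "c \<in> carrier ?F1" for c
  proof (rule FG_induct[OF B M that])
    show "?fe 0 \<in> carrier ?F2 \<and> teval B' M (?fe 0) = F (teval B M 0)" using FG_closed(3)[OF B' M] teval_zero[OF B' M] teval_zero[OF B M] F0 by (simp del: prodm_simps)
  next
    fix c d assume diff: "c \<in> carrier ?F1" "d \<in> carrier ?F1"
      "?fe c \<in> carrier ?F2 \<and> teval B' M (?fe c) = F (teval B M c)"
      "?fe d \<in> carrier ?F2 \<and> teval B' M (?fe d) = F (teval B M d)"
    then show "?fe (c - d) \<in> carrier ?F2 \<and> teval B' M (?fe (c - d)) = F (teval B M (c - d))"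
      using FG_closed(2)[OF B' M] teval_diff[OF B' M] teval_diff[OF B M diff(1,2)]
        F[OF teval_closed[OF B M diff(1)] teval_closed[OF B M diff(2)]]
      by (simp only: frag_extend_diff)
  next
    fix z assume of: "z \<in> (B \<rightarrow>\<^sub>E carrier K) \<times> carrier M"
    obtain v t where z: "z = (v, t)" "v \<in> B \<rightarrow>\<^sub>E carrier K" "t \<in> carrier M" using of by blast
    have m: "(\<phi> v, \<psi> t) \<in> (B' \<rightarrow>\<^sub>E carrier K) \<times> carrier M" using \<phi>[OF z(2)] \<psi>[OF z(3)] by blast
    show "?fe (frag_of z) \<in> carrier ?F2 \<and> teval B' M (?fe (frag_of z)) = F (teval B M (frag_of z))"
      using FG_closed(4)[OF B' M m] teval(2)[OF B' M m] teval(2)[OF B M of] Fp[OF z(2,3)] z(1) by simp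
  qed
  have car: "fibre B M x \<in> carrier (tensor_group K (free_space K B) (und M))"
    using TM_carrier[OF B M] x by (simp add: tensor_module_def Let_def del: prodm_simps)
  have "(\<Union>z\<in>fibre B M x. tensor_relations K (free_space K B') (und M) #>\<^bsub>?F2\<^esub> ?fe z) = (\<Union>z\<in>fibre B M x. fibre B' M (F x))"
  proof (rule SUP_cong[OF refl])
    fix z assume "z \<in> fibre B M x"
    then have z: "z \<in> carrier ?F1" "teval B M z = x" unfolding fibre_def[OF B M] by blast+
    show "tensor_relations K (free_space K B') (und M) #>\<^bsub>?F2\<^esub> ?fe z = fibre B' M (F x)"
      using coset_fibre[OF B' M, of "?fe z"] key[OF z(1)] z(2) by simp
  qed
  also have "\<dots> = fibre B' M (F x)" using fibre_sect[OF B M x] by blast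
  finally show ?thesis using car by (simp add: tensor_map_def)
qed

end

section \<open>The category of modules\<close>

lemma restrict_eq_iff: "restrict f S = restrict g S \<longleftrightarrow> (\<forall>x\<in>S. f x = g x)"
  by (auto simp: fun_eq_iff)

lemma mod_hom_eq_compose_iff:
  "h \<in> mod_hom R L N \<Longrightarrow> compose (carrier L) g f = h \<longleftrightarrow> (\<forall>x\<in>carrier L. g (f x) = h x)"
  using restrict_eq_iff[of "\<lambda>x. g (f x)" "carrier L" h] by (simp add: compose_def mod_hom_restrict)

context fd_algebra
begin

lemma mod_cat_simps [simp]:
  "M \<in> Obj (mod_cat K A) \<longleftrightarrow> fd_module K A M"
  "Hom (mod_cat K A) = mod_hom A"
  "Comp (mod_cat K A) X Y Z g f = compose (carrier X) g f"
  "Ident (mod_cat K A) X = (\<lambda>x\<in>carrier X. x)"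
  "Hplus (mod_cat K A) X Y f g = (\<lambda>x\<in>carrier X. f x \<oplus>\<^bsub>Y\<^esub> g x)"
  "Hzero (mod_cat K A) X Y = (\<lambda>x\<in>carrier X. \<zero>\<^bsub>Y\<^esub>)"
  by (simp_all add: mod_cat_def)

lemma mod_zero_object_iff:
  fixes M :: "('a, 'm) module"
  assumes "fd_module K A M"
  shows "zero_object (mod_cat K A) M \<longleftrightarrow> carrier M = {\<zero>\<^bsub>M\<^esub>}"
proof
  note lm = fd_left_module[OF assms]
  have z: "\<zero>\<^bsub>M\<^esub> \<in> carrier M" by (rule lsubD(2)[OF lsub_carrier[OF lm]])
  {
    assume "zero_object (mod_cat K A) M"
    then have "\<exists>!f. f \<in> homA M M" using assms by (simp add: zero_object_def)
    then have "(\<lambda>x\<in>carrier M. x) = (\<lambda>x\<in>carrier M. \<zero>\<^bsub>M\<^esub>)"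
      using mod_hom_id[OF lm] mod_hom_const_zero[OF lm lm] by blast
    then show "carrier M = {\<zero>\<^bsub>M\<^esub>}" using z unfolding restrict_eq_iff by blast
  next
    assume c: "carrier M = {\<zero>\<^bsub>M\<^esub>}"
    have "(\<exists>!f. f \<in> homA M Y) \<and> (\<exists>!f. f \<in> homA Y M)" if "fd_module K A Y" for Y :: "('a, 'm) module"
    proof (intro conjI ex_ex1I)
      note lY = fd_left_module[OF that]
      show "\<exists>f. f \<in> homA M Y" "\<exists>f. f \<in> homA Y M"
        using mod_hom_const_zero[OF lm lY] mod_hom_const_zero[OF lY lm] by blast+
      show "f = g" if "f \<in> homA M Y" "g \<in> homA M Y" for f g
        by (rule mod_hom_eqI[OF that]) (use c mod_hom_zero[OF lm lY that(1)] mod_hom_zero[OF lm lY that(2)] in auto)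
      show "f = g" if "f \<in> homA Y M" "g \<in> homA Y M" for f g
        by (rule mod_hom_eqI[OF that]) (use c mod_hom_closed[OF that(1)] mod_hom_closed[OF that(2)] in auto)
    qed
    then show "zero_object (mod_cat K A) M" using assms by (simp add: zero_object_def)
  }
qed

lemma mod_biproduct_iff:
  assumes "fd_module K A X" "fd_module K A Y" "fd_module K A B"
    "i\<^sub>1 \<in> homA X B" "i\<^sub>2 \<in> homA Y B" "p\<^sub>1 \<in> homA B X" "p\<^sub>2 \<in> homA B Y"
  shows "is_biproduct (mod_cat K A) X Y B i\<^sub>1 i\<^sub>2 p\<^sub>1 p\<^sub>2 \<longleftrightarrow>
    (\<forall>x\<in>carrier X. p\<^sub>1 (i\<^sub>1 x) = x \<and> p\<^sub>2 (i\<^sub>1 x) = \<zero>\<^bsub>Y\<^esub>) \<and>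
    (\<forall>y\<in>carrier Y. p\<^sub>2 (i\<^sub>2 y) = y \<and> p\<^sub>1 (i\<^sub>2 y) = \<zero>\<^bsub>X\<^esub>) \<and>
    (\<forall>b\<in>carrier B. i\<^sub>1 (p\<^sub>1 b) \<oplus>\<^bsub>B\<^esub> i\<^sub>2 (p\<^sub>2 b) = b)"
proof -
  have "(\<lambda>x\<in>carrier B. compose (carrier B) i\<^sub>1 p\<^sub>1 x \<oplus>\<^bsub>B\<^esub> compose (carrier B) i\<^sub>2 p\<^sub>2 x) = (\<lambda>x\<in>carrier B. x) \<longleftrightarrow>
    (\<forall>b\<in>carrier B. i\<^sub>1 (p\<^sub>1 b) \<oplus>\<^bsub>B\<^esub> i\<^sub>2 (p\<^sub>2 b) = b)"
    unfolding restrict_eq_iff by (simp add: compose_def)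
  then show ?thesis
    using assms by (simp add: is_biproduct_def compose_def[of "carrier X"] compose_def[of "carrier Y"] restrict_eq_iff) blast
qed

text \<open>The inclusion of a submodule is an inflation because the quotient has a copy in the same
  type.\<close>

lemma injective_object_inj_in:
  fixes I :: "('a, 'm) module"
  assumes univ: "lists (carrier K) \<lesssim> (UNIV :: 'm set)" and inj: "injective_object (mod_cat K A) (mod_exact K A) I"
  shows "inj_in TYPE('m) I"
  unfolding inj_in_def
proof (intro conjI allI impI)
  show "left_module A I" by (rule fd_left_module) (use inj in \<open>simp add: injective_object_def\<close>)
  fix N :: "('a, 'm) module" and U h
  assume N: "fd_module K A N" and U: "lsub A N U" and h: "h \<in> homA (N\<lparr>carrier := U\<rparr>) I"
  let ?U = "N\<lparr>carrier := U\<rparr>"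
  obtain Z :: "('a, 'm) module" and q where Z: "fd_module K A Z" "q \<in> homA N Z" "q ` carrier N = carrier Z"
    "\<And>x. x \<in> carrier N \<Longrightarrow> q x = \<zero>\<^bsub>Z\<^esub> \<longleftrightarrow> x \<in> U"
    by (rule fd_quotient[OF N U univ]) blast
  have "mod_exact K A ?U (\<lambda>x\<in>U. x) N q Z"
    using Z N fd_module_lsub[OF N U] mod_hom_incl[OF fd_left_module[OF N] U] lsubD(1)[OF U]
    by (auto simp: mod_exact_def short_exact_def)
  then have "inflation (mod_exact K A) ?U (\<lambda>x\<in>U. x) N" unfolding inflation_def by blast
  then have "\<forall>h\<in>homA ?U I. \<exists>u\<in>homA N I. compose (carrier ?U) u (\<lambda>x\<in>U. x) = h"
    using inj unfolding injective_object_def mod_cat_simps by blast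
  from this[THEN bspec, OF h] have "\<exists>u\<in>homA N I. compose U u (\<lambda>x\<in>U. x) = h" by simp
  then obtain u where u: "u \<in> homA N I" "compose U u (\<lambda>x\<in>U. x) = h" by blast
  have "u x = h x" if "x \<in> U" for x using fun_cong[OF u(2), of x] that by (simp add: compose_def)
  then show "\<exists>u\<in>homA N I. \<forall>x\<in>U. u x = h x" using u(1) by blast
qed

text \<open>Self-injectivity speaks about a copy of \<open>A\<close> in the type \<open>'m\<close>;
  here it is moved back to \<open>A\<close> itself and to the test type
  \<open>'k list\<close>.\<close>

lemma self_injective_inj_mod:
  assumes univ: "lists (carrier K) \<lesssim> (UNIV :: 'm set)" and "self_injective TYPE('m) K A"
  shows "inj_mod AA"
proof -
  obtain I :: "('a, 'm) module" and f where I: "injective_object (mod_cat K A) (mod_exact K A) I"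
    and f: "f \<in> homA AA I" "bij_betw f (carrier AA) (carrier I)"
    using assms(2) unfolding self_injective_def mod_iso_def by blast
  have i: "inj_in TYPE('m) I" by (rule injective_object_inj_in[OF univ I])
  show ?thesis
  proof (rule inj_mod_retract[OF inj_in_imp_inj_mod[OF i univ] left_module_AA
        mod_hom_inv[OF f left_module_AA inj_mod_left_module[OF i]] f(1)])
    fix x assume x: "x \<in> carrier AA"
    then show "(\<lambda>y\<in>carrier I. inv_into (carrier AA) f y) (f x) = x"
      using f(2) mod_hom_closed[OF f(1) x] by (simp add: bij_betw_def)
  qed
qed

lemma mod_deflation_iff:
  "deflation (mod_exact K A) Y g Z \<longleftrightarrow>
    fd_module K A Y \<and> fd_module K A Z \<and> g \<in> homA Y Z \<and> g ` carrier Y = carrier Z"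
proof
  assume *: "fd_module K A Y \<and> fd_module K A Z \<and> g \<in> homA Y Z \<and> g ` carrier Y = carrier Z"
  then have lm: "left_module A Y" "left_module A Z" and g: "g \<in> homA Y Z" using fd_left_module by blast+
  let ?U = "{y \<in> carrier Y. g y = \<zero>\<^bsub>Z\<^esub>}"
  have U: "lsub A Y ?U" by (rule lsub_ker[OF lm g])
  have "mod_exact K A (Y\<lparr>carrier := ?U\<rparr>) (\<lambda>x\<in>?U. x) Y g Z"
    using * fd_module_lsub[OF _ U] mod_hom_incl[OF lm(1) U] by (auto simp: mod_exact_def short_exact_def)
  then show "deflation (mod_exact K A) Y g Z" unfolding deflation_def by blast
qed (auto simp: deflation_def mod_exact_def short_exact_def)

end

text \<open>A projective module is a retract of an injective cover, and injective modules lift by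
  \<open>inj_mod_lift\<close>.\<close>

lemma (in self_injective_quiver) mod_projective_iff:
  fixes P :: "('a, 'm) module"
  shows "projective_object (mod_cat K A) (mod_exact K A) P \<longleftrightarrow> fd_module K A P \<and> inj_mod P"
proof
  assume *: "projective_object (mod_cat K A) (mod_exact K A) P"
  then have P: "fd_module K A P" by (simp add: projective_object_def)
  note lP = fd_left_module[OF P]
  obtain N :: "('a, 'm) module" and p where N: "fd_module K A N" "inj_mod N" "p \<in> homA N P" "p ` carrier N = carrier P"
    using injective_cover[OF P] by blast
  have "\<exists>s\<in>homA P N. compose (carrier P) p s = (\<lambda>x\<in>carrier P. x)"
    using * N P mod_hom_id[OF lP] unfolding projective_object_def mod_deflation_iff mod_cat_simps by blast
  then obtain s where s: "s \<in> homA P N" "compose (carrier P) p s = (\<lambda>x\<in>carrier P. x)" by blast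
  have "inj_mod P"
  proof (rule inj_mod_retract[OF N(2) lP N(3) s(1)])
    fix x assume "x \<in> carrier P"
    then show "p (s x) = x" using fun_cong[OF s(2), of x] by (simp add: compose_def)
  qed
  then show "fd_module K A P \<and> inj_mod P" using P by blast
next
  assume P: "fd_module K A P \<and> inj_mod P"
  have "\<exists>u\<in>homA P Y. compose (carrier P) g u = h"
    if g: "deflation (mod_exact K A) Y g Z" and h: "h \<in> homA P Z" for Y Z :: "('a, 'm) module" and g h
    unfolding mod_hom_eq_compose_iff[OF h]
    by (rule inj_mod_lift[OF AA_inj _ _ _ _ _ _ h, of Y g]) (use g P fd_left_module in \<open>auto simp: mod_deflation_iff\<close>)
  then show "projective_object (mod_cat K A) (mod_exact K A) P"
    using P unfolding projective_object_def mod_cat_simps by blast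
qed

section \<open>The representations \<open>m\<^sub>i(P)\<close>\<close>

context fd_algebra
begin

lemma tensor_module_smult:
  assumes "finite B" and M: "left_module A M" and a: "a \<in> carrier A" and "x \<in> carrier (prodm B (\<lambda>_. M))"
  shows "a \<odot>\<^bsub>tensor_module K A (free_space K B) M\<^esub> fibre B M x = fibre B M (a \<odot>\<^bsub>prodm B (\<lambda>_. M)\<^esub> x)"
proof -
  interpret M: left_module A M by fact
  interpret P: left_module A "prodm B (\<lambda>_. M)" by (rule left_module_prodm[OF ring_A M])
  have "tensor_map K (free_space K B) (und M) (free_space K B) (und M) (\<lambda>v. v) (\<lambda>t. a \<odot>\<^bsub>M\<^esub> t) (fibre B M x)
    = fibre B M (a \<odot>\<^bsub>prodm B (\<lambda>_. M)\<^esub> x)"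
  proof (rule tensor_map_fibre[OF assms(1,1) M, where F = "\<lambda>x. a \<odot>\<^bsub>prodm B (\<lambda>_. M)\<^esub> x"])
    show "a \<odot>\<^bsub>M\<^esub> t \<in> carrier M" if "t \<in> carrier M" for t using a that by (rule M.smult_closed)
    show "a \<odot>\<^bsub>prodm B (\<lambda>_. M)\<^esub> (x \<ominus>\<^bsub>prodm B (\<lambda>_. M)\<^esub> y) =
        a \<odot>\<^bsub>prodm B (\<lambda>_. M)\<^esub> x \<ominus>\<^bsub>prodm B (\<lambda>_. M)\<^esub> a \<odot>\<^bsub>prodm B (\<lambda>_. M)\<^esub> y"
      if "x \<in> carrier (prodm B (\<lambda>_. M))" "y \<in> carrier (prodm B (\<lambda>_. M))" for x y
      using a that by (rule P.smult_minus)
    show "a \<odot>\<^bsub>prodm B (\<lambda>_. M)\<^esub> \<zero>\<^bsub>prodm B (\<lambda>_. M)\<^esub> = \<zero>\<^bsub>prodm B (\<lambda>_. M)\<^esub>" by (rule P.smult_zero_right[OF a])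
    show "a \<odot>\<^bsub>prodm B (\<lambda>_. M)\<^esub> pure B M (v, t) = pure B M (v, a \<odot>\<^bsub>M\<^esub> t)"
      if v: "v \<in> B \<rightarrow>\<^sub>E carrier K" and t: "t \<in> carrier M" for v t
    proof -
      \<comment> \<open>The image of \<open>K\<close> in \<open>A\<close> is central, so the action
        of a commutes with multiplication by the coordinates v b.\<close>
      have "a \<odot>\<^bsub>M\<^esub> (scal (v b) \<odot>\<^bsub>M\<^esub> t) = scal (v b) \<odot>\<^bsub>M\<^esub> (a \<odot>\<^bsub>M\<^esub> t)" if "b \<in> B" for b
        using M.smult_assoc[OF a scal_closed[OF PiE_mem[OF v that]] t] M.smult_assoc[OF scal_closed[OF PiE_mem[OF v that]] a t]
          scal_commute[OF PiE_mem[OF v that] a] by simp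
      then show ?thesis by (auto simp: pure_def[OF assms(1) M])
    qed
  qed ((assumption | rule assms(4))+)
  then show ?thesis by (simp add: tensor_module_def Let_def)
qed

lemma fibre_hom:
  assumes B: "finite B" and M: "left_module A M"
  shows "restrict (fibre B M) (carrier (prodm B (\<lambda>_. M))) \<in> homA (prodm B (\<lambda>_. M)) (tensor_module K A (free_space K B) M)"
    "bij_betw (restrict (fibre B M) (carrier (prodm B (\<lambda>_. M)))) (carrier (prodm B (\<lambda>_. M)))
      (carrier (tensor_module K A (free_space K B) M))"
    "left_module A (tensor_module K A (free_space K B) M)"
proof -
  let ?P = "prodm B (\<lambda>_. M)" and ?T = "tensor_module K A (free_space K B) M"
  have P: "left_module A ?P" by (rule left_module_prodm[OF ring_A M])
  interpret P: left_module A ?P by fact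
  show h: "restrict (fibre B M) (carrier ?P) \<in> homA ?P ?T"
  proof (rule mod_homI)
    fix x assume x: "x \<in> carrier ?P"
    show "fibre B M x \<in> carrier ?T" unfolding TM_carrier[OF B M] using x by (rule imageI)
    show "a \<odot>\<^bsub>?P\<^esub> x \<in> carrier ?P \<and> fibre B M (a \<odot>\<^bsub>?P\<^esub> x) = a \<odot>\<^bsub>?T\<^esub> fibre B M x" if "a \<in> carrier A" for a
      using tensor_module_smult[OF B M that x] P.smult_closed[OF that x] by (simp only:)
    fix y assume y: "y \<in> carrier ?P"
    show "x \<oplus>\<^bsub>?P\<^esub> y \<in> carrier ?P \<and> fibre B M (x \<oplus>\<^bsub>?P\<^esub> y) = fibre B M x \<oplus>\<^bsub>?T\<^esub> fibre B M y"
      using TM_add[OF B M x y] P.M.a_closed[OF x y] by (simp only:)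
  qed
  show b: "bij_betw (restrict (fibre B M) (carrier ?P)) (carrier ?P) (carrier ?T)"
    unfolding bij_betw_def TM_carrier[OF B M]
  proof
    show "inj_on (restrict (fibre B M) (carrier ?P)) (carrier ?P)"
      by (rule inj_onI) (use fibre_inj[OF B M] in \<open>simp only: restrict_apply'\<close>)
    show "restrict (fibre B M) (carrier ?P) ` carrier ?P = fibre B M ` carrier ?P" by (intro image_cong refl) (simp only: restrict_apply')
  qed
  show "left_module A ?T"
  proof (rule left_module_image[OF P h])
    show "restrict (fibre B M) (carrier ?P) ` carrier ?P = carrier ?T" using b by (simp only: bij_betw_def)
    show "restrict (fibre B M) (carrier ?P) \<zero>\<^bsub>?P\<^esub> = \<zero>\<^bsub>?T\<^esub>"
      using TM_zero[OF B M] P.M.zero_closed by (simp only: restrict_apply')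
  qed
qed

end

context self_injective_quiver
begin

text \<open>The family concentrated at i, so that \<open>free_rep (conc i P)\<close> is
  \<open>m_i(P)\<close> in coordinates. At the other vertices stands the zero submodule of
  \<open>P\<close>, which has the same zero element.\<close>

definition conc :: "'v \<Rightarrow> ('a, 'n) module \<Rightarrow> 'v \<Rightarrow> ('a, 'n) module" where
  "conc i P v = (if v = i then P else P\<lparr>carrier := {\<zero>\<^bsub>P\<^esub>}\<rparr>)"

lemma conc_simps: "conc i P i = P" "v \<noteq> i \<Longrightarrow> carrier (conc i P v) = {\<zero>\<^bsub>P\<^esub>}" "\<zero>\<^bsub>conc i P v\<^esub> = \<zero>\<^bsub>P\<^esub>"
  by (simp_all add: conc_def)

lemma conc_fd: "fd_module K A P \<Longrightarrow> fd_module K A (conc i P v)"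
  using fd_module_lsub[OF _ lsub_zero[OF fd_left_module], of P] by (simp add: conc_def)

lemma paths_iff: "p \<in> paths Q i j \<longleftrightarrow> (i, p) \<in> idx j"
  by (simp add: paths_def idx_def)

lemma finite_paths: "j \<in> V \<Longrightarrow> finite (paths Q i j)"
  by (rule finite_subset[OF _ finite_imageI[OF idx_finite, of j snd]]) (force simp: paths_iff)

lemma paths_butlast:
  assumes "q \<in> paths Q i (head Q \<mu>)" "q \<noteq> []" "last q = \<mu>"
  shows "butlast q \<in> paths Q i (tail Q \<mu>)"
proof -
  have "(i, butlast q @ [\<mu>]) \<in> idx (head Q \<mu>)" using assms append_butlast_last_id[of q] by (simp add: paths_iff)
  then show ?thesis unfolding idx_snoc paths_iff by blast
qed

context
  fixes i :: 'v and P :: "('a, 'n) module"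
  assumes P: "fd_module K A P"
begin

interpretation P: left_module A P by (rule fd_left_module[OF P])

abbreviation "PP j \<equiv> prodm (paths Q i j) (\<lambda>_. P)"

lemma PP_lm: "left_module A (PP j)"
  by (rule left_module_prodm[OF ring_A fd_left_module[OF P]])

text \<open>The arrow of P(i) tensored with \<open>P\<close>, in coordinates. The inner abstraction
  gives it the shape required by \<open>tuple_mod_hom\<close>.\<close>

definition parr :: "'e \<Rightarrow> ('e list \<Rightarrow> 'n) \<Rightarrow> 'e list \<Rightarrow> 'n" where
  "parr \<mu> = (\<lambda>x\<in>carrier (PP (tail Q \<mu>)). \<lambda>q\<in>paths Q i (head Q \<mu>).
     (\<lambda>x\<in>carrier (PP (tail Q \<mu>)). if q \<noteq> [] \<and> last q = \<mu> then x (butlast q) else \<zero>\<^bsub>P\<^esub>) x)"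

lemma parr_apply:
  "x \<in> carrier (PP (tail Q \<mu>)) \<Longrightarrow> q \<in> paths Q i (head Q \<mu>) \<Longrightarrow>
    parr \<mu> x q = (if q \<noteq> [] \<and> last q = \<mu> then x (butlast q) else \<zero>\<^bsub>P\<^esub>)"
  by (simp only: parr_def restrict_apply')

lemma parr_hom: "parr \<mu> \<in> homA (PP (tail Q \<mu>)) (PP (head Q \<mu>))"
  unfolding parr_def
proof (rule tuple_mod_hom[OF PP_lm])
  fix q assume q: "q \<in> paths Q i (head Q \<mu>)"
  show "(\<lambda>x\<in>carrier (PP (tail Q \<mu>)). if q \<noteq> [] \<and> last q = \<mu> then x (butlast q) else \<zero>\<^bsub>P\<^esub>) \<in> homA (PP (tail Q \<mu>)) P"
  proof (cases "q \<noteq> [] \<and> last q = \<mu>")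
    case True
    then have "butlast q \<in> paths Q i (tail Q \<mu>)" using paths_butlast[OF q] by blast
    from prodm_proj[OF ring_A fd_left_module[OF P] this] True show ?thesis by (simp del: prodm_simps)
  next
    case False
    then show ?thesis using mod_hom_const_zero[OF PP_lm fd_left_module[OF P]] by (simp only: if_False)
  qed
qed

text \<open>At most one path p satisfies p @ [\<mu>] = q, namely \<open>butlast q\<close>, so the
  sum in \<open>proj_rep\<close> has at most one term.\<close>

lemma proj_rep_arr:
  assumes v: "v \<in> paths Q i (tail Q \<mu>) \<rightarrow>\<^sub>E carrier K" and \<mu>: "\<mu> \<in> arcs Q"
  shows "arr (proj_rep Q K i) \<mu> v = (\<lambda>q\<in>paths Q i (head Q \<mu>). if q \<noteq> [] \<and> last q = \<mu> then v (butlast q) else \<zero>\<^bsub>K\<^esub>)"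
proof -
  have "(\<Oplus>\<^bsub>K\<^esub>p\<in>{p \<in> paths Q i (tail Q \<mu>). p @ [\<mu>] = q}. v p) = (if q \<noteq> [] \<and> last q = \<mu> then v (butlast q) else \<zero>\<^bsub>K\<^esub>)"
    if q: "q \<in> paths Q i (head Q \<mu>)" for q
  proof (cases "q \<noteq> [] \<and> last q = \<mu>")
    case True
    note b = paths_butlast[OF q conjunct1[OF True] conjunct2[OF True]]
    have "p @ [\<mu>] = q \<longleftrightarrow> p = butlast q" for p using True by (metis append_butlast_last_id butlast_snoc)
    then have "{p \<in> paths Q i (tail Q \<mu>). p @ [\<mu>] = q} = {butlast q}" using b by auto
    then show ?thesis using True PiE_mem[OF v b] by simp
  next
    case False
    then have "{p \<in> paths Q i (tail Q \<mu>). p @ [\<mu>] = q} = {}" by auto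
    then show ?thesis using False by (simp only: K.finsum_empty if_False)
  qed
  then show ?thesis using v by (simp add: proj_rep_def cong: restrict_cong)
qed

lemma m_functor_arr:
  assumes \<mu>: "\<mu> \<in> arcs Q" and x: "x \<in> carrier (PP (tail Q \<mu>))"
  shows "arr (m_functor Q K A i P) \<mu> (fibre (paths Q i (tail Q \<mu>)) P x) = fibre (paths Q i (head Q \<mu>)) P (parr \<mu> x)"
proof -
  let ?B = "paths Q i (tail Q \<mu>)" and ?B' = "paths Q i (head Q \<mu>)"
  have fin: "finite ?B" "finite ?B'" using \<mu> finite_paths by simp_all
  have "tensor_map K (free_space K ?B) (und P) (free_space K ?B') (und P) (arr (proj_rep Q K i) \<mu>) (\<lambda>t. t) (fibre ?B P x)
      = fibre ?B' P (parr \<mu> x)"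
  proof (rule tensor_map_fibre[OF fin fd_left_module[OF P], where F = "parr \<mu>"])
    show "parr \<mu> (x \<ominus>\<^bsub>PP (tail Q \<mu>)\<^esub> y) = parr \<mu> x \<ominus>\<^bsub>PP (head Q \<mu>)\<^esub> parr \<mu> y"
      if "x \<in> carrier (PP (tail Q \<mu>))" "y \<in> carrier (PP (tail Q \<mu>))" for x y
      using mod_hom_minus[OF PP_lm PP_lm parr_hom that] .
    show "parr \<mu> \<zero>\<^bsub>PP (tail Q \<mu>)\<^esub> = \<zero>\<^bsub>PP (head Q \<mu>)\<^esub>" by (rule mod_hom_zero[OF PP_lm PP_lm parr_hom])
    fix v assume v: "v \<in> ?B \<rightarrow>\<^sub>E carrier K"
    have va: "v (butlast q) \<in> carrier K" if "q \<in> ?B'" "q \<noteq> []" "last q = \<mu>" for q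
      by (rule PiE_mem[OF v paths_butlast[OF that]])
    then show "arr (proj_rep Q K i) \<mu> v \<in> ?B' \<rightarrow>\<^sub>E carrier K" unfolding proj_rep_arr[OF v \<mu>] by auto
    fix t assume t: "t \<in> carrier P"
    note pc = pure_closed[OF fin(1) fd_left_module[OF P], of "(v, t)"]
    show "parr \<mu> (pure ?B P (v, t)) = pure ?B' P (arr (proj_rep Q K i) \<mu> v, t)"
    proof (rule extensionalityI[of _ ?B'])
      show "parr \<mu> (pure ?B P (v, t)) \<in> extensional ?B'"
        using mod_hom_closed[OF parr_hom pc] v t by (simp add: PiE_def)
      show "pure ?B' P (arr (proj_rep Q K i) \<mu> v, t) \<in> extensional ?B'" by (simp add: pure_def[OF fin(2) fd_left_module[OF P]])
      fix q assume q: "q \<in> ?B'"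
      show "parr \<mu> (pure ?B P (v, t)) q = pure ?B' P (arr (proj_rep Q K i) \<mu> v, t) q"
        using parr_apply[OF pc q] v t q paths_butlast[OF q]
        by (auto simp: pure_def[OF fin(2) fd_left_module[OF P]] pure_def[OF fin(1) fd_left_module[OF P]]
            proj_rep_arr[OF v \<mu>] scal_zero P.smult_zero_left)
    qed
  qed (use x in auto)
  then show ?thesis by (simp add: m_functor_def proj_rep_def)
qed

abbreviation "MF \<equiv> m_functor Q K A i P"
abbreviation "FP \<equiv> free_rep (conc i P)"

lemma MF_space: "space MF j = tensor_module K A (free_space K (paths Q i j)) P"
  by (simp add: m_functor_def proj_rep_def)

abbreviation "mfib j \<equiv> restrict (fibre (paths Q i j) P) (carrier (PP j))"

lemma mfib:
  assumes "j \<in> V"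
  shows "mfib j \<in> homA (PP j) (space MF j)" "bij_betw (mfib j) (carrier (PP j)) (sp MF j)" "left_module A (space MF j)"
  unfolding MF_space by (rule fibre_hom[OF finite_paths[OF assms] fd_left_module[OF P]])+

lemma MF_robj: "robj MF"
  unfolding robj_iff
proof (intro conjI ballI)
  fix j assume j: "j \<in> V"
  show "fd_module K A (space MF j)"
    by (rule fd_module_image[OF fd_module_prodm[OF finite_paths[OF j] P] mfib(3)[OF j] mfib(1)[OF j]])
      (use mfib(2)[OF j] in \<open>simp only: bij_betw_def\<close>)
next
  fix \<mu> assume \<mu>: "\<mu> \<in> arcs Q"
  have t: "tail Q \<mu> \<in> V" "head Q \<mu> \<in> V" using \<mu> by simp_all
  let ?inv = "\<lambda>y\<in>sp MF (tail Q \<mu>). inv_into (carrier (PP (tail Q \<mu>))) (mfib (tail Q \<mu>)) y"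
  \<comment> \<open>The arrow of \<open>MF\<close> is \<open>parr\<close> conjugated by the
    coordinate isomorphisms, which shows its linearity.\<close>
  let ?g = "compose (sp MF (tail Q \<mu>)) (compose (carrier (PP (tail Q \<mu>))) (mfib (head Q \<mu>)) (parr \<mu>)) ?inv"
  have "?g \<in> homA (space MF (tail Q \<mu>)) (space MF (head Q \<mu>))"
    by (rule mod_hom_compose[OF mod_hom_inv[OF mfib(1,2)[OF t(1)] PP_lm mfib(3)[OF t(1)]]
          mod_hom_compose[OF parr_hom mfib(1)[OF t(2)] PP_lm] mfib(3)[OF t(1)]])
  moreover have "?g = arr MF \<mu>"
  proof (rule extensionalityI[of _ "sp MF (tail Q \<mu>)"])
    show "arr MF \<mu> \<in> extensional (sp MF (tail Q \<mu>))"
      by (simp add: m_functor_def tensor_map_def tensor_module_def Let_def)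
    fix y assume y: "y \<in> sp MF (tail Q \<mu>)"
    then have "y \<in> mfib (tail Q \<mu>) ` carrier (PP (tail Q \<mu>))" using mfib(2)[OF t(1)] by (simp only: bij_betw_def)
    then obtain x where x: "x \<in> carrier (PP (tail Q \<mu>))" "y = mfib (tail Q \<mu>) x" by blast
    have i: "inv_into (carrier (PP (tail Q \<mu>))) (mfib (tail Q \<mu>)) y = x"
      unfolding x(2) by (rule inv_into_f_f[OF _ x(1)]) (use mfib(2)[OF t(1)] in \<open>simp only: bij_betw_def\<close>)
    have "?g y = fibre (paths Q i (head Q \<mu>)) P (parr \<mu> x)"
      unfolding compose_eq[OF y] restrict_apply'[OF y] i compose_eq[OF x(1)] restrict_apply'[OF mod_hom_closed[OF parr_hom x(1)]] ..
    also have "\<dots> = arr MF \<mu> y" unfolding x(2) restrict_apply'[OF x(1)] by (rule m_functor_arr[OF \<mu> x(1), symmetric])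
    finally show "?g y = arr MF \<mu> y" .
  qed (rule compose_extensional)
  ultimately show "arr MF \<mu> \<in> homA (space MF (tail Q \<mu>)) (space MF (head Q \<mu>))" by (simp only:)
qed

lemma FP_mem: "x \<in> sp FP j \<Longrightarrow> (v, p) \<in> idx j \<Longrightarrow> v \<noteq> i \<Longrightarrow> x (v, p) = \<zero>\<^bsub>P\<^esub>"
  using prodm_mem[of x "idx j" "\<lambda>z. conc i P (fst z)" "(v, p)"] by (simp add: free_rep_space conc_def)

text \<open>Forgets the coordinates at paths that do not start at i; the modules there are zero, so
  nothing is lost (\<open>fred_bij\<close>).\<close>

definition fred :: "'v \<Rightarrow> ('v \<times> 'e list \<Rightarrow> 'n) \<Rightarrow> 'e list \<Rightarrow> 'n" where
  "fred j x = (\<lambda>p\<in>paths Q i j. x (i, p))"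

lemma fred_hom: "restrict (fred j) (sp FP j) \<in> homA (space FP j) (PP j)"
proof -
  have "(\<lambda>x\<in>sp FP j. \<lambda>p\<in>paths Q i j. (\<lambda>x\<in>sp FP j. x (i, p)) x) \<in> homA (space FP j) (PP j)"
  proof (rule tuple_mod_hom)
    have lm: "left_module A (conc i P (fst z))" for z :: "'v \<times> 'e list" by (rule fd_left_module[OF conc_fd[OF P]])
    show "left_module A (space FP j)" unfolding free_rep_space by (rule left_module_prodm[OF ring_A lm])
    fix p assume "p \<in> paths Q i j"
    then show "(\<lambda>x\<in>sp FP j. x (i, p)) \<in> homA (space FP j) P"
      using prodm_proj[where I = "idx j" and M = "\<lambda>z. conc i P (fst z)" and i = "(i, p)", OF ring_A lm]
      by (simp add: free_rep_space paths_iff conc_simps(1))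
  qed
  then show ?thesis by (simp add: fred_def cong: restrict_cong)
qed

lemma fred_bij: "bij_betw (restrict (fred j) (sp FP j)) (sp FP j) (carrier (PP j))"
proof (rule bij_betwI[where g = "\<lambda>y. \<lambda>z\<in>idx j. if fst z = i then y (snd z) else \<zero>\<^bsub>P\<^esub>"])
  show "restrict (fred j) (sp FP j) \<in> sp FP j \<rightarrow> carrier (PP j)" by (intro funcsetI mod_hom_closed[OF fred_hom])
  show g: "(\<lambda>y. \<lambda>z\<in>idx j. if fst z = i then y (snd z) else \<zero>\<^bsub>P\<^esub>) \<in> carrier (PP j) \<rightarrow> sp FP j"
    by (auto simp: free_rep_space conc_def paths_iff PiE_mem)
  show "(\<lambda>z\<in>idx j. if fst z = i then restrict (fred j) (sp FP j) x (snd z) else \<zero>\<^bsub>P\<^esub>) = x" if "x \<in> sp FP j" for x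
  proof (rule extensionalityI[of _ "idx j"])
    show "x \<in> extensional (idx j)" using that by (simp add: free_rep_space PiE_def)
    fix z assume z: "z \<in> idx j"
    obtain v p where vp: "z = (v, p)" by (cases z)
    show "(\<lambda>z\<in>idx j. if fst z = i then restrict (fred j) (sp FP j) x (snd z) else \<zero>\<^bsub>P\<^esub>) z = x z"
      using FP_mem[OF that, of v p] z vp that by (auto simp: fred_def paths_iff)
  qed simp
  show "restrict (fred j) (sp FP j) (\<lambda>z\<in>idx j. if fst z = i then y (snd z) else \<zero>\<^bsub>P\<^esub>) = y" if "y \<in> carrier (PP j)" for y
    unfolding restrict_apply'[OF funcset_mem[OF g that]]
    using that by (auto simp: fred_def paths_iff fun_eq_iff PiE_def extensional_def)
qed

lemma m_functor_free_rep:
  obtains \<theta> where "\<theta> \<in> rhom FP MF" "\<And>j. j \<in> V \<Longrightarrow> bij_betw (\<theta> j) (sp FP j) (sp MF j)"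
proof -
  have fred_cl: "fred j x \<in> carrier (PP j)" if "x \<in> sp FP j" for j x
    using mod_hom_closed[OF fred_hom that] that by (simp only: restrict_apply')
  have lmF: "left_module A (space FP j)" if "j \<in> V" for j
    by (rule robj_lm[OF FJ_robj[where J = "conc i P", OF conc_fd[OF P]] that])
  let ?t = "\<lambda>j. compose (sp FP j) (mfib j) (restrict (fred j) (sp FP j))"
  have t: "?t j x = fibre (paths Q i j) P (fred j x)" if "x \<in> sp FP j" for j x
    unfolding compose_eq[OF that] restrict_apply'[OF that] restrict_apply'[OF fred_cl[OF that]] ..
  have "(\<lambda>j\<in>V. ?t j) \<in> rhom FP MF"
  proof (rule rep_homI)
    show "?t j \<in> homA (space FP j) (space MF j)" if "j \<in> V" for j
      by (rule mod_hom_compose[OF fred_hom mfib(1)[OF that] lmF[OF that]])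
    fix \<mu> x assume \<mu>: "\<mu> \<in> arcs Q" and x: "x \<in> sp FP (tail Q \<mu>)"
    have ax: "arr FP \<mu> x \<in> sp FP (head Q \<mu>)"
      by (rule arr_closed[OF FJ_robj[where J = "conc i P", OF conc_fd[OF P]] \<mu> x])
    have "parr \<mu> (fred (tail Q \<mu>) x) = fred (head Q \<mu>) (arr FP \<mu> x)"
    proof (rule extensionalityI[of _ "paths Q i (head Q \<mu>)"])
      show "parr \<mu> (fred (tail Q \<mu>) x) \<in> extensional (paths Q i (head Q \<mu>))"
        using mod_hom_closed[OF parr_hom fred_cl[OF x]] by (simp add: PiE_def)
      show "fred (head Q \<mu>) (arr FP \<mu> x) \<in> extensional (paths Q i (head Q \<mu>))" by (simp add: fred_def)
      fix q assume q: "q \<in> paths Q i (head Q \<mu>)"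
      have "arr FP \<mu> x (i, q) = (if q \<noteq> [] \<and> last q = \<mu> then x (i, butlast q) else \<zero>\<^bsub>P\<^esub>)"
        using FJ_arr_apply[where J = "conc i P", OF conc_fd[OF P] x, of "(i, q)"] q by (simp add: paths_iff conc_simps(1))
      then show "parr \<mu> (fred (tail Q \<mu>) x) q = fred (head Q \<mu>) (arr FP \<mu> x) q"
        unfolding parr_apply[OF fred_cl[OF x] q] using q paths_butlast[OF q] by (simp add: fred_def)
    qed
    then show "arr MF \<mu> (?t (tail Q \<mu>) x) = ?t (head Q \<mu>) (arr FP \<mu> x)"
      unfolding t[OF x] t[OF ax] m_functor_arr[OF \<mu> fred_cl[OF x]] by (simp only:)
  qed (rule wf_digraph_axioms)
  moreover have "bij_betw ((\<lambda>j\<in>V. ?t j) j) (sp FP j) (sp MF j)" if j: "j \<in> V" for j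
    unfolding restrict_apply'[OF j]
    using bij_betw_trans[OF fred_bij mfib(2)[OF j]] by (rule bij_betw_cong[THEN iffD1, rotated]) (simp add: compose_def)
  ultimately show thesis by (rule that)
qed

text \<open>Lets the classification be proved for free representations in coordinates and stated
  with tensor products.\<close>

lemma rep_iso_m_functor:
  fixes X :: "('v, 'e, 'a, 'x) rep"
  assumes "robj X"
  shows "rep_iso Q A X MF \<longleftrightarrow> rep_iso Q A X FP"
proof -
  note FP = FJ_robj[where J = "conc i P", OF conc_fd[OF P]]
  have trans: "rep_iso Q A X Z" if "rep_iso Q A X Y" "g \<in> rhom Y Z" "\<And>j. j \<in> V \<Longrightarrow> bij_betw (g j) (sp Y j) (sp Z j)"
    for Y :: "('v, 'e, 'a, 'y) rep" and Z :: "('v, 'e, 'a, 'z) rep" and g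
  proof -
    note XY = that(1)
    obtain f where f: "f \<in> rhom X Y" "\<And>j. j \<in> V \<Longrightarrow> bij_betw (f j) (sp X j) (sp Y j)"
      using XY unfolding rep_iso_def by blast
    have "bij_betw (rcomp X g f j) (sp X j) (sp Z j)" if j: "j \<in> V" for j
      using bij_betw_trans[OF f(2)[OF j] \<open>\<And>j. j \<in> V \<Longrightarrow> bij_betw (g j) (sp Y j) (sp Z j)\<close>[OF j]]
      by (rule bij_betw_cong[THEN iffD1, rotated]) (simp add: j)
    then show ?thesis using rcomp_rhom[OF f(1) that(2) assms] unfolding rep_iso_def by blast
  qed
  obtain \<theta> where \<theta>: "\<theta> \<in> rhom FP MF" "\<And>j. j \<in> V \<Longrightarrow> bij_betw (\<theta> j) (sp FP j) (sp MF j)"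
    by (rule m_functor_free_rep) blast
  obtain \<eta> where \<eta>: "\<eta> \<in> rhom MF FP" "\<And>j. j \<in> V \<Longrightarrow> bij_betw (\<eta> j) (sp MF j) (sp FP j)"
    by (rule rhom_inverse[OF \<theta>(1) FP MF_robj \<theta>(2)]) blast+
  show ?thesis using trans[OF _ \<theta>] trans[OF _ \<eta>] by blast
qed

end

end

section \<open>Indecomposable projective objects\<close>

context self_injective_quiver
begin

section \<open>Free representations concentrated at one vertex\<close>

context
  fixes i :: 'v and P :: "('a, 'n) module"
  assumes i: "i \<in> V" and P: "fd_module K A P"
begin

abbreviation "FR \<equiv> free_rep (conc i P)"
abbreviation "cJ \<equiv> conc i P"

lemma FR_robj: "robj FR" by (rule FJ_robj[where J = cJ, OF conc_fd[OF P]])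

lemma FR_fiota: "y \<in> carrier P \<Longrightarrow> fiota cJ i y \<in> sp FR i" "y \<in> carrier P \<Longrightarrow> fpi i (fiota cJ i y) = y"
  using fiota_closed[where J = cJ, OF conc_fd[OF P] i] fpi_fiota[where J = cJ, OF conc_fd[OF P] i]
  by (simp_all add: conc_simps(1))

lemma FR_fpi_hom: "restrict (fpi i) (sp FR i) \<in> homA (space FR i) P"
  using fpi_hom[where J = cJ, OF conc_fd[OF P] i] by (simp only: conc_simps(1))

lemma FR_fpi: "x \<in> sp FR i \<Longrightarrow> fpi i x \<in> carrier P"
  using mod_hom_closed[OF FR_fpi_hom] by (simp only: restrict_apply')

text \<open>Nonzero modules can sit only on paths starting at i, and none of these ends at the
  source of \<mu>, because \<mu> would close a cycle.\<close>

lemma FR_tail: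
  assumes "\<mu> \<in> into i" "x \<in> sp FR (tail Q \<mu>)"
  shows "x = \<zero>[FR,tail Q \<mu>]"
proof (rule FJ_eqI[where J = cJ, OF conc_fd[OF P] assms(2) zero_in[OF FR_robj into_tail[OF assms(1)]]])
  fix z assume z: "z \<in> idx (tail Q \<mu>)"
  obtain v p where vp: "z = (v, p)" by (cases z)
  have "v \<noteq> i" using z awalk_into_no_return[OF assms(1)] unfolding vp by (auto simp: idx_def)
  then show "x z = \<zero>[FR,tail Q \<mu>] z"
    using FP_mem[OF P assms(2), of v p] z unfolding vp by (simp add: free_rep_space conc_simps(3))
qed

text \<open>No path starting at \<open>i\<close> returns to the source of an arrow into \<open>i\<close>.\<close>

lemma FR_fiota_fpi:
  assumes "x \<in> sp FR i"
  shows "fiota cJ i (fpi i x) = x"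
proof -
  interpret Fi: left_module A "space FR i" by (rule robj_lm[OF FR_robj i])
  note r = frho_closed[where J = cJ, OF conc_fd[OF P] i assms]
  have "frho i x = \<zero>\<^bsub>dmod FR i\<^esub>"
    by (rule dmod_zeroI[OF r]) (rule FR_tail[OF _ prodm_mem[OF r]])
  then have "delta Q FR i (frho i x) = \<zero>[FR,i]" using delta_zero[OF FR_robj i] by (simp only:)
  then show ?thesis
    using FJ_decomp[where J = cJ, OF conc_fd[OF P] i assms] Fi.M.l_zero[OF FR_fiota(1)[OF FR_fpi[OF assms]]]
    by (simp only:)
qed

text \<open>The representation is generated by its component at i: the other members of the family
  \<open>cJ\<close> are zero, so \<open>FJ_unique\<close> leaves only i to be checked.\<close>

lemma FR_unique:
  fixes Y :: "('v, 'e, 'a, 'y) rep"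
  assumes "robj Y" "f \<in> rhom FR Y" "g \<in> rhom FR Y" and eq: "\<And>x. x \<in> sp FR i \<Longrightarrow> f i x = g i x"
  shows "f = g"
proof (rule FJ_unique[where J = cJ, OF conc_fd[OF P] assms(1-3)])
  fix v y assume v: "v \<in> V" and y: "y \<in> carrier (cJ v)"
  show "f v (fiota cJ v y) = g v (fiota cJ v y)"
  proof (cases "v = i")
    case True
    then show ?thesis using eq FR_fiota(1) y by (simp add: conc_simps(1))
  next
    case False
    then have y0: "y = \<zero>\<^bsub>cJ v\<^esub>" using y conc_simps(2)[OF False, of P] conc_simps(3)[of i P v] by auto
    have "fiota cJ v y = \<zero>[FR,v]"
      using mod_hom_zero[OF fd_left_module[OF conc_fd[OF P]] robj_lm[OF FR_robj v] fiota_hom[where J = cJ, OF conc_fd[OF P] v]] y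
      unfolding y0 by simp
    then show ?thesis using rhom_zero[OF assms(2) FR_robj assms(1) v] rhom_zero[OF assms(3) FR_robj assms(1) v] by simp
  qed
qed

lemma FR_zero_iff: "(\<forall>j\<in>V. sp FR j = {\<zero>[FR,j]}) \<longleftrightarrow> carrier P = {\<zero>\<^bsub>P\<^esub>}"
proof
  have P0: "\<zero>\<^bsub>P\<^esub> \<in> carrier P" by (rule lsubD(2)[OF lsub_carrier[OF fd_left_module[OF P]]])
  assume "\<forall>j\<in>V. sp FR j = {\<zero>[FR,j]}"
  then have "y = \<zero>\<^bsub>P\<^esub>" if "y \<in> carrier P" for y
    using FR_fiota[OF that] FR_fiota[OF P0] i by (metis singletonD)
  then show "carrier P = {\<zero>\<^bsub>P\<^esub>}" using P0 by blast
next
  assume P0: "carrier P = {\<zero>\<^bsub>P\<^esub>}"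
  have "rid FR = rzero FR FR"
  proof (rule FR_unique[OF FR_robj rid_rhom[OF FR_robj] rzero_rhom[OF FR_robj FR_robj]])
    fix x assume x: "x \<in> sp FR i"
    have "fpi i x = fpi i \<zero>[FR,i]" using FR_fpi[OF x] FR_fpi[OF zero_in[OF FR_robj i]] P0 by simp
    then have "x = \<zero>[FR,i]" using FR_fiota_fpi[OF x] FR_fiota_fpi[OF zero_in[OF FR_robj i]] by metis
    then show "rid FR i x = rzero FR FR i x" using x i by simp
  qed
  then have "x = \<zero>[FR,j]" if "j \<in> V" "x \<in> sp FR j" for j x using that by (metis rid_apply rzero_apply)
  then show "\<forall>j\<in>V. sp FR j = {\<zero>[FR,j]}" using zero_in[OF FR_robj] by blast
qed

end

lemma zero_rep_iso:
  assumes "robj X" "robj Y" "q \<in> rhom X Y" "\<And>j. j \<in> V \<Longrightarrow> bij_betw (q j) (sp X j) (sp Y j)"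
  shows "(\<forall>j\<in>V. sp X j = {\<zero>[X,j]}) \<longleftrightarrow> (\<forall>j\<in>V. sp Y j = {\<zero>[Y,j]})"
proof (intro ball_cong refl)
  fix j assume j: "j \<in> V"
  have im: "q j ` sp X j = sp Y j" and inj: "inj_on (q j) (sp X j)" using assms(4)[OF j] by (auto simp: bij_betw_def)
  note z = rhom_zero[OF assms(3,1,2) j]
  show "sp X j = {\<zero>[X,j]} \<longleftrightarrow> sp Y j = {\<zero>[Y,j]}"
  proof
    assume "sp X j = {\<zero>[X,j]}"
    then show "sp Y j = {\<zero>[Y,j]}" using im z by (metis image_insert image_empty)
  next
    assume Y: "sp Y j = {\<zero>[Y,j]}"
    have "x = \<zero>[X,j]" if "x \<in> sp X j" for x
      using inj that zero_in[OF assms(1) j] z im Y by (metis imageI inj_onD singletonD)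
    then show "sp X j = {\<zero>[X,j]}" using zero_in[OF assms(1) j] by blast
  qed
qed

text \<open>A decomposition of \<open>X\<close> induces one of its module at i, which is isomorphic
  to \<open>P\<close>; so one of the two summands vanishes at i. Being a quotient of
  \<open>X\<close>, that summand is generated by its component at i, hence zero.\<close>

lemma free_indecomposable:
  fixes X :: "('v, 'e, 'a, 'm) rep" and P :: "('a, 'm) module"
  assumes X: "mobj X" and i: "i \<in> V" and P: "indecomposable (mod_cat K A) P" and iso: "rep_iso Q A X (free_rep (conc i P))"
  shows "indecomposable C X"
proof -
  note Xr = mobjD(1)[OF X]
  let ?F = "free_rep (conc i P)"
  have Pf: "fd_module K A P" using P by (simp add: indecomposable_def)
  note Fr = FR_robj[OF i Pf] and lP = fd_left_module[OF Pf] and lX = robj_lm[OF Xr i]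
  obtain g where g: "g \<in> rhom X ?F" "\<And>j. j \<in> V \<Longrightarrow> bij_betw (g j) (sp X j) (sp ?F j)"
    using iso unfolding rep_iso_def by blast
  obtain h where h: "h \<in> rhom ?F X" "\<And>j x. \<lbrakk>j \<in> V; x \<in> sp X j\<rbrakk> \<Longrightarrow> h j (g j x) = x"
    "\<And>j y. \<lbrakk>j \<in> V; y \<in> sp ?F j\<rbrakk> \<Longrightarrow> g j (h j y) = y"
    by (rule rhom_inverse[OF g(1) Xr Fr g(2)]) blast+
  have "zero_object C X \<longleftrightarrow> (\<forall>j\<in>V. sp ?F j = {\<zero>[?F,j]})"
    unfolding zero_object_iff[OF X] by (rule zero_rep_iso[OF Xr Fr g])
  also have "\<dots> \<longleftrightarrow> zero_object (mod_cat K A) P" unfolding FR_zero_iff[OF i Pf] mod_zero_object_iff[OF Pf] ..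
  finally have nz: "\<not> zero_object C X" using P by (simp add: indecomposable_def)
  \<comment> \<open>\<open>q\<close> and \<open>q'\<close> identify the module of \<open>X\<close>
    at i with \<open>P\<close>, through the coordinate at the trivial path.\<close>
  define q where "q = (\<lambda>x\<in>sp X i. fpi i (g i x))"
  define q' where "q' = (\<lambda>y\<in>carrier P. h i (fiota (conc i P) i y))"
  have q: "q \<in> homA (space X i) P"
    using mod_hom_compose[OF rep_hom_at[OF g(1) i] FR_fpi_hom[OF i Pf] lX] rhom_closed[OF g(1) i]
    by (simp add: q_def compose_def cong: restrict_cong)
  have q': "q' \<in> homA P (space X i)"
    using mod_hom_compose[OF fiota_hom[where J = "conc i P", OF conc_fd[OF Pf] i] rep_hom_at[OF h(1) i]]
      lP by (simp add: q'_def compose_def conc_simps(1) cong: restrict_cong)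
  have qq': "q (q' y) = y" if "y \<in> carrier P" for y
    using that mod_hom_closed[OF q' that] FR_fiota[OF i Pf that] h(3)[OF i] by (simp add: q_def q'_def)
  have q'q: "q' (q x) = x" if "x \<in> sp X i" for x
    using that mod_hom_closed[OF q that] FR_fiota_fpi[OF i Pf rhom_closed[OF g(1) i that]] h(2)[OF i that]
    by (simp add: q_def q'_def)
  have vanish: "\<forall>j\<in>V. sp Y j = {\<zero>[Y,j]}"
    if "robj Y" "p \<in> rhom X Y" "\<And>j y. \<lbrakk>j \<in> V; y \<in> sp Y j\<rbrakk> \<Longrightarrow> \<exists>x\<in>sp X j. p j x = y" "sp Y i = {\<zero>[Y,i]}"
    for Y :: "('v, 'e, 'a, 'm) rep" and p
  proof -
    note Y = that
    have "rcomp ?F p h = rzero ?F Y"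
    proof (rule FR_unique[OF i Pf Y(1) rcomp_rhom[OF h(1) Y(2) Fr] rzero_rhom[OF Fr Y(1)]])
      fix x assume x: "x \<in> sp ?F i"
      show "rcomp ?F p h i x = rzero ?F Y i x"
        using x i Y(4) rhom_closed[OF Y(2) i rhom_closed[OF h(1) i x]] by simp
    qed
    then have "p j (h j y) = \<zero>[Y,j]" if "j \<in> V" "y \<in> sp ?F j" for j y using that by (metis rcomp_apply rzero_apply)
    then have "p j x = \<zero>[Y,j]" if "j \<in> V" "x \<in> sp X j" for j x
      using that h(2)[OF that] rhom_closed[OF g(1) that] by metis
    then show ?thesis using Y(3) zero_in[OF Y(1)] by fastforce
  qed
  have "zero_object C Y \<or> zero_object C Z" if bp: "is_biproduct C Y Z X i\<^sub>1 i\<^sub>2 p\<^sub>1 p\<^sub>2" for Y Z i\<^sub>1 i\<^sub>2 p\<^sub>1 p\<^sub>2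
  proof -
    have m: "mobj Y" "mobj Z" and hm: "i\<^sub>1 \<in> rhom Y X" "i\<^sub>2 \<in> rhom Z X" "p\<^sub>1 \<in> rhom X Y" "p\<^sub>2 \<in> rhom X Z"
      using bp by (auto simp: is_biproduct_def)
    note Yr = mobjD(1)[OF m(1)] and Zr = mobjD(1)[OF m(2)]
    note fi = rep_hom_at[OF hm(1) i] rep_hom_at[OF hm(2) i] rep_hom_at[OF hm(3) i] rep_hom_at[OF hm(4) i]
    note e = bp[unfolded biproduct_iff[OF m X hm]]
    have "is_biproduct (mod_cat K A) (space Y i) (space Z i) P (compose (sp Y i) q (i\<^sub>1 i)) (compose (sp Z i) q (i\<^sub>2 i))
        (compose (carrier P) (p\<^sub>1 i) q') (compose (carrier P) (p\<^sub>2 i) q')"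
    proof (subst mod_biproduct_iff[OF robj_fd[OF Yr i] robj_fd[OF Zr i] Pf
          mod_hom_compose[OF fi(1) q robj_lm[OF Yr i]] mod_hom_compose[OF fi(2) q robj_lm[OF Zr i]]
          mod_hom_compose[OF q' fi(3) lP] mod_hom_compose[OF q' fi(4) lP]], intro conjI ballI)
      fix y assume y: "y \<in> sp Y i"
      note c = mod_hom_closed[OF fi(1) y]
      show "compose (carrier P) (p\<^sub>1 i) q' (compose (sp Y i) q (i\<^sub>1 i) y) = y"
        "compose (carrier P) (p\<^sub>2 i) q' (compose (sp Y i) q (i\<^sub>1 i) y) = \<zero>[Z,i]"
        unfolding compose_eq[OF y] compose_eq[OF mod_hom_closed[OF q c]] q'q[OF c] using e i y by blast+
    next
      fix y assume y: "y \<in> sp Z i"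
      note c = mod_hom_closed[OF fi(2) y]
      show "compose (carrier P) (p\<^sub>2 i) q' (compose (sp Z i) q (i\<^sub>2 i) y) = y"
        "compose (carrier P) (p\<^sub>1 i) q' (compose (sp Z i) q (i\<^sub>2 i) y) = \<zero>[Y,i]"
        unfolding compose_eq[OF y] compose_eq[OF mod_hom_closed[OF q c]] q'q[OF c] using e i y by blast+
    next
      fix b assume b: "b \<in> carrier P"
      note c = mod_hom_closed[OF q' b]
      note cc = mod_hom_closed[OF fi(3) c] mod_hom_closed[OF fi(4) c]
      show "compose (sp Y i) q (i\<^sub>1 i) (compose (carrier P) (p\<^sub>1 i) q' b) \<oplus>\<^bsub>P\<^esub>
          compose (sp Z i) q (i\<^sub>2 i) (compose (carrier P) (p\<^sub>2 i) q' b) = b"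
        unfolding compose_eq[OF b] compose_eq[OF cc(1)] compose_eq[OF cc(2)]
          mod_hom_add[OF q mod_hom_closed[OF fi(1) cc(1)] mod_hom_closed[OF fi(2) cc(2)], symmetric]
        using e i c qq'[OF b] by (metis (full_types))
    qed
    then have "zero_object (mod_cat K A) (space Y i) \<or> zero_object (mod_cat K A) (space Z i)"
      using P unfolding indecomposable_def by blast
    then consider "sp Y i = {\<zero>[Y,i]}" | "sp Z i = {\<zero>[Z,i]}"
      unfolding mod_zero_object_iff[OF robj_fd[OF Yr i]] mod_zero_object_iff[OF robj_fd[OF Zr i]] by blast
    then show ?thesis
    proof cases
      case 1
      have "\<exists>x\<in>sp X j. p\<^sub>1 j x = y" if "j \<in> V" "y \<in> sp Y j" for j y
        using e that rhom_closed[OF hm(1) that] by blast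
      from vanish[OF Yr hm(3) this 1] show ?thesis unfolding zero_object_iff[OF m(1)] by blast
    next
      case 2
      have "\<exists>x\<in>sp X j. p\<^sub>2 j x = y" if "j \<in> V" "y \<in> sp Z j" for j y
        using e that rhom_closed[OF hm(2) that] by blast
      from vanish[OF Zr hm(4) this 2] show ?thesis unfolding zero_object_iff[OF m(2)] by blast
    qed
  qed
  then show ?thesis using X nz unfolding indecomposable_def by blast
qed

lemma conc_inj:
  assumes P: "fd_module K A P" "inj_mod P"
  shows "inj_mod (conc i P v)"
proof (cases "v = i")
  case True
  then show ?thesis using P(2) by (simp add: conc_simps(1))
next
  case False
  note lP = fd_left_module[OF P(1)] and lJ = fd_left_module[OF conc_fd[OF P(1), of i v]]
  show ?thesis
  proof (rule inj_mod_retract[OF P(2) lJ mod_hom_const_zero[OF lP lJ] mod_hom_const_zero[OF lJ lP]])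
    fix x assume x: "x \<in> carrier (conc i P v)"
    then have "x = \<zero>\<^bsub>conc i P v\<^esub>" using conc_simps(2)[OF False, of P] conc_simps(3)[of i P v] by auto
    then show "(\<lambda>x\<in>carrier P. \<zero>\<^bsub>conc i P v\<^esub>) ((\<lambda>x\<in>carrier (conc i P v). \<zero>\<^bsub>P\<^esub>) x) = x"
      using x lsubD(2)[OF lsub_carrier[OF lP]] by simp
  qed
qed

text \<open>\<open>X\<close> vanishes at the sources of arrows into i, so the domain of \<delta>_i
  is zero and \<open>r\<close>, extended by zero maps at the other vertices, may be fed into
  \<open>FJ_colift\<close>. The lift of \<open>u\<close> followed by this colift is the identity at
  i, and hence everywhere by \<open>FR_unique\<close>.\<close>

lemma split_off:
  fixes X :: "('v, 'e, 'a, 'm) rep" and P :: "('a, 'm) module"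
  assumes X: "mobj X" "good X" and i: "i \<in> V" "\<And>\<mu>. \<mu> \<in> into i \<Longrightarrow> sp X (tail Q \<mu>) = {\<zero>[X,tail Q \<mu>]}"
    and P: "fd_module K A P" and u: "u \<in> homA P (space X i)" and r: "r \<in> homA (space X i) P"
    and ru: "\<And>y. y \<in> carrier P \<Longrightarrow> r (u y) = y"
  obtains e \<rho> where "e \<in> rhom (free_rep (conc i P)) X" "\<rho> \<in> rhom X (free_rep (conc i P))"
    "\<And>x. x \<in> sp X i \<Longrightarrow> fpi i (\<rho> i x) = r x" "\<And>j x. \<lbrakk>j \<in> V; x \<in> sp (free_rep (conc i P)) j\<rbrakk> \<Longrightarrow> \<rho> j (e j x) = x"
proof -
  let ?J = "conc i P" and ?F = "free_rep (conc i P)"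
  note Xr = mobjD(1)[OF X(1)] and Fr = FR_robj[OF i(1) P] and lP = fd_left_module[OF P]
  have lJ: "left_module A (?J v)" for v by (rule fd_left_module[OF conc_fd[OF P]])
  have injP: "inj_mod P" by (rule inj_mod_retract[OF _ lP r u ru]) (use X(2) i(1) in blast)
  have J0: "x = \<zero>\<^bsub>?J v\<^esub>" if "v \<noteq> i" "x \<in> carrier (?J v)" for v x
    using that conc_simps(2)[OF that(1), of P] conc_simps(3)[of i P v] by auto
  have injJ: "inj_mod (?J v)" for v by (rule conc_inj[OF P injP])
  define c where "c v = (if v = i then r else (\<lambda>x\<in>sp X v. \<zero>\<^bsub>?J v\<^esub>))" for v
  define w where "w v = (if v = i then u else (\<lambda>x\<in>carrier (?J v). \<zero>[X,v]))" for v
  have c: "c v \<in> homA (space X v) (?J v)" if "v \<in> V" for v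
    using r mod_hom_const_zero[OF robj_lm[OF Xr that] lJ] by (simp add: c_def conc_simps(1))
  have w: "w v \<in> homA (?J v) (space X v)" if "v \<in> V" for v
    using u mod_hom_const_zero[OF lJ robj_lm[OF Xr that]] by (simp add: w_def conc_simps(1))
  have c0: "c v (delta Q X v d) = \<zero>\<^bsub>?J v\<^esub>" if v: "v \<in> V" and d: "d \<in> dsp X v" for v d
  proof (cases "v = i")
    case True
    have "d = \<zero>\<^bsub>dmod X i\<^esub>"
      by (rule dmod_zeroI[OF d[unfolded True]]) (use i(2) prodm_mem[OF d[unfolded True]] in blast)
    then have "delta Q X v d = \<zero>[X,v]" using delta_zero[OF Xr i(1)] True by (simp only:)
    then show ?thesis using mod_hom_zero[OF robj_lm[OF Xr v] lJ c[OF v]] by (simp only:)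
  next
    case False
    show ?thesis by (rule J0[OF False mod_hom_closed[OF c[OF v] delta_closed[OF Xr v d]]])
  qed
  obtain \<rho> where \<rho>: "\<rho> \<in> rhom X ?F" "\<And>v x. \<lbrakk>v \<in> V; x \<in> sp X v\<rbrakk> \<Longrightarrow> fpi v (\<rho> v x) = c v x"
    by (rule FJ_colift[where J = ?J, OF conc_fd[OF P] X(1) injJ c c0]) blast+
  obtain e where e: "e \<in> rhom ?F X" "\<And>v y. \<lbrakk>v \<in> V; y \<in> carrier (?J v)\<rbrakk> \<Longrightarrow> e v (fiota ?J v y) = w v y"
    by (rule FJ_lift[where J = ?J, OF conc_fd[OF P] Xr w]) blast+
  have pr: "fpi i (\<rho> i x) = r x" if "x \<in> sp X i" for x using \<rho>(2)[OF i(1) that] by (simp add: c_def)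
  have "rcomp ?F \<rho> e = rid ?F"
  proof (rule FR_unique[OF i(1) P Fr rcomp_rhom[OF e(1) \<rho>(1) Fr] rid_rhom[OF Fr]])
    fix x assume x: "x \<in> sp ?F i"
    note p = FR_fpi[OF i(1) P x] and ex = rhom_closed[OF e(1) i(1) x]
    have "e i x = u (fpi i x)"
      using e(2)[OF i(1), of "fpi i x"] p unfolding FR_fiota_fpi[OF i(1) P x] by (simp add: conc_simps(1) w_def)
    then have "fpi i (\<rho> i (e i x)) = fpi i x" using pr[OF ex] ru[OF p] by simp
    then have "\<rho> i (e i x) = x"
      using FR_fiota_fpi[OF i(1) P x] FR_fiota_fpi[OF i(1) P rhom_closed[OF \<rho>(1) i(1) ex]] by simp
    then show "rcomp ?F \<rho> e i x = rid ?F i x" using x i(1) by simp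
  qed
  then have "\<rho> j (e j x) = x" if "j \<in> V" "x \<in> sp ?F j" for j x using that by (metis rcomp_apply rid_apply)
  then show thesis using that e(1) \<rho>(1) pr by blast
qed

text \<open>The complement of the split summand is the kernel of the retraction, which is monic as a
  subrepresentation. Indecomposability makes it zero, since the split summand is not. The second
  conclusion, for arbitrary retracts \<open>P\<close> of the module at i, is what later shows that
  this module is itself indecomposable.\<close>

lemma split_iso:
  fixes X :: "('v, 'e, 'a, 'm) rep" and P :: "('a, 'm) module"
  assumes X: "indecomposable C X" "good X" and i: "i \<in> V" "\<And>\<mu>. \<mu> \<in> into i \<Longrightarrow> sp X (tail Q \<mu>) = {\<zero>[X,tail Q \<mu>]}"
    and P: "fd_module K A P" "carrier P \<noteq> {\<zero>\<^bsub>P\<^esub>}" and u: "u \<in> homA P (space X i)" and r: "r \<in> homA (space X i) P"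
    and ru: "\<And>y. y \<in> carrier P \<Longrightarrow> r (u y) = y"
  shows "rep_iso Q A X (free_rep (conc i P))" "inj_on r (sp X i)"
proof -
  let ?F = "free_rep (conc i P)"
  have Xm: "mobj X" using X(1) by (simp add: indecomposable_def)
  note Xr = mobjD(1)[OF Xm] and Fr = FR_robj[OF i(1) P(1)]
  obtain e \<rho> where e: "e \<in> rhom ?F X" and \<rho>: "\<rho> \<in> rhom X ?F" and pr: "\<And>x. x \<in> sp X i \<Longrightarrow> fpi i (\<rho> i x) = r x"
    and \<rho>e: "\<And>j x. \<lbrakk>j \<in> V; x \<in> sp ?F j\<rbrakk> \<Longrightarrow> \<rho> j (e j x) = x"
    by (rule split_off[OF Xm X(2) i P(1) u r ru]) blast+
  \<comment> \<open>A biproduct relates objects of the category, so the free representation is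
    replaced by a copy with elements of type \<open>'m\<close>.\<close>
  obtain Z :: "('v, 'e, 'a, 'm) rep" and q where Z: "mobj Z" "q \<in> rhom ?F Z" "\<And>j. j \<in> V \<Longrightarrow> bij_betw (q j) (sp ?F j) (sp Z j)"
    by (rule rep_transport[OF FJ_mobj[where J = "conc i P", OF conc_fd[OF P(1)]] universe]) blast
  note Zr = mobjD(1)[OF Z(1)]
  obtain s where s: "s \<in> rhom Z ?F" "\<And>j x. \<lbrakk>j \<in> V; x \<in> sp ?F j\<rbrakk> \<Longrightarrow> s j (q j x) = x" "\<And>j y. \<lbrakk>j \<in> V; y \<in> sp Z j\<rbrakk> \<Longrightarrow> q j (s j y) = y"
    by (rule rhom_inverse[OF Z(2) Fr Zr Z(3)]) blast+
  let ?U = "\<lambda>j. {x \<in> sp X j. \<rho> j x = \<zero>[?F,j]}"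
  let ?S = "sub_rep X ?U"
  have U: "subrep X ?U" by (rule subrep_ker[OF \<rho> Xr Fr])
  have Sm: "mobj ?S" by (rule sub_rep_mobj[OF Xm U])
  note Sr = mobjD(1)[OF Sm] and inc = sub_incl_rhom[OF Xr U]
  note e\<rho> = rcomp_rhom[OF \<rho> e Xr]
  \<comment> \<open>The projection 1 - e \<rho> onto the kernel of \<rho>.\<close>
  let ?d = "rminus X X (rid X) (rcomp X e \<rho>)"
  have d: "?d \<in> rhom X X" by (rule rminus_rhom[OF rid_rhom[OF Xr] e\<rho> Xr Xr])
  have dap: "?d j x = x \<ominus>\<^bsub>space X j\<^esub> e j (\<rho> j x)" if "j \<in> V" "x \<in> sp X j" for j x using that by simp
  have dU: "?d j x \<in> ?U j" if j: "j \<in> V" and x: "x \<in> sp X j" for j x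
  proof -
    interpret Fj: left_module A "space ?F j" by (rule robj_lm[OF Fr j])
    note c = rhom_closed[OF \<rho> j x]
    note c' = rhom_closed[OF e j c]
    have "\<rho> j (?d j x) = \<rho> j x \<ominus>\<^bsub>space ?F j\<^esub> \<rho> j (e j (\<rho> j x))"
      unfolding dap[OF j x] by (rule rhom_minus[OF \<rho> Xr Fr j x c'])
    also have "\<dots> = \<zero>[?F,j]" unfolding \<rho>e[OF j c] by (rule Fj.M.minus_self[OF c])
    finally show ?thesis using rhom_closed[OF d j x] by blast
  qed
  obtain \<pi> where \<pi>: "\<pi> \<in> rhom X ?S" "\<And>j x. \<lbrakk>j \<in> V; x \<in> sp X j\<rbrakk> \<Longrightarrow> sub_incl ?U j (\<pi> j x) = ?d j x"
  proof (rule rep_factor_inj[OF Sr Xr Xr inc _ d])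
    show "inj_on (sub_incl ?U j) (sp ?S j)" if "j \<in> V" for j
      by (rule inj_onI) (use that sub_incl_apply[where U = ?U] in \<open>simp add: sub_rep_sp\<close>)
    show "?d j ` sp X j \<subseteq> sub_incl ?U j ` sp ?S j" if j: "j \<in> V" for j
    proof
      fix y assume "y \<in> ?d j ` sp X j"
      then have y: "y \<in> ?U j" using dU[OF j] by blast
      then have "sub_incl ?U j y = y" by (rule sub_incl_apply[where U = ?U, OF j])
      then show "y \<in> sub_incl ?U j ` sp ?S j" using y unfolding sub_rep_sp by (metis (no_types, lifting) imageI)
    qed
  qed blast
  have \<pi>d: "\<pi> j x = ?d j x" if "j \<in> V" "x \<in> sp X j" for j x
    using \<pi>(2)[OF that] sub_incl_apply[where U = ?U, OF that(1)] rhom_closed[OF \<pi>(1) that] unfolding sub_rep_sp by simp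
  note i1 = rcomp_rhom[OF s(1) e Zr] and p1 = rcomp_rhom[OF \<rho> Z(2) Xr]
  have "is_biproduct C Z ?S X (rcomp Z e s) (sub_incl ?U) (rcomp X q \<rho>) \<pi>"
    unfolding biproduct_iff[OF Z(1) Sm Xm i1 inc p1 \<pi>(1)]
  proof (intro ballI conjI)
    fix j assume j: "j \<in> V"
    interpret Xj: left_module A "space X j" by (rule robj_lm[OF Xr j])
    {
      fix z assume z: "z \<in> sp Z j"
      note sz = rhom_closed[OF s(1) j z]
      note ez = rhom_closed[OF e j sz]
      show "rcomp X q \<rho> j (rcomp Z e s j z) = z" using j z ez \<rho>e[OF j sz] s(3)[OF j z] by simp
      have "\<pi> j (e j (s j z)) = \<zero>[X,j]"
        unfolding \<pi>d[OF j ez] dap[OF j ez] \<rho>e[OF j sz] by (rule Xj.M.minus_self[OF ez])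
      then show "\<pi> j (rcomp Z e s j z) = \<zero>[?S,j]" using j z by simp
    next
      fix y assume "y \<in> sp ?S j"
      then have yU: "y \<in> ?U j" unfolding sub_rep_sp .
      then have y: "y \<in> sp X j" "\<rho> j y = \<zero>[?F,j]" by blast+
      have iy: "sub_incl ?U j y = y" by (rule sub_incl_apply[where U = ?U, OF j yU])
      have "\<pi> j y = y"
        unfolding \<pi>d[OF j y(1)] dap[OF j y(1)] y(2) rhom_zero[OF e Fr Xr j] using y(1) by (simp add: Xj.M.minus_eq)
      then show "\<pi> j (sub_incl ?U j y) = y" unfolding iy .
      show "rcomp X q \<rho> j (sub_incl ?U j y) = \<zero>[Z,j]"
        unfolding iy using j y rhom_zero[OF Z(2) Fr Zr j] by simp
    next
      fix b assume b: "b \<in> sp X j"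
      note \<rho>b = rhom_closed[OF \<rho> j b]
      note eb = rhom_closed[OF e j \<rho>b]
      have 1: "rcomp Z e s j (rcomp X q \<rho> j b) = e j (\<rho> j b)" using j b \<rho>b rhom_closed[OF Z(2) j \<rho>b] s(2)[OF j \<rho>b] by simp
      show "rcomp Z e s j (rcomp X q \<rho> j b) \<oplus>\<^bsub>space X j\<^esub> sub_incl ?U j (\<pi> j b) = b"
        unfolding 1 \<pi>(2)[OF j b] dap[OF j b] Xj.M.a_comm[OF eb Xj.M.minus_closed[OF b eb]] by (rule Xj.M.minus_add_cancel[OF b eb])
    }
  qed
  then have "zero_object C Z \<or> zero_object C ?S" using X(1) unfolding indecomposable_def by blast
  moreover have "\<not> zero_object C Z"
    using P(2) zero_rep_iso[OF Fr Zr Z(2,3)] FR_zero_iff[OF i(1) P(1)] zero_object_iff[OF Z(1)] by blast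
  ultimately have S0: "?U j = {\<zero>[X,j]}" if "j \<in> V" for j
    using that unfolding zero_object_iff[OF Sm] by simp
  have inj: "inj_on (\<rho> j) (sp X j)" if "j \<in> V" for j
    unfolding rhom_inj_iff[OF \<rho> Xr Fr that] using S0[OF that] by blast
  have "bij_betw (\<rho> j) (sp X j) (sp ?F j)" if j: "j \<in> V" for j
    unfolding bij_betw_def
  proof (intro conjI inj[OF j] equalityI subsetI)
    show "y \<in> sp ?F j" if "y \<in> \<rho> j ` sp X j" for y using that rhom_closed[OF \<rho> j] by blast
    show "y \<in> \<rho> j ` sp X j" if "y \<in> sp ?F j" for y using \<rho>e[OF j that] rhom_closed[OF e j that] by (metis imageI)
  qed
  then show "rep_iso Q A X ?F" using \<rho> unfolding rep_iso_def by blast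
  show "inj_on r (sp X i)"
  proof (rule inj_onI)
    fix x y assume xy: "x \<in> sp X i" "y \<in> sp X i" "r x = r y"
    then have "\<rho> i x = \<rho> i y"
      using FR_fiota_fpi[OF i(1) P(1) rhom_closed[OF \<rho> i(1) xy(1)]] FR_fiota_fpi[OF i(1) P(1) rhom_closed[OF \<rho> i(1) xy(2)]]
      by (simp add: pr)
    then show "x = y" using inj[OF i(1)] xy by (simp add: inj_on_eq_iff)
  qed
qed

text \<open>\<open>split_iso\<close> is used twice: with the whole module of \<open>X\<close> at i
  for the isomorphism, and with an arbitrary nonzero summand of that module, where injectivity of
  the projection onto it forces the other summand to be zero.\<close>

lemma indecomposable_projective_free:
  fixes X :: "('v, 'e, 'a, 'm) rep"
  assumes X: "indecomposable C X" "projective_object C E X"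
  obtains i and P :: "('a, 'm) module" where "i \<in> V" "indecomposable (mod_cat K A) P"
    "projective_object (mod_cat K A) (mod_exact K A) P" "rep_iso Q A X (free_rep (conc i P))"
proof -
  have Xm: "mobj X" using X(1) by (simp add: indecomposable_def)
  note Xr = mobjD(1)[OF Xm] and gX = projective_good(2)[OF X(2)]
  \<comment> \<open>Otherwise all modules of \<open>X\<close> vanish by induction along the arrows,
    and \<open>X\<close> is a zero object.\<close>
  have "\<exists>i\<in>V. (\<forall>\<mu>\<in>into i. sp X (tail Q \<mu>) = {\<zero>[X,tail Q \<mu>]}) \<and> sp X i \<noteq> {\<zero>[X,i]}"
  proof (rule ccontr)
    assume neg: "\<not> ?thesis"
    have "sp X j = {\<zero>[X,j]}" if "j \<in> V" for j
      using that by (rule vertex_induct) (use neg in blast)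
    then show False using X(1) zero_object_iff[OF Xm] unfolding indecomposable_def by blast
  qed
  then obtain i where i: "i \<in> V" "\<And>\<mu>. \<mu> \<in> into i \<Longrightarrow> sp X (tail Q \<mu>) = {\<zero>[X,tail Q \<mu>]}"
    and nz: "sp X i \<noteq> {\<zero>[X,i]}" by blast
  let ?P = "space X i"
  note P = robj_fd[OF Xr i(1)] and lP = robj_lm[OF Xr i(1)]
  have "(\<lambda>x\<in>carrier ?P. x) ((\<lambda>x\<in>carrier ?P. x) y) = y" if "y \<in> carrier ?P" for y
    unfolding restrict_apply'[OF that] by (rule refl)
  then have iso: "rep_iso Q A X (free_rep (conc i ?P))"
    using split_iso(1)[OF X(1) gX i P nz mod_hom_id[OF lP] mod_hom_id[OF lP]] by blast
  have "zero_object (mod_cat K A) M \<or> zero_object (mod_cat K A) N"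
    if bp: "is_biproduct (mod_cat K A) M N ?P i\<^sub>1 i\<^sub>2 p\<^sub>1 p\<^sub>2" for M N i\<^sub>1 i\<^sub>2 p\<^sub>1 p\<^sub>2
  proof -
    have f: "fd_module K A M" "fd_module K A N"
      and hm: "i\<^sub>1 \<in> homA M ?P" "i\<^sub>2 \<in> homA N ?P" "p\<^sub>1 \<in> homA ?P M" "p\<^sub>2 \<in> homA ?P N"
      using bp by (auto simp: is_biproduct_def)
    note e = bp[unfolded mod_biproduct_iff[OF f P hm]]
    have "carrier N = {\<zero>\<^bsub>N\<^esub>}" if M: "carrier M \<noteq> {\<zero>\<^bsub>M\<^esub>}"
    proof -
      have "p\<^sub>1 (i\<^sub>1 y) = y" if "y \<in> carrier M" for y using e that by blast
      from split_iso(2)[OF X(1) gX i f(1) M hm(1,3) this] have "inj_on p\<^sub>1 (carrier ?P)" .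
      then have inj: "x = \<zero>\<^bsub>?P\<^esub>" if "x \<in> carrier ?P" "p\<^sub>1 x = \<zero>\<^bsub>M\<^esub>" for x
        using that mod_hom_inj_iff[OF lP fd_left_module[OF f(1)] hm(3)] by blast
      have "y = \<zero>\<^bsub>N\<^esub>" if y: "y \<in> carrier N" for y
      proof -
        have "i\<^sub>2 y = \<zero>\<^bsub>?P\<^esub>" by (rule inj[OF mod_hom_closed[OF hm(2) y]]) (use e y in blast)
        moreover have "p\<^sub>2 (i\<^sub>2 y) = y" using e y by blast
        ultimately show ?thesis using mod_hom_zero[OF lP fd_left_module[OF f(2)] hm(4)] by simp
      qed
      then show ?thesis using lsubD(2)[OF lsub_carrier[OF fd_left_module[OF f(2)]]] by blast
    qed
    then show ?thesis unfolding mod_zero_object_iff[OF f(1)] mod_zero_object_iff[OF f(2)] by blast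
  qed
  then have "indecomposable (mod_cat K A) ?P"
    using P nz unfolding indecomposable_def mod_zero_object_iff[OF P] mod_cat_simps(1) by blast
  moreover have "projective_object (mod_cat K A) (mod_exact K A) ?P"
    unfolding mod_projective_iff using P gX i(1) by blast
  ultimately show thesis using that i(1) iso by blast
qed

text \<open>For the converse, \<open>free_indecomposable\<close> gives indecomposability, and the
  free representation on a family of injective modules is vertexwise injective, hence
  projective.\<close>

theorem indecomposable_projective_iff:
  fixes X :: "('v, 'e, 'a, 'm) rep"
  assumes X: "mobj X"
  shows "indecomposable C X \<and> projective_object C E X \<longleftrightarrow>
    (\<exists>i\<in>V. \<exists>P :: ('a, 'm) module. indecomposable (mod_cat K A) P \<and>
      projective_object (mod_cat K A) (mod_exact K A) P \<and> rep_iso Q A X (m_functor Q K A i P))"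
proof
  assume *: "indecomposable C X \<and> projective_object C E X"
  obtain i and P :: "('a, 'm) module" where i: "i \<in> V" and P: "indecomposable (mod_cat K A) P"
    "projective_object (mod_cat K A) (mod_exact K A) P" "rep_iso Q A X (free_rep (conc i P))"
    by (rule indecomposable_projective_free[OF conjunct1[OF *] conjunct2[OF *]]) blast
  have "fd_module K A P" using P(1) by (simp add: indecomposable_def)
  from rep_iso_m_functor[OF this mobjD(1)[OF X]] i P
  show "\<exists>i\<in>V. \<exists>P :: ('a, 'm) module. indecomposable (mod_cat K A) P \<and>
      projective_object (mod_cat K A) (mod_exact K A) P \<and> rep_iso Q A X (m_functor Q K A i P)" by blast
next
  assume "\<exists>i\<in>V. \<exists>P :: ('a, 'm) module. indecomposable (mod_cat K A) P \<and>
      projective_object (mod_cat K A) (mod_exact K A) P \<and> rep_iso Q A X (m_functor Q K A i P)"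
  then obtain i and P :: "('a, 'm) module" where i: "i \<in> V" and P: "indecomposable (mod_cat K A) P"
    "projective_object (mod_cat K A) (mod_exact K A) P" "rep_iso Q A X (m_functor Q K A i P)" by blast
  have Pf: "fd_module K A P" and injP: "inj_mod P"
    using P(2) unfolding mod_projective_iff by blast+
  note Xr = mobjD(1)[OF X] and Fr = FR_robj[OF i Pf]
  have iso: "rep_iso Q A X (free_rep (conc i P))" using P(3) unfolding rep_iso_m_functor[OF Pf Xr] .
  have inj: "inj_mod (conc i P v)" for v by (rule conc_inj[OF Pf injP])
  obtain g where g: "g \<in> rhom X (free_rep (conc i P))" "\<And>j. j \<in> V \<Longrightarrow> bij_betw (g j) (sp X j) (sp (free_rep (conc i P)) j)"
    using iso unfolding rep_iso_def by blast
  obtain h where h: "h \<in> rhom (free_rep (conc i P)) X" "\<And>j. j \<in> V \<Longrightarrow> bij_betw (h j) (sp (free_rep (conc i P)) j) (sp X j)"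
    by (rule rhom_inverse[OF g(1) Xr Fr g(2)]) blast+
  have "good X" by (rule good_iso[OF FJ_good[where J = "conc i P", OF conc_fd[OF Pf] inj] Fr Xr h])
  then have "projective_object C E X" using projective_iff_good X by blast
  then show "indecomposable C X \<and> projective_object C E X" using free_indecomposable[OF X i P(1) iso] by blast
qed

end

theorem lemma4p1:
  fixes K :: "'k ring" and A :: "('k, 'a) module" and Q :: "('v, 'e) pre_digraph"
  assumes "field K"
    and "fin_digraph Q" and "acyclic_quiver Q"
    and "fd_algebra K A"
    and universe: "lists (carrier K) \<lesssim> (UNIV :: 'm set)"
    and "self_injective TYPE('m) K A"
  shows "exact_category
           (Mon Q K A :: (('v, 'e, 'a, 'm) rep, 'v \<Rightarrow> 'm \<Rightarrow> 'm) cat) (Mon_exact Q K A)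
       \<and> frobenius_category
           (Mon Q K A :: (('v, 'e, 'a, 'm) rep, 'v \<Rightarrow> 'm \<Rightarrow> 'm) cat) (Mon_exact Q K A)
       \<and> (\<forall>X \<in> Obj (Mon Q K A :: (('v, 'e, 'a, 'm) rep, 'v \<Rightarrow> 'm \<Rightarrow> 'm) cat).
            indecomposable (Mon Q K A) X \<and> projective_object (Mon Q K A) (Mon_exact Q K A) X \<longleftrightarrow>
            (\<exists>i \<in> verts Q. \<exists>P :: ('a, 'm) module.
               indecomposable (mod_cat K A) P \<and>
               projective_object (mod_cat K A) (mod_exact K A) P \<and>
               rep_iso Q A X (m_functor Q K A i P)))"
proof -
  interpret A: fd_algebra K A by fact
  interpret self_injective_quiver K A Q "TYPE('m)"
    using assms A.self_injective_inj_mod[OF universe]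
    by (simp add: self_injective_quiver_def self_injective_quiver_axioms_def mon_category_def
        mon_category_axioms_def quiver_algebra_def quiver_algebra_axioms_def)
  show ?thesis using exact frobenius indecomposable_projective_iff by blast
qed

end
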